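(* Fix $f\in\mathring{\mathcal V}=\mathcal V\cap\psi(\mathcal M)$ and write $\phi=\phi_f$. Let $q\in\psi^{-1}(f)$ with $\phi(q)=([\mathcal D],c,O,A)\in\mathrm{Pic}^g(C_f)\times\mathcal S_f\times R_O\times R_A$, $O=(O_1,\dots,O_N)$, $A=(A_1,\dots,A_m)$. Put $\mathcal A_u=uP-\sum_{i=1}^uA_i$ and $\mathcal O_u=uP-\sum_{i=N-u+1}^NO_i$. Then (wherever the birational maps are defined) $$\phi(e_u(q))=([\mathcal D-\mathcal A_u],\tau^{-u}(c),O,A)\quad\text{for }u=1,\dots,m,$$ $$\phi(\tilde e_u(q))=([\mathcal D+\mathcal O_u],\tau^{u}(c),O,A)\quad\text{for }u=1,\dots,N,$$ where $\tau(c_1,\dots,c_M)=(c_M,c_1,\dots,c_{M-1})$.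
   Context: Setup. Fix integers $n\ge2$, $m\ge1$, $1\le k\le n$; $N=\gcd(n,k)$, $n'=n/N$, $k'=k/N$, $M=\gcd(n,m+k)$. $\mathcal M=\mathbb C^{mn}$ with coordinates $q=(q_{ij})_{1\le i\le m,1\le j\le n}$. $Q_i(x)$ is the $n\times n$ matrix with diagonal entries $q_{i1},\dots,q_{in}$, entries $1$ in positions $(j+1,j)$ ($1\le j\le n-1$), entry $x$ in position $(1,n)$, zeros elsewhere; $P(x)$ is the same with zero diagonal. $L(x)=\alpha(q)=Q_1(x)\cdots Q_m(x)P(x)^k$ and $\psi(q)=\det(L(x)-y)$. Actions. For $\mathbf a=(a_1,\dots,a_l)$ put $\mathbf a^{(i)}=(a_{i+1},\dots,a_l,a_1,\dots,a_i)$; $E(\mathbf a,\mathbf b)=\sum_{i=0}^{l-1}\prod_{j=1}^ib_j\prod_{j=i+2}^{l}a_j$; $R(\mathbf a,\mathbf b)=(\mathbf b',\mathbf a')$ with $b_i'=b_iE_i/E_{i-1}$, $a_i'=a_iE_{i-1}/E_i$, $E_i=E(\mathbf a^{(i)},\mathbf b^{(i)})$. Extend $q_{ij}$ to $\mathbb Z^2$ by $q_{i,j+n}=q_{i,j}$, $q_{i+m,j}=q_{i,j-k}$. $s_r$ ($1\le r\le m-1$) replaces the pair $((q_{r,j})_{j\in[n]},(q_{r+1,j})_{j\in[n]})$ by its image under $R$, fixing the other coordinates; $\pi(q)_{ij}=q_{i+1,j}$. With $\tilde q_{r,l}=q_{m+1-l,N+1-r}$ ($1\le r\le N$, $1\le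 l\le mn'$), $\tilde s_r$ ($1\le r\le N-1$) replaces $((\tilde q_{r,l})_l,(\tilde q_{r+1,l})_l)$ by its image under $R$, fixing the other coordinates; $\tilde\pi(q)_{ij}=q_{i,j-1}$. Define the commuting birational maps $e_u=(s_u\cdots s_{m-1})(s_{u-1}\cdots s_{m-2})\cdots(s_1\cdots s_{m-u})\pi^u$ for $1\le u\le m$, and $\tilde e_u=(\tilde s_u\cdots\tilde s_{N-1})(\tilde s_{u-1}\cdots\tilde s_{N-2})\cdots(\tilde s_1\cdots\tilde s_{N-u})\tilde\pi^u$ for $1\le u\le N$ (rightmost factor applied first; $e_m=\pi^m$, $\tilde e_N=\tilde\pi^N$). They preserve $\psi$. The set $\mathcal V$. Write $f_{i,j}$ for the coefficient of $x^jy^i$ in $f$. $V_{n,m,k}$ is the set of polynomials $((-y)^{n/M}+x^{(k+m)/M})^M+\sum f_{i,j}x^jy^i$, the sum over lattice points $(j,i)$ of the triangle with vertices $(k,0),(0,n),(k+m,0)$ not on the edge joining $(0,n)$ and $(k+m,0)$. Let $L_c=\{(j,i)\in\mathbb Z_{\ge0}^2:(m+k)i+nj=n(m+k)-M\}$ and $f_c=\epsilon_0\sum_{(j,i)\in L_c}f_{i,j}$, $\epsilon_0=(-1)^{(n-i-1)j+i}$ (the same sign for all $(j,i)\in L_c$). $C'_f=\{f=0\}\subset\mathbb C^2$; $C_f$ is the normalization of its closure in $\mathbb P^2(\mathbb C)$. Points of $C_f$ are special if $x=0$ or $y=0$ there, or if they do not lie over $C_f'$. $\mathcal V$ is the set of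 $f\in V_{n,m,k}$ such that $f$ is irreducible, $C_f'$ is smooth away from $(0,0)$, $f_c\ne0$, and the special points are exactly: $m$ distinct points $((-1)^n\epsilon_r,0)$ with $\epsilon_r\ne0$ (the "$A$-points"); $N$ distinct points over $(0,0)$ (the "$O$-points"), the $r$-th having a local coordinate $u$ with $(x,y)\sim(u^{n'},-(-\sigma_r)^{1/n'}u^{k'})$, $\sigma_r\ne0$; and a single point $P$ over the line at infinity. $C_f$ has genus $g=\frac12((n-1)m-M-N+2)$. Spectral map $\phi_f$. For $q\in\psi^{-1}(f)$ and $L=\alpha(q)$: $O=(O_1,\dots,O_N)$, where $O_r$ is the $O$-point at which $y^{n'}/x^{k'}=(-1)^{n'+1}\sigma_r(q)$, $\sigma_r(q)=\prod_{i=1}^m\prod_{j=0}^{n'-1}q_{i,r+jN}$; set $O_j=O_r$ for $j\equiv r\bmod N$. $A=(A_1,\dots,A_m)$ with $A_r=((-1)^n\epsilon_r(q),0)$, $\epsilon_r(q)=\prod_{j=1}^nq_{rj}$. Let $\Delta_{i,j}=(-1)^{i+j}$ times the minor of $L(x)-y$ with row $i$ and column $j$ deleted, $h_i=\Delta_{n,i}/\Delta_{n,n}$ as rational functions on $C_f$; $\mathcal D$ is the minimum positive divisor with $(h_i)+\mathcal D\ge\sum_{j=i+1}^nO_j-(n-i)P$ for $i=1,\dots,n-1$ (it has degree $g$). $c_\ell$ ($1\le\ell\le M$) is the coefficient of the maximal (generic) power of $x$ in the $(\ell,\ell+1)$ entry (column index mod $n$) of $L(x)^{n/M}$. $\mathcal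 S_f=\{(x_\ell)\in(\mathbb C^* )^M:\prod x_\ell=f_c\}$; $R_O$, $R_A$ are the sets of orderings of the $O$-points and of the $A$-points. $\phi_f(q)=([\mathcal D],(c_1,\dots,c_M),O,A)$. By convention $\psi^{-1}(f)$ means its intersection with the open set of $q\in\mathcal M$ where $\alpha:\mathcal M\to\alpha(\mathcal M)$ is $m!$ to $1$ and the action of the group $\mathfrak S_m$ generated by $s_1,\dots,s_{m-1}$ is well defined.
   Formalization: Two signs corrected: V_{n,m,k} has edge part ((-y)^{n/M}+(-1)^{n/M+1}x^{(k+m)/M})^M (as given, V misses ψ(M) for n/M even), and O_r is the O-point with y^{n'}/x^{k'}=σ_r(q), not (-1)^{n'+1}σ_r(q) (for n=2, m=k=1 no such point exists). *)

theory Defs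
  imports
    "HOL-Library.Poly_Mapping"
    "HOL-Computational_Algebra.Computational_Algebra"
    "Jordan_Normal_Form.Determinant"
begin

section \<open>The phase space and the Lax matrix\<close>

text \<open>
  A point of \<open>M = C^(mn)\<close> is represented by its extension to \<open>Z^2\<close>, i.e. by the family
  \<open>q i j\<close> with \<open>q i (j + n) = q i j\<close> and \<open>q (i + m) j = q i (j - k)\<close>.  Such a family is
  determined by, and can be prescribed freely through, its values at \<open>1 \<le> i \<le> m\<close>, \<open>1 \<le> j \<le> n\<close>.
\<close>

type_synonym point = "int \<Rightarrow> int \<Rightarrow> complex"

definition phase_space :: "nat \<Rightarrow> nat \<Rightarrow> nat \<Rightarrow> point set" where
  "phase_space n m k =
     {q. (\<forall>i j. q i (j + int n) = q i j) \<and> (\<forall>i j. q (i + int m) j = q i (j - int k))}"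

text \<open>Matrices are indexed from \<open>0\<close>; coordinates, points and tuples of the source from \<open>1\<close>.\<close>

definition Q_mat :: "nat \<Rightarrow> (nat \<Rightarrow> complex) \<Rightarrow> complex poly mat" where
  "Q_mat n d = mat n n (\<lambda>(a, b).
     if a = b then [:d (a + 1):]
     else if a = b + 1 then 1
     else if a = 0 \<and> b = n - 1 then [:0, 1:]
     else 0)"

definition P_mat :: "nat \<Rightarrow> complex poly mat" where
  "P_mat n = Q_mat n (\<lambda>_. 0)"

definition lax :: "nat \<Rightarrow> nat \<Rightarrow> nat \<Rightarrow> point \<Rightarrow> complex poly mat" where
  "lax n m k q =
     foldr (*) (map (\<lambda>i. Q_mat n (\<lambda>j. q (int i) (int j))) [1..<Suc m]) (1\<^sub>m n) * P_mat n ^\<^sub>m k"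

text \<open>
  \<open>C[x,y]\<close> is \<open>complex poly poly\<close> with outer variable \<open>y\<close>: the coefficient of \<open>x^j y^i\<close> in \<open>f\<close>
  is \<open>coeff (coeff f i) j\<close>.
\<close>

type_synonym poly2 = "complex poly poly"

definition const2 :: "complex \<Rightarrow> poly2" where "const2 c = [:[:c:]:]"
definition X :: poly2 where "X = [:[:0, 1:]:]"
definition Y :: poly2 where "Y = [:0, 1:]"

definition eval2 :: "poly2 \<Rightarrow> complex \<Rightarrow> complex \<Rightarrow> complex" where
  "eval2 f a b = poly (poly f [:b:]) a"

definition lax_minus_y :: "nat \<Rightarrow> nat \<Rightarrow> nat \<Rightarrow> point \<Rightarrow> poly2 mat" where
  "lax_minus_y n m k q = map_mat (\<lambda>p. [:p:]) (lax n m k q) - Y \<cdot>\<^sub>m 1\<^sub>m n"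

definition psi :: "nat \<Rightarrow> nat \<Rightarrow> nat \<Rightarrow> point \<Rightarrow> poly2" where
  "psi n m k q = det (lax_minus_y n m k q)"


section \<open>The birational actions\<close>

definition E_sum :: "complex list \<Rightarrow> complex list \<Rightarrow> complex" where
  "E_sum a b = (\<Sum>i<length a. prod_list (take i b) * prod_list (drop (i + 1) a))"

definition E_rot :: "complex list \<Rightarrow> complex list \<Rightarrow> nat \<Rightarrow> complex" where
  "E_rot a b i = E_sum (rotate i a) (rotate i b)"

definition R_map :: "complex list \<Rightarrow> complex list \<Rightarrow> complex list \<times> complex list" where
  "R_map a b =
     (map (\<lambda>i. b ! (i - 1) * E_rot a b i / E_rot a b (i - 1)) [1..<Suc (length a)],
      map (\<lambda>i. a ! (i - 1) * E_rot a b (i - 1) / E_rot a b i) [1..<Suc (length a)])"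

definition R_defined :: "complex list \<Rightarrow> complex list \<Rightarrow> bool" where
  "R_defined a b \<longleftrightarrow> (\<forall>i\<le>length a. E_rot a b i \<noteq> 0)"

text \<open>
  \<open>rw q r\<close>, for \<open>1 \<le> r \<le> d\<close>, are \<open>d\<close> tuples which together are coordinates on the phase
  space; \<open>exchange\<close> replaces the pair formed by the tuples \<open>r\<close> and \<open>r + 1\<close> by its image under
  \<open>R\<close>.  Birational maps are partial functions, a composite being defined where each of its factors is.
\<close>

definition exchange ::
  "point set \<Rightarrow> nat \<Rightarrow> (point \<Rightarrow> nat \<Rightarrow> complex list) \<Rightarrow> nat \<Rightarrow> point \<rightharpoonup> point" where
  "exchange S d rw r q =
     (if R_defined (rw q r) (rw q (r + 1))
      then Some (THE p. p \<in> S
             \<and> (rw p r, rw p (r + 1)) = R_map (rw q r) (rw q (r + 1))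
             \<and> (\<forall>t\<in>{1..d} - {r, r + 1}. rw p t = rw q t))
      else None)"

definition row_of :: "nat \<Rightarrow> point \<Rightarrow> nat \<Rightarrow> complex list" where
  "row_of n q r = map (\<lambda>j. q (int r) (int j)) [1..<Suc n]"

definition trow_of :: "nat \<Rightarrow> nat \<Rightarrow> nat \<Rightarrow> point \<Rightarrow> nat \<Rightarrow> complex list" where
  "trow_of n m k q r =
     map (\<lambda>l. q (int m + 1 - int l) (int (gcd n k) + 1 - int r)) [1..<Suc (m * (n div gcd n k))]"

definition s_map :: "nat \<Rightarrow> nat \<Rightarrow> nat \<Rightarrow> nat \<Rightarrow> point \<rightharpoonup> point" where
  "s_map n m k r = exchange (phase_space n m k) m (row_of n) r"

definition ts_map :: "nat \<Rightarrow> nat \<Rightarrow> nat \<Rightarrow> nat \<Rightarrow> point \<rightharpoonup> point" where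
  "ts_map n m k r = exchange (phase_space n m k) (gcd n k) (trow_of n m k) r"

definition pi_map :: "point \<Rightarrow> point" where
  "pi_map q = (\<lambda>i j. q (i + 1) j)"

definition tpi_map :: "point \<Rightarrow> point" where
  "tpi_map q = (\<lambda>i j. q i (j - 1))"

definition comp_list :: "('a \<rightharpoonup> 'a) list \<Rightarrow> 'a \<rightharpoonup> 'a" where
  "comp_list fs = foldr (\<circ>\<^sub>m) fs Some"

text \<open>The index word \<open>(u, \<dots>, d-1)(u-1, \<dots>, d-2) \<dots> (1, \<dots>, d-u)\<close>.\<close>

definition e_word :: "nat \<Rightarrow> nat \<Rightarrow> nat list" where
  "e_word d u = concat (map (\<lambda>t. [t..<d - u + t]) (rev [1..<Suc u]))"

definition e_map :: "nat \<Rightarrow> nat \<Rightarrow> nat \<Rightarrow> nat \<Rightarrow> point \<rightharpoonup> point" where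
  "e_map n m k u = comp_list (map (s_map n m k) (e_word m u)) \<circ>\<^sub>m (Some \<circ> (pi_map ^^ u))"

definition te_map :: "nat \<Rightarrow> nat \<Rightarrow> nat \<Rightarrow> nat \<Rightarrow> point \<rightharpoonup> point" where
  "te_map n m k u = comp_list (map (ts_map n m k) (e_word (gcd n k) u)) \<circ>\<^sub>m (Some \<circ> (tpi_map ^^ u))"


section \<open>The curve \<open>C_f\<close>, its points and its divisors\<close>

text \<open>
  For irreducible \<open>f\<close>, the points of the normalization \<open>C_f\<close> of the projective closure of
  \<open>f = 0\<close> are the normalized discrete valuations, trivial on the constants, of its function field
  \<open>Frac(C[x,y]/(f))\<close>.  A valuation is given by its restriction to \<open>C[x,y]\<close>; the order of \<open>g/h\<close>
  at \<open>p\<close> is \<open>p g - p h\<close>.  The order of the zero function is infinite; multiples of \<open>f\<close> get the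
  dummy value \<open>0\<close>, which makes the representing function unique.
\<close>

type_synonym place = "poly2 \<Rightarrow> int"

definition places :: "poly2 \<Rightarrow> place set" where
  "places f = {p.
     (\<forall>g. f dvd g \<longrightarrow> p g = 0) \<and>
     (\<forall>g h. f dvd g - h \<longrightarrow> p g = p h) \<and>
     (\<forall>c. c \<noteq> 0 \<longrightarrow> p (const2 c) = 0) \<and>
     (\<forall>g h. \<not> f dvd g \<longrightarrow> \<not> f dvd h \<longrightarrow> p (g * h) = p g + p h) \<and>
     (\<forall>g h. \<not> f dvd g \<longrightarrow> \<not> f dvd h \<longrightarrow> \<not> f dvd g + h \<longrightarrow> min (p g) (p h) \<le> p (g + h)) \<and>
     (\<exists>g h. \<not> f dvd g \<and> \<not> f dvd h \<and> p g - p h = 1)}"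

definition vanishes_at :: "poly2 \<Rightarrow> place \<Rightarrow> poly2 \<Rightarrow> bool" where
  "vanishes_at f p g \<longleftrightarrow> f dvd g \<or> p g > 0"

text \<open>The rational function \<open>g/h\<close> on \<open>C_f\<close> is regular at \<open>p\<close> and has the value \<open>c\<close> there.\<close>

definition has_value_at :: "poly2 \<Rightarrow> place \<Rightarrow> poly2 \<Rightarrow> poly2 \<Rightarrow> complex \<Rightarrow> bool" where
  "has_value_at f p g h c \<longleftrightarrow>
     \<not> f dvd h \<and> (f dvd g - const2 c * h \<or> p (g - const2 c * h) - p h > 0)"

definition lies_over :: "poly2 \<Rightarrow> place \<Rightarrow> complex \<Rightarrow> complex \<Rightarrow> bool" where
  "lies_over f p a b \<longleftrightarrow> vanishes_at f p (X - const2 a) \<and> vanishes_at f p (Y - const2 b)"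

definition at_infinity :: "poly2 \<Rightarrow> place \<Rightarrow> bool" where
  "at_infinity f p \<longleftrightarrow> (\<nexists>a b. lies_over f p a b)"

definition special :: "poly2 \<Rightarrow> place \<Rightarrow> bool" where
  "special f p \<longleftrightarrow> vanishes_at f p X \<or> vanishes_at f p Y \<or> at_infinity f p"

definition smooth_off_origin :: "poly2 \<Rightarrow> bool" where
  "smooth_off_origin f \<longleftrightarrow>
     (\<forall>a b. eval2 f a b = 0 \<longrightarrow> (a, b) \<noteq> (0, 0) \<longrightarrow>
        eval2 (map_poly pderiv f) a b \<noteq> 0 \<or> eval2 (pderiv f) a b \<noteq> 0)"

type_synonym divisor = "place \<Rightarrow>\<^sub>0 int"

definition divisors :: "poly2 \<Rightarrow> divisor set" where
  "divisors f = {D. Poly_Mapping.keys D \<subseteq> places f}"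

definition div_degree :: "divisor \<Rightarrow> int" where
  "div_degree D = (\<Sum>p\<in>Poly_Mapping.keys D. Poly_Mapping.lookup D p)"

definition lin_equiv :: "poly2 \<Rightarrow> divisor \<Rightarrow> divisor \<Rightarrow> bool" where
  "lin_equiv f D D' \<longleftrightarrow> D \<in> divisors f \<and> D' \<in> divisors f \<and>
     (\<exists>g h. \<not> f dvd g \<and> \<not> f dvd h \<and>
        (\<forall>p\<in>places f. Poly_Mapping.lookup D' p - Poly_Mapping.lookup D p = p g - p h))"

definition pic_class :: "poly2 \<Rightarrow> divisor \<Rightarrow> divisor set" where
  "pic_class f D = {D'. lin_equiv f D D'}"

definition Pic :: "poly2 \<Rightarrow> int \<Rightarrow> divisor set set" where
  "Pic f d = pic_class f ` {D \<in> divisors f. div_degree D = d}"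


section \<open>The set of admissible spectral polynomials\<close>

text \<open>
  Sign: at \<open>q = 0\<close> one has \<open>psi q = det (P^(m+k) - y)\<close>, and the eigenvalues of \<open>P\<close> are the
  \<open>n\<close>-th roots of \<open>x\<close>.  With \<open>r = n/M\<close> and \<open>t = x^((m+k)/M)\<close> this is
  \<open>((-y)^r + (-1)^(r+1) t)^M\<close>.  The formula \<open>((-y)^r + t)^M\<close> found in the source is right
  for odd \<open>r\<close> only; for even \<open>r\<close> it would exclude every \<open>psi q\<close>
  (e.g. \<open>psi q = y^2 - x (q_11 + q_12) y + q_11 q_12 x^2 - x^3\<close> for \<open>n = k = 2\<close>, \<open>m = 1\<close>).
\<close>

definition V_top :: "nat \<Rightarrow> nat \<Rightarrow> nat \<Rightarrow> poly2" where
  "V_top n m k = (let M = gcd n (m + k) in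
     ((- Y) ^ (n div M) + (-1) ^ (n div M + 1) * X ^ ((k + m) div M)) ^ M)"

definition V_set :: "nat \<Rightarrow> nat \<Rightarrow> nat \<Rightarrow> poly2 set" where
  "V_set n m k = {f. \<forall>i j. coeff (coeff (f - V_top n m k) i) j \<noteq> 0 \<longrightarrow>
     n * k \<le> n * j + k * i \<and> n * j + (k + m) * i < n * (k + m)}"

text \<open>The sign below does not depend on the point of \<open>L_c\<close>, so it may be put inside the sum.\<close>

definition L_c :: "nat \<Rightarrow> nat \<Rightarrow> nat \<Rightarrow> (nat \<times> nat) set" where
  "L_c n m k = {(j, i). int ((m + k) * i + n * j) = int (n * (m + k)) - int (gcd n (m + k))}"

definition f_c :: "nat \<Rightarrow> nat \<Rightarrow> nat \<Rightarrow> poly2 \<Rightarrow> complex" where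
  "f_c n m k f = (\<Sum>(j, i)\<in>L_c n m k. (-1) ^ ((n - i - 1) * j + i) * coeff (coeff f i) j)"

text \<open>
  A local coordinate \<open>u = g/h\<close> at \<open>p\<close> with \<open>x \<sim> u^n'\<close> and \<open>y \<sim> - a u^k'\<close>, where \<open>a\<close> is an
  \<open>n'\<close>-th root of \<open>- \<sigma>\<close>.
\<close>

definition O_coordinate :: "nat \<Rightarrow> nat \<Rightarrow> poly2 \<Rightarrow> place \<Rightarrow> complex \<Rightarrow> bool" where
  "O_coordinate n k f p \<sigma> \<longleftrightarrow> (let n' = n div gcd n k; k' = k div gcd n k in
     \<exists>g h a. \<not> f dvd g \<and> \<not> f dvd h \<and> p g - p h = 1 \<and> a ^ n' = - \<sigma> \<and>
       has_value_at f p (X * h ^ n') (g ^ n') 1 \<and>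
       has_value_at f p (Y * h ^ k') (g ^ k') (- a))"

definition V_cal :: "nat \<Rightarrow> nat \<Rightarrow> nat \<Rightarrow> poly2 set" where
  "V_cal n m k = {f \<in> V_set n m k.
     irreducible f \<and> smooth_off_origin f \<and> f_c n m k f \<noteq> 0 \<and>
     (\<exists>\<epsilon> A \<sigma> Op P.
        (\<forall>r\<in>{1..m}. A r \<in> places f \<and> \<epsilon> r \<noteq> 0 \<and> lies_over f (A r) ((-1) ^ n * \<epsilon> r) 0) \<and>
        inj_on \<epsilon> {1..m} \<and>
        (\<forall>r\<in>{1..gcd n k}. Op r \<in> places f \<and> lies_over f (Op r) 0 0 \<and>
            \<sigma> r \<noteq> 0 \<and> O_coordinate n k f (Op r) (\<sigma> r)) \<and>
        inj_on Op {1..gcd n k} \<and>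
        P \<in> places f \<and> at_infinity f P \<and>
        {p \<in> places f. special f p} = A ` {1..m} \<union> Op ` {1..gcd n k} \<union> {P})}"

definition V_ring :: "nat \<Rightarrow> nat \<Rightarrow> nat \<Rightarrow> poly2 set" where
  "V_ring n m k = V_cal n m k \<inter> psi n m k ` phase_space n m k"

definition genus_C :: "nat \<Rightarrow> nat \<Rightarrow> nat \<Rightarrow> int" where
  "genus_C n m k =
     ((int n - 1) * int m - int (gcd n (m + k)) - int (gcd n k) + 2) div 2"

definition P_point :: "poly2 \<Rightarrow> place" where
  "P_point f = (THE p. p \<in> places f \<and> at_infinity f p)"

definition O_points :: "poly2 \<Rightarrow> place set" where
  "O_points f = {p \<in> places f. lies_over f p 0 0}"

definition A_points :: "poly2 \<Rightarrow> place set" where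
  "A_points f = {p \<in> places f. \<exists>a. a \<noteq> 0 \<and> lies_over f p a 0}"


section \<open>The spectral map\<close>

definition generic_locus :: "nat \<Rightarrow> nat \<Rightarrow> nat \<Rightarrow> point set" where
  "generic_locus n m k = {q \<in> phase_space n m k.
     card {q' \<in> phase_space n m k. lax n m k q' = lax n m k q} = fact m \<and>
     (\<forall>w. set w \<subseteq> {1..<m} \<longrightarrow> comp_list (map (s_map n m k) w) q \<noteq> None)}"

definition psi_fibre :: "nat \<Rightarrow> nat \<Rightarrow> nat \<Rightarrow> poly2 \<Rightarrow> point set" where
  "psi_fibre n m k f = {q \<in> generic_locus n m k. psi n m k q = f}"

definition sigma :: "nat \<Rightarrow> nat \<Rightarrow> nat \<Rightarrow> point \<Rightarrow> nat \<Rightarrow> complex" where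
  "sigma n m k q r =
     (\<Prod>i=1..m. \<Prod>j<n div gcd n k. q (int i) (int (r + j * gcd n k)))"

definition epsilon :: "nat \<Rightarrow> point \<Rightarrow> nat \<Rightarrow> complex" where
  "epsilon n q r = (\<Prod>j=1..n. q (int r) (int j))"

text \<open>
  Sign: near the \<open>O\<close>-points the lowest order part of \<open>psi q\<close> is
  \<open>det (diag d P^k - y)\<close> with \<open>d_j\<close> the product of the \<open>q_ij\<close> over \<open>i\<close>, which is the product over
  \<open>r\<close> of \<open>(-y)^n' + (-1)^(n'-1) \<sigma>_r x^k'\<close>.  So the point \<open>O_r\<close> belonging to \<open>\<sigma>_r\<close> is the one with
  \<open>y^n' / x^k' = \<sigma>_r\<close>.  The source has \<open>(-1)^(n'+1) \<sigma>_r\<close>, which is the same for odd \<open>n'\<close> but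
  is no value taken by \<open>y^n' / x^k'\<close>, in general, for even \<open>n'\<close> (for \<open>n = 2\<close>, \<open>m = k = 1\<close>:
  \<open>psi q = (x - y)^2 - q_11 q_12 x\<close>, so \<open>y^2 / x = q_11 q_12 = \<sigma>_1\<close> at \<open>O_1\<close>).
\<close>

definition O_list :: "nat \<Rightarrow> nat \<Rightarrow> nat \<Rightarrow> poly2 \<Rightarrow> point \<Rightarrow> place list" where
  "O_list n m k f q = (let N = gcd n k; n' = n div N; k' = k div N in
     map (\<lambda>r. THE p. p \<in> O_points f \<and> has_value_at f p (Y ^ n') (X ^ k') (sigma n m k q r))
       [1..<Suc N])"

definition A_list :: "nat \<Rightarrow> nat \<Rightarrow> poly2 \<Rightarrow> point \<Rightarrow> place list" where
  "A_list n m f q =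
     map (\<lambda>r. THE p. p \<in> places f \<and> lies_over f p ((-1) ^ n * epsilon n q r) 0) [1..<Suc m]"

text \<open>The signed minor with row \<open>i\<close> and column \<open>j\<close> (counted from \<open>1\<close>) deleted.\<close>

definition Delta :: "nat \<Rightarrow> nat \<Rightarrow> nat \<Rightarrow> point \<Rightarrow> nat \<Rightarrow> nat \<Rightarrow> poly2" where
  "Delta n m k q i j = cofactor (lax_minus_y n m k q) (i - 1) (j - 1)"

text \<open>
  The right-hand side of the condition on \<open>h_i\<close>; \<open>os ! ((j - 1) mod length os)\<close> is the
  periodic extension \<open>O_j\<close> of the list \<open>os\<close>.
\<close>

definition h_bound :: "nat \<Rightarrow> poly2 \<Rightarrow> place list \<Rightarrow> nat \<Rightarrow> divisor" where
  "h_bound n f os i =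
     (\<Sum>j=i+1..n. frag_of (os ! ((j - 1) mod length os)))
       - frag_cmul (int (n - i)) (frag_of (P_point f))"

text \<open>
  \<open>(h_i) + D \<ge> h_bound\<close> for \<open>i = 1, \<dots>, n-1\<close>, where \<open>h_i = \<Delta>_{n,i} / \<Delta>_{n,n}\<close>; there is no
  condition from an \<open>h_i\<close> that is identically zero.
\<close>

definition D_admissible :: "nat \<Rightarrow> nat \<Rightarrow> nat \<Rightarrow> poly2 \<Rightarrow> point \<Rightarrow> divisor \<Rightarrow> bool" where
  "D_admissible n m k f q D \<longleftrightarrow>
     D \<in> divisors f \<and> (\<forall>p. Poly_Mapping.lookup D p \<ge> 0) \<and>
     (\<forall>i\<in>{1..n - 1}. \<forall>p\<in>places f. \<not> f dvd Delta n m k q n i \<longrightarrow>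
        p (Delta n m k q n i) - p (Delta n m k q n n) + Poly_Mapping.lookup D p
          \<ge> Poly_Mapping.lookup (h_bound n f (O_list n m k f q) i) p)"

definition D_min :: "nat \<Rightarrow> nat \<Rightarrow> nat \<Rightarrow> poly2 \<Rightarrow> point \<Rightarrow> divisor" where
  "D_min n m k f q = (THE D. D_admissible n m k f q D \<and>
     (\<forall>D'. D_admissible n m k f q D' \<longrightarrow>
        (\<forall>p. Poly_Mapping.lookup D p \<le> Poly_Mapping.lookup D' p)))"

text \<open>
  The \<open>(l, l+1)\<close> entry, column index mod \<open>n\<close>, of \<open>L^(n/M)\<close> (\<open>l\<close> counted from \<open>1\<close>).  Its generic
  degree in \<open>x\<close> is its maximal degree as \<open>q\<close> varies.
\<close>

definition c_entry :: "nat \<Rightarrow> nat \<Rightarrow> nat \<Rightarrow> nat \<Rightarrow> point \<Rightarrow> complex poly" where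
  "c_entry n m k l q = (lax n m k q ^\<^sub>m (n div gcd n (m + k))) $$ (l - 1, l mod n)"

definition c_list :: "nat \<Rightarrow> nat \<Rightarrow> nat \<Rightarrow> point \<Rightarrow> complex list" where
  "c_list n m k q =
     map (\<lambda>l. coeff (c_entry n m k l q)
                (Max ((\<lambda>p. degree (c_entry n m k l p)) ` phase_space n m k)))
       [1..<Suc (gcd n (m + k))]"

definition phi :: "nat \<Rightarrow> nat \<Rightarrow> nat \<Rightarrow> poly2 \<Rightarrow> point \<Rightarrow>
    divisor set \<times> complex list \<times> place list \<times> place list" where
  "phi n m k f q =
     (pic_class f (D_min n m k f q), c_list n m k q, O_list n m k f q, A_list n m f q)"

definition S_f :: "nat \<Rightarrow> nat \<Rightarrow> nat \<Rightarrow> poly2 \<Rightarrow> complex list set" where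
  "S_f n m k f = {xs. length xs = gcd n (m + k) \<and> 0 \<notin> set xs \<and> prod_list xs = f_c n m k f}"

definition orderings :: "'a set \<Rightarrow> 'a list set" where
  "orderings S = {xs. distinct xs \<and> set xs = S}"

definition phi_target :: "nat \<Rightarrow> nat \<Rightarrow> nat \<Rightarrow> poly2 \<Rightarrow>
    (divisor set \<times> complex list \<times> place list \<times> place list) set" where
  "phi_target n m k f =
     Pic f (genus_C n m k) \<times> S_f n m k f \<times> orderings (O_points f) \<times> orderings (A_points f)"


section \<open>The divisors \<open>A_u\<close>, \<open>O_u\<close> and the shift\<close>

definition A_div :: "poly2 \<Rightarrow> place list \<Rightarrow> nat \<Rightarrow> divisor" where
  "A_div f as u = frag_cmul (int u) (frag_of (P_point f)) - (\<Sum>i=1..u. frag_of (as ! (i - 1)))"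

definition O_div :: "poly2 \<Rightarrow> place list \<Rightarrow> nat \<Rightarrow> divisor" where
  "O_div f os u = frag_cmul (int u) (frag_of (P_point f))
     - (\<Sum>i=length os - u + 1..length os. frag_of (os ! (i - 1)))"

definition tau :: "'a list \<Rightarrow> 'a list" where
  "tau xs = last xs # butlast xs"

definition tau_inv :: "'a list \<Rightarrow> 'a list" where
  "tau_inv xs = tl xs @ [hd xs]"

lemma tau_tau_inv:
  assumes "xs \<noteq> []"
  shows "tau (tau_inv xs) = xs" "tau_inv (tau xs) = xs"
  using assms by (simp_all add: tau_def tau_inv_def)

end

theory Submission
  imports Defs "HOL-Computational_Algebra.Field_as_Ring" "Jordan_Normal_Form.Char_Poly"
begin

text \<open>
  Let \<open>v\<close> be an eigenvector of the Lax matrix \<open>L\<close> over the function field, extended to a sequence by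
  \<open>v_(j-n) = x v_j\<close>.  The orders of the \<open>h_i\<close> are those of \<open>v_i / v_n\<close>, so at each place the divisor
  of \<open>q\<close> is the order of \<open>v_n\<close> minus the minimum of the orders of the \<open>v_j\<close>, weighted by the
  divisors \<open>O_(j+1) + \<dots> + O_n - (n-j) P\<close>.

  The row exchanges leave \<open>L\<close> unchanged, and \<open>v' = Q_(u+1) \<dots> Q_m P^k v\<close> is an eigenvector for
  \<open>\<pi>^u(q)\<close> with \<open>Q_1 \<dots> Q_u v' = y v\<close>.  Since \<open>Q_i\<close> is invertible at all finite places except \<open>A_i\<close>,
  comparing the minimal orders of \<open>v\<close> and \<open>v'\<close> place by place gives \<open>(y) + \<A>_u\<close>, and the function
  \<open>v'_n / (y v_n)\<close> realises the linear equivalence.  The column shift lowers the indices of \<open>v\<close> by \<open>u\<close>, and a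
  column exchange adds multiples of \<open>v_(j+1)\<close> to \<open>v_j\<close> for \<open>j\<close> in one residue class modulo \<open>N\<close>.  At
  the \<open>O\<close>-point belonging to \<open>\<sigma>_s\<close> the minimum is attained exactly for \<open>j \<equiv> s\<close> modulo \<open>N\<close>, so that it
  suffices to follow the order of one entry.

  The orders of \<open>x\<close>, \<open>y\<close> and \<open>v_j\<close> at \<open>P\<close> come from \<open>L^(n/M) v_j = x^b v_j + c_j v_(j-nb+1) + \<dots>\<close>,
  \<open>b = (m+k)/M\<close>, where all \<open>c_j\<close> are nonzero; under the elementary steps \<open>c\<close> changes by sums
  that telescope over a period.
\<close>

section \<open>Orders of functions at a place\<close>

text \<open>No function field is built: a function is a polynomial read modulo \<open>f\<close>, and
  a fraction enters only as a difference of orders. This is why sequences live on indices j \<le> n,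
  where quasi-periodicity multiplies by x; going upwards would divide by x. The obstacle is that the
  definition of admissible \<open>f\<close> says little about the special places. It gives the
  orders of x and y at the O-points, but at P only that no affine point lies below, and it does not
  say that y^n'/x^k' separates the O-points. Both gaps are closed by one device: every polynomial
  multiple of v_n is a combination of the v_j with constant coefficients, so the orders of the v_j
  at a place control the orders of all functions there. At P the normalisation of places then fixes
  the scale; over the origin two places with the same data coincide. Two nonvanishing facts start
  this: c_l \<noteq> 0 is part of the target of \<open>phi\<close>, and q_ij \<noteq> 0 because x
  \<noteq> 0 at the A-points. A column exchange adds v_(j+1) to v_j, which is harmless where weights
  do not decrease in j. At the O-points they do decrease, so the entry in the class of the point is
  followed instead.\<close>

lemma const2_simps [simp]:
  "const2 0 = 0" "const2 1 = 1"
  "const2 (a + b) = const2 a + const2 b" "const2 (- a) = - const2 a"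
  "const2 (a - b) = const2 a - const2 b" "const2 (a * b) = const2 a * const2 b"
  by (simp_all add: const2_def one_pCons mult.commute)

lemma const2_eq_0_iff [simp]: "const2 c = 0 \<longleftrightarrow> c = 0"
  by (simp add: const2_def)

lemma const2_power: "const2 (a ^ i) = const2 a ^ i"
  by (induction i) auto

lemma const2_inverse: "c \<noteq> 0 \<Longrightarrow> const2 c * const2 (1 / c) = 1"
  by (simp flip: const2_simps(6))

lemma dvd_diff_sym: "f dvd g - h \<longleftrightarrow> f dvd h - (g :: poly2)"
  using dvd_minus_iff[of f "g - h"] by simp

lemma dvd_diff_cong: "f dvd g - h \<Longrightarrow> f dvd g \<longleftrightarrow> f dvd (h :: poly2)"
  using dvd_add[of f "g - h" h] dvd_diff[of f g "g - h"] by auto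

text \<open>The zero function has infinite order: multiples of \<open>f\<close> satisfy every lower
  bound, and the dummy value 0 that a place gives them never enters.\<close>

definition vge :: "poly2 \<Rightarrow> place \<Rightarrow> poly2 \<Rightarrow> int \<Rightarrow> bool" where
  "vge f p g c \<longleftrightarrow> f dvd g \<or> c \<le> p g"

definition veq :: "poly2 \<Rightarrow> place \<Rightarrow> poly2 \<Rightarrow> int \<Rightarrow> bool" where
  "veq f p g c \<longleftrightarrow> \<not> f dvd g \<and> p g = c"

text \<open>The axioms of a place without the normalisation that some order difference is 1, so that
  multiples of a place are instances as well.\<close>

locale val =
  fixes f :: poly2 and p :: place
  assumes irr: "irreducible f"
    and p_dvd: "\<And>g. f dvd g \<Longrightarrow> p g = 0"
    and p_cong: "\<And>g h. f dvd g - h \<Longrightarrow> p g = p h"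
    and p_const: "\<And>c. c \<noteq> 0 \<Longrightarrow> p (const2 c) = 0"
    and p_mult: "\<And>g h. \<not> f dvd g \<Longrightarrow> \<not> f dvd h \<Longrightarrow> p (g * h) = p g + p h"
    and p_add: "\<And>g h. \<not> f dvd g \<Longrightarrow> \<not> f dvd h \<Longrightarrow> \<not> f dvd g + h \<Longrightarrow>
      min (p g) (p h) \<le> p (g + h)"
begin

lemma prime: "prime_elem f"
  using irr by (rule irreducible_imp_prime_elem)

lemma f_neq_0 [simp]: "f \<noteq> 0"
  using irr by auto

lemma dvd_mult_iff: "f dvd g * h \<longleftrightarrow> f dvd g \<or> f dvd h"
  using prime by (rule prime_elem_dvd_mult_iff)

lemma not_unit: "\<not> f dvd 1"
  using irr by (auto simp: irreducible_def)

lemma not_dvd_const: "c \<noteq> 0 \<Longrightarrow> \<not> f dvd const2 c"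
  using not_unit const2_inverse[of c] dvd_mult2[of f "const2 c" "const2 (1/c)"] by auto

lemma vge_mono: "vge f p g c \<Longrightarrow> d \<le> c \<Longrightarrow> vge f p g d"
  by (auto simp: vge_def)

lemma vge_0 [simp]: "vge f p 0 c"
  by (simp add: vge_def)

lemma vge_const: "vge f p (const2 a) 0"
  by (cases "a = 0") (auto simp: vge_def p_const)

lemma vge_mult: "vge f p g c \<Longrightarrow> vge f p h d \<Longrightarrow> vge f p (g * h) (c + d)"
  using p_mult[of g h] by (cases "f dvd g"; cases "f dvd h") (auto simp: vge_def)

lemma vge_cmult: "vge f p g c \<Longrightarrow> vge f p (const2 a * g) c"
  using vge_mult[OF vge_const, of g c a] by simp

lemma vge_cong_imp: "f dvd g - h \<Longrightarrow> vge f p h c \<Longrightarrow> vge f p g c"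
  using p_cong[of g h] dvd_diff_sym[of f g h] dvd_add[of f "g - h" h]
  by (auto simp: vge_def)

lemma vge_cong: "f dvd g - h \<Longrightarrow> vge f p g c \<longleftrightarrow> vge f p h c"
  using vge_cong_imp[of g h c] vge_cong_imp[of h g c] dvd_diff_sym[of f g h] by auto

lemma vge_add: assumes "vge f p g c" "vge f p h c" shows "vge f p (g + h) c"
proof (cases "f dvd g \<or> f dvd h")
  case True
  then show ?thesis
    using vge_cong_imp[of "g + h" h c] vge_cong_imp[of "g + h" g c] assms by auto
next
  case False
  with p_add[of g h] assms show ?thesis by (cases "f dvd g + h") (auto simp: vge_def)
qed

lemma vge_minus: "vge f p g c \<Longrightarrow> vge f p (- g) c"
  using vge_cmult[of g c "-1"] by simp

lemma vge_diff: "vge f p g c \<Longrightarrow> vge f p h c \<Longrightarrow> vge f p (g - h) c"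
  using vge_add[of g c "- h"] vge_minus[of h c] by simp

lemma vge_sum: "(\<And>i. i \<in> I \<Longrightarrow> vge f p (g i) c) \<Longrightarrow> vge f p (\<Sum>i\<in>I. g i) c"
  by (induction I rule: infinite_finite_induct) (auto intro: vge_add)

lemma veq_mult: "veq f p g c \<Longrightarrow> veq f p h d \<Longrightarrow> veq f p (g * h) (c + d)"
  by (auto simp: veq_def dvd_mult_iff p_mult)

lemma veq_const: "a \<noteq> 0 \<Longrightarrow> veq f p (const2 a) 0"
  by (simp add: veq_def p_const not_dvd_const)

lemma veq_cmult: "veq f p g c \<Longrightarrow> a \<noteq> 0 \<Longrightarrow> veq f p (const2 a * g) c"
  using veq_mult[OF veq_const, of a g c] by simp

lemma veq_power: "veq f p g c \<Longrightarrow> veq f p (g ^ i) (int i * c)"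
proof (induction i)
  case 0
  show ?case using veq_const[of 1] by simp
next
  case (Suc i)
  then show ?case using veq_mult[of g c "g ^ i" "int i * c"] by (simp add: algebra_simps)
qed

lemma veq_imp_vge: "veq f p g c \<Longrightarrow> d \<le> c \<Longrightarrow> vge f p g d"
  by (auto simp: veq_def vge_def)

lemma veq_not_vge: "veq f p g c \<Longrightarrow> c < d \<Longrightarrow> \<not> vge f p g d"
  by (auto simp: veq_def vge_def)

lemma veqI: "vge f p g c \<Longrightarrow> \<not> vge f p g (c + 1) \<Longrightarrow> veq f p g c"
  by (auto simp: veq_def vge_def)

lemma veq_cong: "f dvd g - h \<Longrightarrow> veq f p g c \<longleftrightarrow> veq f p h c"
  using p_cong[of g h] dvd_diff_sym[of f g h] dvd_add[of f "g - h" h] dvd_add[of f "h - g" g]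
  by (auto simp: veq_def)

lemma veq_add: assumes "veq f p g c" "vge f p h (c + 1)" shows "veq f p (g + h) c"
proof (rule veqI)
  show "vge f p (g + h) c"
    using assms by (intro vge_add) (auto intro: veq_imp_vge vge_mono)
  show "\<not> vge f p (g + h) (c + 1)"
    using vge_diff[of "g + h" "c + 1" h] assms veq_not_vge[of g c "c + 1"] by auto
qed

lemma veq_diff_cong: assumes "vge f p (g - h) (c + 1)" shows "veq f p g c \<longleftrightarrow> veq f p h c"
  using veq_add[of g c "h - g"] veq_add[of h c "g - h"] vge_minus[OF assms] assms by auto

lemma vge_mult_cancel: "veq f p g c \<Longrightarrow> vge f p (g * h) (c + d) \<Longrightarrow> vge f p h d"
  using p_mult[of g h] by (cases "f dvd h") (auto simp: veq_def vge_def dvd_mult_iff)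

lemma veq_mult_cancel: "veq f p g c \<Longrightarrow> veq f p (g * h) (c + d) \<Longrightarrow> veq f p h d"
  by (auto simp: veq_def dvd_mult_iff p_mult)

lemma p_power: "\<not> f dvd g \<Longrightarrow> p (g ^ i) = int i * p g"
  using veq_power[of g "p g" i] by (simp add: veq_def)

end

locale place =
  fixes f :: poly2 and p :: place
  assumes irreducible: "irreducible f" and pl: "p \<in> places f"

sublocale place \<subseteq> val
proof
  show "irreducible f" by (rule irreducible)
qed (use pl in \<open>auto simp: places_def\<close>)

lemma (in place) p_uniformizer: obtains g h where "\<not> f dvd g" "\<not> f dvd h" "p g - p h = 1"
  using pl by (auto simp: places_def)

text \<open>Multiples of a place keep the weights at the \<open>O\<close>-points integral.\<close>

lemma (in val) val_scaled: "val f (\<lambda>g. int r * p g)"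
proof
  show "irreducible f" by (rule irr)
  show "min (int r * p g) (int r * p h) \<le> int r * p (g + h)"
    if "\<not> f dvd g" "\<not> f dvd h" "\<not> f dvd g + h" for g h
    using p_add[OF that] by (auto simp: min_le_iff_disj mult_left_mono)
qed (use p_cong p_mult p_const p_dvd in \<open>auto simp: algebra_simps\<close>)

section \<open>Linear spans over the constants modulo \<open>f\<close>\<close>

lemma C2_module: "Modules.module (\<lambda>c g. const2 c * g)"
  by unfold_locales (simp_all add: algebra_simps)

text \<open>Multiples of \<open>f\<close> belong to the span, so membership is a statement about
  functions on the curve. Varying the index set gives a filtration in which leading terms can be
  discussed.\<close>

definition Sp :: "poly2 \<Rightarrow> (int \<Rightarrow> poly2) \<Rightarrow> int set \<Rightarrow> poly2 set" where
  "Sp f v J = Modules.module.span (\<lambda>c g. const2 c * g) (v ` J \<union> {g. f dvd g})"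

lemma Sp_base: "j \<in> J \<Longrightarrow> v j \<in> Sp f v J"
  unfolding Sp_def by (rule Modules.module.span_base[OF C2_module]) auto

lemma Sp_dvd: "f dvd g \<Longrightarrow> g \<in> Sp f v J"
  unfolding Sp_def by (rule Modules.module.span_base[OF C2_module]) auto

lemma Sp_0 [simp]: "0 \<in> Sp f v J"
  by (rule Sp_dvd) simp

lemma Sp_add: "g \<in> Sp f v J \<Longrightarrow> h \<in> Sp f v J \<Longrightarrow> g + h \<in> Sp f v J"
  unfolding Sp_def by (rule Modules.module.span_add[OF C2_module])

lemma Sp_scale: "g \<in> Sp f v J \<Longrightarrow> const2 c * g \<in> Sp f v J"
  unfolding Sp_def by (rule Modules.module.span_scale[OF C2_module])

lemma Sp_mono: "g \<in> Sp f v J \<Longrightarrow> J \<subseteq> J' \<Longrightarrow> g \<in> Sp f v J'"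
  unfolding Sp_def
  using Modules.module.span_mono[OF C2_module, of "v ` J \<union> {g. f dvd g}" "v ` J' \<union> {g. f dvd g}"] by blast

lemma Sp_cong: "g \<in> Sp f v J \<Longrightarrow> f dvd h - g \<Longrightarrow> h \<in> Sp f v J"
  using Sp_add[OF _ Sp_dvd, of g f v J "h - g"] by simp

lemma Sp_breakdown:
  assumes "g \<in> Sp f v (insert j J)"
  obtains c where "g - const2 c * v j \<in> Sp f v J"
proof -
  have "g \<in> Modules.module.span (\<lambda>c g. const2 c * g) (insert (v j) (v ` J \<union> {g. f dvd g}))"
    using assms by (simp add: Sp_def)
  then show ?thesis using that unfolding Modules.module.span_breakdown_eq[OF C2_module] Sp_def by auto
qed

lemma Sp_induct [consumes 1, case_names dvd base add scale]:
  assumes "g \<in> Sp f v J"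
    and dvd: "\<And>g. f dvd g \<Longrightarrow> P g" and base: "\<And>j. j \<in> J \<Longrightarrow> P (v j)"
    and add: "\<And>g h. P g \<Longrightarrow> P h \<Longrightarrow> P (g + h)" and scale: "\<And>c g. P g \<Longrightarrow> P (const2 c * g)"
  shows "P g"
proof -
  have "Modules.module.subspace (\<lambda>c g. const2 c * g) (Collect P)"
    using dvd[of 0] add scale by (auto simp: Modules.module.subspace_def[OF C2_module])
  moreover have "P x" if "x \<in> v ` J \<union> {g. f dvd g}" for x
    using that base dvd by auto
  ultimately show ?thesis
    using Modules.module.span_induct[OF C2_module, of g "v ` J \<union> {g. f dvd g}" P] assms(1)
    unfolding Sp_def by blast
qed

lemma Sp_trans:
  assumes "g \<in> Sp f w J" "\<And>j. j \<in> J \<Longrightarrow> w j \<in> Sp f v J'"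
  shows "g \<in> Sp f v J'"
  using assms(1) by (induction rule: Sp_induct) (auto intro: Sp_dvd Sp_add Sp_scale assms(2))

context val
begin

lemma vge_Sp:
  assumes "g \<in> Sp f v J" "\<And>j. j \<in> J \<Longrightarrow> vge f p (v j) c"
  shows "vge f p g c"
  using assms(1)
  by (induction rule: Sp_induct) (auto intro: vge_add vge_cmult assms(2), auto simp: vge_def)

end

section \<open>Places of the curve\<close>

lemma eval2_simps [simp]:
  "eval2 (const2 c) a b = c" "eval2 X a b = a" "eval2 Y a b = b"
  "eval2 0 a b = 0" "eval2 1 a b = 1"
  "eval2 (g + h) a b = eval2 g a b + eval2 h a b"
  "eval2 (g - h) a b = eval2 g a b - eval2 h a b"
  "eval2 (g * h) a b = eval2 g a b * eval2 h a b"
  by (simp_all add: eval2_def const2_def X_def Y_def)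

lemma poly2_induct [case_names const X Y add mult]:
  assumes const: "\<And>c. P (const2 c)" and X: "P X" and Y: "P Y"
    and add: "\<And>g h. P g \<Longrightarrow> P h \<Longrightarrow> P (g + h)" and mult: "\<And>g h. P g \<Longrightarrow> P h \<Longrightarrow> P (g * h)"
  shows "P (g :: poly2)"
proof -
  have inner: "P [:a:]" for a :: "complex poly"
  proof (induction a)
    case 0
    show ?case using const[of 0] by simp
  next
    case (pCons c a)
    have "[:pCons c a:] = const2 c + X * [:a:]" by (simp add: const2_def X_def)
    then show ?case using add[OF const mult[OF X pCons.IH]] by simp
  qed
  show ?thesis
  proof (induction g)
    case 0
    show ?case using const[of 0] by simp
  next
    case (pCons a g)
    have "pCons a g = [:a:] + Y * g" by (simp add: Y_def)
    then show ?case using add[OF inner mult[OF Y pCons.IH]] by simp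
  qed
qed

text \<open>The kernel of evaluation at (a, b) is the ideal generated by x - a and y - b. This
  first-order Taylor formula takes the place of power series in all local arguments.\<close>

lemma eval2_decompose:
  "\<exists>g1 g2. g = const2 (eval2 g a b) + (X - const2 a) * g1 + (Y - const2 b) * g2"
proof (induction g rule: poly2_induct)
  case (const c)
  show ?case by (intro exI[of _ 0]) simp
next
  case X
  show ?case by (intro exI[of _ 1] exI[of _ 0]) simp
next
  case Y
  show ?case by (intro exI[of _ 1] exI[of _ 0]) simp
next
  case (add g h)
  then obtain g1 g2 h1 h2 where "g = const2 (eval2 g a b) + (X - const2 a) * g1 + (Y - const2 b) * g2"
    "h = const2 (eval2 h a b) + (X - const2 a) * h1 + (Y - const2 b) * h2" by blast
  then have "g + h = (const2 (eval2 g a b) + (X - const2 a) * g1 + (Y - const2 b) * g2)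
      + (const2 (eval2 h a b) + (X - const2 a) * h1 + (Y - const2 b) * h2)"
    by (rule arg_cong2)
  also have "\<dots> = const2 (eval2 (g + h) a b) + (X - const2 a) * (g1 + h1) + (Y - const2 b) * (g2 + h2)"
    by (simp add: algebra_simps)
  finally show ?case by blast
next
  case (mult g h)
  then obtain g1 g2 h1 h2 where g: "g = const2 (eval2 g a b) + (X - const2 a) * g1 + (Y - const2 b) * g2"
    and h: "h = const2 (eval2 h a b) + (X - const2 a) * h1 + (Y - const2 b) * h2" by blast
  have "g * h = const2 (eval2 g a b) * h + (X - const2 a) * (g1 * h) + (Y - const2 b) * (g2 * h)"
    by (subst g) (simp add: algebra_simps)
  also have "const2 (eval2 g a b) * h = const2 (eval2 (g * h) a b)
      + (X - const2 a) * (const2 (eval2 g a b) * h1) + (Y - const2 b) * (const2 (eval2 g a b) * h2)"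
    by (subst h) (simp add: algebra_simps)
  finally have "g * h = const2 (eval2 (g * h) a b)
      + (X - const2 a) * (const2 (eval2 g a b) * h1 + g1 * h)
      + (Y - const2 b) * (const2 (eval2 g a b) * h2 + g2 * h)"
    by (simp add: algebra_simps)
  then show ?case by blast
qed

text \<open>In the product rule every term except B keeps a factor vanishing at (a, b), and x - a is
  constant in y. The outer variable is y, so \<open>pderiv\<close> is the y-derivative.\<close>

lemma eval2_pderiv:
  assumes "f = (X - const2 a) * A + (Y - const2 b) * B"
  shows "eval2 (pderiv f) a b = eval2 B a b"
proof -
  have [simp]: "pderiv X = 0" "pderiv Y = 1" "pderiv (const2 c) = 0" for c
    by (simp_all add: X_def Y_def const2_def pderiv_pCons)
  show ?thesis unfolding assms by (simp add: pderiv_add pderiv_mult pderiv_diff)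
qed

text \<open>The x-derivative acts on the coefficients of the powers of y. There x - a is a scalar
  while y - b mixes neighbouring coefficients; hence the coefficientwise comparison.\<close>

lemma eval2_map_pderiv:
  assumes "f = (X - const2 a) * A + (Y - const2 b) * B"
  shows "eval2 (map_poly pderiv f) a b = eval2 A a b"
proof -
  have "map_poly pderiv f = A + (X - const2 a) * map_poly pderiv A + (Y - const2 b) * map_poly pderiv B"
  proof (rule poly_eqI)
    fix i
    have X: "(X - const2 a) * g = Polynomial.smult [:-a, 1:] g" for g
      by (simp add: X_def const2_def)
    have Y: "coeff ((Y - const2 b) * g) i = (case i of 0 \<Rightarrow> 0 | Suc i \<Rightarrow> coeff g i) - Polynomial.smult b (coeff g i)" for g i
      by (simp add: Y_def const2_def algebra_simps coeff_pCons)
    show "coeff (map_poly pderiv f) i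
      = coeff (A + (X - const2 a) * map_poly pderiv A + (Y - const2 b) * map_poly pderiv B) i"
      unfolding assms coeff_add X Y
      by (cases i) (simp_all add: coeff_map_poly X Y coeff_add pderiv_add pderiv_diff pderiv_mult
            pderiv_smult pderiv_pCons add_ac del: mult_pCons_left)
  qed
  then show ?thesis by simp
qed

text \<open>Elimination of y: the ideal (f, g) contains a nonzero polynomial in x alone. A nonzero
  element d of least y-degree divides f and g up to factors from C[x]; were its degree positive,
  primality of f would give f | d and then f | g.\<close>

lemma norm_multiple:
  assumes irr: "irreducible (f :: poly2)" and deg: "degree f > 0" and ndvd: "\<not> f dvd g"
  obtains b c where "c \<noteq> 0" "f dvd g * b - [:c:]"
proof -
  have prime: "prime_elem f" using irr by (rule irreducible_imp_prime_elem)
  define I where "I = {d. \<exists>u w. d = u * f + w * g}"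
  have "g = 0 * f + 1 * g" "f = 1 * f + 0 * g" by simp_all
  then have gI: "g \<in> I" and fI: "f \<in> I" unfolding I_def by blast+
  have "g \<noteq> 0" using ndvd by auto
  with gI obtain d where d: "d \<in> I" "d \<noteq> 0"
    and min: "\<And>e. e \<in> I \<Longrightarrow> e \<noteq> 0 \<Longrightarrow> degree d \<le> degree e"
    using ex_has_least_nat[of "\<lambda>d. d \<in> I \<and> d \<noteq> 0" g degree] by blast
  \<comment> \<open>Pseudo-division by d: the remainder again lies in the ideal, so minimality of
    the degree of d makes it 0.\<close>
  have divides: "\<exists>a q. a \<noteq> 0 \<and> [:a:] * e = d * q" if e: "e \<in> I" for e
  proof -
    obtain a q where aq: "a \<noteq> 0" "Polynomial.smult a e = d * q + pseudo_mod e d"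
      using pseudo_mod(1)[OF d(2), of e] by blast
    from e d(1) obtain u w u' w' where "e = u * f + w * g" "d = u' * f + w' * g"
      unfolding I_def by blast
    then have "pseudo_mod e d = (Polynomial.smult a u - q * u') * f + (Polynomial.smult a w - q * w') * g"
      using aq(2) by (simp add: algebra_simps smult_add_right)
    then have "pseudo_mod e d \<in> I" unfolding I_def by blast
    with min[of "pseudo_mod e d"] pseudo_mod(2)[OF d(2), of e] have "pseudo_mod e d = 0" by linarith
    with aq show ?thesis by auto
  qed
  have small: "\<not> f dvd [:a:]" if "a \<noteq> 0" for a
    using dvd_imp_degree_le[of f "[:a:]"] deg that by auto
  have "degree d = 0"
  proof (rule ccontr)
    assume dd: "degree d \<noteq> 0"
    obtain a q where a: "a \<noteq> 0" "[:a:] * f = d * q" using divides[OF fI] by blast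
    have "f dvd d * q" using a(2) by (metis dvd_triv_right)
    then have "f dvd d \<or> f dvd q" using prime prime_elem_dvd_mult_iff by blast
    \<comment> \<open>If f divided q, cancelling f would exhibit a nonzero polynomial of y-degree 0
      as a multiple of d.\<close>
    moreover have "\<not> f dvd q"
    proof
      assume "f dvd q"
      then obtain q' where "q = f * q'" by auto
      then have "f * [:a:] = f * (d * q')" using a(2) by (simp add: algebra_simps)
      moreover have "f \<noteq> 0" using irr by auto
      ultimately have eq: "[:a:] = d * q'" by (metis mult_left_cancel)
      then have "q' \<noteq> 0" using a by auto
      then have "degree [:a:] = degree d + degree q'" using eq d(2) degree_mult_eq by metis
      then show False using dd by simp
    qed
    ultimately have "f dvd d" by blast
    obtain a' q' where a': "a' \<noteq> 0" "[:a':] * g = d * q'" using divides[OF gI] by blast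
    then have "f dvd [:a':] * g" using \<open>f dvd d\<close> by auto
    then show False using small[OF a'(1)] ndvd prime prime_elem_dvd_mult_iff by blast
  qed
  then obtain c where c: "d = [:c:]" using degree_eq_zeroE by blast
  from d(1) obtain u w where "d = u * f + w * g" unfolding I_def by blast
  then have "g * w - [:c:] = f * (- u)" by (simp add: c algebra_simps)
  then have "f dvd g * w - [:c:]" by (rule dvdI)
  with that[of c w] c d(2) show thesis by auto
qed

section \<open>Values of x and y at a place\<close>

lemma vanishes_at_vge: "vanishes_at f p g \<longleftrightarrow> vge f p g 1"
  by (auto simp: vanishes_at_def vge_def)

text \<open>Over C the polynomial splits into linear factors, and one of them vanishes at p because
  orders add. The embedding \<open>h\<close> is abstract since polynomials in x and polynomials in y
  are both treated.\<close>

lemma (in place) vge_poly_root: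
  assumes h: "comm_ring_hom h" and hc: "\<And>c. h [:c:] = const2 c"
    and t: "vge f p (h [:0, 1:]) 0"
    and "c \<noteq> 0" "vge f p (h c) 1"
  shows "\<exists>\<alpha>. poly c \<alpha> = 0 \<and> vge f p (h [:0, 1:] - const2 \<alpha>) 1"
  using assms(4,5)
proof (induction "degree c" arbitrary: c)
  case 0
  then obtain a where a: "c = [:a:]" using degree_eq_zeroE by metis
  then have "veq f p (h c) 0" using 0 veq_const hc by simp
  then show ?case using 0 veq_not_vge[of "h c" 0 1] by simp
next
  case (Suc d)
  interpret h: comm_ring_hom h by (rule h)
  have "\<not> constant (poly c)" using Suc(2) by (simp add: constant_degree)
  then obtain \<alpha> where \<alpha>: "poly c \<alpha> = 0" using fundamental_theorem_of_algebra by blast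
  then obtain c' where c': "c = [:-\<alpha>, 1:] * c'" using poly_eq_0_iff_dvd by blast
  have "c' \<noteq> 0" using Suc.prems c' by auto
  then have "degree c = Suc (degree c')" unfolding c' by (subst degree_mult_eq) auto
  then have deg: "d = degree c'" using Suc(2) by simp
  have "[:-\<alpha>, 1:] = [:0, 1:] - [:\<alpha>:]" by simp
  then have hl: "h [:-\<alpha>, 1:] = h [:0, 1:] - const2 \<alpha>" using hc h.hom_minus by metis
  show ?case
  proof (cases "vge f p (h [:-\<alpha>, 1:]) 1")
    case True
    then show ?thesis using \<alpha> hl by auto
  next
    case False
    have "vge f p (h [:-\<alpha>, 1:]) 0" unfolding hl using t vge_const by (rule vge_diff)
    with False have "veq f p (h [:-\<alpha>, 1:]) 0" using veqI[of _ 0] by simp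
    moreover have "vge f p (h [:-\<alpha>, 1:] * h c') (0 + 1)"
      using Suc.prems(2) c' h.hom_mult[of "[:-\<alpha>, 1:]" c'] by simp
    ultimately have "vge f p (h c') 1" by (rule vge_mult_cancel)
    from Suc(1)[OF deg \<open>c' \<noteq> 0\<close> this] show ?thesis unfolding c' by auto
  qed
qed

lemma coeff0_hom: "comm_ring_hom (\<lambda>c :: complex poly. [:c:])"
  by unfold_locales (simp_all add: one_pCons)

lemma map_const_hom: "comm_ring_hom (map_poly (\<lambda>a :: complex. [:a:]))"
proof -
  interpret c: comm_ring_hom "\<lambda>a :: complex. [:a:]" by unfold_locales (simp_all add: one_pCons)
  interpret map_poly_comm_ring_hom "\<lambda>a :: complex. [:a:]" ..
  show ?thesis ..
qed

context place
begin

lemma vge_all_0: assumes "vge f p X 0" "vge f p Y 0" shows "vge f p g 0"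
  by (induction g rule: poly2_induct)
     (use assms vge_const vge_add vge_mult[of _ 0 _ 0] in auto)

text \<open>The polynomial in x eliminated from \<open>g\<close> vanishes at p as well, and one of
  its roots is the value of x.\<close>

lemma exists_root_X:
  assumes "degree f > 0" and all: "\<And>g. vge f p g 0" and g: "\<not> f dvd g" "vge f p g 1"
  obtains b c \<alpha> where "c \<noteq> 0" "f dvd g * b - [:c:]" "poly c \<alpha> = 0" "vge f p (X - const2 \<alpha>) 1"
proof -
  obtain b c where bc: "c \<noteq> 0" "f dvd g * b - [:c:]"
    using norm_multiple[OF irr assms(1) g(1)] by blast
  have "vge f p (g * b) (1 + 0)" using g(2) all by (rule vge_mult)
  then have "vge f p [:c:] 1" using vge_cong[OF bc(2)] by simp
  then obtain \<alpha> where "poly c \<alpha> = 0" "vge f p (X - const2 \<alpha>) 1"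
    using vge_poly_root[OF coeff0_hom _ all bc(1)] by (auto simp: const2_def X_def)
  with bc that show thesis by blast
qed

text \<open>The leading coefficient of f in y is constant, so y is integral over C[x] and has no
  pole where x has none. The value of x is a root of an eliminated polynomial, that of y a root of f
  at this value of x.\<close>

lemma lies_over_exists:
  assumes X0: "vge f p X 0" and deg: "degree f > 0" and lc: "lead_coeff f = [:l:]" "l \<noteq> 0"
  shows "\<exists>a b. lies_over f p a b"
proof -
  have Y0: "vge f p Y 0"
  proof (rule ccontr)
    assume neg: "\<not> vge f p Y 0"
    then have Yp: "\<not> f dvd Y" "p Y < 0" by (auto simp: vge_def)
    define n where "n = degree f"
    have "f = (\<Sum>i\<le>n. monom (coeff f i) i)" by (simp add: n_def poly_as_sum_of_monoms)
    also have "\<dots> = (\<Sum>i\<le>n. [:coeff f i:] * Y ^ i)"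
      by (simp add: Y_def monom_altdef)
    also have "\<dots> = (\<Sum>i<n. [:coeff f i:] * Y ^ i) + const2 l * Y ^ n"
      using lc by (simp add: lessThan_Suc_atMost[symmetric] n_def const2_def)
    finally have f: "f = (\<Sum>i<n. [:coeff f i:] * Y ^ i) + const2 l * Y ^ n" .
    have c0: "vge f p [:c:] 0" for c
    proof (induction c)
      case (pCons a c)
      have "[:pCons a c:] = const2 a + X * [:c:]" by (simp add: const2_def X_def)
      then show ?case using vge_add[OF vge_const] vge_mult[OF X0 pCons.IH] by simp
    qed simp
    have Yeq: "veq f p Y (p Y)" using Yp by (simp add: veq_def)
    have top: "veq f p (const2 l * Y ^ n) (int n * p Y)"
      using veq_cmult[OF veq_power[OF Yeq] lc(2)] .
    \<comment> \<open>With a pole of y, the term l y^n alone has the smallest order, so f could not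
      be zero on its own curve.\<close>
    have "vge f p (\<Sum>i<n. [:coeff f i:] * Y ^ i) (int n * p Y + 1)"
    proof (rule vge_sum)
      fix i assume i: "i \<in> {..<n}"
      have "vge f p ([:coeff f i:] * Y ^ i) (0 + int i * p Y)"
        using vge_mult[OF c0 veq_imp_vge[OF veq_power[OF Yeq]]] by blast
      moreover have "int n * p Y + 1 \<le> int i * p Y"
      proof -
        have "(int n - int i) * p Y \<le> 1 * p Y" using i Yp by (intro mult_right_mono_neg) auto
        then show ?thesis using Yp by (simp add: algebra_simps)
      qed
      ultimately show "vge f p ([:coeff f i:] * Y ^ i) (int n * p Y + 1)" by (auto intro: vge_mono)
    qed
    from veq_add[OF top this] f have "veq f p f (int n * p Y)" by (simp add: add.commute)
    then show False by (simp add: veq_def)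
  qed
  have all: "vge f p g 0" for g using X0 Y0 by (rule vge_all_0)
  \<comment> \<open>All orders are nonnegative here, so an order difference of 1 produces a function
    with a zero at p.\<close>
  obtain g h where gh: "\<not> f dvd g" "\<not> f dvd h" "p g - p h = 1" by (rule p_uniformizer)
  then have "vge f p g 1" using all[of h] by (auto simp: vge_def)
  then obtain \<alpha> where \<alpha>: "vge f p (X - const2 \<alpha>) 1" using exists_root_X[OF deg all gh(1)] by metis
  \<comment> \<open>f with x specialised to \<alpha>, a polynomial in y; it is nonzero because the
    constant leading coefficient l survives.\<close>
  define c where "c = map_poly (\<lambda>a. poly a \<alpha>) f"
  have cn0: "c \<noteq> 0"
  proof -
    have "coeff c (degree f) = l" unfolding c_def using lc by (simp add: coeff_map_poly)
    then show ?thesis using lc(2) by (metis coeff_0)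
  qed
  have "vge f p (f - map_poly (\<lambda>a. [:a:]) c) 1"
  proof -
    have "X - const2 \<alpha> dvd f - map_poly (\<lambda>a. [:a:]) c"
    proof -
      have "[:-\<alpha>, 1:] dvd coeff (f - map_poly (\<lambda>a. [:a:]) c) i" for i
        unfolding c_def by (simp add: coeff_map_poly flip: poly_eq_0_iff_dvd)
      then have "[:[:-\<alpha>, 1:]:] dvd f - map_poly (\<lambda>a. [:a:]) c"
        by (simp add: const_poly_dvd_iff)
      then show ?thesis by (simp add: X_def const2_def)
    qed
    then obtain r where "f - map_poly (\<lambda>a. [:a:]) c = (X - const2 \<alpha>) * r" by auto
    then show ?thesis using vge_mult[OF \<alpha> all[of r]] by simp
  qed
  then have "vge f p (map_poly (\<lambda>a. [:a:]) c) 1"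
    using vge_cong[of "f - map_poly (\<lambda>a. [:a:]) c" "- map_poly (\<lambda>a. [:a:]) c" 1]
      vge_minus[of "- map_poly (\<lambda>a. [:a:]) c" 1] by simp
  moreover have "map_poly (\<lambda>a. [:a:]) [:a:] = const2 a" for a
    by (intro poly_eqI) (simp add: const2_def coeff_map_poly coeff_pCons split: nat.split)
  ultimately obtain \<beta> where "vge f p (map_poly (\<lambda>a. [:a:]) [:0, 1:] - const2 \<beta>) 1"
    using vge_poly_root[OF map_const_hom _ all cn0] by blast
  then have "vge f p (Y - const2 \<beta>) 1" by (simp add: Y_def map_poly_pCons one_pCons)
  with \<alpha> show ?thesis unfolding lies_over_def vanishes_at_vge by blast
qed

lemma lies_over_vge_0: assumes "lies_over f p a b" shows "vge f p g 0"
proof (rule vge_all_0)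
  have "vge f p (X - const2 a + const2 a) 0" "vge f p (Y - const2 b + const2 b) 0"
    using assms unfolding lies_over_def vanishes_at_vge
    by (intro vge_add vge_const; auto elim: vge_mono)+
  then show "vge f p X 0" "vge f p Y 0" by simp_all
qed

lemma lies_over_eval:
  assumes "lies_over f p a b" shows "vge f p (g - const2 (eval2 g a b)) 1"
proof -
  obtain g1 g2 where g: "g = const2 (eval2 g a b) + (X - const2 a) * g1 + (Y - const2 b) * g2"
    using eval2_decompose by blast
  have "vge f p ((X - const2 a) * g1 + (Y - const2 b) * g2) (1 + 0)"
    using assms lies_over_vge_0[OF assms] unfolding lies_over_def vanishes_at_vge
    by (intro vge_add vge_mult) auto
  moreover have "g - const2 (eval2 g a b) = (X - const2 a) * g1 + (Y - const2 b) * g2"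
    by (subst g) simp
  ultimately show ?thesis by simp
qed

lemma lies_over_eval_veq:
  assumes "lies_over f p a b" "eval2 g a b \<noteq> 0" shows "veq f p g 0"
  using veq_add[OF veq_const[OF assms(2)], of "g - const2 (eval2 g a b)"]
    lies_over_eval[OF assms(1), of g] by simp

lemma lies_over_on_curve: assumes "lies_over f p a b" shows "eval2 f a b = 0"
  using lies_over_eval_veq[OF assms, of f] by (auto simp: veq_def)

lemma lies_over_unique: assumes "lies_over f p a b" "lies_over f p a' b'" shows "a = a'" "b = b'"
proof -
  have nv: "c = 0" if "vge f p (const2 c) 1" for c
    using veq_not_vge[OF veq_const, of c 1] that by auto
  have "vge f p (const2 (a' - a)) 1" "vge f p (const2 (b' - b)) 1"
    using assms vge_diff[of "X - const2 a" 1 "X - const2 a'"]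
      vge_diff[of "Y - const2 b" 1 "Y - const2 b'"]
    unfolding lies_over_def vanishes_at_vge by auto
  from this[THEN nv] show "a = a'" "b = b'" by auto
qed

section \<open>Local parameters at smooth points\<close>

lemma local_step:
  assumes f: "f = t * A + s * B" and B: "veq f p B 0"
    and dec: "\<And>g. \<exists>c g1 g2. g = const2 c + t * g1 + s * g2"
    and t: "vge f p t 1" and s: "vge f p s 1" and all: "\<And>g. vge f p g 0" and g: "vge f p g 1"
  shows "\<exists>h. f dvd B * g - t * h"
proof -
  obtain c g1 g2 where g': "g = const2 c + t * g1 + s * g2" using dec by blast
  have "vge f p (g - (t * g1 + s * g2)) 1"
    using vge_add[OF vge_mult[OF t all[of g1]] vge_mult[OF s all[of g2]]] g by (intro vge_diff) auto
  then have "vge f p (const2 c) 1" using g' by simp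
  then have "c = 0" using veq_not_vge[OF veq_const, of c 1] by auto
  \<comment> \<open>Since s B = f - t A, multiplication by the unit B turns the s-part of g into a
    multiple of t modulo f.\<close>
  have "B * g - t * (B * g1 - A * g2) = f * g2"
    unfolding f unfolding g' \<open>c = 0\<close> by (simp add: algebra_simps)
  then show ?thesis using dvd_triv_left[of f g2] by metis
qed

text \<open>Algebraic form of the implicit function theorem: as B is a unit at p, every vanishing
  function is divisible by t up to a unit. Descent on the order shows that p t divides all orders,
  and some difference of orders is 1.\<close>

lemma local_parameter:
  assumes f: "f = t * A + s * B" and B: "veq f p B 0"
    and dec: "\<And>g. \<exists>c g1 g2. g = const2 c + t * g1 + s * g2"
    and t: "vge f p t 1" and s: "vge f p s 1" and all: "\<And>g. vge f p g 0"
  shows "veq f p t 1"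
proof -
  have mult: "p t dvd p g \<and> \<not> f dvd t" if "\<not> f dvd g" "p g = int i" "i > 0" for g i
    using that
  proof (induction i arbitrary: g rule: less_induct)
    case (less i)
    then have "vge f p g 1" by (simp add: vge_def)
    then obtain h where h: "f dvd B * g - t * h" using local_step[OF assms] by blast
    have "veq f p (B * g) (0 + int i)" using B less.prems by (intro veq_mult) (auto simp: veq_def)
    then have th: "veq f p (t * h) (int i)" using veq_cong[OF h] by simp
    then have nd: "\<not> f dvd t" "\<not> f dvd h" and sum: "p t + p h = int i"
      by (auto simp: veq_def dvd_mult_iff p_mult)
    have "p t \<ge> 1" "p h \<ge> 0" using t all[of h] nd by (auto simp: vge_def)
    show ?case
    proof (cases "p h = 0")
      case True
      then show ?thesis using sum less.prems nd by simp
    next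
      case False
      then have "p t dvd p h"
        using less.IH[of "nat (p h)" h] \<open>p t \<ge> 1\<close> \<open>p h \<ge> 0\<close> sum nd by auto
      then show ?thesis using sum less.prems nd by (metis dvd_add dvd_refl)
    qed
  qed
  have mult0: "p t dvd p g" if "\<not> f dvd g" for g
    using mult[of g "nat (p g)"] that all[of g] by (cases "p g = 0") (auto simp: vge_def)
  obtain g h where gh: "\<not> f dvd g" "\<not> f dvd h" "p g - p h = 1" by (rule p_uniformizer)
  then have "p g > 0" using all[of h] by (auto simp: vge_def)
  then have nt: "\<not> f dvd t" using mult[of g "nat (p g)"] gh by auto
  have "p t dvd 1" using mult0[OF gh(1)] mult0[OF gh(2)] gh(3) by (metis dvd_diff)
  moreover have "p t \<ge> 1" using t nt by (auto simp: vge_def)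
  ultimately show ?thesis using nt by (auto simp: veq_def)
qed

end

text \<open>At both places t has order 1, and dividing a vanishing function by t is one and the same
  polynomial identity. In the induction on the order at p, a function of order 0 has nonzero
  constant term c, which makes it a unit at p' too.\<close>

lemma local_place_unique:
  assumes p: "place f p" "place f p'"
    and f: "f = t * A + s * B" and B: "veq f p B 0" "veq f p' B 0"
    and dec: "\<And>g. \<exists>c g1 g2. g = const2 c + t * g1 + s * g2"
    and t: "vge f p t 1" "vge f p' t 1" and s: "vge f p s 1" "vge f p' s 1"
    and all: "\<And>g. vge f p g 0" "\<And>g. vge f p' g 0"
  shows "p = p'"
proof -
  interpret p: place f p by (rule p)
  interpret p': place f p' by (rule p)
  have tp: "veq f p t 1" by (rule p.local_parameter[OF f B(1) dec t(1) s(1) all(1)])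
  have tp': "veq f p' t 1" by (rule p'.local_parameter[OF f B(2) dec t(2) s(2) all(2)])
  have le: "p' g = p g" if "\<not> f dvd g" "p g = int i" for g i
    using that
  proof (induction i arbitrary: g rule: less_induct)
    case (less i)
    show ?case
    proof (cases "i = 0")
      case True
      obtain c g1 g2 where g': "g = const2 c + t * g1 + s * g2" using dec by blast
      have v: "vge f p (t * g1 + s * g2) (1 + 0)" "vge f p' (t * g1 + s * g2) (1 + 0)"
        using t s all by (intro p.vge_add p.vge_mult p'.vge_add p'.vge_mult; simp)+
      have "c \<noteq> 0"
      proof
        assume "c = 0"
        then have "vge f p g 1" using v(1) g' by simp
        then show False using less.prems True by (simp add: vge_def)
      qed
      then have "veq f p' g 0" using p'.veq_add[OF p'.veq_const, of c "t * g1 + s * g2"] v(2) g'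
        by (simp add: add.assoc)
      then show ?thesis using less.prems True by (simp add: veq_def)
    next
      case False
      then have "vge f p g 1" using less.prems by (simp add: vge_def)
      then obtain h where h: "f dvd B * g - t * h"
        using p.local_step[OF f B(1) dec t(1) s(1) all(1)] by blast
      have "veq f p (B * g) (0 + int i)" using B(1) less.prems
        by (intro p.veq_mult) (auto simp: veq_def)
      then have "veq f p (t * h) (1 + (int i - 1))" using p.veq_cong[OF h] by simp
      then have hp: "veq f p h (int i - 1)" using p.veq_mult_cancel[OF tp] by blast
      then have "p' h = p h"
        using less.IH[of "i - 1" h] False by (auto simp: veq_def of_nat_diff)
      then have "veq f p' (t * h) (1 + (int i - 1))" using hp
        by (intro p'.veq_mult[OF tp']) (auto simp: veq_def)
      then have "veq f p' (B * g) (0 + int i)" using p'.veq_cong[OF h] by simp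
      then have "veq f p' g (int i)" using p'.veq_mult_cancel[OF B(2)] by blast
      then show ?thesis using less.prems by (simp add: veq_def)
    qed
  qed
  show "p = p'"
  proof
    fix g
    show "p g = p' g"
      using le[of g "nat (p g)"] all(1)[of g] p.p_dvd[of g] p'.p_dvd[of g]
      by (cases "f dvd g") (auto simp: vge_def)
  qed
qed

lemma smooth_point_decompose:
  assumes "eval2 f a b = 0"
  obtains A B where "f = (X - const2 a) * A + (Y - const2 b) * B"
    "eval2 A a b = eval2 (map_poly pderiv f) a b" "eval2 B a b = eval2 (pderiv f) a b"
proof -
  obtain A B where "f = const2 (eval2 f a b) + (X - const2 a) * A + (Y - const2 b) * B"
    using eval2_decompose by blast
  then have "f = (X - const2 a) * A + (Y - const2 b) * B" using assms by simp
  then show thesis using that eval2_pderiv eval2_map_pderiv by metis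
qed

text \<open>One partial derivative is nonzero at (a, b). Its coefficient in the expansion of f
  serves as the unit, and the other coordinate as the local parameter.\<close>

lemma smooth_place_unique:
  assumes smooth: "smooth_off_origin f" and "irreducible f" "p \<in> places f" "p' \<in> places f"
    and p: "lies_over f p a b" and p': "lies_over f p' a b" and ab: "(a, b) \<noteq> (0, 0)"
  shows "p = p'"
proof -
  have pl: "place f p" "place f p'" using assms by (auto simp: place_def)
  interpret p: place f p by (rule pl)
  interpret p': place f p' by (rule pl)
  have f0: "eval2 f a b = 0" using p.lies_over_on_curve[OF p] .
  obtain A B where f: "f = (X - const2 a) * A + (Y - const2 b) * B"
    and A: "eval2 A a b = eval2 (map_poly pderiv f) a b" and B: "eval2 B a b = eval2 (pderiv f) a b"
    using smooth_point_decompose[OF f0] by metis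
  have v: "vge f p (X - const2 a) 1" "vge f p (Y - const2 b) 1"
    "vge f p' (X - const2 a) 1" "vge f p' (Y - const2 b) 1"
    using p p' by (auto simp: lies_over_def vanishes_at_vge)
  show ?thesis
  proof (cases "eval2 B a b = 0")
    case False
    show ?thesis
      by (rule local_place_unique[OF pl f p.lies_over_eval_veq[OF p False] p'.lies_over_eval_veq[OF p' False]])
         (use eval2_decompose v p.lies_over_vge_0[OF p] p'.lies_over_vge_0[OF p'] in blast)+
  next
    case True
    then have A0: "eval2 A a b \<noteq> 0" using smooth f0 ab A B unfolding smooth_off_origin_def by auto
    have f': "f = (Y - const2 b) * B + (X - const2 a) * A" using f by (simp add: add.commute)
    have dec: "\<exists>c g1 g2. g = const2 c + (Y - const2 b) * g1 + (X - const2 a) * g2" for g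
      using eval2_decompose[of g a b] by (metis add.assoc add.commute)
    show ?thesis
      by (rule local_place_unique[OF pl f' p.lies_over_eval_veq[OF p A0] p'.lies_over_eval_veq[OF p' A0]])
         (use dec v p.lies_over_vge_0[OF p] p'.lies_over_vge_0[OF p'] in blast)+
  qed
qed

lemma smooth_place_parameter:
  assumes smooth: "smooth_off_origin f" and "irreducible f" "p \<in> places f"
    and p: "lies_over f p a b" and ab: "(a, b) \<noteq> (0, 0)"
  shows "veq f p (X - const2 a) 1 \<or> veq f p (Y - const2 b) 1"
proof -
  have pl: "place f p" using assms by (auto simp: place_def)
  interpret p: place f p by (rule pl)
  have f0: "eval2 f a b = 0" using p.lies_over_on_curve[OF p] .
  obtain A B where f: "f = (X - const2 a) * A + (Y - const2 b) * B"
    and A: "eval2 A a b = eval2 (map_poly pderiv f) a b" and B: "eval2 B a b = eval2 (pderiv f) a b"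
    using smooth_point_decompose[OF f0] by metis
  have v: "vge f p (X - const2 a) 1" "vge f p (Y - const2 b) 1"
    using p by (auto simp: lies_over_def vanishes_at_vge)
  show ?thesis
  proof (cases "eval2 B a b = 0")
    case False
    have "veq f p (X - const2 a) 1"
      by (rule p.local_parameter[OF f p.lies_over_eval_veq[OF p False]])
         (use eval2_decompose v p.lies_over_vge_0[OF p] in blast)+
    then show ?thesis ..
  next
    case True
    then have A0: "eval2 A a b \<noteq> 0" using smooth f0 ab A B unfolding smooth_off_origin_def by auto
    have f': "f = (Y - const2 b) * B + (X - const2 a) * A" using f by (simp add: add.commute)
    have dec: "\<exists>c g1 g2. g = const2 c + (Y - const2 b) * g1 + (X - const2 a) * g2" for g
      using eval2_decompose[of g a b] by (metis add.assoc add.commute)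
    have "veq f p (Y - const2 b) 1"
      by (rule p.local_parameter[OF f' p.lies_over_eval_veq[OF p A0]])
         (use dec v p.lies_over_vge_0[OF p] in blast)+
    then show ?thesis ..
  qed
qed

text \<open>Over an affine point (\<alpha>, \<beta>) orders are nonnegative, and a zero of g makes
  \<alpha> a root of the polynomial eliminated from g. Each \<alpha> admits finitely many \<beta> by
  the constant leading coefficient of f, and a smooth point carries at most one place.\<close>

lemma finite_zeros_poles:
  assumes irr: "irreducible f" and deg: "degree f > 0" and lc: "lead_coeff f = [:l:]" "l \<noteq> 0"
    and smooth: "smooth_off_origin f"
    and inf: "finite {p \<in> places f. at_infinity f p}" and O: "finite {p \<in> places f. lies_over f p 0 0}"
    and g: "\<not> f dvd g"
  shows "finite {p \<in> places f. p g \<noteq> 0}"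
proof -
  obtain b c where bc: "c \<noteq> 0" "f dvd g * b - [:c:]" using norm_multiple[OF irr deg g] by blast
  define Z where "Z = (SIGMA \<alpha>:{\<alpha>. poly c \<alpha> = 0}. {\<beta>. poly (map_poly (\<lambda>a. poly a \<alpha>) f) \<beta> = 0})"
  have "finite Z" unfolding Z_def
  proof (rule finite_SigmaI)
    show "finite {\<alpha>. poly c \<alpha> = 0}" using bc(1) by (rule poly_roots_finite)
    fix \<alpha>
    have "coeff (map_poly (\<lambda>a. poly a \<alpha>) f) (degree f) = l" using lc by (simp add: coeff_map_poly)
    then have "map_poly (\<lambda>a. poly a \<alpha>) f \<noteq> 0" using lc(2) by (metis coeff_0)
    then show "finite {\<beta>. poly (map_poly (\<lambda>a. poly a \<alpha>) f) \<beta> = 0}" by (rule poly_roots_finite)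
  qed
  have ev: "poly (map_poly (\<lambda>a. poly a \<alpha>) h) \<beta> = eval2 h \<alpha> \<beta>" for h :: poly2 and \<alpha> \<beta>
    unfolding eval2_def by (induction h) (simp_all add: map_poly_pCons)
  have "finite {p \<in> places f. lies_over f p \<alpha> \<beta>}" for \<alpha> \<beta>
  proof (cases "(\<alpha>, \<beta>) = (0, 0)")
    case True
    then show ?thesis using O by simp
  next
    case False
    have "p = p'" if "p \<in> {p \<in> places f. lies_over f p \<alpha> \<beta>}" "p' \<in> {p \<in> places f. lies_over f p \<alpha> \<beta>}" for p p'
      using that smooth_place_unique[OF smooth irr _ _ _ _ False] by blast
    then show ?thesis by (metis (no_types, lifting) finite.emptyI finite_insert is_singletonI'
          is_singleton_the_elem)
  qed
  then have "finite (\<Union>(\<alpha>, \<beta>)\<in>Z. {p \<in> places f. lies_over f p \<alpha> \<beta>})" using \<open>finite Z\<close> by auto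
  moreover have "{p \<in> places f. p g \<noteq> 0} \<subseteq> {p \<in> places f. at_infinity f p}
    \<union> (\<Union>(\<alpha>, \<beta>)\<in>Z. {p \<in> places f. lies_over f p \<alpha> \<beta>})"
  proof
    fix p assume p: "p \<in> {p \<in> places f. p g \<noteq> 0}"
    interpret place f p using p irr by (simp add: place_def)
    show "p \<in> {p \<in> places f. at_infinity f p} \<union> (\<Union>(\<alpha>, \<beta>)\<in>Z. {p \<in> places f. lies_over f p \<alpha> \<beta>})"
    proof (cases "at_infinity f p")
      case True
      then show ?thesis using p by blast
    next
      case False
      then obtain \<alpha> \<beta> where ab: "lies_over f p \<alpha> \<beta>" by (auto simp: at_infinity_def)
      have all: "vge f p h 0" for h using lies_over_vge_0[OF ab] .
      have "vge f p g 1" using p all[of g] by (auto simp: vge_def)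
      then have "vge f p (g * b) (1 + 0)" using all by (rule vge_mult)
      then have v: "vge f p [:c:] 1" using vge_cong[OF bc(2)] by simp
      have "poly c \<alpha> = 0"
      proof (rule ccontr)
        assume "poly c \<alpha> \<noteq> 0"
        then have "veq f p [:c:] 0" using lies_over_eval_veq[OF ab, of "[:c:]"] by (simp add: eval2_def)
        then show False using v veq_not_vge by fastforce
      qed
      moreover have "eval2 f \<alpha> \<beta> = 0" using lies_over_on_curve[OF ab] .
      ultimately show ?thesis using ab p by (auto simp: Z_def ev)
    qed
  qed
  ultimately show ?thesis using inf by (meson finite_UnI finite_subset)
qed

section \<open>The Lax matrix as an operator on sequences\<close>

text \<open>
  A vector \<open>(v_1, \<dots>, v_n)\<close> is extended to indices \<open>j \<le> n\<close> by \<open>v_(j-n) = x v_j\<close>.  Then \<open>P\<close>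
  becomes the shift \<open>v_j \<mapsto> v_(j-1)\<close> and \<open>Q_i\<close> becomes \<open>v_j \<mapsto> q_ij v_j + v_(j-1)\<close>.
\<close>

definition qper :: "nat \<Rightarrow> (int \<Rightarrow> poly2) \<Rightarrow> bool" where
  "qper n v \<longleftrightarrow> (\<forall>j\<le>int n. v (j - int n) = X * v j)"

definition shift :: "int \<Rightarrow> (int \<Rightarrow> poly2) \<Rightarrow> int \<Rightarrow> poly2" where
  "shift d v = (\<lambda>j. v (j - d))"

definition Tq :: "point \<Rightarrow> int \<Rightarrow> (int \<Rightarrow> poly2) \<Rightarrow> int \<Rightarrow> poly2" where
  "Tq q i v = (\<lambda>j. const2 (q i j) * v j + v (j - 1))"

definition Tl :: "point \<Rightarrow> int list \<Rightarrow> (int \<Rightarrow> poly2) \<Rightarrow> int \<Rightarrow> poly2" where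
  "Tl q is v = foldr (Tq q) is v"

definition Lop :: "nat \<Rightarrow> nat \<Rightarrow> point \<Rightarrow> (int \<Rightarrow> poly2) \<Rightarrow> int \<Rightarrow> poly2" where
  "Lop m k q v = Tl q [1..int m] (shift (int k) v)"

definition vec_of :: "nat \<Rightarrow> (int \<Rightarrow> poly2) \<Rightarrow> poly2 vec" where
  "vec_of n v = vec n (\<lambda>a. v (int a + 1))"

abbreviation emb :: "complex poly mat \<Rightarrow> poly2 mat" where
  "emb A \<equiv> map_mat (\<lambda>p. [:p:]) A"

lemma phase_space_col: "q \<in> phase_space n m k \<Longrightarrow> q i (j + int n) = q i j"
  and phase_space_row: "q \<in> phase_space n m k \<Longrightarrow> q (i + int m) j = q i (j - int k)"
  by (auto simp: phase_space_def)

lemma phase_space_col': "q \<in> phase_space n m k \<Longrightarrow> q i (j - int n) = q i j"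
  using phase_space_col[of q n m k i "j - int n"] by simp

lemma Tl_simps [simp]: "Tl q [] v = v" "Tl q (i # is) v = Tq q i (Tl q is v)"
  "Tl q (is @ js) v = Tl q is (Tl q js v)"
  by (simp_all add: Tl_def)

lemma qper_Tq: "q \<in> phase_space n m k \<Longrightarrow> qper n v \<Longrightarrow> qper n (Tq q i v)"
  unfolding qper_def Tq_def
  by (auto simp: phase_space_col' algebra_simps)
     (metis (no_types, opaque_lifting) diff_diff_eq add.commute diff_le_eq le_add_same_cancel1
       order_trans zero_le_one)

lemma qper_shift: "qper n v \<Longrightarrow> 0 \<le> d \<Longrightarrow> qper n (shift d v)"
  unfolding qper_def shift_def
proof (intro allI impI)
  fix j :: int assume a: "\<forall>j\<le>int n. v (j - int n) = X * v j" "0 \<le> d" "j \<le> int n"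
  then have "v (j - d - int n) = X * v (j - d)" by simp
  then show "v (j - int n - d) = X * v (j - d)" by (simp add: algebra_simps)
qed

lemma qper_Tl: "q \<in> phase_space n m k \<Longrightarrow> qper n v \<Longrightarrow> qper n (Tl q is v)"
  by (induction "is") (auto intro: qper_Tq)

lemma qper_Lop: "q \<in> phase_space n m k \<Longrightarrow> qper n v \<Longrightarrow> qper n (Lop m k q v)"
  unfolding Lop_def by (intro qper_Tl qper_shift) auto

lemma qper_reduce:
  assumes "qper n v" "n > 0" "j \<le> int n"
  obtains j0 t where "j0 \<in> {1..int n}" "j = j0 - int t * int n" "v j = X ^ t * v j0"
proof -
  have "\<exists>j0\<in>{1..int n}. \<exists>t. j = j0 - int t * int n \<and> v j = X ^ t * v j0"
    using assms(3)
  proof (induction "nat (int n - j)" arbitrary: j rule: less_induct)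
    case less
    show ?case
    proof (cases "j \<ge> 1")
      case True
      then show ?thesis using less.prems by (intro bexI[of _ j] exI[of _ 0]) auto
    next
      case False
      then obtain j0 t where jt: "j0 \<in> {1..int n}" "j + int n = j0 - int t * int n"
        "v (j + int n) = X ^ t * v j0"
        using less.hyps[of "j + int n"] \<open>n > 0\<close> by auto
      have "v (j + int n - int n) = X * v (j + int n)"
        using assms(1) False unfolding qper_def by (metis add_le_same_cancel2 linear order_trans
            int_one_le_iff_zero_less not_le zle_add1_eq_le zless_add1_eq)
      then have "v j = X ^ Suc t * v j0" using jt(3) by simp
      moreover have "j = j0 - int (Suc t) * int n" using jt(2) by (simp add: algebra_simps)
      ultimately show ?thesis using jt(1) by blast
    qed
  qed
  then show thesis using that by blast
qed

lemma qper_dvd_all: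
  assumes "qper n v" "n > 0" "\<And>j. j \<in> {1..int n} \<Longrightarrow> f dvd v j" "j \<le> int n"
  shows "f dvd v j"
  using qper_reduce[OF assms(1,2,4)] assms(3) by (metis dvd_mult)

text \<open>Dictionary between matrices over C[x] and operators on sequences. Preservation of
  quasi-periodicity is included so that products of matrices correspond to composites.\<close>

definition lifts :: "nat \<Rightarrow> complex poly mat \<Rightarrow> ((int \<Rightarrow> poly2) \<Rightarrow> int \<Rightarrow> poly2) \<Rightarrow> bool" where
  "lifts n A F \<longleftrightarrow> A \<in> carrier_mat n n \<and>
     (\<forall>v. qper n v \<longrightarrow> qper n (F v) \<and> emb A *\<^sub>v vec_of n v = vec_of n (F v))"

lemma lifts_one: "lifts n (1\<^sub>m n) (\<lambda>v. v)"
proof -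
  interpret comm_ring_hom "\<lambda>c :: complex poly. [:c:]" by (rule coeff0_hom)
  show ?thesis by (simp add: lifts_def mat_hom_one vec_of_def)
qed

lemma lifts_mult: assumes "lifts n A F" "lifts n B G" shows "lifts n (A * B) (\<lambda>v. F (G v))"
proof -
  interpret comm_ring_hom "\<lambda>c :: complex poly. [:c:]" by (rule coeff0_hom)
  have A: "A \<in> carrier_mat n n" and B: "B \<in> carrier_mat n n"
    using assms by (auto simp: lifts_def)
  have "emb (A * B) *\<^sub>v vec_of n v = emb A *\<^sub>v (emb B *\<^sub>v vec_of n v)" for v
    unfolding mat_hom_mult[OF A B]
    by (rule assoc_mult_mat_vec[where ?n\<^sub>1.0=n and ?n\<^sub>2.0=n and ?n\<^sub>3.0=n])
       (use A B in \<open>auto simp: vec_of_def\<close>)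
  then show ?thesis using assms by (auto simp: lifts_def)
qed

lemma lifts_power: "lifts n A F \<Longrightarrow> lifts n (A ^\<^sub>m i) (F ^^ i)"
proof (induction i)
  case 0
  have "A ^\<^sub>m 0 = 1\<^sub>m n" using 0 by (auto simp: lifts_def)
  then show ?case using lifts_one[of n] by (simp add: id_def)
next
  case (Suc i)
  then have "lifts n (A ^\<^sub>m i * A) (\<lambda>v. (F ^^ i) (F v))" by (intro lifts_mult) auto
  then show ?case by (simp add: funpow_Suc_right comp_def del: funpow.simps)
qed

lemma Q_mat_mult:
  assumes n: "n \<ge> 2" and v: "qper n v"
  shows "emb (Q_mat n d) *\<^sub>v vec_of n v = vec_of n (\<lambda>j. const2 (d (nat j)) * v j + v (j - 1))"
proof (rule eq_vecI)
  fix a assume "a < dim_vec (vec_of n (\<lambda>j. const2 (d (nat j)) * v j + v (j - 1)))"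
  then have a: "a < n" by (simp add: vec_of_def)
  \<comment> \<open>Column of the off-diagonal entry of row a. In row 0 it is the corner entry x,
    and x v_n is read as v_0.\<close>
  define b where "b = (if a = 0 then n - 1 else a - 1)"
  have b: "b < n" "b \<noteq> a" using n a by (auto simp: b_def)
  have entry: "[:Q_mat n d $$ (a, j):] = (if j = a then const2 (d (a + 1)) else 0)
      + (if j = b then (if a = 0 then X else 1) else 0)" if "j < n" for j
    using that a n by (auto simp: Q_mat_def b_def const2_def X_def one_pCons)
  have "(emb (Q_mat n d) *\<^sub>v vec_of n v) $ a = (\<Sum>j<n. [:Q_mat n d $$ (a, j):] * v (int j + 1))"
    using a by (simp add: scalar_prod_def vec_of_def Q_mat_def lessThan_atLeast0)
  also have "\<dots> = (\<Sum>j<n. (if j = a then const2 (d (a + 1)) * v (int j + 1) else 0)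
      + (if j = b then (if a = 0 then X else 1) * v (int j + 1) else 0))"
    by (intro sum.cong) (auto simp: entry distrib_right)
  also have "\<dots> = const2 (d (a + 1)) * v (int a + 1) + (if a = 0 then X else 1) * v (int b + 1)"
    using a b by (simp add: sum.distrib)
  also have "(if a = 0 then X else 1) * v (int b + 1) = v (int a)"
    using v n a unfolding qper_def b_def by (auto simp: of_nat_diff elim: allE[of _ "int n"])
  finally show "(emb (Q_mat n d) *\<^sub>v vec_of n v) $ a
      = vec_of n (\<lambda>j. const2 (d (nat j)) * v j + v (j - 1)) $ a"
    using a by (simp add: vec_of_def nat_add_distrib)
qed (simp add: vec_of_def Q_mat_def)

lemma vec_of_cong: "(\<And>j. j \<in> {1..int n} \<Longrightarrow> v j = w j) \<Longrightarrow> vec_of n v = vec_of n w"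
  by (auto simp: vec_of_def)

lemma lifts_Tq:
  assumes "n \<ge> 2" "q \<in> phase_space n m k"
  shows "lifts n (Q_mat n (\<lambda>j. q i (int j))) (Tq q i)"
  unfolding lifts_def
proof (intro conjI allI impI)
  show "Q_mat n (\<lambda>j. q i (int j)) \<in> carrier_mat n n" by (simp add: Q_mat_def)
  fix v assume v: "qper n v"
  show "qper n (Tq q i v)" using assms(2) v by (rule qper_Tq)
  show "emb (Q_mat n (\<lambda>j. q i (int j))) *\<^sub>v vec_of n v = vec_of n (Tq q i v)"
    unfolding Q_mat_mult[OF assms(1) v] by (rule vec_of_cong) (simp add: Tq_def)
qed

lemma lifts_P: assumes "n \<ge> 2" shows "lifts n (P_mat n) (shift 1)"
  unfolding lifts_def
proof (intro conjI allI impI)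
  show "P_mat n \<in> carrier_mat n n" by (simp add: P_mat_def Q_mat_def)
  fix v assume v: "qper n v"
  then show "qper n (shift 1 v)" by (simp add: qper_shift)
  show "emb (P_mat n) *\<^sub>v vec_of n v = vec_of n (shift 1 v)"
    unfolding P_mat_def Q_mat_mult[OF assms(1) v] by (rule vec_of_cong) (simp add: shift_def)
qed

lemma shift_pow: "shift 1 ^^ i = shift (int i)"
  by (induction i) (auto simp: shift_def fun_eq_iff algebra_simps)

lemma lifts_lax:
  assumes "n \<ge> 2" "q \<in> phase_space n m k"
  shows "lifts n (lax n m k q) (Lop m k q)"
proof -
  have "lifts n (foldr (*) (map (\<lambda>i. Q_mat n (\<lambda>j. q (int i) (int j))) is) (1\<^sub>m n)) (Tl q (map int is))" for "is"
  proof (induction "is")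
    case Nil
    show ?case using lifts_one[of n] by (simp add: Tl_def)
  next
    case (Cons i "is")
    then show ?case using lifts_mult[OF lifts_Tq[OF assms, of "int i"] Cons.IH] by (simp add: comp_def)
  qed
  from lifts_mult[OF this lifts_power[OF lifts_P[OF assms(1)]]]
  have "lifts n (lax n m k q) (\<lambda>v. Tl q (map int [1..<Suc m]) (shift (int k) v))"
    unfolding lax_def shift_pow .
  moreover have "map int [1..<Suc m] = [1..int m]" by (induction m) (auto simp: upto_rec2)
  ultimately show ?thesis by (simp add: Lop_def[abs_def])
qed

lemma lax_carrier: assumes "n \<ge> 2" "q \<in> phase_space n m k" shows "lax n m k q \<in> carrier_mat n n"
  using lifts_lax[OF assms] by (simp add: lifts_def)

lemma lax_minus_y_carrier:
  assumes "n \<ge> 2" "q \<in> phase_space n m k" shows "lax_minus_y n m k q \<in> carrier_mat n n"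
  using lax_carrier[OF assms] by (simp add: lax_minus_y_def minus_carrier_mat)

lemma smult_one_mult_vec:
  assumes "v \<in> carrier_vec n" shows "(c \<cdot>\<^sub>m 1\<^sub>m n) *\<^sub>v v = c \<cdot>\<^sub>v (v :: 'a :: comm_ring_1 vec)"
proof (rule eq_vecI)
  fix a assume "a < dim_vec (c \<cdot>\<^sub>v v)"
  then have a: "a < n" using assms by simp
  have "((c \<cdot>\<^sub>m 1\<^sub>m n) *\<^sub>v v) $ a = (\<Sum>i = 0..<n. c * (if i = a then 1 else 0) * v $ i)"
    using a assms by (simp add: scalar_prod_def)
  also have "\<dots> = (\<Sum>i = 0..<n. if i = a then c * v $ i else 0)"
    by (intro sum.cong) auto
  finally show "((c \<cdot>\<^sub>m 1\<^sub>m n) *\<^sub>v v) $ a = (c \<cdot>\<^sub>v v) $ a"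
    using a assms by simp
qed (use assms in simp)

lemma lax_minus_y_mult:
  assumes "n \<ge> 2" "q \<in> phase_space n m k" "qper n v"
  shows "lax_minus_y n m k q *\<^sub>v vec_of n v = vec_of n (\<lambda>j. Lop m k q v j - Y * v j)"
proof -
  have c: "emb (lax n m k q) \<in> carrier_mat n n" "Y \<cdot>\<^sub>m 1\<^sub>m n \<in> carrier_mat n n"
    "vec_of n v \<in> carrier_vec n"
    using lax_carrier[OF assms(1,2)] by (auto simp: vec_of_def)
  have "(Y \<cdot>\<^sub>m 1\<^sub>m n) *\<^sub>v vec_of n v = Y \<cdot>\<^sub>v vec_of n v" using c(3) by (rule smult_one_mult_vec)
  moreover have "emb (lax n m k q) *\<^sub>v vec_of n v = vec_of n (Lop m k q v)"
    using lifts_lax[OF assms(1,2)] assms(3) by (simp add: lifts_def)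
  ultimately show ?thesis
    unfolding lax_minus_y_def minus_mult_distrib_mat_vec[OF c] by (auto simp: vec_of_def)
qed

section \<open>Eigenvectors\<close>

definition eig :: "poly2 \<Rightarrow> nat \<Rightarrow> nat \<Rightarrow> nat \<Rightarrow> point \<Rightarrow> (int \<Rightarrow> poly2) \<Rightarrow> bool" where
  "eig f n m k q v \<longleftrightarrow> qper n v \<and> (\<exists>j\<le>int n. \<not> f dvd v j) \<and>
     (\<forall>j\<le>int n. f dvd Lop m k q v j - Y * v j)"

lemma lax_minus_y_char_poly:
  assumes "A \<in> carrier_mat r r"
  shows "emb A - Y \<cdot>\<^sub>m 1\<^sub>m r = - 1 \<cdot>\<^sub>m char_poly_matrix A"
  using assms by (intro eq_matI) (auto simp: char_poly_matrix_def Y_def)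

text \<open>Up to the sign (-1)^n this is the characteristic polynomial of L. Its constant leading
  coefficient is what makes y integral over C[x].\<close>

lemma degree_psi:
  assumes "n \<ge> 2" "q \<in> phase_space n m k"
  shows "degree (psi n m k q) = n" "lead_coeff (psi n m k q) = [:(-1) ^ n:]"
proof -
  note A = lax_carrier[OF assms]
  have "psi n m k q = (-1) ^ n * char_poly (lax n m k q)"
    using A unfolding psi_def lax_minus_y_def lax_minus_y_char_poly[OF A]
    by (simp add: char_poly_def del: one_pCons) (simp add: char_poly_matrix_def)
  moreover have "(-1 :: poly2) ^ n = const2 ((-1) ^ n)" by (simp add: const2_power)
  ultimately have "psi n m k q = Polynomial.smult [:(-1) ^ n:] (char_poly (lax n m k q))"
    by (simp add: const2_def)
  then show "degree (psi n m k q) = n" "lead_coeff (psi n m k q) = [:(-1) ^ n:]"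
    using degree_monic_char_poly[OF A] by (auto simp: one_pCons)
qed

text \<open>Up to sign this minor is the characteristic polynomial of a matrix of size n - 1, so its
  y-degree is too small for a nonzero multiple of f.\<close>

lemma Delta_nn:
  assumes "n \<ge> 2" "q \<in> phase_space n m k" "degree f = n"
  shows "\<not> f dvd Delta n m k q n n"
proof -
  define A where "A = mat_delete (lax n m k q) (n - 1) (n - 1)"
  have A: "A \<in> carrier_mat (n - 1) (n - 1)"
    using lax_carrier[OF assms(1,2)] unfolding A_def by (auto simp: mat_delete_def)
  have "mat_delete (lax_minus_y n m k q) (n - 1) (n - 1) = emb A - Y \<cdot>\<^sub>m 1\<^sub>m (n - 1)"
    using lax_carrier[OF assms(1,2)] unfolding A_def lax_minus_y_def
    by (intro eq_matI) (auto simp: mat_delete_def)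
  also have "\<dots> = - 1 \<cdot>\<^sub>m char_poly_matrix A" by (rule lax_minus_y_char_poly[OF A])
  finally have "Delta n m k q n n = (-1) ^ (n - 1 + (n - 1)) * ((-1) ^ (n - 1) * char_poly A)"
    using A unfolding Delta_def cofactor_def by (simp add: char_poly_def) (simp add: char_poly_matrix_def)
  also have "(-1 :: poly2) ^ (n - 1 + (n - 1)) * ((-1) ^ (n - 1) * char_poly A)
      = Polynomial.smult [:(-1) ^ (n - 1):] (char_poly A)"
  proof -
    have "(-1 :: poly2) ^ (n - 1) = const2 ((-1) ^ (n - 1))" by (simp add: const2_power)
    then show ?thesis by (simp add: const2_def flip: mult_2)
  qed
  finally have D: "Delta n m k q n n = Polynomial.smult [:(-1) ^ (n - 1):] (char_poly A)" .
  then have "degree (Delta n m k q n n) = n - 1" "Delta n m k q n n \<noteq> 0"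
    using degree_monic_char_poly[OF A] by auto
  then show ?thesis using dvd_imp_degree_le[of f "Delta n m k q n n"] assms(1,3) by auto
qed

text \<open>Take the last column of the adjugate: (L - y) adj(L - y) = det(L - y) = f vanishes on
  the curve. Its entries are the cofactors that define the h_i, and the last of them is nonzero
  modulo f.\<close>

lemma eig_exists:
  assumes n: "n \<ge> 2" and q: "q \<in> phase_space n m k" and f: "psi n m k q = f"
  obtains v where "eig f n m k q v" "\<And>i. i \<in> {1..n} \<Longrightarrow> v (int i) = Delta n m k q n i"
proof -
  \<comment> \<open>Quasi-periodic extension: the index of the minor is the representative of j in
    1, ..., n, and the exponent counts the periods from j up to it.\<close>
  define v where "v j = X ^ nat ((int n - j) div int n)
    * Delta n m k q n (nat (int n - (int n - j) mod int n))" for j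
  have vi: "v (int i) = Delta n m k q n i" if "i \<in> {1..n}" for i
  proof -
    have "(int n - int i) div int n = 0" "(int n - int i) mod int n = int n - int i"
      by (rule div_pos_pos_trivial mod_pos_pos_trivial; use that in force)+
    then show ?thesis unfolding v_def by simp
  qed
  have qv: "qper n v" unfolding qper_def
  proof (intro allI impI)
    fix j assume j: "j \<le> int n"
    have "(int n - (j - int n)) div int n = (int n - j) div int n + 1"
      using n div_add_self2[of "int n" "int n - j"] by (simp add: algebra_simps)
    moreover have "(int n - j) div int n \<ge> 0" using j n by (simp add: pos_imp_zdiv_nonneg_iff)
    moreover have "(int n - (j - int n)) mod int n = (int n - j) mod int n"
      using mod_add_self2[of "int n - j" "int n"] by (simp add: algebra_simps)
    ultimately show "v (j - int n) = X * v j" by (simp add: v_def nat_add_distrib)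
  qed
  note M = lax_minus_y_carrier[OF n q]
  have col: "vec_of n v = col (adj_mat (lax_minus_y n m k q)) (n - 1)"
  proof (rule eq_vecI)
    fix a assume "a < dim_vec (col (adj_mat (lax_minus_y n m k q)) (n - 1))"
    then have a: "a < n" using M by (simp add: adj_mat_def)
    then have "vec_of n v $ a = Delta n m k q n (a + 1)"
      using vi[of "a + 1"] by (simp add: vec_of_def add.commute)
    then show "vec_of n v $ a = col (adj_mat (lax_minus_y n m k q)) (n - 1) $ a"
      using a M by (simp add: adj_mat_def Delta_def)
  qed (use M in \<open>simp add: vec_of_def adj_mat_def\<close>)
  have "f dvd Lop m k q v j - Y * v j" if j: "j \<in> {1..int n}" for j
  proof -
    define a where "a = nat (j - 1)"
    have a: "a < n" "j = int a + 1" using j by (auto simp: a_def)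
    have "Lop m k q v j - Y * v j = (lax_minus_y n m k q *\<^sub>v vec_of n v) $ a"
      unfolding lax_minus_y_mult[OF n q qv] using a by (simp add: vec_of_def)
    also have "\<dots> = (lax_minus_y n m k q * adj_mat (lax_minus_y n m k q)) $$ (a, n - 1)"
      using a M adj_mat(1)[OF M] n unfolding col by simp
    also have "\<dots> = (f \<cdot>\<^sub>m 1\<^sub>m n) $$ (a, n - 1)"
      unfolding adj_mat(2)[OF M] using f by (simp add: psi_def)
    finally show ?thesis using a n by simp
  qed
  moreover have "qper n (\<lambda>j. Lop m k q v j - Y * v j)"
    using qper_Lop[OF q qv] qv unfolding qper_def by (simp add: algebra_simps)
  ultimately have "f dvd Lop m k q v j - Y * v j" if "j \<le> int n" for j
    using qper_dvd_all[of n "\<lambda>j. Lop m k q v j - Y * v j" f j] that n by auto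
  moreover have "\<not> f dvd v (int n)"
    using Delta_nn[OF n q, of f] degree_psi[OF n q] f vi[of n] n by auto
  ultimately have "eig f n m k q v" using qv unfolding eig_def by auto
  with vi that show thesis by blast
qed

text \<open>
  By Cramer's rule for \<open>L - y\<close> with its last row replaced by \<open>(0, \<dots>, 0, 1)\<close>, an operation that
  does not affect the cofactors of that row.
\<close>

lemma eig_proportional:
  assumes n: "n \<ge> 2" and q: "q \<in> phase_space n m k" and v: "eig f n m k q v" and i: "i \<in> {1..n}"
  shows "f dvd Delta n m k q n n * v (int i) - Delta n m k q n i * v (int n)"
proof -
  define M where "M = lax_minus_y n m k q"
  have M: "M \<in> carrier_mat n n" unfolding M_def by (rule lax_minus_y_carrier[OF n q])
  define H where "H = mat n n (\<lambda>(a, b). if a = n - 1 then (if b = n - 1 then 1 else 0) else M $$ (a, b))"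
  have H: "H \<in> carrier_mat n n" by (simp add: H_def)
  have qv: "qper n v" using v by (simp add: eig_def)
  have cof: "cofactor H (n - 1) b = cofactor M (n - 1) b" if "b < n" for b
  proof -
    have "mat_delete H (n - 1) b = mat_delete M (n - 1) b"
      using M that by (intro eq_matI) (auto simp: H_def mat_delete_def)
    then show ?thesis by (simp add: cofactor_def)
  qed
  have "det H = (\<Sum>b<n. H $$ (n - 1, b) * cofactor H (n - 1) b)"
    using laplace_expansion_row[OF H, of "n - 1"] n by simp
  also have "\<dots> = (\<Sum>b<n. if b = n - 1 then cofactor H (n - 1) b else 0)"
    using n by (intro sum.cong) (auto simp: H_def)
  also have "\<dots> = cofactor M (n - 1) (n - 1)" using n cof by simp
  finally have det: "det H = Delta n m k q n n" by (simp add: Delta_def M_def)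
  have vc: "vec_of n v \<in> carrier_vec n" by (simp add: vec_of_def)
  define w where "w = H *\<^sub>v vec_of n v"
  have w: "w $ a = (if a = n - 1 then v (int n) else Lop m k q v (int a + 1) - Y * v (int a + 1))"
    if a: "a < n" for a
  proof (cases "a = n - 1")
    case True
    have "w $ a = (\<Sum>b<n. (if b = n - 1 then 1 else 0) * v (int b + 1))"
      using a True by (simp add: w_def scalar_prod_def H_def vec_of_def lessThan_atLeast0)
    also have "\<dots> = (\<Sum>b<n. if b = n - 1 then v (int b + 1) else 0)"
      by (intro sum.cong) auto
    also have "\<dots> = v (int n)" using n by (simp add: of_nat_diff)
    finally show ?thesis using True by simp
  next
    case False
    have "row H a = row M a" using a False M by (intro eq_vecI) (auto simp: H_def)
    then have "w $ a = (M *\<^sub>v vec_of n v) $ a" using a M by (simp add: w_def H_def)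
    then show ?thesis using False a unfolding M_def lax_minus_y_mult[OF n q qv] by (simp add: vec_of_def)
  qed
  define a where "a = i - 1"
  have a: "a < n" "int i = int a + 1" "i = a + 1" using i by (auto simp: a_def)
  have "adj_mat H *\<^sub>v w = (adj_mat H * H) *\<^sub>v vec_of n v"
    unfolding w_def using adj_mat(1)[OF H] H vc
    by (intro assoc_mult_mat_vec[symmetric, where ?n\<^sub>1.0=n and ?n\<^sub>2.0=n and ?n\<^sub>3.0=n]) auto
  also have "\<dots> = det H \<cdot>\<^sub>v vec_of n v"
    unfolding adj_mat(3)[OF H] using vc by (rule smult_one_mult_vec)
  finally have "(adj_mat H *\<^sub>v w) $ a = Delta n m k q n n * v (int i)"
    using a det by (simp add: vec_of_def add.commute)
  moreover have "(adj_mat H *\<^sub>v w) $ a = (\<Sum>b<n. cofactor H b a * w $ b)"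
    using a by (simp add: adj_mat_def w_def scalar_prod_def H_def lessThan_atLeast0)
  moreover have "\<dots> = cofactor H (n - 1) a * w $ (n - 1) + (\<Sum>b<n - 1. cofactor H b a * w $ b)"
    using n by (subst sum.remove[of _ "n - 1"]) (auto intro!: sum.cong)
  moreover have "cofactor H (n - 1) a * w $ (n - 1) = Delta n m k q n i * v (int n)"
    using n w[of "n - 1"] cof[OF a(1)] a by (simp add: Delta_def M_def)
  ultimately have "Delta n m k q n n * v (int i)
      = Delta n m k q n i * v (int n) + (\<Sum>b<n - 1. cofactor H b a * w $ b)" by simp
  then have "Delta n m k q n n * v (int i) - Delta n m k q n i * v (int n)
      = (\<Sum>b<n - 1. cofactor H b a * w $ b)" by simp
  also have "f dvd \<dots>"
  proof (rule dvd_sum)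
    fix b assume "b \<in> {..<n - 1}"
    then have b: "b < n" "b \<noteq> n - 1" "int b + 1 \<le> int n" by auto
    then show "f dvd cofactor H b a * w $ b" using v w[OF b(1)] unfolding eig_def by auto
  qed
  finally show ?thesis .
qed

section \<open>The divisor of an eigenvector\<close>

locale spectral_curve =
  fixes n m k :: nat and f :: poly2
  assumes n2: "n \<ge> 2" and m1: "m \<ge> 1" and k1: "1 \<le> k" and kn: "k \<le> n"
    and V: "f \<in> V_cal n m k" and psi_f: "\<exists>q\<in>phase_space n m k. psi n m k q = f"
begin

definition N :: nat where "N = gcd n k"
definition n' :: nat where "n' = n div N"
definition k' :: nat where "k' = k div N"

lemma N_pos: "N > 0" and nN: "n = n' * N" and kN: "k = k' * N" and n'_pos: "n' > 0" and k'_pos: "k' > 0"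
  using n2 k1 unfolding N_def n'_def k'_def
  by (auto simp: dvd_div_eq_0_iff intro!: Nat.gr0I)

lemma irr: "irreducible f" and smooth: "smooth_off_origin f"
  using V by (auto simp: V_cal_def)

lemma deg: "degree f = n" and lc: "lead_coeff f = [:(-1) ^ n:]"
  using psi_f degree_psi[OF n2] by auto

lemma deg_pos: "degree f > 0" using deg n2 by simp

lemma placeI: "p \<in> places f \<Longrightarrow> place f p"
  using irr by (simp add: place_def)

text \<open>The three kinds of special places are told apart by position: over a point with x
  \<noteq> 0, over the origin, over no affine point. This replaces the enumerations in
  \<open>V_cal\<close> by statements that do not depend on them.\<close>

lemma special_points:
  shows P_place: "P_point f \<in> places f" and P_inf: "at_infinity f (P_point f)"
    and P_unique: "\<And>p. p \<in> places f \<Longrightarrow> at_infinity f p \<Longrightarrow> p = P_point f"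
    and special_cases: "\<And>p. p \<in> places f \<Longrightarrow> special f p \<Longrightarrow>
      p = P_point f \<or> p \<in> O_points f \<or> (\<exists>a. a \<noteq> 0 \<and> lies_over f p a 0)"
    and O_points_image: "\<exists>Op. O_points f = Op ` {1..N} \<and> inj_on Op {1..N}"
    and O_points_coordinate: "\<And>p. p \<in> O_points f \<Longrightarrow> \<exists>\<sigma>. \<sigma> \<noteq> 0 \<and> O_coordinate n k f p \<sigma>"
    and A_points_eps: "\<exists>\<epsilon>. inj_on \<epsilon> {1..m} \<and> (\<forall>r\<in>{1..m}. \<epsilon> r \<noteq> 0 \<and>
      (\<exists>p\<in>places f. lies_over f p ((-1) ^ n * \<epsilon> r) 0))"
proof -
  define data where "data \<epsilon> A \<sigma> Op P \<longleftrightarrow>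
        (\<forall>r\<in>{1..m}. A r \<in> places f \<and> \<epsilon> r \<noteq> 0 \<and> lies_over f (A r) ((-1) ^ n * \<epsilon> r) 0) \<and>
        inj_on \<epsilon> {1..m} \<and>
        (\<forall>r\<in>{1..gcd n k}. Op r \<in> places f \<and> lies_over f (Op r) 0 0 \<and>
            \<sigma> r \<noteq> 0 \<and> O_coordinate n k f (Op r) (\<sigma> r)) \<and>
        inj_on Op {1..gcd n k} \<and>
        P \<in> places f \<and> at_infinity f P \<and>
        {p \<in> places f. special f p} = A ` {1..m} \<union> Op ` {1..gcd n k} \<union> {P}" for \<epsilon> A \<sigma> Op P
  have "\<exists>\<epsilon> A \<sigma> Op P. data \<epsilon> A \<sigma> Op P"
    using V unfolding V_cal_def mem_Collect_eq data_def by (elim conjE)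
  then obtain \<epsilon> A \<sigma> Op P where data: "data \<epsilon> A \<sigma> Op P" by metis
  have A: "\<forall>r\<in>{1..m}. A r \<in> places f \<and> \<epsilon> r \<noteq> 0 \<and> lies_over f (A r) ((-1) ^ n * \<epsilon> r) 0"
    and \<epsilon>: "inj_on \<epsilon> {1..m}"
    and O: "\<forall>r\<in>{1..N}. Op r \<in> places f \<and> lies_over f (Op r) 0 0 \<and> \<sigma> r \<noteq> 0
      \<and> O_coordinate n k f (Op r) (\<sigma> r)"
    and Op: "inj_on Op {1..N}" and P: "P \<in> places f" "at_infinity f P"
    and S: "{p \<in> places f. special f p} = A ` {1..m} \<union> Op ` {1..N} \<union> {P}"
  proof -
    note d = data[unfolded data_def, folded N_def]
    note d2 = d[THEN conjunct2] note d3 = d2[THEN conjunct2] note d4 = d3[THEN conjunct2]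
    note d5 = d4[THEN conjunct2] note d6 = d5[THEN conjunct2]
    show "\<forall>r\<in>{1..m}. A r \<in> places f \<and> \<epsilon> r \<noteq> 0 \<and> lies_over f (A r) ((-1) ^ n * \<epsilon> r) 0"
      by (rule d[THEN conjunct1])
    show "inj_on \<epsilon> {1..m}" by (rule d2[THEN conjunct1])
    show "\<forall>r\<in>{1..N}. Op r \<in> places f \<and> lies_over f (Op r) 0 0 \<and> \<sigma> r \<noteq> 0
      \<and> O_coordinate n k f (Op r) (\<sigma> r)" by (rule d3[THEN conjunct1])
    show "inj_on Op {1..N}" by (rule d4[THEN conjunct1])
    show "P \<in> places f" by (rule d5[THEN conjunct1])
    show "at_infinity f P" by (rule d6[THEN conjunct1])
    show "{p \<in> places f. special f p} = A ` {1..m} \<union> Op ` {1..N} \<union> {P}"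
      by (rule d6[THEN conjunct2])
  qed
  have cases: "p = P \<or> (\<exists>r\<in>{1..N}. p = Op r) \<or> (\<exists>r\<in>{1..m}. p = A r)"
    if "p \<in> places f" "special f p" for p
  proof -
    have "p \<in> A ` {1..m} \<union> Op ` {1..N} \<union> {P}" using that S by auto
    then show ?thesis by auto
  qed
  have A': "\<exists>a. a \<noteq> 0 \<and> lies_over f (A r) a 0" if "r \<in> {1..m}" for r
    using A[rule_format, OF that] by (intro exI[of _ "(-1) ^ n * \<epsilon> r"]) simp
  have O': "Op r \<in> places f" "lies_over f (Op r) 0 0" "\<sigma> r \<noteq> 0" "O_coordinate n k f (Op r) (\<sigma> r)"
    if "r \<in> {1..N}" for r
    using O[rule_format, OF that] by simp_all
  have u: "p = P" if p: "p \<in> places f" "at_infinity f p" for p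
  proof -
    have "special f p" using p(2) by (simp add: special_def)
    moreover have "\<not> at_infinity f (A r)" if "r \<in> {1..m}" for r
      using A'[OF that] unfolding at_infinity_def by metis
    moreover have "\<not> at_infinity f (Op r)" if "r \<in> {1..N}" for r
      using O'(2)[OF that] unfolding at_infinity_def by metis
    ultimately show ?thesis using cases[OF p(1)] p(2) by metis
  qed
  have PP: "P_point f = P" unfolding P_point_def
    by (rule the_equality) (use P u in blast)+
  show "P_point f \<in> places f" "at_infinity f (P_point f)" using P PP by auto
  show "p = P_point f" if "p \<in> places f" "at_infinity f p" for p using u[OF that] PP by simp
  have "p \<in> Op ` {1..N}" if p: "p \<in> places f" "lies_over f p 0 0" for p
  proof -
    interpret place f p using p(1) by (rule placeI)
    have "special f p" using p(2) by (simp add: special_def lies_over_def)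
    moreover have "p \<noteq> P" using p(2) P(2) unfolding at_infinity_def by metis
    moreover have "p \<noteq> A r" if "r \<in> {1..m}" for r
      using A'[OF that] lies_over_unique(1)[OF p(2)] by metis
    ultimately show ?thesis using cases[OF p(1)] by (metis image_eqI)
  qed
  then have "O_points f \<subseteq> Op ` {1..N}" unfolding O_points_def by blast
  moreover have "Op r \<in> O_points f" if "r \<in> {1..N}" for r
    using O'(1,2)[OF that] unfolding O_points_def by blast
  ultimately have im: "O_points f = Op ` {1..N}" by (intro equalityI image_subsetI)
  then show "\<exists>Op. O_points f = Op ` {1..N} \<and> inj_on Op {1..N}" using Op by metis
  show "\<exists>\<sigma>. \<sigma> \<noteq> 0 \<and> O_coordinate n k f p \<sigma>" if pO: "p \<in> O_points f" for p
  proof -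
    obtain r where r: "r \<in> {1..N}" "p = Op r" using pO unfolding im by auto
    show ?thesis using O'(3,4)[OF r(1)] r(2) by metis
  qed
  show "p = P_point f \<or> p \<in> O_points f \<or> (\<exists>a. a \<noteq> 0 \<and> lies_over f p a 0)"
    if "p \<in> places f" "special f p" for p
    using cases[OF that] A' unfolding PP im by (metis image_eqI)
  have "\<exists>p\<in>places f. lies_over f p ((-1) ^ n * \<epsilon> r) 0" "\<epsilon> r \<noteq> 0" if "r \<in> {1..m}" for r
    using A[rule_format, OF that] by blast+
  then show "\<exists>\<epsilon>. inj_on \<epsilon> {1..m} \<and> (\<forall>r\<in>{1..m}. \<epsilon> r \<noteq> 0 \<and>
      (\<exists>p\<in>places f. lies_over f p ((-1) ^ n * \<epsilon> r) 0))" using \<epsilon> by metis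
qed

lemma finite_O_points: "finite (O_points f)" and card_O_points: "card (O_points f) = N"
proof -
  obtain Op where "O_points f = Op ` {1..N}" "inj_on Op {1..N}" using O_points_image by metis
  then show "finite (O_points f)" "card (O_points f) = N" by (auto simp: card_image)
qed

lemma O_point_orders:
  assumes "p \<in> O_points f" shows "veq f p X (int n')" "veq f p Y (int k')"
proof -
  obtain \<sigma> where \<sigma>: "\<sigma> \<noteq> 0" "O_coordinate n k f p \<sigma>" using O_points_coordinate[OF assms] by metis
  have "\<exists>g h a. \<not> f dvd g \<and> \<not> f dvd h \<and> p g - p h = 1 \<and> a ^ n' = - \<sigma> \<and>
    has_value_at f p (X * h ^ n') (g ^ n') 1 \<and> has_value_at f p (Y * h ^ k') (g ^ k') (- a)"
    using \<sigma>(2) unfolding O_coordinate_def Let_def N_def n'_def k'_def .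
  then obtain g h a where *: "\<not> f dvd g \<and> \<not> f dvd h \<and> p g - p h = 1 \<and> a ^ n' = - \<sigma> \<and>
    has_value_at f p (X * h ^ n') (g ^ n') 1 \<and> has_value_at f p (Y * h ^ k') (g ^ k') (- a)"
    by (elim exE) (rule that)
  then have gh: "\<not> f dvd g" "\<not> f dvd h" "p g - p h = 1" "a ^ n' = - \<sigma>"
    "has_value_at f p (X * h ^ n') (g ^ n') 1" "has_value_at f p (Y * h ^ k') (g ^ k') (- a)"
    by simp_all
  interpret place f p using placeI assms by (auto simp: O_points_def)
  \<comment> \<open>If Z/u^i has a nonzero finite value for the local coordinate u = g/h, then Z has
    order i. This is applied to x \<sim> u^n' and y \<sim> -a u^k'.\<close>
  have key: "veq f p Z (int i)" if v: "has_value_at f p (Z * h ^ i) (g ^ i) c" "c \<noteq> 0" for Z i c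
  proof -
    have g: "veq f p (const2 c * g ^ i) (int i * p g)"
      using veq_cmult[OF veq_power] v(2) gh(1) by (simp add: veq_def)
    have "vge f p (Z * h ^ i - const2 c * g ^ i) (int i * p g + 1)"
      using v(1) p_power[OF gh(1), of i] unfolding has_value_at_def vge_def by auto
    from veq_diff_cong[OF this] g have "veq f p (Z * h ^ i) (int i * p g)" by simp
    moreover have "int i * p g = int i * p h + int i" using gh(3) by (simp add: algebra_simps)
    ultimately have "veq f p (h ^ i * Z) (int i * p h + int i)" by (simp add: mult.commute)
    moreover have "veq f p (h ^ i) (int i * p h)" using gh(2) by (intro veq_power) (simp add: veq_def)
    ultimately show ?thesis by (metis veq_mult_cancel)
  qed
  show "veq f p X (int n')" using key[OF gh(5)] by simp
  have "a \<noteq> 0"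
  proof
    assume "a = 0"
    then show False using gh(4) \<sigma>(1) n'_pos by (simp add: power_0_left)
  qed
  then show "veq f p Y (int k')" using key[OF gh(6)] by simp
qed

lemma place_cases:
  assumes "p \<in> places f"
  obtains "p = P_point f" | "p \<in> O_points f" | a b where "a \<noteq> 0" "lies_over f p a b"
proof -
  show thesis
  proof (cases "special f p")
    case True
    then show thesis using special_cases[OF assms] that by metis
  next
    case False
    then obtain a b where ab: "lies_over f p a b" unfolding special_def at_infinity_def by metis
    moreover have "a \<noteq> 0"
    proof
      assume "a = 0"
      then show False using False ab by (simp add: special_def lies_over_def)
    qed
    ultimately show thesis using that(3) by metis
  qed
qed

lemma finite_places: "\<not> f dvd g \<Longrightarrow> finite {p \<in> places f. p g \<noteq> 0}"
proof (rule finite_zeros_poles[OF irr deg_pos lc _ smooth])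
  have "{p \<in> places f. at_infinity f p} \<subseteq> {P_point f}" using P_unique by auto
  then show "finite {p \<in> places f. at_infinity f p}" by (rule finite_subset) simp
  show "finite {p \<in> places f. lies_over f p 0 0}" using finite_O_points by (simp add: O_points_def)
qed simp_all

text \<open>By proportionality to the cofactors, v_n = 0 would force \<Delta>_nn v_i = 0 for all i,
  while \<Delta>_nn \<noteq> 0 on the curve.\<close>

lemma eig_last:
  assumes "q \<in> phase_space n m k" "eig f n m k q v" shows "\<not> f dvd v (int n)"
proof
  assume d: "f dvd v (int n)"
  obtain p where "p \<in> places f" using P_place by blast
  then interpret place f p by (rule placeI)
  have "f dvd v (int i)" if "i \<in> {1..n}" for i
  proof -
    have "f dvd Delta n m k q n n * v (int i)"
      using dvd_add[OF eig_proportional[OF n2 assms that] dvd_mult[OF d, of "Delta n m k q n i"]] by simp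
    then show ?thesis using dvd_mult_iff Delta_nn[OF n2 assms(1) deg] by blast
  qed
  note all = this
  have "f dvd v j" if "j \<in> {1..int n}" for j
  proof -
    have "nat j \<in> {1..n}" "int (nat j) = j" using that by auto
    then show ?thesis using all[of "nat j"] by simp
  qed
  then have "f dvd v j" if "j \<le> int n" for j
    using qper_dvd_all[of n v f j] assms(2) that n2 unfolding eig_def by auto
  then show False using assms(2) by (auto simp: eig_def)
qed

definition hb :: "point \<Rightarrow> place \<Rightarrow> nat \<Rightarrow> int" where
  "hb q p i = Poly_Mapping.lookup (h_bound n f (O_list n m k f q) i) p"

text \<open>At each place the minimal divisor is the maximum over i of the bound minus the order of
  h_i, and h_i has the order of v_i/v_n. So its value is ord v_n - c, where c is the minimum of ord
  v_i minus the bound; in this form any eigenvector may be used.\<close>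

lemma D_min_lookup:
  assumes q: "q \<in> phase_space n m k" and v: "eig f n m k q v"
  shows "D_min n m k f q \<in> divisors f"
    and "p \<in> places f \<Longrightarrow> \<exists>c. (\<forall>i\<in>{1..n}. vge f p (v (int i)) (hb q p i + c)) \<and>
      (\<exists>i\<in>{1..n}. veq f p (v (int i)) (hb q p i + c)) \<and>
      Poly_Mapping.lookup (D_min n m k f q) p = p (v (int n)) - c"
proof -
  define S where "S = {i \<in> {1..n}. \<not> f dvd v (int i)}"
  have vn: "\<not> f dvd v (int n)" by (rule eig_last[OF q v])
  have S: "finite S" "S \<noteq> {}" "n \<in> S" using vn n2 by (auto simp: S_def)
  have Dnn: "\<not> f dvd Delta n m k q n n" by (rule Delta_nn[OF n2 q deg])
  \<comment> \<open>Index n has bound 0 and h_n = 1, so including it in the maximum encodes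
    positivity of the divisor.\<close>
  have hbn: "hb q p n = 0" for p by (simp add: hb_def h_bound_def)
  have prpn: "(f dvd Delta n m k q n i \<longleftrightarrow> f dvd v (int i)) \<and> (\<not> f dvd v (int i) \<longrightarrow>
      p (Delta n m k q n i) - p (Delta n m k q n n) = p (v (int i)) - p (v (int n)))"
    if i: "i \<in> {1..n}" and p: "p \<in> places f" for i p
  proof -
    interpret place f p using p by (rule placeI)
    note d = eig_proportional[OF n2 q v i]
    have "f dvd Delta n m k q n n * v (int i) \<longleftrightarrow> f dvd Delta n m k q n i * v (int n)"
      using d by (rule dvd_diff_cong)
    then have iff: "f dvd Delta n m k q n i \<longleftrightarrow> f dvd v (int i)"
      using dvd_mult_iff Dnn vn by blast
    moreover have "p (Delta n m k q n i) - p (Delta n m k q n n) = p (v (int i)) - p (v (int n))"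
      if nd: "\<not> f dvd v (int i)"
      using p_cong[OF d] p_mult[OF Dnn nd] p_mult[of "Delta n m k q n i" "v (int n)"] iff nd vn by simp
    ultimately show ?thesis by blast
  qed
  define D0 where "D0 p = (if p \<in> places f
    then Max ((\<lambda>i. hb q p i - p (v (int i))) ` S) + p (v (int n)) else 0)" for p
  have attained: "\<exists>i\<in>S. D0 p = hb q p i - p (v (int i)) + p (v (int n))" if "p \<in> places f" for p
  proof -
    have "Max ((\<lambda>i. hb q p i - p (v (int i))) ` S) \<in> (\<lambda>i. hb q p i - p (v (int i))) ` S"
      using S by (intro Max_in) auto
    then obtain i where "i \<in> S" "Max ((\<lambda>i. hb q p i - p (v (int i))) ` S) = hb q p i - p (v (int i))"
      by (elim imageE)
    then show ?thesis using that by (auto simp: D0_def)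
  qed
  have bound: "hb q p i - p (v (int i)) + p (v (int n)) \<le> D0 p" if "p \<in> places f" "i \<in> S" for p i
    using S that by (auto simp: D0_def)
  have nonneg: "D0 p \<ge> 0" for p
    using bound[of p n] S hbn by (cases "p \<in> places f") (auto simp: D0_def)
  \<comment> \<open>Where D0 is nonzero, some bound or some order of v_i or v_n is nonzero, and each
    of these happens at finitely many places.\<close>
  have "finite {p. D0 p \<noteq> 0}"
  proof (rule finite_subset)
    show "{p. D0 p \<noteq> 0} \<subseteq> (\<Union>i\<in>S. Poly_Mapping.keys (h_bound n f (O_list n m k f q) i)
        \<union> {p \<in> places f. p (v (int i)) \<noteq> 0} \<union> {p \<in> places f. p (v (int n)) \<noteq> 0})"
    proof
      fix p assume "p \<in> {p. D0 p \<noteq> 0}"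
      then have p: "p \<in> places f" "D0 p \<noteq> 0" by (auto simp: D0_def split: if_splits)
      then obtain i where "i \<in> S" "D0 p = hb q p i - p (v (int i)) + p (v (int n))"
        using attained by blast
      then show "p \<in> (\<Union>i\<in>S. Poly_Mapping.keys (h_bound n f (O_list n m k f q) i)
        \<union> {p \<in> places f. p (v (int i)) \<noteq> 0} \<union> {p \<in> places f. p (v (int n)) \<noteq> 0})"
        using p by (auto simp: hb_def in_keys_iff)
    qed
    show "finite (\<Union>i\<in>S. Poly_Mapping.keys (h_bound n f (O_list n m k f q) i)
        \<union> {p \<in> places f. p (v (int i)) \<noteq> 0} \<union> {p \<in> places f. p (v (int n)) \<noteq> 0})"
      using S(1) finite_places vn by (auto simp: S_def)
  qed
  define D where "D = Poly_Mapping.Abs_poly_mapping D0"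
  have lk: "Poly_Mapping.lookup D = D0"
    unfolding D_def using \<open>finite {p. D0 p \<noteq> 0}\<close> by (rule lookup_Abs_poly_mapping)
  have Ddiv: "D \<in> divisors f"
    by (auto simp: divisors_def in_keys_iff lk D0_def split: if_splits)
  have adm: "D_admissible n m k f q D"
    unfolding D_admissible_def lk
  proof (intro conjI ballI allI impI Ddiv nonneg)
    fix i p assume ip: "i \<in> {1..n - 1}" "p \<in> places f" "\<not> f dvd Delta n m k q n i"
    then have "i \<in> {1..n}" by auto
    then show "Poly_Mapping.lookup (h_bound n f (O_list n m k f q) i) p
        \<le> p (Delta n m k q n i) - p (Delta n m k q n n) + D0 p"
      using prpn[of i p] ip bound[of p i] by (auto simp: S_def hb_def)
  qed
  have least: "Poly_Mapping.lookup D p \<le> Poly_Mapping.lookup D' p" if D': "D_admissible n m k f q D'" for D' p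
  proof (cases "p \<in> places f")
    case True
    then obtain i where i: "i \<in> S" "D0 p = hb q p i - p (v (int i)) + p (v (int n))"
      using attained by blast
    show ?thesis
    proof (cases "i = n")
      case True
      then show ?thesis using i hbn D' by (simp add: lk D_admissible_def)
    next
      case False
      then have "i \<in> {1..n - 1}" "i \<in> {1..n}" "\<not> f dvd v (int i)" using i by (auto simp: S_def)
      then have "hb q p i \<le> p (Delta n m k q n i) - p (Delta n m k q n n) + Poly_Mapping.lookup D' p"
        using D' prpn[of i p] True unfolding D_admissible_def hb_def by blast
      then show ?thesis using i prpn[of i p] True \<open>i \<in> {1..n}\<close> \<open>\<not> f dvd v (int i)\<close> by (simp add: lk)
    qed
  next
    case False
    then show ?thesis using D' by (simp add: lk D0_def D_admissible_def)
  qed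
  have "D_min n m k f q = D"
    unfolding D_min_def
  proof (rule the_equality)
    fix E assume E: "D_admissible n m k f q E \<and> (\<forall>D'. D_admissible n m k f q D' \<longrightarrow>
      (\<forall>p. Poly_Mapping.lookup E p \<le> Poly_Mapping.lookup D' p))"
    show "E = D"
    proof (rule poly_mapping_eqI, rule antisym)
      fix p
      show "Poly_Mapping.lookup E p \<le> Poly_Mapping.lookup D p" using E adm by blast
      show "Poly_Mapping.lookup D p \<le> Poly_Mapping.lookup E p" using E least by blast
    qed
  qed (use adm least in blast)
  then show "D_min n m k f q \<in> divisors f" using Ddiv by simp
  assume p: "p \<in> places f"
  then obtain j where j: "j \<in> S" "D0 p = hb q p j - p (v (int j)) + p (v (int n))"
    using attained by blast
  show "\<exists>c. (\<forall>i\<in>{1..n}. vge f p (v (int i)) (hb q p i + c)) \<and>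
      (\<exists>i\<in>{1..n}. veq f p (v (int i)) (hb q p i + c)) \<and>
      Poly_Mapping.lookup (D_min n m k f q) p = p (v (int n)) - c"
  proof (intro exI[of _ "p (v (int n)) - D0 p"] conjI ballI)
    fix i assume "i \<in> {1..n}"
    then show "vge f p (v (int i)) (hb q p i + (p (v (int n)) - D0 p))"
      using bound[OF p, of i] by (cases "f dvd v (int i)") (auto simp: vge_def S_def)
  next
    show "\<exists>i\<in>{1..n}. veq f p (v (int i)) (hb q p i + (p (v (int n)) - D0 p))"
      using j by (intro bexI[of _ j]) (auto simp: S_def veq_def)
  qed (simp add: \<open>D_min n m k f q = D\<close> lk)
qed

end

section \<open>Minimal weighted orders of sequences\<close>

definition WM :: "poly2 \<Rightarrow> nat \<Rightarrow> place \<Rightarrow> (int \<Rightarrow> int) \<Rightarrow> (int \<Rightarrow> poly2) \<Rightarrow> int \<Rightarrow> bool" where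
  "WM f n p b v c \<longleftrightarrow> (\<forall>j\<le>int n. vge f p (v j) (b j + c)) \<and> (\<exists>j\<le>int n. veq f p (v j) (b j + c))"

lemma qper_D: "qper n v \<Longrightarrow> j \<le> int n \<Longrightarrow> v (j - int n) = X * v j"
  by (simp add: qper_def)

context val
begin

lemma WM_I:
  assumes "\<And>j. j \<le> int n \<Longrightarrow> vge f p (v j) (b j + c)"
    and "\<not> (\<forall>j\<le>int n. vge f p (v j) (b j + (c + 1)))"
  shows "WM f n p b v c"
proof -
  obtain j where j: "j \<le> int n" "\<not> vge f p (v j) (b j + c + 1)"
    using assms(2) by (auto simp: add.assoc)
  then have "veq f p (v j) (b j + c)" using veqI[OF assms(1)[OF j(1)]] by simp
  then show ?thesis using assms(1) j(1) unfolding WM_def by blast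
qed

lemma WM_vge: "WM f n p b v c \<Longrightarrow> j \<le> int n \<Longrightarrow> vge f p (v j) (b j + c)"
  by (simp add: WM_def)

lemma WM_not: assumes "WM f n p b v c" "d > c" shows "\<not> (\<forall>j\<le>int n. vge f p (v j) (b j + d))"
proof -
  obtain j where "j \<le> int n" "veq f p (v j) (b j + c)" using assms(1) by (auto simp: WM_def)
  then show ?thesis using veq_not_vge[of "v j" "b j + c" "b j + d"] assms(2) by auto
qed

lemma WM_unique: "WM f n p b v c \<Longrightarrow> WM f n p b v d \<Longrightarrow> c = d"
  using WM_not[of n b v c d] WM_not[of n b v d c] WM_vge[of n b v c] WM_vge[of n b v d]
  by (cases c d rule: linorder_cases) auto

text \<open>Lowering j by n raises the order of v_j and the weight b_j by the same amount e = ord x,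
  so their difference has period n.\<close>

lemma periodic_reduce:
  assumes v: "qper n v" and n: "n > 0" and X: "veq f p X e"
    and b: "\<And>j. j \<le> int n \<Longrightarrow> b (j - int n) = b j + e" and j: "j \<le> int n"
  obtains i where "i \<in> {1..int n}" "\<And>c. vge f p (v i) (b i + c) \<longleftrightarrow> vge f p (v j) (b j + c)"
    "\<And>c. veq f p (v i) (b i + c) \<longleftrightarrow> veq f p (v j) (b j + c)"
proof -
  obtain j0 t where jt: "j0 \<in> {1..int n}" "j = j0 - int t * int n" "v j = X ^ t * v j0"
    using qper_reduce[OF v n j] by metis
  have "b (j0 - int t * int n) = b j0 + int t * e"
  proof (induction t)
    case (Suc t)
    have "0 \<le> int t * int n" by simp
    then have "j0 - int t * int n \<le> int n" using jt(1) unfolding atLeastAtMost_iff by linarith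
    then show ?case using b[of "j0 - int t * int n"] Suc by (simp add: algebra_simps)
  qed simp
  then have bj: "b j = b j0 + int t * e" using jt(2) by simp
  have Xt: "veq f p (X ^ t) (int t * e)" by (rule veq_power[OF X])
  have "vge f p (v j0) (b j0 + c) \<longleftrightarrow> vge f p (v j) (b j + c)" for c
    using vge_mult[OF veq_imp_vge[OF Xt order_refl], of "v j0" "b j0 + c"]
      vge_mult_cancel[OF Xt, of "v j0" "b j0 + c"]
    by (auto simp: jt(3) bj add_ac)
  moreover have "veq f p (v j0) (b j0 + c) \<longleftrightarrow> veq f p (v j) (b j + c)" for c
    using veq_mult[OF Xt, of "v j0" "b j0 + c"] veq_mult_cancel[OF Xt, of "v j0" "b j0 + c"]
    by (auto simp: jt(3) bj add_ac)
  ultimately show thesis using that jt(1) by metis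
qed

lemma WM_iff_period:
  assumes v: "qper n v" and n: "n > 0" and X: "veq f p X e"
    and b: "\<And>j. j \<le> int n \<Longrightarrow> b (j - int n) = b j + e"
  shows "WM f n p b v c \<longleftrightarrow> (\<forall>i\<in>{1..n}. vge f p (v (int i)) (b (int i) + c)) \<and>
    (\<exists>i\<in>{1..n}. veq f p (v (int i)) (b (int i) + c))"
proof -
  have red: "\<exists>i\<in>{1..n}. (vge f p (v (int i)) (b (int i) + c) \<longleftrightarrow> vge f p (v j) (b j + c)) \<and>
    (veq f p (v (int i)) (b (int i) + c) \<longleftrightarrow> veq f p (v j) (b j + c))" if jn: "j \<le> int n" for j
  proof -
    obtain i where i: "i \<in> {1..int n}" "vge f p (v i) (b i + c) \<longleftrightarrow> vge f p (v j) (b j + c)"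
      "veq f p (v i) (b i + c) \<longleftrightarrow> veq f p (v j) (b j + c)"
      using periodic_reduce[where b = b, OF v n X b jn] by metis
    then have "nat i \<in> {1..n}" "int (nat i) = i" by auto
    then show ?thesis using i by metis
  qed
  have le: "int i \<le> int n" if "i \<in> {1..n}" for i using that by simp
  show ?thesis unfolding WM_def using red le by metis
qed

text \<open>The minimum recurs in every lower period. An attaining index far enough below n leaves
  room for an upward shift within j \<le> n.\<close>

lemma WM_low:
  assumes "qper n v" "n > 0" "veq f p X e" "\<And>j. j \<le> int n \<Longrightarrow> b (j - int n) = b j + e"
    and "WM f n p b v c"
  shows "\<exists>j\<le>J. j \<le> int n \<and> veq f p (v j) (b j + c)"
proof -
  obtain j where j: "j \<le> int n" "veq f p (v j) (b j + c)" using assms(5) by (auto simp: WM_def)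
  have "veq f p (v (j - int t * int n)) (b (j - int t * int n) + c)" for t
  proof (induction t)
    case (Suc t)
    define i where "i = j - int t * int n"
    have "0 \<le> int t * int n" by simp
    then have "i \<le> int n" using j(1) unfolding i_def by linarith
    then have "v (i - int n) = X * v i" "b (i - int n) = b i + e"
      using qper_D[OF assms(1)] assms(4) by auto
    then have "veq f p (v (i - int n)) (b (i - int n) + c)"
      using veq_mult[OF assms(3) Suc[folded i_def]] by (simp add: add_ac)
    then show ?case by (simp add: i_def algebra_simps)
  qed (use j in simp)
  moreover have "j - int (nat \<bar>j - J\<bar>) * int n \<le> J"
  proof -
    have "\<bar>j - J\<bar> * 1 \<le> \<bar>j - J\<bar> * int n" using assms(2) by (intro mult_left_mono) auto
    then show ?thesis by simp
  qed
  moreover have "j - int (nat \<bar>j - J\<bar>) * int n \<le> int n"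
  proof -
    have "0 \<le> int (nat \<bar>j - J\<bar>) * int n" by simp
    then show ?thesis using j(1) by linarith
  qed
  ultimately show ?thesis by metis
qed

lemma WM_exists:
  assumes v: "qper n v" and n: "n > 0" and X: "veq f p X e"
    and b: "\<And>j. j \<le> int n \<Longrightarrow> b (j - int n) = b j + e" and "\<exists>j\<le>int n. \<not> f dvd v j"
  shows "\<exists>c. WM f n p b v c"
proof -
  define S where "S = {i \<in> {1..n}. \<not> f dvd v (int i)}"
  have "S \<noteq> {}"
  proof
    assume "S = {}"
    then have "f dvd v j" if "j \<in> {1..int n}" for j
    proof -
      have "nat j \<in> {1..n}" "int (nat j) = j" using that by auto
      then show ?thesis using \<open>S = {}\<close> unfolding S_def by (metis (mono_tags, lifting) empty_Collect_eq)
    qed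
    then show False using qper_dvd_all[OF v n, of f] assms(5) by metis
  qed
  moreover have "finite S" by (simp add: S_def)
  ultimately have M: "Min ((\<lambda>i. p (v (int i)) - b (int i)) ` S) \<in> (\<lambda>i. p (v (int i)) - b (int i)) ` S"
    by (intro Min_in) auto
  define c where "c = Min ((\<lambda>i. p (v (int i)) - b (int i)) ` S)"
  obtain i where i: "i \<in> S" "c = p (v (int i)) - b (int i)" using M unfolding c_def by (elim imageE)
  have "c \<le> p (v (int i)) - b (int i)" if "i \<in> S" for i
    unfolding c_def using \<open>finite S\<close> that by (intro Min_le) auto
  then have "vge f p (v (int i)) (b (int i) + c)" if "i \<in> {1..n}" for i
    using that by (cases "f dvd v (int i)") (force simp: vge_def S_def)+
  moreover have "veq f p (v (int i)) (b (int i) + c)" "i \<in> {1..n}" using i by (auto simp: veq_def S_def)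
  ultimately show ?thesis using WM_iff_period[where b = b, OF v n X b] by metis
qed

lemma vge_Tq:
  assumes "\<And>j. b j \<le> b (j - 1)" "\<And>j. j \<le> int n \<Longrightarrow> vge f p (v j) (b j + c)" "j \<le> int n"
  shows "vge f p (Tq q i v j) (b j + c)"
  unfolding Tq_def using assms(2)[OF assms(3)] assms(2)[of "j - 1"] assms(1)[of j] assms(3)
  by (intro vge_add vge_cmult) (auto elim: vge_mono)

lemma vge_Tl:
  assumes "\<And>j. b j \<le> b (j - 1)" "\<And>j. j \<le> int n \<Longrightarrow> vge f p (v j) (b j + c)" "j \<le> int n"
  shows "vge f p (Tl q is v j) (b j + c)"
  using assms(3)
proof (induction "is" arbitrary: j)
  case (Cons i "is")
  show ?case using vge_Tq[where b = b, OF assms(1) Cons.IH Cons.prems] by simp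
qed (use assms(2) in simp)

text \<open>Covers the general points and the \<open>O\<close>-points at once.\<close>

lemma WM_factor:
  assumes b: "\<And>j. b j \<le> b (j - 1)" and bk: "\<And>j. b (j - int k) = b j + e"
    and Y: "veq f p Y e" and v: "WM f n p b v c"
    and fac: "\<And>j. j \<le> int n \<Longrightarrow> f dvd Tl q is (Tl q js (shift (int k) v)) j - Y * v j"
  shows "WM f n p b (Tl q js (shift (int k) v)) (c + e)"
proof (rule WM_I)
  have s: "vge f p (shift (int k) v j) (b j + (c + e))" if "j \<le> int n" for j
    using WM_vge[OF v, of "j - int k"] that bk[of j] by (simp add: shift_def add_ac)
  show "vge f p (Tl q js (shift (int k) v) j) (b j + (c + e))" if "j \<le> int n" for j
    using vge_Tl[where b = b, OF b s that] .
  show "\<not> (\<forall>j\<le>int n. vge f p (Tl q js (shift (int k) v) j) (b j + (c + e + 1)))"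
  proof
    assume a: "\<forall>j\<le>int n. vge f p (Tl q js (shift (int k) v) j) (b j + (c + e + 1))"
    \<comment> \<open>The remaining rows do not lower weighted orders and lead to y v, so a gain
      here would be a gain for v itself.\<close>
    have "vge f p (v j) (b j + (c + 1))" if j: "j \<le> int n" for j
    proof -
      have "vge f p (Tl q is (Tl q js (shift (int k) v)) j) (b j + (c + e + 1))"
        by (rule vge_Tl[where b = b, OF b _ j]) (rule a[rule_format])
      then have "vge f p (Y * v j) (e + (b j + (c + 1)))"
        using vge_cong[OF fac[OF j]] by (simp add: add_ac)
      then show ?thesis by (rule vge_mult_cancel[OF Y])
    qed
    then show False using WM_not[OF v, of "c + 1"] by simp
  qed
qed

text \<open>Up to order c one has v_(j-1) = - q_ij v_j, and after n steps v_(j-n) = x v_j. The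
  factor in front of v_j is det Q_i up to sign, obtained here from the recursion.\<close>

lemma Tq_cyclic:
  assumes v: "qper n v" and T: "\<And>j. j \<le> int n \<Longrightarrow> vge f p (Tq q i v j) c" and j: "j \<le> int n"
    and per: "\<And>j. q i (j - int n) = q i j"
  shows "vge f p ((X - const2 ((-1) ^ n * (\<Prod>j=1..n. q i (int j)))) * v j) c"
proof -
  have step: "vge f p (v (j - int t) - const2 ((-1) ^ t * (\<Prod>s<t. q i (j - int s))) * v j) c" for t
  proof (induction t)
    case (Suc t)
    define P where "P = (-1) ^ t * (\<Prod>s<t. q i (j - int s))"
    define a where "a = q i (j - int t)"
    have "vge f p (const2 a * v (j - int t) + v (j - int t - 1)) c"
      using T[of "j - int t"] j by (simp add: Tq_def a_def)
    moreover have "vge f p (const2 a * (v (j - int t) - const2 P * v j)) c"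
      using Suc by (intro vge_cmult) (simp add: P_def)
    ultimately have "vge f p ((const2 a * v (j - int t) + v (j - int t - 1))
      - const2 a * (v (j - int t) - const2 P * v j)) c" by (rule vge_diff)
    moreover have "(x * u + w) - x * (u - y * z) = w - (- (x * y)) * z" for x y z u w :: poly2
      by (simp add: right_diff_distrib)
    moreover have "const2 (- a * P) = - (const2 a * const2 P)" by simp
    moreover have "j - int (Suc t) = j - int t - 1" by simp
    moreover have "- a * P = (-1) ^ Suc t * (\<Prod>s<Suc t. q i (j - int s))"
      by (simp add: P_def a_def)
    ultimately show ?case by (metis (no_types, lifting))
  qed simp
  have "(\<Prod>s<n. q i (j - int s)) = (\<Prod>j=1..n. q i (int j))"
  proof (cases "n = 0")
    case False
    have per': "q i (z - int n * y) = q i z" for z y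
    proof (induction y rule: int_induct[where k = 0])
      case (step1 y)
      then show ?case using per[of "z - int n * y"] by (simp add: algebra_simps)
    next
      case (step2 y)
      then show ?case using per[of "z - int n * (y - 1)"] by (simp add: algebra_simps)
    qed simp
    have modq: "q i z = q i (z mod int n)" for z
      using per'[of z "z div int n"] by (simp add: minus_mult_div_eq_mod)
    have "(\<Prod>s<n. q i (j - int s)) = (\<Prod>z\<in>{0..<int n}. q i z)"
    proof (rule prod.reindex_bij_witness[where i = "\<lambda>z. nat ((j - z) mod int n)"
          and j = "\<lambda>s. (j - int s) mod int n"])
      fix s assume s: "s \<in> {..<n}"
      have "(j - (j - int s) mod int n) mod int n = int s mod int n"
        by (subst mod_diff_right_eq) simp
      then show "nat ((j - (j - int s) mod int n) mod int n) = s" using s by simp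
      show "(j - int s) mod int n \<in> {0..<int n}" using False by simp
      show "q i ((j - int s) mod int n) = q i (j - int s)" using modq[of "j - int s"] by simp
    next
      fix z assume z: "z \<in> {0..<int n}"
      have "(j - int (nat ((j - z) mod int n))) mod int n = (j - (j - z) mod int n) mod int n"
        using False by simp
      also have "\<dots> = z mod int n"
        by (subst mod_diff_right_eq) simp
      finally show "(j - int (nat ((j - z) mod int n))) mod int n = z" using z by simp
      show "nat ((j - z) mod int n) \<in> {..<n}" using False by (simp add: nat_less_iff)
    qed
    moreover have mod_le: "b mod n = b" if "b \<le> n" "0 < b mod n" for b
      using that by (cases "b = n") auto
    moreover have "(\<Prod>z\<in>{0..<int n}. q i z) = (\<Prod>j=1..n. q i (int j))"
    proof (rule prod.reindex_bij_witness[where i = "\<lambda>j. int j mod int n"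
          and j = "\<lambda>z. if z = 0 then n else nat z"])
      show "q i (int (if z = 0 then n else nat z)) = q i z" if "z \<in> {0..<int n}" for z
        using that modq[of "int n"] by auto
    qed (use False mod_le in \<open>auto split: if_splits simp: zmod_int[symmetric]\<close>)
    ultimately show ?thesis by simp
  qed simp
  then show ?thesis using step[of n] qper_D[OF v j] by (simp add: algebra_simps)
qed

end

section \<open>Leading coefficients of powers of the Lax matrix\<close>

text \<open>Coefficient of the next-to-longest shift in L: (L v)_j = v_(j-m-k) + delta_j v_(j-m-k+1)
  + .... Row i acts after i - 1 shifts, hence the column j - i + 1.\<close>

definition delta :: "nat \<Rightarrow> point \<Rightarrow> int \<Rightarrow> complex" where
  "delta m q j = (\<Sum>i=1..m. q (int i) (j - int i + 1))"

text \<open>The same coefficient for L^(n/M), whose longest shift is a whole number of periods. Its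
  values at j = 1, ..., M turn out to be the coordinates c.\<close>

definition csum :: "nat \<Rightarrow> nat \<Rightarrow> nat \<Rightarrow> point \<Rightarrow> int \<Rightarrow> complex" where
  "csum n m k q j = (\<Sum>l<n div gcd n (m + k). delta m q (j - int (l * (m + k))))"

text \<open>The two terms with the most shifts.\<close>

definition upper :: "((int \<Rightarrow> poly2) \<Rightarrow> int \<Rightarrow> poly2) \<Rightarrow> int \<Rightarrow> (int \<Rightarrow> complex) \<Rightarrow> int \<Rightarrow> bool" where
  "upper F s \<delta> d \<longleftrightarrow> d \<ge> 0 \<and> (d = 0 \<longrightarrow> (\<forall>j. \<delta> j = 0)) \<and>
     (\<forall>f v j. F v j - v (j - s) - const2 (\<delta> j) * v (j - s + 1) \<in> Sp f v {j - s + 2..j - s + d})"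

lemma upperD:
  assumes "upper F s \<delta> d"
  shows "d \<ge> 0" "d = 0 \<Longrightarrow> \<delta> j = 0"
    "F v j - v (j - s) - const2 (\<delta> j) * v (j - s + 1) \<in> Sp f v {j - s + 2..j - s + d}"
  using assms by (auto simp: upper_def)

lemma upper_id: "upper (\<lambda>v. v) 0 (\<lambda>_. 0) 0"
  by (simp add: upper_def)

lemma upper_shift: "upper (shift s) s (\<lambda>_. 0) 0"
  by (simp add: upper_def shift_def)

lemma upper_Tq: "upper (Tq q i) 1 (q i) 1"
  by (simp add: upper_def Tq_def)

lemma upper_Sp_next:
  assumes F: "upper F s \<delta> d" shows "F v j - v (j - s) \<in> Sp f v {j - s + 1..j - s + d}"
proof -
  define r where "r = F v j - v (j - s) - const2 (\<delta> j) * v (j - s + 1)"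
  have "r \<in> Sp f v {j - s + 2..j - s + d}" unfolding r_def by (rule upperD(3)[OF F])
  then have "r \<in> Sp f v {j - s + 1..j - s + d}" by (rule Sp_mono) auto
  moreover have "const2 (\<delta> j) * v (j - s + 1) \<in> Sp f v {j - s + 1..j - s + d}"
  proof (cases "d = 0")
    case True
    then show ?thesis using upperD(2)[OF F] by simp
  next
    case False
    then show ?thesis using upperD(1)[OF F] by (intro Sp_scale Sp_base) auto
  qed
  ultimately have "r + const2 (\<delta> j) * v (j - s + 1) \<in> Sp f v {j - s + 1..j - s + d}" by (rule Sp_add)
  then show ?thesis by (simp add: r_def)
qed

lemma upper_Sp:
  assumes F: "upper F s \<delta> d" shows "F v j \<in> Sp f v {j - s..j - s + d}"
proof -
  have "F v j - v (j - s) \<in> Sp f v {j - s..j - s + d}"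
    by (rule Sp_mono[OF upper_Sp_next[OF F]]) auto
  moreover have "v (j - s) \<in> Sp f v {j - s..j - s + d}"
    using upperD(1)[OF F] by (intro Sp_base) auto
  ultimately have "F v j - v (j - s) + v (j - s) \<in> Sp f v {j - s..j - s + d}" by (rule Sp_add)
  then show ?thesis by simp
qed

lemma upper_comp:
  assumes F: "upper F s \<delta> d" and G: "upper G s' \<delta>' d'"
  shows "upper (\<lambda>v. F (G v)) (s + s') (\<lambda>j. \<delta> j + \<delta>' (j - s)) (d + d')"
  unfolding upper_def
proof (intro conjI allI impI)
  have d: "d \<ge> 0" "d' \<ge> 0" using upperD(1)[OF F] upperD(1)[OF G] .
  then show "0 \<le> d + d'" by simp
  show "\<delta> j + \<delta>' (j - s) = 0" if "d + d' = 0" for j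
    using that d upperD(2)[OF F] upperD(2)[OF G] by simp
  fix f :: poly2 and v :: "int \<Rightarrow> poly2" and j :: int
  define w where "w = G v"
  define J where "J = {j - s - s' + 2..j - s - s' + (d + d')}"
  define r where "r = F w j - w (j - s) - const2 (\<delta> j) * w (j - s + 1)"
  define r1 where "r1 = w (j - s) - v (j - s - s') - const2 (\<delta>' (j - s)) * v (j - s - s' + 1)"
  define r2 where "r2 = const2 (\<delta> j) * (w (j - s + 1) - v (j - s + 1 - s'))"
  have "r \<in> Sp f w {j - s + 2..j - s + d}" unfolding r_def by (rule upperD(3)[OF F])
  then have rJ: "r \<in> Sp f v J"
  proof (rule Sp_trans)
    fix i assume "i \<in> {j - s + 2..j - s + d}"
    then show "w i \<in> Sp f v J"
      using Sp_mono[OF upper_Sp[OF G, of v i f], of J] by (auto simp: w_def J_def)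
  qed
  have "r1 \<in> Sp f v {j - s - s' + 2..j - s - s' + d'}"
    unfolding r1_def w_def by (rule upperD(3)[OF G])
  then have r1J: "r1 \<in> Sp f v J" by (rule Sp_mono) (use d in \<open>auto simp: J_def\<close>)
  \<comment> \<open>The error of \<open>G\<close> at the second term reaches one index higher, which
    fits into J only for d > 0; for d = 0 the coefficient is 0 by the definition of
    \<open>upper\<close>.\<close>
  have r2J: "r2 \<in> Sp f v J"
  proof (cases "d = 0")
    case True
    then show ?thesis using upperD(2)[OF F] by (simp add: r2_def)
  next
    case False
    have "w (j - s + 1) - v (j - s + 1 - s') \<in> Sp f v J"
      unfolding w_def by (rule Sp_mono[OF upper_Sp_next[OF G]]) (use d False in \<open>auto simp: J_def\<close>)
    then show ?thesis unfolding r2_def by (rule Sp_scale)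
  qed
  have idx: "j - (s + s') = j - s - s'" "j - s - s' + 1 = j - s + 1 - s'" by simp_all
  have "r + r1 + r2 \<in> Sp f v J" using rJ r1J r2J by (intro Sp_add)
  moreover have "r + r1 + r2 = F w j - v (j - s - s')
      - (const2 (\<delta> j) + const2 (\<delta>' (j - s))) * v (j - s - s' + 1)"
    unfolding r_def r1_def r2_def idx(2) by (simp add: algebra_simps)
  ultimately show "F (G v) j - v (j - (s + s')) - const2 (\<delta> j + \<delta>' (j - s)) * v (j - (s + s') + 1)
      \<in> Sp f v {j - (s + s') + 2..j - (s + s') + (d + d')}"
    unfolding idx(1) by (simp add: w_def J_def)
qed

lemma upper_Tl: "upper (Tl q is) (int (length is)) (\<lambda>j. \<Sum>t<length is. q (is ! t) (j - int t)) (int (length is))"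
proof (induction "is")
  case Nil
  show ?case using upper_id by (simp add: Tl_def)
next
  case (Cons i "is")
  have "(\<Sum>t<length (i # is). q ((i # is) ! t) (j - int t))
      = q i j + (\<Sum>t<length is. q (is ! t) (j - 1 - int t))" for j
    by (simp add: sum.lessThan_Suc_shift algebra_simps del: sum.lessThan_Suc)
  then show ?case
    using upper_comp[OF upper_Tq[of q i] Cons.IH] by (simp add: Tl_def comp_def add_ac)
qed

lemma upper_Lop: "upper (Lop m k q) (int (m + k)) (delta m q) (int m)"
proof -
  have "upper (\<lambda>v. Tl q [1..int m] (shift (int k) v)) (int m + int k)
    (\<lambda>j. (\<Sum>t<m. q ([1..int m] ! t) (j - int t)) + 0) (int m + 0)"
    using upper_comp[OF upper_Tl[of q "[1..int m]"] upper_shift[of "int k"]] by simp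
  moreover have "(\<Sum>t<m. q ([1..int m] ! t) (j - int t)) = delta m q j" for j
    unfolding delta_def
    by (rule sum.reindex_bij_witness[where i = "\<lambda>i. i - 1" and j = Suc]) (auto simp: algebra_simps of_nat_diff)
  ultimately show ?thesis by (simp add: Lop_def[abs_def])
qed

lemma upper_Lop_pow: "upper (Lop m k q ^^ a) (int (a * (m + k)))
  (\<lambda>j. \<Sum>l<a. delta m q (j - int (l * (m + k)))) (int (a * m))"
proof (induction a)
  case 0
  show ?case using upper_id by (simp add: id_def)
next
  case (Suc a)
  have "(\<Sum>l<Suc a. delta m q (j - int (l * (m + k))))
      = delta m q j + (\<Sum>l<a. delta m q (j - int (m + k) - int (l * (m + k))))" for j
    by (simp add: sum.lessThan_Suc_shift algebra_simps del: sum.lessThan_Suc)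
  moreover have "int (m + k) + int (a * (m + k)) = int (Suc a * (m + k))"
    "int m + int (a * m) = int (Suc a * m)"
    by (simp_all add: algebra_simps)
  ultimately show ?case using upper_comp[OF upper_Lop[of m k q] Suc.IH] by (simp add: comp_def)
qed

text \<open>L^(n/M) is the least positive power of L whose longest shift is a multiple of n, namely
  n b with b = (m+k)/M.\<close>

lemma gcd_data:
  fixes n m k M :: nat
  assumes "n \<ge> 2" "k \<ge> 1" and M: "M = gcd n (m + k)"
  shows "M > 0" "n div M * (m + k) = n * ((m + k) div M)" "(m + k) div M \<ge> 1" "n div M \<ge> 1" "M \<le> n"
proof -
  show "M > 0" using assms by auto
  have d: "M dvd n" "M dvd m + k" by (simp_all add: M)
  then show "n div M * (m + k) = n * ((m + k) div M)" by (metis dvd_div_mult div_mult_swap mult.commute)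
  show "M \<le> n" using d(1) assms by (auto intro: dvd_imp_le)
  show "n div M \<ge> 1" using \<open>M \<le> n\<close> \<open>M > 0\<close> by (simp add: Suc_leI div_greater_zero_iff)
  have "M \<le> m + k" using d(2) assms by (intro dvd_imp_le) auto
  then show "(m + k) div M \<ge> 1" using \<open>M > 0\<close> by (simp add: Suc_leI div_greater_zero_iff)
qed

text \<open>Quasi-periodic extension of the c-th standard basis vector; an operator applied to it
  reads off a column of its matrix.\<close>

definition unit_seq :: "nat \<Rightarrow> int \<Rightarrow> int \<Rightarrow> poly2" where
  "unit_seq n c j = (if j \<le> c \<and> int n dvd c - j then X ^ nat ((c - j) div int n) else 0)"

lemma qper_unit_seq:
  assumes "1 \<le> c" "c \<le> int n" shows "qper n (unit_seq n c)"
  unfolding qper_def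
proof (intro allI impI)
  fix j assume j: "j \<le> int n"
  have n: "int n > 0" using assms by simp
  have dvd: "int n dvd c - (j - int n) \<longleftrightarrow> int n dvd c - j"
    using dvd_add_left_iff[of "int n" "int n" "c - j"] by (simp add: algebra_simps)
  have "j \<le> c" if d: "int n dvd c - j"
  proof (rule ccontr)
    assume "\<not> j \<le> c"
    then have "int n \<le> j - c" using d by (intro zdvd_imp_le) (auto simp: dvd_diff_commute)
    then show False using j assms by simp
  qed
  moreover have "nat ((c - (j - int n)) div int n) = Suc (nat ((c - j) div int n))" if "j \<le> c"
  proof -
    have "(c - (j - int n)) div int n = (c - j) div int n + 1"
      using n div_add_self2[of "int n" "c - j"] by (simp add: algebra_simps)
    moreover have "(c - j) div int n \<ge> 0" using n that by (simp add: pos_imp_zdiv_nonneg_iff)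
    ultimately show ?thesis by (simp add: nat_add_distrib)
  qed
  ultimately show "unit_seq n c (j - int n) = X * unit_seq n c j"
    using dvd n j unfolding unit_seq_def by auto
qed

lemma lifts_entry:
  assumes A: "lifts n A F" and a: "a < n" and c: "c < n"
  shows "[:A $$ (a, c):] = F (unit_seq n (int c + 1)) (int a + 1)"
proof -
  have u: "unit_seq n (int c + 1) (int b + 1) = (if b = c then 1 else 0)" if b: "b < n" for b
  proof -
    have "\<not> int n dvd int c - int b" if "b \<noteq> c" "b \<le> c"
      using that b c by (auto dest: zdvd_imp_le)
    then show ?thesis by (auto simp: unit_seq_def)
  qed
  have Ac: "A \<in> carrier_mat n n" using A by (simp add: lifts_def)
  have "vec_of n (F (unit_seq n (int c + 1))) = emb A *\<^sub>v vec_of n (unit_seq n (int c + 1))"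
    using A qper_unit_seq[of "int c + 1" n] c by (simp add: lifts_def)
  then have "F (unit_seq n (int c + 1)) (int a + 1) = (emb A *\<^sub>v vec_of n (unit_seq n (int c + 1))) $ a"
    using a by (metis index_vec vec_of_def)
  also have "\<dots> = (\<Sum>b<n. [:A $$ (a, b):] * unit_seq n (int c + 1) (int b + 1))"
    using a Ac by (simp add: scalar_prod_def vec_of_def lessThan_atLeast0)
  also have "\<dots> = (\<Sum>b<n. if b = c then [:A $$ (a, b):] else 0)"
    by (intro sum.cong) (auto simp: u)
  finally show ?thesis using c by simp
qed

text \<open>On the basis sequence of the column next to l, the longest shift of L^(n/M) meets a
  zero, the next one contributes \<open>csum\<close> times x^B, and the remaining terms have larger
  index, hence smaller powers of x. For l = n, possible only if M = n, the column wraps to 1, which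
  lowers B by one.\<close>

lemma c_entry_coeff:
  assumes n: "n \<ge> 2" and k: "k \<ge> 1" and q: "q \<in> phase_space n m k" and l: "l \<in> {1..gcd n (m + k)}"
  defines "B \<equiv> (m + k) div gcd n (m + k) - (if l = n then 1 else 0)"
  shows "coeff (c_entry n m k l q) B = csum n m k q (int l)"
    "\<And>i. i > B \<Longrightarrow> coeff (c_entry n m k l q) i = 0"
proof -
  define a where "a = n div gcd n (m + k)"
  define b where "b = (m + k) div gcd n (m + k)"
  note g = gcd_data[OF n k refl, of m, folded a_def b_def]
  have l1: "1 \<le> l" "l \<le> n" using l g(5) by auto
  define c where "c = l mod n"
  have c: "c < n" using n by (simp add: c_def)
  have cl: "int l + 1 = int c + 1 + (if l = n then int n else 0)"
    using l1 by (auto simp: c_def)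
  define u where "u = unit_seq n (int c + 1)"
  have ab: "int (a * (m + k)) = int n * int b" using g(2) by simp
  have b1: "b \<ge> 1" using g(3) .
  have Bb: "int B = int b - (if l = n then 1 else 0)" using b1 by (simp add: B_def b_def)
  then have bB: "int b = int B + (if l = n then 1 else 0)" by simp
  have entry: "[:c_entry n m k l q:] = (Lop m k q ^^ a) u (int l)"
    using lifts_entry[OF lifts_power[OF lifts_lax[OF n q]], of "l - 1" c a] c l1
    unfolding c_entry_def a_def u_def c_def by (simp add: of_nat_diff)
  have top: "u (int l - int n * int b + 1) = X ^ B"
  proof -
    have "int c + 1 - (int l - int n * int b + 1) = int n * int B"
      using cl by (simp add: bB algebra_simps)
    then have e: "int c + 1 - (int l - int n * int b + 1) = int n * int B" .
    then have "int l - int n * int b + 1 \<le> int c + 1"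
      by (metis diff_ge_0_iff_ge of_nat_0_le_iff zero_le_mult_iff)
    then show ?thesis using e n unfolding u_def unit_seq_def by (simp del: of_nat_mult)
  qed
  have zero: "u (int l - int n * int b) = 0"
  proof -
    have "\<not> int n dvd int c + 1 - (int l - int n * int b)"
    proof
      assume "int n dvd int c + 1 - (int l - int n * int b)"
      moreover have "int c + 1 - (int l - int n * int b) = int n * int B + 1"
        using cl by (simp add: bB algebra_simps)
      ultimately have "int n dvd 1" by (metis dvd_add_right_iff dvd_triv_left)
      then show False using n by simp
    qed
    then show ?thesis by (simp add: u_def unit_seq_def)
  qed
  define r where "r = (Lop m k q ^^ a) u (int l) - u (int l - int (a * (m + k)))
    - const2 (csum n m k q (int l)) * u (int l - int (a * (m + k)) + 1)"
  \<comment> \<open>Modulus 0: the entries are compared as polynomials and not as functions on a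
    curve.\<close>
  have "r \<in> Sp 0 u {int l - int (a * (m + k)) + 2..int l - int (a * (m + k)) + int (a * m)}"
    unfolding r_def csum_def a_def[symmetric] by (rule upperD(3)[OF upper_Lop_pow])
  then have "\<exists>\<rho>. r = [:\<rho>:] \<and> (\<forall>i\<ge>B. coeff \<rho> i = 0)"
  proof (induction rule: Sp_induct)
    case (dvd g)
    then show ?case by (intro exI[of _ 0]) simp
  next
    case (base j)
    then have j: "j \<ge> int l - int n * int b + 2" using ab by simp
    show ?case
    proof (cases "j \<le> int c + 1 \<and> int n dvd int c + 1 - j")
      case True
      then obtain z where z: "int c + 1 - j = int n * z" by (auto elim: dvdE)
      have "int n * z < int n * int B" using z j cl by (auto simp: bB algebra_simps split: if_splits)
      then have "z < int B" using n by simp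
      moreover have "z \<ge> 0" using z True n by (metis diff_ge_0_iff_ge of_nat_0_less_iff
            zero_le_mult_iff not_numeral_le_zero linorder_not_less le_zero_eq of_nat_le_0_iff)
      moreover have "u j = X ^ nat z" using True z n by (simp add: u_def unit_seq_def)
      moreover have "X ^ i = [:monom 1 i:]" for i
        by (induction i) (simp_all add: X_def one_pCons monom_Suc)
      ultimately show ?thesis by (intro exI[of _ "monom 1 (nat z)"]) auto
    next
      case False
      then show ?thesis by (intro exI[of _ 0]) (auto simp: u_def unit_seq_def)
    qed
  next
    case (add g h)
    then obtain \<rho> \<rho>' where "g = [:\<rho>:]" "h = [:\<rho>':]" "\<forall>i\<ge>B. coeff \<rho> i = 0" "\<forall>i\<ge>B. coeff \<rho>' i = 0"
      by metis
    then show ?case by (intro exI[of _ "\<rho> + \<rho>'"]) simp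
  next
    case (scale x g)
    then obtain \<rho> where "g = [:\<rho>:]" "\<forall>i\<ge>B. coeff \<rho> i = 0" by metis
    then show ?case by (intro exI[of _ "Polynomial.smult x \<rho>"]) (simp add: const2_def)
  qed
  then obtain \<rho> where \<rho>: "r = [:\<rho>:]" "\<And>i. i \<ge> B \<Longrightarrow> coeff \<rho> i = 0" by metis
  have "X ^ i = [:monom 1 i:]" for i
    by (induction i) (simp_all add: X_def one_pCons monom_Suc)
  then have "[:c_entry n m k l q:] = [:\<rho> + Polynomial.smult (csum n m k q (int l)) (monom 1 B):]"
    using entry \<rho>(1) top zero ab unfolding r_def by (simp add: const2_def algebra_simps)
  then have ce: "c_entry n m k l q = \<rho> + Polynomial.smult (csum n m k q (int l)) (monom 1 B)" by simp
  show "coeff (c_entry n m k l q) B = csum n m k q (int l)" by (simp add: ce \<rho>(2))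
  show "coeff (c_entry n m k l q) i = 0" if "i > B" for i using that by (simp add: ce \<rho>(2))
qed

lemma c_list_csum:
  assumes n: "n \<ge> 2" and k: "k \<ge> 1" and m: "m \<ge> 1" and q: "q \<in> phase_space n m k"
  shows "c_list n m k q = map (\<lambda>l. csum n m k q (int l)) [1..<Suc (gcd n (m + k))]"
  unfolding c_list_def
proof (rule map_cong[OF refl])
  fix l assume "l \<in> set [1..<Suc (gcd n (m + k))]"
  then have l: "l \<in> {1..gcd n (m + k)}" by auto
  define B where "B = (m + k) div gcd n (m + k) - (if l = n then 1 else 0)"
  note co = c_entry_coeff[OF n k _ l, folded B_def]
  have le: "degree (c_entry n m k l p) \<le> B" if "p \<in> phase_space n m k" for p
    using co(2)[OF that] by (intro degree_le) auto
  \<comment> \<open>At the all-ones point the coefficient counts m n/M terms and is nonzero, so the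
    degree bound B is attained on the phase space.\<close>
  define o1 :: point where "o1 = (\<lambda>_ _. 1)"
  have o1: "o1 \<in> phase_space n m k" by (simp add: phase_space_def o1_def)
  have "csum n m k o1 (int l) = of_nat (n div gcd n (m + k) * m)"
    by (simp add: csum_def delta_def o1_def)
  moreover have "n div gcd n (m + k) * m \<noteq> 0" using gcd_data(4)[OF n k refl, of m] m by simp
  ultimately have "coeff (c_entry n m k l o1) B \<noteq> 0" using co(1)[OF o1] by (metis of_nat_eq_0_iff)
  then have "B \<le> degree (c_entry n m k l o1)" by (rule le_degree)
  then have "degree (c_entry n m k l o1) = B" using le[OF o1] by simp
  then have "Max ((\<lambda>p. degree (c_entry n m k l p)) ` phase_space n m k) = B"
    using le o1 by (intro Max_eqI) (auto intro: finite_subset[of _ "{..B}"])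
  then show "coeff (c_entry n m k l q) (Max ((\<lambda>p. degree (c_entry n m k l p)) ` phase_space n m k))
    = csum n m k q (int l)" using co(1)[OF q] by simp
qed

section \<open>The place at infinity\<close>

text \<open>Multiplication by g is, up to higher weighted order, a nonzero multiple of the shift by
  s. An attaining index low enough to be shifted up bounds ord g from above, and any attaining index
  bounds it from below. Consequently the set of attaining indices is stable under the shift in both
  directions.\<close>

lemma (in val) multiplier_order:
  assumes n: "n > 0" and v: "qper n v" and X: "veq f p X e0"
    and b: "\<And>j. j \<le> int n \<Longrightarrow> b (j - int n) = b j + e0" and W: "WM f n p b v \<mu>"
    and s: "s \<ge> 0" and bs: "\<And>j. b (j - s) = b j - e"
    and g: "\<And>j. j \<le> int n \<Longrightarrow> vge f p (g * v j - const2 (c j) * v (j - s)) (b (j - s) + \<mu> + 1)"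
    and c: "\<And>j. c j \<noteq> 0"
  shows "veq f p g (- e)"
    and "j \<le> int n \<Longrightarrow> veq f p (v (j - s)) (b (j - s) + \<mu>) \<longleftrightarrow> veq f p (v j) (b j + \<mu>)"
proof -
  have iff: "veq f p (g * v j) (b (j - s) + \<mu>) \<longleftrightarrow> veq f p (v (j - s)) (b (j - s) + \<mu>)" if "j \<le> int n" for j
  proof -
    have "veq f p (g * v j) (b (j - s) + \<mu>) \<longleftrightarrow> veq f p (const2 (c j) * v (j - s)) (b (j - s) + \<mu>)"
      by (rule veq_diff_cong[OF g[OF that]])
    also have "\<dots> \<longleftrightarrow> veq f p (v (j - s)) (b (j - s) + \<mu>)"
      using veq_cmult[of "v (j - s)" _ "c j"] veq_mult_cancel[OF veq_const[OF c[of j]], of "v (j - s)" "b (j - s) + \<mu>"] c[of j]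
      by auto
    finally show ?thesis .
  qed
  obtain j0 where j0: "j0 \<le> int n - s" "j0 \<le> int n" "veq f p (v j0) (b j0 + \<mu>)"
    using WM_low[where b = b, OF v n X b W] by metis
  have bj0: "b j0 = b (j0 + s) - e" using bs[of "j0 + s"] by simp
  have 1: "veq f p (g * v (j0 + s)) (b j0 + \<mu>)" using iff[of "j0 + s"] j0 by simp
  then have g0: "\<not> f dvd g" by (auto simp: veq_def)
  then have gq: "veq f p g (p g)" by (simp add: veq_def)
  have "vge f p (g * v (j0 + s)) (p g + (b (j0 + s) + \<mu>))"
    using veq_imp_vge[OF gq order_refl] WM_vge[OF W, of "j0 + s"] j0(1) by (intro vge_mult) auto
  then have "p g + (b (j0 + s) + \<mu>) \<le> b j0 + \<mu>" using veq_not_vge[OF 1] by force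
  then have le: "p g \<le> - e" using bj0 by simp
  obtain j1 where j1: "j1 \<le> int n" "veq f p (v j1) (b j1 + \<mu>)" using W by (auto simp: WM_def)
  have "vge f p (const2 (c j1) * v (j1 - s)) (b (j1 - s) + \<mu>)"
    using WM_vge[OF W, of "j1 - s"] j1(1) s by (intro vge_cmult) auto
  moreover have "vge f p (g * v j1 - const2 (c j1) * v (j1 - s)) (b (j1 - s) + \<mu>)"
    using g[OF j1(1)] by (rule vge_mono) simp
  ultimately have "vge f p (g * v j1 - const2 (c j1) * v (j1 - s) + const2 (c j1) * v (j1 - s)) (b (j1 - s) + \<mu>)"
    by (intro vge_add)
  then have "vge f p (g * v j1) (b (j1 - s) + \<mu>)" by simp
  moreover have "veq f p (g * v j1) (p g + (b j1 + \<mu>))" by (rule veq_mult[OF gq j1(2)])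
  ultimately have "b (j1 - s) + \<mu> \<le> p g + (b j1 + \<mu>)" using veq_not_vge by force
  then have "p g \<ge> - e" using bs[of j1] by simp
  with le have pg: "p g = - e" by simp
  then show ge: "veq f p g (- e)" using gq by simp
  show "veq f p (v (j - s)) (b (j - s) + \<mu>) \<longleftrightarrow> veq f p (v j) (b j + \<mu>)" if j: "j \<le> int n"
  proof -
    have eq: "b (j - s) + \<mu> = - e + (b j + \<mu>)" using bs[of j] by simp
    show ?thesis using iff[OF j] veq_mult[OF ge, of "v j" "b j + \<mu>"] veq_mult_cancel[OF ge, of "v j" "b j + \<mu>"]
      unfolding eq by auto
  qed
qed

context spectral_curve
begin

lemma not_dvd_X: "\<not> f dvd X" and not_dvd_Y: "\<not> f dvd Y"
  using dvd_imp_degree_le[of f X] dvd_imp_degree_le[of f Y] deg n2 by (auto simp: X_def Y_def)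

lemma Tl_cong:
  assumes "\<And>j. j \<le> int n \<Longrightarrow> f dvd v j - w j" "j \<le> int n"
  shows "f dvd Tl q is v j - Tl q is w j"
  using assms(2)
proof (induction "is" arbitrary: j)
  case (Cons i "is")
  have "Tl q (i # is) v j - Tl q (i # is) w j
      = const2 (q i j) * (Tl q is v j - Tl q is w j) + (Tl q is v (j - 1) - Tl q is w (j - 1))"
    by (simp add: Tq_def algebra_simps)
  moreover have "f dvd Tl q is v j - Tl q is w j" "f dvd Tl q is v (j - 1) - Tl q is w (j - 1)"
    using Cons.IH[of j] Cons.IH[of "j - 1"] Cons.prems by auto
  ultimately show ?case by (simp only: dvd_add dvd_mult)
qed (use assms(1) in simp)

lemma Tl_scale: "Tl q is (\<lambda>j. g * v j) j = g * Tl q is v j"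
  by (induction "is" arbitrary: j) (auto simp: Tq_def algebra_simps)

lemma Lop_pow_eig:
  assumes q: "q \<in> phase_space n m k" and v: "eig f n m k q v" and j: "j \<le> int n"
  shows "f dvd (Lop m k q ^^ a) v j - Y ^ a * v j"
  using j
proof (induction a arbitrary: j)
  case (Suc a)
  have "f dvd Tl q [1..int m] (shift (int k) ((Lop m k q ^^ a) v)) j
      - Tl q [1..int m] (shift (int k) (\<lambda>j. Y ^ a * v j)) j"
    by (rule Tl_cong) (use Suc in \<open>auto simp: shift_def\<close>)
  moreover have "shift (int k) (\<lambda>j. Y ^ a * v j) = (\<lambda>j. Y ^ a * shift (int k) v j)"
    by (simp add: shift_def)
  ultimately have 1: "f dvd Lop m k q ((Lop m k q ^^ a) v) j - Y ^ a * Lop m k q v j"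
    by (simp add: Lop_def Tl_scale)
  have "f dvd Y ^ a * (Lop m k q v j - Y * v j)" using v Suc.prems by (simp add: eig_def)
  from dvd_add[OF 1 this] show ?case by (simp add: algebra_simps)
qed simp

lemma qper_pow: assumes "qper n v" "j \<le> int n" shows "v (j - int n * int t) = X ^ t * v j"
proof (induction t)
  case (Suc t)
  have "0 \<le> int n * int t" by simp
  then have "j - int n * int t \<le> int n" using assms(2) by linarith
  then have "v (j - int n * int t - int n) = X * v (j - int n * int t)" using qper_D[OF assms(1)] by simp
  then show ?case using Suc by (simp add: algebra_simps)
qed simp

text \<open>
  With a trivial bound on the indices these spans contain every multiple of \<open>v_n\<close>.
\<close>

lemma multiples_Sp:
  assumes q: "q \<in> phase_space n m k" and v: "eig f n m k q v"
  shows "\<exists>w. g * v (int n) \<in> Sp f v {w..int n}"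
proof -
  have qv: "qper n v" using v by (simp add: eig_def)
  have mono: "h \<in> Sp f v {w'..int n}" if "h \<in> Sp f v {w..int n}" "w' \<le> w" for h w w'
    by (rule Sp_mono[OF that(1)]) (use that(2) in auto)
  have XY: "\<exists>w'. X * h \<in> Sp f v {w'..int n} \<and> Y * h \<in> Sp f v {w'..int n}"
    if "h \<in> Sp f v {w..int n}" for h w
  proof -
    \<comment> \<open>Multiplication by x lowers indices by n; multiplication by y acts as L and
      lowers them by at most m + k.\<close>
    define w' where "w' = min (w - int n) (w - int (m + k))"
    have "X * h \<in> Sp f v {w'..int n} \<and> Y * h \<in> Sp f v {w'..int n}"
      using that
    proof (induction rule: Sp_induct)
      case (base j)
      have "X * v j = v (j - int n)" using qper_D[OF qv, of j] base by simp
      then have "X * v j \<in> Sp f v {w'..int n}" using base by (auto intro!: Sp_base simp: w'_def)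
      moreover have "Lop m k q v j \<in> Sp f v {w'..int n}"
        by (rule Sp_mono[OF upper_Sp[OF upper_Lop]]) (use base k1 in \<open>auto simp: w'_def\<close>)
      then have "Y * v j \<in> Sp f v {w'..int n}"
        using v base by (elim Sp_cong) (auto simp: eig_def dvd_diff_sym)
      ultimately show ?case ..
    next
      case (add g h)
      then show ?case by (auto simp: distrib_left intro: Sp_add)
    next
      case (scale c g)
      then show ?case using Sp_scale[of "X * g" f v _ c] Sp_scale[of "Y * g" f v _ c]
        by (simp add: mult.left_commute)
    qed (auto intro: Sp_dvd)
    then show ?thesis by metis
  qed
  have "\<exists>w'. g * h \<in> Sp f v {w'..int n}" if "h \<in> Sp f v {w..int n}" for h w
    using that
  proof (induction g arbitrary: h w rule: poly2_induct)
    case (const c)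
    then show ?case using Sp_scale by metis
  next
    case X
    then show ?case using XY by metis
  next
    case Y
    then show ?case using XY by metis
  next
    case (add g1 g2)
    obtain w1 w2 where "g1 * h \<in> Sp f v {w1..int n}" "g2 * h \<in> Sp f v {w2..int n}"
      using add by metis
    then have "g1 * h \<in> Sp f v {min w1 w2..int n}" "g2 * h \<in> Sp f v {min w1 w2..int n}"
      by (auto intro: mono)
    then show ?case by (metis distrib_right Sp_add)
  next
    case (mult g1 g2)
    then show ?case by (metis mult.assoc)
  qed
  moreover have "v (int n) \<in> Sp f v {int n..int n}" by (rule Sp_base) simp
  ultimately show ?thesis by metis
qed

text \<open>For weights proportional to j, X and Y act as shifts by n and m + k in the leading
  order. So does z = Y^(n/M) - X^b, by n b - 1, because \<open>csum\<close> never vanishes. Hence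
  every index attains the minimum, and the orders of the v_j form an arithmetic progression with a
  step e. Then e divides every order, so e = 1.\<close>

lemma P_orders:
  assumes q: "q \<in> phase_space n m k" and v: "eig f n m k q v" and C: "\<And>j. csum n m k q j \<noteq> 0"
  shows "veq f (P_point f) X (- int n)" "veq f (P_point f) Y (- int (m + k))"
proof -
  define p where "p = P_point f"
  interpret place f p using P_place placeI p_def by simp
  have qv: "qper n v" using v by (simp add: eig_def)
  have n0: "n > 0" using n2 by simp
  \<comment> \<open>A place without a pole of x would lie over an affine point.\<close>
  have "\<not> vge f p X 0"
    using lies_over_exists[OF _ deg_pos lc] P_inf unfolding at_infinity_def p_def by auto
  then have pX: "p X < 0" by (simp add: vge_def)
  define x where "x = - p X"
  have x: "x > 0" using pX by (simp add: x_def)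
  have Xp: "veq f p X (- x)" using not_dvd_X by (simp add: veq_def x_def)
  \<comment> \<open>The expected slope of ord v_j in j is the pole order of X divided by n; scaling
    orders by n keeps the weights integral.\<close>
  define pn where "pn = (\<lambda>g. int n * p g)"
  interpret pn: val f pn unfolding pn_def by (rule val_scaled)
  have sc: "veq f pn g (int n * c) \<longleftrightarrow> veq f p g c" for g c
    using n0 by (simp add: veq_def pn_def)
  have X: "veq f pn X (- (int n * x))" using sc[of X "- x"] Xp by simp
  define b where "b j = x * j" for j
  have b: "b (j - int n) = b j + - (int n * x)" for j by (simp add: b_def algebra_simps)
  have bs: "b (j - s) = b j - x * s" for j s by (simp add: b_def algebra_simps)
  obtain \<mu> where W: "WM f n pn b v \<mu>"
    using pn.WM_exists[where b = b, OF qv n0 X b] v unfolding eig_def by metis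
  have tail: "vge f pn r (b i + \<mu> + 1)" if "r \<in> Sp f v {i + 1..l}" "l \<le> int n" for r i l
  proof (rule pn.vge_Sp[OF that(1)])
    fix j assume j: "j \<in> {i + 1..l}"
    have "x * (i + 1) \<le> x * j" using j x by (intro mult_left_mono) auto
    then have "b i + 1 \<le> b j" using x by (simp add: b_def algebra_simps)
    then show "vge f pn (v j) (b i + \<mu> + 1)"
      using pn.WM_vge[OF W, of j] j that(2) by (auto elim: pn.vge_mono)
  qed
  note mo = pn.multiplier_order[where b = b, OF n0 qv X b W]
  define s where "s = int (m + k)"
  have Lv: "f dvd Lop m k q v j - Y * v j" if "j \<le> int n" for j using v that by (simp add: eig_def)
  have gY: "vge f pn (Y * v j - const2 1 * v (j - s)) (b (j - s) + \<mu> + 1)" if j: "j \<le> int n" for j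
  proof -
    have "Lop m k q v j - v (j - s) \<in> Sp f v {j - s + 1..j - s + int m}"
      unfolding s_def by (rule upper_Sp_next[OF upper_Lop])
    then have "vge f pn (Lop m k q v j - v (j - s)) (b (j - s) + \<mu> + 1)"
      by (rule tail) (use j k1 in \<open>simp add: s_def\<close>)
    moreover have "f dvd (Y * v j - const2 1 * v (j - s)) - (Lop m k q v j - v (j - s))"
      using Lv[OF j] by (simp add: dvd_diff_sym[of f "Y * v j"])
    ultimately show ?thesis using pn.vge_cong_imp by blast
  qed
  have "veq f pn Y (- (x * s))"
    by (rule mo(1)[of s "x * s" Y "\<lambda>_. 1"]) (use gY in \<open>simp_all add: bs s_def\<close>)
  then have Yn: "int n * p Y = - (x * s)" by (simp add: veq_def pn_def)
  define a where "a = n div gcd n (m + k)"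
  define bb where "bb = (m + k) div gcd n (m + k)"
  note g = gcd_data[OF n2 k1 refl, of m, folded a_def bb_def]
  have ab: "int (a * (m + k)) = int n * int bb" using g(2) by simp
  have bb1: "bb \<ge> 1" using g(3) .
  have nb: "int n * int bb \<ge> int n"
  proof -
    have "int n * 1 \<le> int n * int bb" using bb1 by (intro mult_left_mono) auto
    then show ?thesis by simp
  qed
  \<comment> \<open>X^b v_j = v_(j-nb) cancels the longest shift of L^(n/M) and exposes the term
    with \<open>csum\<close>.\<close>
  define z where "z = Y ^ a - X ^ bb"
  define t where "t = int n * int bb - 1"
  have t0: "t \<ge> 0" using nb n2 by (simp add: t_def)
  have gz: "vge f pn (z * v j - const2 (csum n m k q j) * v (j - t)) (b (j - t) + \<mu> + 1)"
    if j: "j \<le> int n" for j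
  proof -
    have idx: "j - int n * int bb + 1 = j - t" "j - int n * int bb + 2 = j - t + 1" by (simp_all add: t_def)
    have "(Lop m k q ^^ a) v j - v (j - int n * int bb) - const2 (csum n m k q j) * v (j - t)
        \<in> Sp f v {j - t + 1..j - int n * int bb + int (a * m)}"
      using upperD(3)[OF upper_Lop_pow, of a m k q v j f] unfolding csum_def a_def[symmetric] ab idx .
    moreover have "j - int n * int bb + int (a * m) \<le> int n"
    proof -
      have "int (a * m) \<le> int (a * (m + k))" by (intro of_nat_mono mult_le_mono2) simp
      then show ?thesis using j unfolding ab by simp
    qed
    ultimately have "vge f pn ((Lop m k q ^^ a) v j - v (j - int n * int bb)
        - const2 (csum n m k q j) * v (j - t)) (b (j - t) + \<mu> + 1)" by (rule tail)
    moreover have "v (j - int n * int bb) = X ^ bb * v j" by (rule qper_pow[OF qv j])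
    moreover have "f dvd (z * v j - const2 (csum n m k q j) * v (j - t))
        - ((Lop m k q ^^ a) v j - X ^ bb * v j - const2 (csum n m k q j) * v (j - t))"
      using Lop_pow_eig[OF q v j, of a] dvd_diff_sym[of f "Y ^ a * v j" "(Lop m k q ^^ a) v j"]
      by (simp add: z_def algebra_simps)
    ultimately show ?thesis using pn.vge_cong_imp by metis
  qed
  have "veq f pn z (- (x * t))"
    by (rule mo(1)[of t "x * t" z "csum n m k q"]) (use gz C t0 in \<open>simp_all add: bs\<close>)
  then have zn: "int n * p z = - (x * t)" by (simp add: veq_def pn_def)
  define E where "E j \<longleftrightarrow> veq f pn (v j) (b j + \<mu>)" for j
  have Et: "E (j - t) \<longleftrightarrow> E j" if "j \<le> int n" for j
    unfolding E_def by (rule mo(2)[of t "x * t" z "csum n m k q"]) (use gz C t0 that in \<open>simp_all add: bs\<close>)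
  have En: "E (j - int n) \<longleftrightarrow> E j" if "j \<le> int n" for j
    unfolding E_def
  proof (rule mo(2)[of "int n" "x * int n" X "\<lambda>_. 1"])
    show "vge f pn (X * v j - const2 1 * v (j - int n)) (b (j - int n) + \<mu> + 1)" if "j \<le> int n" for j
      using qper_D[OF qv that] by simp
  qed (use that in \<open>simp_all add: bs\<close>)
  have Enr: "E (j - int n * int r) \<longleftrightarrow> E j" if "j \<le> int n" for j r
  proof (induction r)
    case (Suc r)
    have "0 \<le> int n * int r" by simp
    then have "j - int n * int r \<le> int n" using that by linarith
    then show ?case using En[of "j - int n * int r"] Suc by (simp add: algebra_simps)
  qed simp
  \<comment> \<open>The shifts by n b and by t = n b - 1 combine to a step of 1.\<close>
  have E1: "E (i - 1)" if "i \<le> int n" "E i" for i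
  proof -
    have "E (i - int n * int bb)" using Enr[of i bb] that by simp
    moreover have "i - int n * int bb = i - 1 - t" by (simp add: t_def)
    ultimately show ?thesis using Et[of "i - 1"] that by simp
  qed
  obtain i where i: "i \<le> int n" "E i" using W unfolding WM_def E_def by metis
  have Edown: "E (i - int r)" for r
  proof (induction r)
    case (Suc r)
    then show ?case using E1[of "i - int r"] i by (simp add: algebra_simps)
  qed (use i in simp)
  have all: "veq f pn (v j) (b j + \<mu>)" if "j \<le> int n" for j
  proof -
    define r where "r = nat \<bar>j - i\<bar>"
    have "\<bar>j - i\<bar> * 1 \<le> \<bar>j - i\<bar> * int n" using n0 by (intro mult_left_mono) auto
    then have "j - int n * int r \<le> i" by (simp add: r_def mult.commute)
    then have "E (j - int n * int r)"
      using Edown[of "nat (i - (j - int n * int r))"] by simp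
    then show ?thesis using Enr[OF that] by (simp add: E_def)
  qed
  \<comment> \<open>Chosen so that n p(z) = -x (n b - 1) becomes x = n e: the pole order of X is a
    multiple of n.\<close>
  define e where "e = p z + x * int bb"
  have xe: "x = int n * e"
    using zn by (simp add: e_def t_def algebra_simps)
  then have e: "e > 0" using x n0 by (simp add: zero_less_mult_iff)
  have pv: "veq f p (v j) (p (v (int n)) - e * (int n - j))" if "j \<le> int n" for j
  proof -
    have nd: "\<not> f dvd v j" and "int n * p (v j) = x * j + \<mu>" "int n * p (v (int n)) = x * int n + \<mu>"
      using all[OF that] all[of "int n"] by (auto simp: veq_def pn_def b_def)
    then have "int n * p (v j) = int n * (p (v (int n)) - e * (int n - j))"
      by (simp add: xe algebra_simps)
    then show ?thesis using nd n0 by (simp add: veq_def)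
  qed
  \<comment> \<open>The term of lowest index has strictly the smallest order, so ord g and ord v_n
    differ by a multiple of e. The induction is on the length of the index range and discards
    vanishing lowest terms.\<close>
  have div: "e dvd p g - p (v (int n))" if "g \<in> Sp f v {w..int n}" "\<not> f dvd g" for g w
    using that
  proof (induction "nat (int n + 1 - w)" arbitrary: g w)
    case 0
    then have "g \<in> Sp f v {}" by simp
    then have "f dvd g" by (induction rule: Sp_induct) auto
    then show ?case using 0 by simp
  next
    case (Suc r)
    then have w: "w \<le> int n" and "insert w {w + 1..int n} = {w..int n}" by auto
    then obtain c where c: "g - const2 c * v w \<in> Sp f v {w + 1..int n}"
      using Sp_breakdown[of g f v w "{w + 1..int n}"] Suc.prems(1) by metis
    show ?case
    proof (cases "c = 0")
      case True
      then show ?thesis using Suc.hyps(1)[of "w + 1" g] Suc.hyps(2) c Suc.prems(2) by simp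
    next
      case False
      have "vge f p (g - const2 c * v w) (p (v (int n)) - e * (int n - w) + 1)"
      proof (rule vge_Sp[OF c])
        fix j assume j: "j \<in> {w + 1..int n}"
        have "e * (int n - j) \<le> e * (int n - w - 1)" using e j by (intro mult_left_mono) auto
        then show "vge f p (v j) (p (v (int n)) - e * (int n - w) + 1)"
          using pv[of j] j e by (intro veq_imp_vge[OF pv]) (auto simp: algebra_simps)
      qed
      with veq_cmult[OF pv[OF w] False] have "veq f p g (p (v (int n)) - e * (int n - w))"
        using veq_add[of "const2 c * v w" _ "g - const2 c * v w"] by simp
      then show ?thesis by (simp add: veq_def)
    qed
  qed
  have vn: "\<not> f dvd v (int n)" by (rule eig_last[OF q v])
  have dvd: "e dvd p g" if "\<not> f dvd g" for g
  proof -
    obtain w where w: "g * v (int n) \<in> Sp f v {w..int n}" using multiples_Sp[OF q v] by metis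
    have "\<not> f dvd g * v (int n)" using that vn by (simp add: dvd_mult_iff)
    from div[OF w this] show ?thesis using p_mult[OF that vn] by simp
  qed
  obtain g h where gh: "\<not> f dvd g" "\<not> f dvd h" "p g - p h = 1" by (rule p_uniformizer)
  then have "e dvd 1" using dvd[OF gh(1)] dvd[OF gh(2)] dvd_diff by metis
  then have "e = 1" using e by simp
  then have "x = int n" using xe by simp
  then show "veq f (P_point f) X (- int n)" using Xp by (simp add: p_def)
  have "int n * p Y = int n * (- s)" using Yn \<open>x = int n\<close> by simp
  then have "p Y = - s" using n0 by (metis mult_cancel_left of_nat_eq_0_iff less_irrefl)
  then show "veq f (P_point f) Y (- int (m + k))"
    using not_dvd_Y by (simp add: veq_def s_def flip: p_def)
qed

end

section \<open>The places over the origin\<close>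

text \<open>Coefficient of the shortest shift in L: the diagonal entry of every Q_i is taken, and
  only P^k moves the index.\<close>

definition dprod :: "nat \<Rightarrow> point \<Rightarrow> int \<Rightarrow> complex" where
  "dprod m q j = (\<Prod>i=1..m. q (int i) j)"

text \<open>Counterpart of the expansion by longest shifts: over the origin the weighted bound on
  ord v_j grows as j decreases, so the term with the fewest shifts leads.\<close>

lemma lower_Tl: "Tl q is v j - const2 (\<Prod>i\<leftarrow>is. q i j) * v j \<in> Sp f v {..<j}"
proof (induction "is" arbitrary: j)
  case (Cons i "is")
  define w where "w = Tl q is v"
  have 1: "w j - const2 (\<Prod>i\<leftarrow>is. q i j) * v j \<in> Sp f v {..<j}" unfolding w_def by (rule Cons.IH)
  have "w (j - 1) - const2 (\<Prod>i\<leftarrow>is. q i (j - 1)) * v (j - 1) \<in> Sp f v {..<j}"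
    unfolding w_def by (rule Sp_mono[OF Cons.IH]) auto
  moreover have "const2 (\<Prod>i\<leftarrow>is. q i (j - 1)) * v (j - 1) \<in> Sp f v {..<j}"
    by (intro Sp_scale Sp_base) simp
  ultimately have "w (j - 1) - const2 (\<Prod>i\<leftarrow>is. q i (j - 1)) * v (j - 1)
    + const2 (\<Prod>i\<leftarrow>is. q i (j - 1)) * v (j - 1) \<in> Sp f v {..<j}" by (rule Sp_add)
  then have "w (j - 1) \<in> Sp f v {..<j}" by simp
  from Sp_add[OF Sp_scale[OF 1, of "q i j"] this] show ?case
    by (simp add: Tq_def w_def algebra_simps)
qed simp

lemma lower_Lop: "Lop m k q v j - const2 (dprod m q j) * v (j - int k) \<in> Sp f v {..<j - int k}"
proof -
  have "Lop m k q v j - const2 (\<Prod>i\<leftarrow>[1..int m]. q i j) * shift (int k) v j \<in> Sp f (shift (int k) v) {..<j}"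
    unfolding Lop_def by (rule lower_Tl)
  then have "Lop m k q v j - const2 (\<Prod>i\<leftarrow>[1..int m]. q i j) * shift (int k) v j \<in> Sp f v {..<j - int k}"
    by (rule Sp_trans) (auto simp: shift_def intro: Sp_base)
  moreover have "(\<Prod>i\<leftarrow>[1..int m]. q i j) = dprod m q j"
  proof -
    have "[1..int m] = map int [1..<Suc m]" by (induction m) (auto simp: upto_rec2)
    moreover have "(\<Prod>i\<leftarrow>map int [1..<Suc m]. q i j) = (\<Prod>i=1..m. q (int i) j)"
      by (induction m) (auto simp: mult.commute)
    ultimately show ?thesis by (simp add: dprod_def)
  qed
  ultimately show ?thesis by (simp add: shift_def)
qed

lemma lower_Lop_pow:
  "(Lop m k q ^^ t) v j - const2 (\<Prod>s<t. dprod m q (j - int (s * k))) * v (j - int (t * k))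
    \<in> Sp f v {..<j - int (t * k)}"
proof (induction t arbitrary: j)
  case (Suc t)
  define w where "w = (Lop m k q ^^ t) v"
  define P where "P j = (\<Prod>s<t. dprod m q (j - int (s * k)))" for j
  have IH: "w j - const2 (P j) * v (j - int (t * k)) \<in> Sp f v {..<j - int (t * k)}" for j
    unfolding w_def P_def by (rule Suc.IH)
  have wi: "w i \<in> Sp f v {..i - int (t * k)}" for i
  proof -
    have "w i - const2 (P i) * v (i - int (t * k)) \<in> Sp f v {..i - int (t * k)}"
      by (rule Sp_mono[OF IH]) auto
    moreover have "const2 (P i) * v (i - int (t * k)) \<in> Sp f v {..i - int (t * k)}"
      by (intro Sp_scale Sp_base) simp
    ultimately have "w i - const2 (P i) * v (i - int (t * k)) + const2 (P i) * v (i - int (t * k))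
      \<in> Sp f v {..i - int (t * k)}" by (rule Sp_add)
    then show ?thesis by simp
  qed
  have idx: "j - int (Suc t * k) = j - int k - int (t * k)" by simp
  have "Lop m k q w j - const2 (dprod m q j) * w (j - int k) \<in> Sp f w {..<j - int k}" by (rule lower_Lop)
  then have 1: "Lop m k q w j - const2 (dprod m q j) * w (j - int k) \<in> Sp f v {..<j - int (Suc t * k)}"
  proof (rule Sp_trans)
    fix i assume "i \<in> {..<j - int k}"
    then show "w i \<in> Sp f v {..<j - int (Suc t * k)}"
      unfolding idx by (intro Sp_mono[OF wi]) auto
  qed
  have 2: "const2 (dprod m q j) * (w (j - int k) - const2 (P (j - int k)) * v (j - int k - int (t * k)))
      \<in> Sp f v {..<j - int (Suc t * k)}"
    unfolding idx by (intro Sp_scale IH)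
  have "(\<Prod>s<Suc t. dprod m q (j - int (s * k))) = dprod m q j * P (j - int k)"
    unfolding P_def by (simp add: prod.lessThan_Suc_shift algebra_simps del: prod.lessThan_Suc)
  then show ?case using Sp_add[OF 1 2] by (simp add: w_def idx algebra_simps)
qed simp

lemma coprime_affine_bij:
  fixes a c :: int
  assumes r: "r > 0" and co: "coprime a (int r)"
  shows "bij_betw (\<lambda>s. nat ((c - int s * a) mod int r)) {..<r} {..<r}"
proof -
  have inj: "inj_on (\<lambda>s. nat ((c - int s * a) mod int r)) {..<r}"
  proof (rule inj_onI)
    fix s s' assume s: "s \<in> {..<r}" "s' \<in> {..<r}"
      "nat ((c - int s * a) mod int r) = nat ((c - int s' * a) mod int r)"
    then have "(c - int s * a) mod int r = (c - int s' * a) mod int r"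
      using r by (simp add: eq_nat_nat_iff)
    then have "int r dvd (c - int s * a) - (c - int s' * a)" by (rule mod_eq_dvd_iff[THEN iffD1])
    then have "int r dvd (int s' - int s) * a" by (simp add: algebra_simps)
    then have d: "int r dvd int s' - int s" using co by (simp add: coprime_dvd_mult_left_iff coprime_commute)
    show "s = s'"
    proof (rule ccontr)
      assume "s \<noteq> s'"
      then have "int r \<le> \<bar>int s' - int s\<bar>" using d by (intro zdvd_imp_le) auto
      then show False using s by auto
    qed
  qed
  moreover have "(\<lambda>s. nat ((c - int s * a) mod int r)) ` {..<r} \<subseteq> {..<r}"
    using r by (auto simp: nat_less_iff)
  ultimately show ?thesis using endo_inj_surj[of "{..<r}"] by (simp add: bij_betw_def)
qed

definition scl :: "nat \<Rightarrow> place \<Rightarrow> place" where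
  "scl r p g = int r * p g"

lemma (in val) val_scl: "val f (scl r p)"
  using val_scaled[of r] by (simp add: scl_def[abs_def])

context spectral_curve
begin

lemma int_nN: "int n = int N * int n'" and int_kN: "int k = int N * int k'"
proof -
  show "int n = int N * int n'" using arg_cong[OF nN, of int] by (simp only: of_nat_mult mult.commute)
  show "int k = int N * int k'" using arg_cong[OF kN, of int] by (simp only: of_nat_mult mult.commute)
qed

lemma n'k: "n' * k = n * k'"
proof -
  have "n' * k = n' * (k' * N)" by (rule arg_cong[OF kN])
  also have "\<dots> = (n' * N) * k'" by (simp only: mult_ac)
  also have "\<dots> = n * k'" by (rule arg_cong[OF nN[symmetric]])
  finally show ?thesis .
qed

lemma coprime_n'_k': "coprime k' n'"
  unfolding n'_def k'_def N_def coprime_commute[of "k div _"]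
  by (rule div_gcd_coprime) (use n2 in simp)

lemma dprod_period: "q \<in> phase_space n m k \<Longrightarrow> dprod m q (j - int n * z) = dprod m q j"
proof -
  assume q: "q \<in> phase_space n m k"
  have "q i (j - int n * z) = q i j" for i
  proof (induction z rule: int_induct[where k = 0])
    case (step1 z)
    then show ?case using phase_space_col'[OF q, of i "j - int n * z"] by (simp add: algebra_simps)
  next
    case (step2 z)
    then show ?case using phase_space_col[OF q, of i "j - int n * z"] by (simp add: algebra_simps)
  qed simp
  then show ?thesis by (simp add: dprod_def)
qed

text \<open>As k' is coprime to n', the indices j - s k with s < n' meet each class modulo n inside
  the class of j modulo N exactly once. So the product depends on r only.\<close>

lemma dprod_sigma:
  assumes q: "q \<in> phase_space n m k" and j: "int N dvd j - int r"
  shows "(\<Prod>s<n'. dprod m q (j - int (s * k))) = sigma n m k q r"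
proof -
  obtain c where c: "j - int r = int N * c" using j by (auto elim: dvdE)
  define G where "G t = dprod m q (int r + int t * int N)" for t :: nat
  have "dprod m q (j - int (s * k)) = G (nat ((c - int s * int k') mod int n'))" for s
  proof -
    define y where "y = (c - int s * int k') div int n'"
    define t where "t = nat ((c - int s * int k') mod int n')"
    have t: "int t = (c - int s * int k') mod int n'" using n'_pos by (simp add: t_def)
    have e: "int n' * y = c - int s * int k' - int t"
      unfolding y_def t using minus_mod_eq_mult_div[of "c - int s * int k'" "int n'"] by simp
    have "int n * y = int N * (int n' * y)" by (simp add: int_nN)
    also have "\<dots> = int N * c - int s * (int k' * int N) - int t * int N"
      unfolding e by (simp add: algebra_simps)
    also have "int k' * int N = int k" by (simp add: int_kN)
    finally have "int n * y = int N * c - int s * int k - int t * int N" .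
    then have "j - int (s * k) = int r + int t * int N - int n * (- y)"
      using c by (simp add: algebra_simps)
    then show ?thesis unfolding G_def t_def[symmetric] using dprod_period[OF q] by metis
  qed
  then have "(\<Prod>s<n'. dprod m q (j - int (s * k))) = (\<Prod>s<n'. G (nat ((c - int s * int k') mod int n')))"
    by simp
  also have "\<dots> = (\<Prod>t<n'. G t)"
    using coprime_affine_bij[OF n'_pos, of "int k'" c] coprime_n'_k'
    by (intro prod.reindex_bij_betw) simp
  also have "\<dots> = sigma n m k q r"
    unfolding sigma_def G_def dprod_def N_def[symmetric] n'_def[symmetric]
    by (subst prod.swap) (simp add: mult.commute)
  finally show ?thesis .
qed

text \<open>X^k' has scaled order n' k, and since scaled orders are multiples of N, a strict
  inequality of orders is the same as a gain of at least 1 after scaling.\<close>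

lemma has_value_iff:
  assumes "p \<in> O_points f"
  shows "has_value_at f p (Y ^ n') (X ^ k') c \<longleftrightarrow>
    vge f (scl N p) (Y ^ n' - const2 c * X ^ k') (int (n' * k) + 1)"
proof -
  interpret place f p using assms by (intro placeI) (simp add: O_points_def)
  have "veq f p (X ^ k') (int k' * int n')" using veq_power[OF O_point_orders(1)[OF assms]] .
  then have X: "\<not> f dvd X ^ k'" "p (X ^ k') = int k' * int n'" by (auto simp: veq_def)
  have "int (n' * k) = int N * (int k' * int n')" by (simp add: int_kN)
  moreover have "int N * a + 1 \<le> int N * b \<longleftrightarrow> a < b" for a b
    using mult_less_cancel_left_pos[of "int N" a b] N_pos by (simp add: add1_zle_eq)
  ultimately have e: "int (n' * k) + 1 \<le> int N * b \<longleftrightarrow> int k' * int n' < b" for b by metis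
  show ?thesis unfolding has_value_at_def vge_def scl_def e X(2) using X(1) by auto
qed

lemma value_unique:
  assumes "p \<in> O_points f" "has_value_at f p (Y ^ n') (X ^ k') c" "has_value_at f p (Y ^ n') (X ^ k') d"
  shows "c = d"
proof (rule ccontr)
  assume ne: "c \<noteq> d"
  interpret place f p using assms by (intro placeI) (simp add: O_points_def)
  interpret pN: val f "scl N p" by (rule val_scl)
  have "veq f p (X ^ k') (int k' * int n')" using veq_power[OF O_point_orders(1)[OF assms(1)]] .
  then have "veq f (scl N p) (X ^ k') (int (n' * k))"
    by (simp add: veq_def scl_def int_kN)
  then have "veq f (scl N p) (const2 (d - c) * X ^ k') (int (n' * k))"
    using ne by (intro pN.veq_cmult) auto
  moreover have "vge f (scl N p) ((Y ^ n' - const2 c * X ^ k') - (Y ^ n' - const2 d * X ^ k')) (int (n' * k) + 1)"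
    using assms(2,3) unfolding has_value_iff[OF assms(1)] by (rule pN.vge_diff)
  moreover have "(Y ^ n' - const2 c * X ^ k') - (Y ^ n' - const2 d * X ^ k') = const2 (d - c) * X ^ k'"
    by (simp add: left_diff_distrib)
  ultimately have "vge f (scl N p) (const2 (d - c) * X ^ k') (int (n' * k) + 1)" by (simp only:)
  then show False
    using pN.veq_not_vge[OF \<open>veq f (scl N p) (const2 (d - c) * X ^ k') (int (n' * k))\<close>, of "int (n' * k) + 1"]
    by simp
qed

lemma residue_class: obtains r where "r \<in> {1..N}" "int N dvd j - int r"
proof -
  define r where "r = nat ((j - 1) mod int N) + 1"
  have "(j - 1) mod int N < int N" using N_pos by simp
  then have "r \<in> {1..N}" using N_pos by (auto simp: r_def nat_less_iff Suc_le_eq)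
  moreover have "int N dvd j - int r"
  proof -
    have "int r = (j - 1) mod int N + 1" using N_pos by (simp add: r_def)
    then have "j - int r = (j - 1) - (j - 1) mod int N" by linarith
    also have "\<dots> = int N * ((j - 1) div int N)" by (rule minus_mod_eq_mult_div)
    finally show ?thesis by (simp only: dvd_triv_left)
  qed
  ultimately show thesis by (rule that)
qed

lemma residue_class_unique:
  "r \<in> {1..N} \<Longrightarrow> s \<in> {1..N} \<Longrightarrow> int N dvd j - int r \<Longrightarrow> int N dvd j - int s \<Longrightarrow> r = s"
proof (rule ccontr)
  assume r: "r \<in> {1..N}" "s \<in> {1..N}" "int N dvd j - int r" "int N dvd j - int s" and ne: "r \<noteq> s"
  have "int N dvd (j - int r) - (j - int s)" by (rule dvd_diff[OF r(3,4)])
  then have "int N \<le> \<bar>(j - int r) - (j - int s)\<bar>" using ne by (intro zdvd_imp_le) auto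
  then show False using r by auto
qed

text \<open>The shortest shift of L^n' is n' k = n k', a whole number of periods, so on the class of
  r its leading part is multiplication by \<sigma>_r x^k'. The factor removes exactly this
  part.\<close>

lemma mult_lower:
  assumes q: "q \<in> phase_space n m k" and v: "eig f n m k q v" and j: "j \<le> int n"
    and r: "int N dvd j - int r"
  shows "(Y ^ n' - const2 (sigma n m k q r) * X ^ k') * v j \<in> Sp f v {..<j - int (n' * k)}"
proof -
  have 1: "(Lop m k q ^^ n') v j - const2 (sigma n m k q r) * v (j - int (n' * k)) \<in> Sp f v {..<j - int (n' * k)}"
    using lower_Lop_pow[of n' m k q v j f] unfolding dprod_sigma[OF q r] .
  have qv: "qper n v" using v by (simp add: eig_def)
  have 2: "v (j - int (n' * k)) = X ^ k' * v j"
    unfolding n'k of_nat_mult by (rule qper_pow[OF qv j])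
  have "f dvd Y ^ n' * v j - (Lop m k q ^^ n') v j"
    using Lop_pow_eig[OF q v j, of n'] by (simp only: dvd_diff_sym[of f "Y ^ n' * v j"])
  moreover have "(Y ^ n' - const2 (sigma n m k q r) * X ^ k') * v j
      - ((Lop m k q ^^ n') v j - const2 (sigma n m k q r) * (X ^ k' * v j)) = Y ^ n' * v j - (Lop m k q ^^ n') v j"
    by (simp add: left_diff_distrib mult.assoc)
  ultimately have "f dvd (Y ^ n' - const2 (sigma n m k q r) * X ^ k') * v j
      - ((Lop m k q ^^ n') v j - const2 (sigma n m k q r) * (X ^ k' * v j))" by (simp only:)
  from Sp_cong[OF 1[unfolded 2] this] show ?thesis .
qed

text \<open>With weights -j for N times the order, x and y act as shifts by n and k in leading
  order, so the attaining indices form classes modulo N = gcd(n, k). An attaining index in class r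
  forces the value \<sigma>_r, because the factor that kills its leading term must have larger
  order; distinct \<sigma>_r leave one class.\<close>

lemma O_position:
  assumes pO: "p \<in> O_points f" and q: "q \<in> phase_space n m k" and v: "eig f n m k q v"
    and nz: "\<And>i j. q i j \<noteq> 0" and inj: "inj_on (sigma n m k q) {1..N}"
  shows "\<exists>s\<in>{1..N}. \<exists>\<mu>. has_value_at f p (Y ^ n') (X ^ k') (sigma n m k q s) \<and>
    (\<forall>j\<le>int n. vge f (scl N p) (v j) (\<mu> - j)) \<and>
    (\<forall>j\<le>int n. veq f (scl N p) (v j) (\<mu> - j) \<longleftrightarrow> int N dvd j - int s)"
proof -
  define pN where "pN = (scl N p)"
  interpret place f p using pO by (intro placeI) (simp add: O_points_def)
  interpret pN: val f pN unfolding pN_def by (rule val_scl)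
  have qv: "qper n v" using v by (simp add: eig_def)
  have n0: "n > 0" using n2 by simp
  have X: "veq f pN X (int n)" and Y: "veq f pN Y (int k)"
  proof -
    have "int N * int n' = int n" "int N * int k' = int k"
      using nN kN by (metis mult.commute of_nat_mult)+
    then show "veq f pN X (int n)" "veq f pN Y (int k)"
      using O_point_orders[OF pO] by (simp_all add: veq_def pN_def scl_def)
  qed
  define b where "b j = - j" for j :: int
  have b: "b (j - int n) = b j + int n" for j by (simp add: b_def)
  have bs: "b (j - s) = b j - (- s)" for j s by (simp add: b_def)
  obtain \<mu> where W: "WM f n pN b v \<mu>"
    using pN.WM_exists[where b = b, OF qv n0 X b] v unfolding eig_def by metis
  note mo = pN.multiplier_order[where b = b, OF n0 qv X b W]
  have tail: "vge f pN r (\<mu> - i + 1)" if "r \<in> Sp f v {..<i}" "i \<le> int n + 1" for r i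
  proof (rule pN.vge_Sp[OF that(1)])
    fix j assume j: "j \<in> {..<i}"
    then have "vge f pN (v j) (b j + \<mu>)" using that(2) by (intro pN.WM_vge[OF W]) simp
    then show "vge f pN (v j) (\<mu> - i + 1)" by (rule pN.vge_mono) (use j in \<open>simp add: b_def\<close>)
  qed
  define E where "E j \<longleftrightarrow> veq f pN (v j) (b j + \<mu>)" for j
  have d0: "dprod m q j \<noteq> 0" for j using nz by (simp add: dprod_def)
  have Ek: "E (j - int k) \<longleftrightarrow> E j" if "j \<le> int n" for j
    unfolding E_def
  proof (rule mo(2)[of "int k" "- int k" Y "dprod m q"])
    fix j assume j: "j \<le> int n"
    have "vge f pN (Lop m k q v j - const2 (dprod m q j) * v (j - int k)) (\<mu> - (j - int k) + 1)"
      by (rule tail[OF lower_Lop]) (use j in simp)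
    moreover have "f dvd (Y * v j - const2 (dprod m q j) * v (j - int k))
        - (Lop m k q v j - const2 (dprod m q j) * v (j - int k))"
      using v j by (simp add: eig_def dvd_diff_sym[of f "Y * v j"])
    ultimately have "vge f pN (Y * v j - const2 (dprod m q j) * v (j - int k)) (\<mu> - (j - int k) + 1)"
      using pN.vge_cong_imp by metis
    then show "vge f pN (Y * v j - const2 (dprod m q j) * v (j - int k)) (b (j - int k) + \<mu> + 1)"
      by (simp add: b_def algebra_simps)
  qed (use that d0 bs in simp_all)
  have En: "E (j - int n) \<longleftrightarrow> E j" if "j \<le> int n" for j
    unfolding E_def
  proof (rule mo(2)[of "int n" "- int n" X "\<lambda>_. 1"])
    show "vge f pN (X * v j - const2 1 * v (j - int n)) (b (j - int n) + \<mu> + 1)" if "j \<le> int n" for j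
      using qper_D[OF qv that] by simp
  qed (use that bs in simp_all)
  have iter: "E (j - int d * int r) \<longleftrightarrow> E j"
    if "j \<le> int n" "\<And>j. j \<le> int n \<Longrightarrow> E (j - int d) \<longleftrightarrow> E j" for j d r
  proof (induction r)
    case (Suc r)
    have "0 \<le> int d * int r" by simp
    then have "j - int d * int r \<le> int n" using that(1) by linarith
    then show ?case using that(2)[of "j - int d * int r"] Suc by (simp add: algebra_simps)
  qed simp
  have Enz: "E (j - int n * z) \<longleftrightarrow> E j" if "j \<le> int n" "j - int n * z \<le> int n" for j z
  proof (cases "z \<ge> 0")
    case True
    then show ?thesis using iter[OF that(1) En, of "nat z"] by simp
  next
    case False
    then show ?thesis using iter[OF that(2) En, of "nat (- z)"] by simp
  qed
  have cls: "E j' \<longleftrightarrow> E j" if jj: "j \<le> int n" "j' \<le> int n" "int N dvd j - j'" for j j'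
  proof -
    obtain w where w: "j - j' = int N * w" using jj(3) by (auto elim: dvdE)
    obtain u y where uy: "u * int n + y * int k = int N"
      using bezout_int[of "int n" "int k"] by (auto simp: N_def)
    \<comment> \<open>Invariance under k is iterated downwards only. Reducing the Bezout coefficient
      modulo n' makes the number of k-steps nonnegative; the difference is a multiple of n' k = n
      k', and n-steps may go either way.\<close>
    define t where "t = nat ((w * y) mod int n')"
    define z where "z = (w * y) div int n'"
    have wy: "w * y = int n' * z + int t" unfolding t_def z_def using n'_pos by simp
    have nk: "int n' * int k = int n * int k'" using n'k by (metis of_nat_mult)
    have "j - j' = w * u * int n + (w * y) * int k" using w by (simp add: algebra_simps flip: uy)
    also have "\<dots> = w * u * int n + (int n' * int k) * z + int t * int k"
      unfolding wy by (simp add: algebra_simps)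
    finally have e: "j' = j - int k * int t - int n * (w * u + int k' * z)"
      unfolding nk by (simp add: algebra_simps)
    have "0 \<le> int k * int t" by simp
    then have "j - int k * int t \<le> int n" using jj(1) by linarith
    then have "E j' \<longleftrightarrow> E (j - int k * int t)" using Enz[of "j - int k * int t"] jj(2) unfolding e by simp
    also have "\<dots> \<longleftrightarrow> E j" using iter[OF jj(1) Ek] .
    finally show ?thesis .
  qed
  have val: "has_value_at f p (Y ^ n') (X ^ k') (sigma n m k q r)"
    if j: "j \<le> int n" "E j" "int N dvd j - int r" for j r
  proof -
    define Z where "Z = Y ^ n' - const2 (sigma n m k q r) * X ^ k'"
    have "vge f pN (Z * v j) (\<mu> - (j - int (n' * k)) + 1)"
      unfolding Z_def
    proof (rule tail[OF mult_lower[OF q v j(1,3)]])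
      have "0 \<le> int (n' * k)" by (rule of_nat_0_le_iff)
      then show "j - int (n' * k) \<le> int n + 1" using j(1) by linarith
    qed
    moreover have "Z * v j = v j * Z" by (rule mult.commute)
    moreover have "\<mu> - (j - int (n' * k)) + 1 = (b j + \<mu>) + (int (n' * k) + 1)"
      unfolding b_def by linarith
    ultimately have "vge f pN (v j * Z) ((b j + \<mu>) + (int (n' * k) + 1))" by (simp only:)
    then have "vge f pN Z (int (n' * k) + 1)"
      by (rule pN.vge_mult_cancel[OF j(2)[unfolded E_def]])
    then have "vge f pN (Y ^ n' - const2 (sigma n m k q r) * X ^ k') (int (n' * k) + 1)"
      unfolding Z_def .
    then show ?thesis unfolding has_value_iff[OF pO] pN_def .
  qed
  obtain j0 where j0: "j0 \<le> int n" "E j0" using W unfolding WM_def E_def by metis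
  obtain s where s: "s \<in> {1..N}" "int N dvd j0 - int s" by (rule residue_class)
  have vs: "has_value_at f p (Y ^ n') (X ^ k') (sigma n m k q s)" using val[OF j0 s(2)] .
  have pos: "E j \<longleftrightarrow> int N dvd j - int s" if j: "j \<le> int n" for j
  proof
    assume Ej: "E j"
    obtain r where r: "r \<in> {1..N}" "int N dvd j - int r" by (rule residue_class)
    have "sigma n m k q r = sigma n m k q s" using value_unique[OF pO val[OF j Ej r(2)] vs] .
    then have "r = s" using inj r(1) s(1) by (auto dest: inj_onD)
    then show "int N dvd j - int s" using r(2) by simp
  next
    assume "int N dvd j - int s"
    then have "int N dvd (j0 - int s) - (j - int s)" using s(2) by (rule dvd_diff[rotated])
    then have "int N dvd j0 - j" by simp
    then show "E j" using cls[OF j0(1) j] j0(2) by simp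
  qed
  have "\<forall>j\<le>int n. vge f pN (v j) (\<mu> - j)" using W by (simp add: WM_def b_def)
  moreover have "\<forall>j\<le>int n. veq f pN (v j) (\<mu> - j) \<longleftrightarrow> int N dvd j - int s"
    using pos by (simp add: E_def b_def)
  ultimately show ?thesis using s(1) vs unfolding pN_def by (intro bexI[of _ s] exI[of _ \<mu>] conjI)
qed

text \<open>
  The valuation of an element of the span of the \<open>v_j\<close> with \<open>j \<le> w\<close> can be read off its leading
  term if \<open>w\<close> lies in the class \<open>s\<close>; otherwise one multiplies by the factor belonging to the class
  of \<open>w\<close>, whose order is known, to get rid of the leading term.
\<close>

lemma O_points_unique:
  assumes pO: "p \<in> O_points f" "p' \<in> O_points f"
    and q: "q \<in> phase_space n m k" and v: "eig f n m k q v"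
    and nz: "\<And>i j. q i j \<noteq> 0" and inj: "inj_on (sigma n m k q) {1..N}" and s: "s \<in> {1..N}"
    and vp: "has_value_at f p (Y ^ n') (X ^ k') (sigma n m k q s)"
    and vp': "has_value_at f p' (Y ^ n') (X ^ k') (sigma n m k q s)"
  shows "p = p'"
proof -
  have data: "\<exists>\<mu>. (\<forall>j\<le>int n. vge f (scl N p) (v j) (\<mu> - j)) \<and>
    (\<forall>j\<le>int n. veq f (scl N p) (v j) (\<mu> - j) \<longleftrightarrow> int N dvd j - int s)"
    if pO: "p \<in> O_points f" and vp: "has_value_at f p (Y ^ n') (X ^ k') (sigma n m k q s)" for p
  proof -
    obtain r \<mu> where r: "r \<in> {1..N}" "has_value_at f p (Y ^ n') (X ^ k') (sigma n m k q r)"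
      and \<mu>: "\<forall>j\<le>int n. vge f (scl N p) (v j) (\<mu> - j)"
        "\<forall>j\<le>int n. veq f (scl N p) (v j) (\<mu> - j) \<longleftrightarrow> int N dvd j - int r"
      using O_position[OF pO q v nz inj] by metis
    have "r = s" using value_unique[OF pO r(2) vp] inj r(1) s by (auto dest: inj_onD)
    then show ?thesis using \<mu> by metis
  qed
  interpret p: place f p using pO by (intro placeI) (simp add: O_points_def)
  interpret p': place f p' using pO by (intro placeI) (simp add: O_points_def)
  define pN where "pN = (scl N p)"
  define pN' where "pN' = (scl N p')"
  interpret pN: val f pN unfolding pN_def by (rule p.val_scl)
  interpret pN': val f pN' unfolding pN'_def by (rule p'.val_scl)
  obtain \<mu> where \<mu>: "\<And>j. j \<le> int n \<Longrightarrow> vge f pN (v j) (\<mu> - j)"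
    "\<And>j. j \<le> int n \<Longrightarrow> veq f pN (v j) (\<mu> - j) \<longleftrightarrow> int N dvd j - int s"
    using data[OF pO(1) vp] unfolding pN_def by metis
  obtain \<mu>' where \<mu>': "\<And>j. j \<le> int n \<Longrightarrow> vge f pN' (v j) (\<mu>' - j)"
    "\<And>j. j \<le> int n \<Longrightarrow> veq f pN' (v j) (\<mu>' - j) \<longleftrightarrow> int N dvd j - int s"
    using data[OF pO(2) vp'] unfolding pN'_def by metis
  have X: "veq f pN (X ^ k') (int (n' * k))" "veq f pN' (X ^ k') (int (n' * k))"
    using p.veq_power[OF O_point_orders(1)[OF pO(1)], of k'] p'.veq_power[OF O_point_orders(1)[OF pO(2)], of k']
    by (simp_all add: veq_def pN_def pN'_def scl_def int_kN)
  \<comment> \<open>For c \<noteq> \<sigma>_s the factor is a nonzero multiple of x^k' plus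
    something of larger order, so its order is known and equal at both places.\<close>
  have B: "veq f pN (Y ^ n' - const2 c * X ^ k') (int (n' * k))"
    "veq f pN' (Y ^ n' - const2 c * X ^ k') (int (n' * k))" if "c \<noteq> sigma n m k q s" for c
  proof -
    have ne: "sigma n m k q s - c \<noteq> 0" using that by simp
    have e: "Y ^ n' - const2 c * X ^ k' = const2 (sigma n m k q s - c) * X ^ k'
        + (Y ^ n' - const2 (sigma n m k q s) * X ^ k')" by (simp add: left_diff_distrib)
    show "veq f pN (Y ^ n' - const2 c * X ^ k') (int (n' * k))" unfolding e
      by (rule pN.veq_add[OF pN.veq_cmult[OF X(1) ne]]) (use vp in \<open>simp only: has_value_iff[OF pO(1)] pN_def\<close>)
    show "veq f pN' (Y ^ n' - const2 c * X ^ k') (int (n' * k))" unfolding e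
      by (rule pN'.veq_add[OF pN'.veq_cmult[OF X(2) ne]]) (use vp' in \<open>simp only: has_value_iff[OF pO(2)] pN'_def\<close>)
  qed
  have low: "vge f pN g (\<mu> - w)" "vge f pN' g (\<mu>' - w)" if "g \<in> Sp f v {..w}" "w \<le> int n" for g w
  proof -
    show "vge f pN g (\<mu> - w)"
    proof (rule pN.vge_Sp[OF that(1)])
      fix j assume j: "j \<in> {..w}"
      then have "vge f pN (v j) (\<mu> - j)" using that(2) by (intro \<mu>(1)) simp
      then show "vge f pN (v j) (\<mu> - w)" by (rule pN.vge_mono) (use j in simp)
    qed
    show "vge f pN' g (\<mu>' - w)"
    proof (rule pN'.vge_Sp[OF that(1)])
      fix j assume j: "j \<in> {..w}"
      then have "vge f pN' (v j) (\<mu>' - j)" using that(2) by (intro \<mu>'(1)) simp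
      then show "vge f pN' (v j) (\<mu>' - w)" by (rule pN'.vge_mono) (use j in simp)
    qed
  qed
  \<comment> \<open>Induction on the excess of ord g over the bound given by the highest index w.
    This excess is nonnegative, and each case either settles both orders or lowers it by at least
    1.\<close>
  have main: "pN g - \<mu> = pN' g - \<mu>'" if "g \<in> Sp f v {..w}" "w \<le> int n" "\<not> f dvd g" for g w
    using that
  proof (induction "nat (pN g - \<mu> + w)" arbitrary: g w rule: less_induct)
    case less
    have "insert w {..w - 1} = {..w}" by auto
    then obtain c where c: "g - const2 c * v w \<in> Sp f v {..w - 1}"
      using Sp_breakdown[of g f v w "{..w - 1}"] less.prems(1) by metis
    have ge: "pN g - \<mu> + w \<ge> 0" using low(1)[OF less.prems(1,2)] less.prems(3) by (simp add: vge_def)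
    consider "c = 0" | "c \<noteq> 0" "int N dvd w - int s" | "c \<noteq> 0" "\<not> int N dvd w - int s" by metis
    then show ?case
    proof cases
      case 1
      then have g: "g \<in> Sp f v {..w - 1}" using c by simp
      have "pN g - \<mu> + (w - 1) \<ge> 0"
        using low(1)[OF g] less.prems(2,3) by (simp add: vge_def)
      then show ?thesis using less.hyps[of g "w - 1"] g less.prems(2,3) by simp
    next
      case 2
      have "vge f pN (g - const2 c * v w) (\<mu> - w + 1)" "vge f pN' (g - const2 c * v w) (\<mu>' - w + 1)"
        using low[OF c] less.prems(2) by (simp_all add: algebra_simps)
      moreover have "veq f pN (const2 c * v w) (\<mu> - w)" "veq f pN' (const2 c * v w) (\<mu>' - w)"
        using \<mu>(2)[OF less.prems(2)] \<mu>'(2)[OF less.prems(2)] 2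
        by (auto intro: pN.veq_cmult pN'.veq_cmult)
      ultimately have "veq f pN (const2 c * v w + (g - const2 c * v w)) (\<mu> - w)"
        "veq f pN' (const2 c * v w + (g - const2 c * v w)) (\<mu>' - w)"
        by - (rule pN.veq_add pN'.veq_add; assumption)+
      then show ?thesis by (simp add: veq_def)
    next
      case 3
      obtain r where r: "r \<in> {1..N}" "int N dvd w - int r" by (rule residue_class)
      have "r \<noteq> s" using 3 r by auto
      then have ne: "sigma n m k q r \<noteq> sigma n m k q s" using inj r(1) s by (auto dest: inj_onD)
      define Z where "Z = Y ^ n' - const2 (sigma n m k q r) * X ^ k'"
      note ZB = B[OF ne, folded Z_def]
      define w' where "w' = w - int (n' * k) - 1"
      have Zj: "Z * v j \<in> Sp f v {..w'}" if j: "j \<le> w - 1" for j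
      proof -
        obtain t where t: "t \<in> {1..N}" "int N dvd j - int t" by (rule residue_class)
        have jn: "j \<le> int n" using j less.prems(2) by simp
        have "(Y ^ n' - const2 (sigma n m k q t) * X ^ k') * v j \<in> Sp f v {..w'}"
          by (rule Sp_mono[OF mult_lower[OF q v jn t(2)]]) (use j in \<open>auto simp: w'_def\<close>)
        moreover have "qper n v" using v by (simp add: eig_def)
        then have "X ^ k' * v j = v (j - int (n' * k))"
          unfolding n'k of_nat_mult using qper_pow[of v j k'] jn by simp
        then have "X ^ k' * v j \<in> Sp f v {..w'}" using j by (auto intro!: Sp_base simp: w'_def)
        then have "const2 (sigma n m k q t - sigma n m k q r) * (X ^ k' * v j) \<in> Sp f v {..w'}"
          by (rule Sp_scale)
        ultimately have "(Y ^ n' - const2 (sigma n m k q t) * X ^ k') * v j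
          + const2 (sigma n m k q t - sigma n m k q r) * (X ^ k' * v j) \<in> Sp f v {..w'}" by (rule Sp_add)
        moreover have "(Y ^ n' - const2 (sigma n m k q t) * X ^ k') * v j
          + const2 (sigma n m k q t - sigma n m k q r) * (X ^ k' * v j) = Z * v j"
          by (simp add: Z_def algebra_simps)
        ultimately show ?thesis by simp
      qed
      have "Z * (g - const2 c * v w) \<in> Sp f v {..w'}" using c
      proof (induction rule: Sp_induct)
        case (scale a h)
        then show ?case using Sp_scale[of "Z * h" f v _ a] by (simp add: mult.left_commute)
      qed (auto intro: Sp_dvd Zj Sp_add simp: distrib_left)
      moreover have "Z * v w \<in> Sp f v {..w'}"
        by (rule Sp_mono[OF mult_lower[OF q v less.prems(2) r(2), folded Z_def]]) (auto simp: w'_def)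
      then have "const2 c * (Z * v w) \<in> Sp f v {..w'}" by (rule Sp_scale)
      ultimately have "Z * (g - const2 c * v w) + const2 c * (Z * v w) \<in> Sp f v {..w'}" by (rule Sp_add)
      then have Zg: "Z * g \<in> Sp f v {..w'}" by (simp add: algebra_simps)
      have Z0: "\<not> f dvd Z" "pN Z = int (n' * k)" "pN' Z = int (n' * k)"
        using ZB by (auto simp: veq_def)
      have Zgn: "\<not> f dvd Z * g" using Z0(1) less.prems(3) by (simp add: p.dvd_mult_iff)
      have ps: "pN (Z * g) = int (n' * k) + pN g" "pN' (Z * g) = int (n' * k) + pN' g"
        using pN.p_mult[OF Z0(1) less.prems(3)] pN'.p_mult[OF Z0(1) less.prems(3)] Z0 by simp_all
      have "0 \<le> int (n' * k)" by (rule of_nat_0_le_iff)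
      then have w'n: "w' \<le> int n" using less.prems(2) by (simp add: w'_def del: of_nat_mult)
      have "pN (Z * g) - \<mu> + w' = pN g - \<mu> + w - 1" using ps by (simp add: w'_def)
      moreover have "pN (Z * g) - \<mu> + w' \<ge> 0" using low(1)[OF Zg w'n] Zgn by (simp add: vge_def)
      ultimately have "nat (pN (Z * g) - \<mu> + w') < nat (pN g - \<mu> + w)" by simp
      then have "pN (Z * g) - \<mu> = pN' (Z * g) - \<mu>'" using less.hyps[OF _ Zg w'n Zgn] by simp
      then show ?thesis using ps by simp
    qed
  qed
  have vn: "\<not> f dvd v (int n)" by (rule eig_last[OF q v])
  \<comment> \<open>The content is p g = p' g, written with the contribution of v_n on both sides.
    The detour through g v_n is made because multiples of v_n are known to lie in the span.\<close>
  have gv: "p (v (int n)) + p g - (p' (v (int n)) + p' g) = p (v (int n)) - p' (v (int n))" if g: "\<not> f dvd g" for g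
  proof -
    obtain w where "g * v (int n) \<in> Sp f v {w..int n}" using multiples_Sp[OF q v] by metis
    then have "g * v (int n) \<in> Sp f v {..int n}" by (rule Sp_mono) auto
    moreover have "\<not> f dvd g * v (int n)" using g vn by (simp add: p.dvd_mult_iff)
    ultimately have "pN (g * v (int n)) - \<mu> = pN' (g * v (int n)) - \<mu>'" using main by blast
    then have 1: "int N * p g + int N * p (v (int n)) - \<mu> = int N * p' g + int N * p' (v (int n)) - \<mu>'"
      using p.p_mult[OF g vn] p'.p_mult[OF g vn] by (simp add: pN_def pN'_def scl_def distrib_left)
    have "pN (v (int n)) - \<mu> = pN' (v (int n)) - \<mu>'"
      using main[of "v (int n)" "int n"] vn by (simp add: Sp_base)
    then have "int N * p g = int N * p' g" using 1 unfolding pN_def pN'_def scl_def by linarith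
    then show ?thesis using N_pos by simp
  qed
  show "p = p'"
  proof
    fix g
    show "p g = p' g" using gv[of g] p.p_dvd[of g] p'.p_dvd[of g] by (cases "f dvd g") auto
  qed
qed

text \<open>The entry for r depends on \<sigma>_r alone, so a list without repetitions forces
  distinct \<sigma>_r. Each O-point then has some \<sigma>_s as its value, different points have
  different ones, and there are N of both; hence every \<sigma>_r belongs to exactly one O-point and
  the definite descriptions are proper.\<close>

lemma O_list_props:
  assumes q: "q \<in> phase_space n m k" and v: "eig f n m k q v"
    and nz: "\<And>i j. q i j \<noteq> 0" and ord: "O_list n m k f q \<in> orderings (O_points f)"
  shows "length (O_list n m k f q) = N" "inj_on (sigma n m k q) {1..N}"
    "r \<in> {1..N} \<Longrightarrow> O_list n m k f q ! (r - 1) \<in> O_points f \<and>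
      has_value_at f (O_list n m k f q ! (r - 1)) (Y ^ n') (X ^ k') (sigma n m k q r)"
proof -
  define val where "val p c \<longleftrightarrow> has_value_at f p (Y ^ n') (X ^ k') c" for p c
  define P where "P c = (THE p. p \<in> O_points f \<and> val p c)" for c
  define \<sigma> where "\<sigma> = sigma n m k q"
  have ol: "O_list n m k f q = map (\<lambda>r. P (\<sigma> r)) [1..<Suc N]"
    unfolding O_list_def Let_def P_def val_def \<sigma>_def N_def n'_def k'_def by (rule refl)
  show "length (O_list n m k f q) = N" unfolding ol by simp
  have nth: "O_list n m k f q ! (r - 1) = P (\<sigma> r)" if r: "r \<in> {1..N}" for r
  proof -
    have "r - 1 < N" "1 + (r - 1) = r" using r unfolding atLeastAtMost_iff by linarith+
    then have "r - 1 < length [1..<Suc N]" "[1..<Suc N] ! (r - 1) = r" by (simp_all del: upt_Suc)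
    then show ?thesis unfolding ol by (simp only: nth_map)
  qed
  have "distinct (map (\<lambda>r. P (\<sigma> r)) [1..<Suc N])"
    using ord unfolding ol orderings_def mem_Collect_eq by (rule conjunct1)
  then have "inj_on (\<lambda>r. P (\<sigma> r)) (set [1..<Suc N])" by (simp only: distinct_map)
  moreover have "set [1..<Suc N] = {1..N}" by (simp only: set_upt atLeastLessThanSuc_atLeastAtMost)
  ultimately have injP: "inj_on (\<lambda>r. P (\<sigma> r)) {1..N}" by (simp only:)
  have inj: "inj_on \<sigma> {1..N}"
  proof (rule inj_onI)
    fix r s assume rs: "r \<in> {1..N}" "s \<in> {1..N}" "\<sigma> r = \<sigma> s"
    show "r = s" by (rule inj_onD[OF injP _ rs(1,2)]) (simp only: rs(3))
  qed
  then show inj': "inj_on (sigma n m k q) {1..N}" by (simp only: \<sigma>_def)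
  have "\<exists>s. s \<in> {1..N} \<and> val p (\<sigma> s)" if pO: "p \<in> O_points f" for p
  proof -
    note O_position[OF pO q v nz inj', folded \<sigma>_def]
    then show ?thesis unfolding val_def by (elim bexE exE conjE) (rule exI, rule conjI)
  qed
  then obtain pos where pos: "\<And>p. p \<in> O_points f \<Longrightarrow> pos p \<in> {1..N}"
    "\<And>p. p \<in> O_points f \<Longrightarrow> val p (\<sigma> (pos p))"
    by metis
  have uniq: "p = p'" if "p \<in> O_points f" "p' \<in> O_points f" "r \<in> {1..N}" "val p (\<sigma> r)" "val p' (\<sigma> r)" for p p' r
    by (rule O_points_unique[OF that(1,2) q v nz inj' that(3)]) (use that(4,5) in \<open>simp_all only: val_def \<sigma>_def\<close>)
  have "inj_on pos (O_points f)"
  proof (rule inj_onI)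
    fix p p' assume p: "p \<in> O_points f" "p' \<in> O_points f" "pos p = pos p'"
    show "p = p'"
      by (rule uniq[OF p(1,2) pos(1)[OF p(1)] pos(2)[OF p(1)]]) (simp only: p(3) pos(2)[OF p(2)])
  qed
  then have "card (pos ` O_points f) = N" by (simp only: card_image card_O_points)
  moreover have "pos ` O_points f \<subseteq> {1..N}" using pos(1) by (rule image_subsetI)
  ultimately have im: "pos ` O_points f = {1..N}" by (intro card_subset_eq) simp_all
  show "O_list n m k f q ! (r - 1) \<in> O_points f \<and>
      has_value_at f (O_list n m k f q ! (r - 1)) (Y ^ n') (X ^ k') (sigma n m k q r)" if r: "r \<in> {1..N}"
  proof -
    have "r \<in> pos ` O_points f" using r by (simp only: im)
    then obtain p where p: "p \<in> O_points f" "r = pos p" by (elim imageE)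
    have vp: "val p (\<sigma> r)" using pos(2)[OF p(1)] by (simp only: p(2))
    have "P (\<sigma> r) = p"
      unfolding P_def
    proof (rule the_equality)
      show "p \<in> O_points f \<and> val p (\<sigma> r)" using p(1) vp by (rule conjI)
      fix p' assume "p' \<in> O_points f \<and> val p' (\<sigma> r)"
      then show "p' = p" using uniq[OF _ p(1) r _ vp] by simp
    qed
    then show ?thesis using p(1) vp unfolding nth[OF r] val_def \<sigma>_def by simp
  qed
qed

end

section \<open>Reduction of indices in the phase space\<close>

lemma periodic_multiple:
  fixes g :: "int \<Rightarrow> 'a"
  assumes "\<And>j. g (j + d) = g j" shows "g (j + d * z) = g j"
proof (induction z rule: int_induct[where k = 0])
  case (step1 z)
  then show ?case using assms[of "j + d * z"] by (simp add: algebra_simps)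
next
  case (step2 z)
  then show ?case using assms[of "j + d * (z - 1)"] by (simp add: algebra_simps)
qed simp

lemma phase_space_row_multiple:
  assumes q: "q \<in> phase_space n m k" shows "q (i + int m * z) (j + int k * z) = q i j"
proof (induction z rule: int_induct[where k = 0])
  case (step1 z)
  have "q (i + int m * (z + 1)) (j + int k * (z + 1)) = q (i + int m * z + int m) (j + int k * z + int k)"
    by (simp add: distrib_left add.assoc)
  then show ?case using phase_space_row[OF q, of "i + int m * z" "j + int k * z + int k"] step1 by simp
next
  case (step2 z)
  have "q (i + int m * z) (j + int k * z) = q (i + int m * (z - 1) + int m) (j + int k * (z - 1) + int k)"
    by (simp add: right_diff_distrib)
  then show ?case
    using phase_space_row[OF q, of "i + int m * (z - 1)" "j + int k * (z - 1) + int k"] step2 by simp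
qed simp

lemma phase_space_reduce:
  assumes q: "q \<in> phase_space n m k" and "n \<ge> 1" "m \<ge> 1"
  obtains r s where "r \<in> {1..m}" "s \<in> {1..n}" "q i j = q (int r) (int s)"
proof -
  define z where "z = (i - 1) div int m"
  define r where "r = nat ((i - 1) mod int m) + 1"
  have ir: "i = int r + int m * z" using assms(3) by (simp add: r_def z_def)
  define j' where "j' = j - int k * z"
  define s where "s = nat ((j' - 1) mod int n) + 1"
  have js: "j' = int s + int n * ((j' - 1) div int n)" using assms(2) by (simp add: s_def)
  have "q i j = q (int r) j'" using phase_space_row_multiple[OF q, of "int r" z j'] ir by (simp add: j'_def)
  also have "\<dots> = q (int r) (int s)"
    by (subst js) (rule periodic_multiple[where g = "q (int r)", OF phase_space_col[OF q]])
  finally have "q i j = q (int r) (int s)" .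
  moreover have "r \<in> {1..m}" "s \<in> {1..n}" using assms(2,3) by (auto simp: r_def s_def nat_less_iff Suc_le_eq)
  ultimately show thesis using that by metis
qed

section \<open>The geometric R-matrix\<close>

text \<open>The number E_l of the R-map for tuples extended to sequences of period d, which makes
  sense for every integer l.\<close>

definition Ez :: "nat \<Rightarrow> (int \<Rightarrow> complex) \<Rightarrow> (int \<Rightarrow> complex) \<Rightarrow> int \<Rightarrow> complex" where
  "Ez d a b l = (\<Sum>t<d. (\<Prod>s<t. b (l + 1 + int s)) * (\<Prod>s\<in>{t + 1..<d}. a (l + 1 + int s)))"

lemma period_prod:
  fixes a :: "int \<Rightarrow> complex"
  assumes per: "\<And>j. a (j + int d) = a j"
  shows "(\<Prod>s<d. a (l + int s)) = (\<Prod>s<d. a (int s))"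
proof -
  have step: "(\<Prod>s<d. a (l + 1 + int s)) = (\<Prod>s<d. a (l + int s))" for l
  proof (cases d)
    case (Suc d')
    have "(\<Prod>s<Suc d'. a (l + int s)) = a l * (\<Prod>s<d'. a (l + 1 + int s))"
      by (simp add: prod.lessThan_Suc_shift algebra_simps del: prod.lessThan_Suc)
    moreover have "a (l + 1 + int d') = a l" using per[of l] Suc by (simp add: algebra_simps)
    ultimately show ?thesis using Suc by simp
  qed simp
  show ?thesis
  proof (induction l rule: int_induct[where k = 0])
    case (step1 l)
    then show ?case using step[of l] by simp
  next
    case (step2 l)
    then show ?case using step[of "l - 1"] by simp
  qed simp
qed

text \<open>Both products are sums over words of factors b followed by factors a. The mixed words
  cancel and the pure ones remain. That the difference does not depend on l is the conservation law
  behind the exchange relations.\<close>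

lemma Ez_recursion:
  assumes a: "\<And>j. a (j + int d) = a j" and b: "\<And>j. b (j + int d) = b j" and d: "d > 0"
  shows "a l * Ez d a b (l - 1) - b l * Ez d a b l = (\<Prod>s<d. a (int s)) - (\<Prod>s<d. b (int s))"
proof -
  obtain d' where d': "d = Suc d'" using d by (cases d) auto
  define w where "w t = a l * ((\<Prod>s<t. b (l + int s)) * (\<Prod>s\<in>{t + 1..<d}. a (l + int s)))" for t
  have 1: "a l * Ez d a b (l - 1) = (\<Sum>t<d. w t)"
    by (simp add: Ez_def w_def sum_distrib_left)
  have t1: "b l * ((\<Prod>s<t. b (l + 1 + int s)) * (\<Prod>s\<in>{t + 1..<d}. a (l + 1 + int s))) = w (t + 1)"
    if t: "t < d'" for t
  proof -
    have "b l * (\<Prod>s<t. b (l + 1 + int s)) = (\<Prod>s<t + 1. b (l + int s))"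
      by (simp add: prod.lessThan_Suc_shift algebra_simps del: prod.lessThan_Suc)
    moreover have "(\<Prod>s\<in>{t + 1..<d}. a (l + 1 + int s)) = a l * (\<Prod>s\<in>{t + 2..<d}. a (l + int s))"
    proof -
      have "(\<Prod>s\<in>{t + 1..<d}. a (l + 1 + int s)) = (\<Prod>s\<in>{t + 2..<Suc d}. a (l + int s))"
        by (rule prod.reindex_bij_witness[where i = "\<lambda>s. s - 1" and j = Suc]) (auto simp: algebra_simps of_nat_diff)
      also have "\<dots> = (\<Prod>s\<in>{t + 2..<d}. a (l + int s)) * a (l + int d)"
        using t d' by (subst prod.atLeastLessThan_Suc) auto
      finally show ?thesis using a[of l] by (simp add: mult.commute)
    qed
    ultimately show ?thesis by (simp add: w_def mult.left_commute flip: mult.assoc)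
  qed
  have bl: "b l * (\<Prod>s<d'. b (l + 1 + int s)) = (\<Prod>s<d. b (l + int s))"
    unfolding d' by (simp add: prod.lessThan_Suc_shift algebra_simps del: prod.lessThan_Suc)
  have "b l * Ez d a b l = (\<Sum>t<d. b l * ((\<Prod>s<t. b (l + 1 + int s)) * (\<Prod>s\<in>{t + 1..<d}. a (l + 1 + int s))))"
    by (simp add: Ez_def sum_distrib_left)
  also have "\<dots> = (\<Sum>t<d'. b l * ((\<Prod>s<t. b (l + 1 + int s)) * (\<Prod>s\<in>{t + 1..<d}. a (l + 1 + int s))))
      + b l * (\<Prod>s<d'. b (l + 1 + int s))"
    unfolding d' by simp
  also have "\<dots> = (\<Sum>t<d'. w (t + 1)) + (\<Prod>s<d. b (l + int s))"
    unfolding bl by (intro arg_cong2[of _ _ _ _ "(+)"] sum.cong refl t1) simp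
  finally have 2: "b l * Ez d a b l = (\<Sum>t<d'. w (t + 1)) + (\<Prod>s<d. b (l + int s))" .
  have "(\<Sum>t<d. w t) = w 0 + (\<Sum>t<d'. w (t + 1))"
    unfolding d' by (simp add: sum.lessThan_Suc_shift del: sum.lessThan_Suc)
  moreover have "w 0 = (\<Prod>s<d. a (l + int s))"
  proof -
    have "(\<Prod>s\<in>{Suc 0..<Suc d'}. a (l + int s)) = (\<Prod>s\<in>{0..<d'}. a (l + int (Suc s)))"
      by (rule prod.shift_bounds_Suc_ivl)
    moreover have "(\<Prod>s<Suc d'. a (l + int s)) = a (l + int 0) * (\<Prod>s<d'. a (l + int (Suc s)))"
      by (rule prod.lessThan_Suc_shift)
    ultimately show ?thesis by (simp add: w_def d' lessThan_atLeast0 del: prod.op_ivl_Suc of_nat_Suc)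
  qed
  ultimately show ?thesis
    unfolding 1 2 period_prod[of a, OF a] period_prod[of b, OF b, of l, symmetric]
    using period_prod[of a d l, OF a] by simp
qed

lemma E_rot_Ez:
  assumes a: "\<And>j. a (j + int d) = a j" and b: "\<And>j. b (j + int d) = b j"
  shows "E_rot (map (\<lambda>j. a (int j)) [1..<Suc d]) (map (\<lambda>j. b (int j)) [1..<Suc d]) i = Ez d a b (int i)"
proof -
  have rot: "rotate i (map (\<lambda>j. a (int j)) [1..<Suc d]) = map (\<lambda>s. a (int i + 1 + int s)) [0..<d]"
    if a: "\<And>j. a (j + int d) = a j" for a :: "int \<Rightarrow> complex"
  proof (rule nth_equalityI)
    fix s assume "s < length (rotate i (map (\<lambda>j. a (int j)) [1..<Suc d]))"
    then have s: "s < d" by (simp del: upt_Suc)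
    have "rotate i (map (\<lambda>j. a (int j)) [1..<Suc d]) ! s = a (int ((i + s) mod d) + 1)"
      using s by (simp add: nth_rotate add.commute del: upt_Suc)
    also have "int ((i + s) mod d) + 1 = (int i + 1 + int s) + int d * (- (int (i + s) div int d))"
      using minus_mult_div_eq_mod[of "int (i + s)" "int d"] by (simp add: zmod_int)
    also have "a \<dots> = a (int i + 1 + int s)"
    proof -
      have "a (j + int d * z) = a j" for j z
      proof (induction z rule: int_induct[where k = 0])
        case (step1 z)
        then show ?case using a[of "j + int d * z"] by (simp add: algebra_simps)
      next
        case (step2 z)
        then show ?case using a[of "j + int d * (z - 1)"] by (simp add: algebra_simps)
      qed simp
      then show ?thesis .
    qed
    finally show "rotate i (map (\<lambda>j. a (int j)) [1..<Suc d]) ! s = map (\<lambda>s. a (int i + 1 + int s)) [0..<d] ! s"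
      using s by simp
  qed simp
  have tk: "prod_list (take t (map g [0..<d])) = (\<Prod>s<t. g s)" if "t \<le> d" for t and g :: "nat \<Rightarrow> complex"
    using that by (simp add: take_map prod.list_conv_set_nth lessThan_atLeast0 flip: prod.distinct_set_conv_list)
  have dr: "prod_list (drop t (map g [0..<d])) = (\<Prod>s\<in>{t..<d}. g s)" for t and g :: "nat \<Rightarrow> complex"
    by (simp add: drop_map flip: prod.distinct_set_conv_list)
  show ?thesis unfolding E_rot_def rot[of a, OF a] rot[of b, OF b] E_sum_def Ez_def
    by (intro sum.cong) (auto simp: tk dr)
qed

lemma Ez_period:
  assumes "\<And>j. a (j + int d) = a j" "\<And>j. b (j + int d) = b j"
  shows "Ez d a b (l + int d) = Ez d a b l"
proof -
  have "a (l + int d + 1 + int s) = a (l + 1 + int s)" "b (l + int d + 1 + int s) = b (l + 1 + int s)" for s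
    using assms(1)[of "l + 1 + int s"] assms(2)[of "l + 1 + int s"] by (simp_all add: algebra_simps)
  then show ?thesis by (simp add: Ez_def)
qed

lemma Ez_nonzero:
  assumes a: "\<And>j. a (j + int d) = a j" and b: "\<And>j. b (j + int d) = b j" and d: "d > 0"
    and R: "R_defined (map (\<lambda>j. a (int j)) [1..<Suc d]) (map (\<lambda>j. b (int j)) [1..<Suc d])"
  shows "Ez d a b l \<noteq> 0"
proof -
  have nz: "Ez d a b (int i) \<noteq> 0" if "i \<le> d" for i
    using R that unfolding R_defined_def E_rot_Ez[of a d b, OF a b] by simp
  have "Ez d a b (l + int d * z) = Ez d a b l" for z
  proof (induction z rule: int_induct[where k = 0])
    case (step1 z)
    then show ?case using Ez_period[of a d b "l + int d * z", OF a b] by (simp add: algebra_simps)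
  next
    case (step2 z)
    then show ?case using Ez_period[of a d b "l + int d * (z - 1)", OF a b] by (simp add: algebra_simps)
  qed simp
  from this[of "- (l div int d)"] have "Ez d a b l = Ez d a b (l mod int d)"
    by (simp add: minus_mult_div_eq_mod)
  also have "l mod int d = int (nat (l mod int d))" using d by simp
  finally show ?thesis using nz[of "nat (l mod int d)"] d by (simp add: nat_le_iff less_imp_le)
qed

lemma R_map_Ez:
  assumes a: "\<And>j. a (j + int d) = a j" and b: "\<And>j. b (j + int d) = b j"
  shows "R_map (map (\<lambda>j. a (int j)) [1..<Suc d]) (map (\<lambda>j. b (int j)) [1..<Suc d]) =
    (map (\<lambda>j. b (int j) * Ez d a b (int j) / Ez d a b (int j - 1)) [1..<Suc d],
     map (\<lambda>j. a (int j) * Ez d a b (int j - 1) / Ez d a b (int j)) [1..<Suc d])"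
proof -
  have "map (\<lambda>j. c (int j)) [1..<Suc d] ! (i - 1) = c (int i)" if "i \<in> {1..d}" for i and c :: "int \<Rightarrow> complex"
  proof -
    have "i - 1 < d" "1 + (i - 1) = i" using that unfolding atLeastAtMost_iff by linarith+
    then show ?thesis by (simp del: upt_Suc)
  qed
  moreover have "int (i - 1) = int i - 1" if "i \<in> {1..d}" for i using that by (simp add: of_nat_diff)
  ultimately show ?thesis
    unfolding R_map_def E_rot_Ez[of a d b, OF a b] by (auto simp del: upt_Suc)
qed

lemma exchange_eqI:
  assumes R: "R_defined (rw q r) (rw q (r + 1))"
    and p: "p \<in> S" "(rw p r, rw p (r + 1)) = R_map (rw q r) (rw q (r + 1))"
      "\<And>t. t \<in> {1..d} - {r, r + 1} \<Longrightarrow> rw p t = rw q t"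
    and r: "1 \<le> r" "r < d"
    and inj: "\<And>p p'. p \<in> S \<Longrightarrow> p' \<in> S \<Longrightarrow> (\<And>t. t \<in> {1..d} \<Longrightarrow> rw p t = rw p' t) \<Longrightarrow> p = p'"
  shows "exchange S d rw r q = Some p"
proof -
  have "(THE p. p \<in> S \<and> (rw p r, rw p (r + 1)) = R_map (rw q r) (rw q (r + 1))
             \<and> (\<forall>t\<in>{1..d} - {r, r + 1}. rw p t = rw q t)) = p"
  proof (rule the_equality)
    fix p' assume p': "p' \<in> S \<and> (rw p' r, rw p' (r + 1)) = R_map (rw q r) (rw q (r + 1))
             \<and> (\<forall>t\<in>{1..d} - {r, r + 1}. rw p' t = rw q t)"
    show "p' = p"
    proof (rule inj)
      fix t assume t: "t \<in> {1..d}"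
      have "(rw p' r, rw p' (r + 1)) = (rw p r, rw p (r + 1))" using p(2) p' by simp
      then show "rw p' t = rw p t" using p(3)[of t] p' t by (cases "t = r \<or> t = r + 1") auto
    qed (use p p' in auto)
  qed (use p in auto)
  then show ?thesis unfolding exchange_def using R by simp
qed

section \<open>The \<open>A\<close>-points\<close>

context place
begin

text \<open>Unless a is the zero (-1)^n times the row product of det Q_i, the multiplier x - const
  of the cyclic recursion is a unit at p, and Q_i can be inverted there.\<close>

lemma vge_Tq_inv:
  assumes over: "lies_over f p a b" and v: "qper n v" and per: "\<And>j. q i (j - int n) = q i j"
    and ns: "a \<noteq> (-1) ^ n * (\<Prod>j=1..n. q i (int j))"
    and T: "\<And>j. j \<le> int n \<Longrightarrow> vge f p (Tq q i v j) c" and j: "j \<le> int n"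
  shows "vge f p (v j) c"
proof -
  have "veq f p (X - const2 ((-1) ^ n * (\<Prod>j=1..n. q i (int j)))) 0"
    using lies_over_eval_veq[OF over, of "X - const2 ((-1) ^ n * (\<Prod>j=1..n. q i (int j)))"] ns
    by (simp only: eval2_simps right_minus_eq not_False_eq_True)
  moreover have "vge f p ((X - const2 ((-1) ^ n * (\<Prod>j=1..n. q i (int j)))) * v j) (0 + c)"
    unfolding add_0_left by (rule Tq_cyclic[where q = q and i = i, OF v T j per])
  ultimately show ?thesis by (rule vge_mult_cancel)
qed

lemma vge_Tl_inv:
  assumes over: "lies_over f p a b" and q: "q \<in> phase_space n m k" and v: "qper n v"
    and ns: "\<And>i. i \<in> set is \<Longrightarrow> a \<noteq> (-1) ^ n * (\<Prod>j=1..n. q i (int j))"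
    and T: "\<And>j. j \<le> int n \<Longrightarrow> vge f p (Tl q is v j) c" and j: "j \<le> int n"
  shows "vge f p (v j) c"
proof -
  define E where "E i = (-1) ^ n * (\<Prod>j=1..n. q i (int j))" for i
  have step: "\<forall>j\<le>int n. vge f p (w j) c"
    if w: "qper n w" and i: "a \<noteq> E i" and T: "\<forall>j\<le>int n. vge f p (Tq q i w j) c" for w i
  proof (intro allI impI)
    fix j assume j: "j \<le> int n"
    have T': "vge f p (Tq q i w j) c" if "j \<le> int n" for j using T that by metis
    have i': "a \<noteq> (-1) ^ n * (\<Prod>j=1..n. q i (int j))" using i unfolding E_def .
    show "vge f p (w j) c" by (rule vge_Tq_inv[where q = q and i = i, OF over w phase_space_col'[OF q] i' T' j])
  qed
  have "(\<forall>i\<in>set is. a \<noteq> E i) \<longrightarrow> (\<forall>j\<le>int n. vge f p (Tl q is v j) c) \<longrightarrow> (\<forall>j\<le>int n. vge f p (v j) c)"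
  proof (induction "is")
    case (Cons i "is")
    show ?case
    proof (intro impI)
      assume "\<forall>i\<in>set (i # is). a \<noteq> E i" and T: "\<forall>j\<le>int n. vge f p (Tl q (i # is) v j) c"
      then have E: "a \<noteq> E i" "\<forall>i\<in>set is. a \<noteq> E i" by simp_all
      have "\<forall>j\<le>int n. vge f p (Tl q is v j) c"
        by (rule step[OF qper_Tl[OF q v] E(1)]) (use T in \<open>simp only: Tl_simps\<close>)
      then show "\<forall>j\<le>int n. vge f p (v j) c" using Cons.IH E(2) by simp
    qed
  qed simp
  moreover have "\<forall>i\<in>set is. a \<noteq> E i" using ns unfolding E_def by metis
  moreover have "\<forall>j\<le>int n. vge f p (Tl q is v j) c" using T by metis
  ultimately show ?thesis using j by metis
qed

lemma WM_Tl_unit: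
  assumes over: "lies_over f p a b" and q: "q \<in> phase_space n m k" and v: "qper n v"
    and ns: "\<And>i. i \<in> set is \<Longrightarrow> a \<noteq> (-1) ^ n * (\<Prod>j=1..n. q i (int j))"
    and W: "WM f n p (\<lambda>_. 0) v c"
  shows "WM f n p (\<lambda>_. 0) (Tl q is v) c"
proof (rule WM_I)
  show "vge f p (Tl q is v j) (0 + c)" if "j \<le> int n" for j
    by (rule vge_Tl[where b = "\<lambda>_. 0", OF _ WM_vge[OF W] that]) simp_all
  show "\<not> (\<forall>j\<le>int n. vge f p (Tl q is v j) (0 + (c + 1)))"
  proof
    assume T: "\<forall>j\<le>int n. vge f p (Tl q is v j) (0 + (c + 1))"
    have "vge f p (v j) (0 + (c + 1))" if "j \<le> int n" for j
      by (rule vge_Tl_inv[OF over q v ns _ that]) (use T in blast)+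
    then show False using WM_not[OF W, of "c + 1"] by simp
  qed
qed

lemma WM_shift:
  assumes v: "qper n v" and n: "n > 0" and X: "veq f p X e0"
    and b: "\<And>j. j \<le> int n \<Longrightarrow> b (j - int n) = b j + e0" and W: "WM f n p b v c"
    and s: "s \<ge> 0" and bs: "\<And>j. b (j - s) = b j + e"
  shows "WM f n p b (shift s v) (c + e)"
  unfolding WM_def
proof (intro conjI allI impI)
  show "vge f p (shift s v j) (b j + (c + e))" if "j \<le> int n" for j
    using WM_vge[OF W, of "j - s"] that s bs[of j] by (simp add: shift_def add_ac)
  obtain j0 where "j0 \<le> int n - s" "veq f p (v j0) (b j0 + c)"
    using WM_low[where b = b, OF v n X b W] by metis
  then show "\<exists>j\<le>int n. veq f p (shift s v j) (b j + (c + e))"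
    using bs[of "j0 + s"] by (intro exI[of _ "j0 + s"]) (simp add: shift_def add_ac)
qed

end

section \<open>Rows of the array and the A-points\<close>

context spectral_curve
begin

definition eps :: "point \<Rightarrow> int \<Rightarrow> complex" where
  "eps q i = (-1) ^ n * (\<Prod>j=1..n. q i (int j))"

lemma eps_epsilon: "eps q (int r) = (-1) ^ n * epsilon n q r"
  by (simp add: eps_def epsilon_def)

lemma n_pos: "n > 0" using n2 by simp

lemma A_point_X: "place f p \<Longrightarrow> lies_over f p a b \<Longrightarrow> a \<noteq> 0 \<Longrightarrow> veq f p X 0"
  using place.lies_over_eval_veq[of f p a b X] by simp

text \<open>Otherwise every Q_i would be invertible at p, and so would P since x \<noteq> 0. Then L
  would preserve minimal orders, while its eigenvalue y vanishes at p.\<close>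

lemma A_point_eps:
  assumes q: "q \<in> phase_space n m k" and v: "eig f n m k q v"
    and p: "p \<in> places f" and over: "lies_over f p a 0" and a: "a \<noteq> 0"
  shows "\<exists>r\<in>{1..m}. a = eps q (int r)"
proof (rule ccontr)
  assume no: "\<not> ?thesis"
  interpret place f p using p by (rule placeI)
  have qv: "qper n v" using v by (simp add: eig_def)
  note X = A_point_X[OF place_axioms over a]
  obtain c where W: "WM f n p (\<lambda>_. 0) v c"
    using WM_exists[where b = "\<lambda>_. 0", OF qv n_pos X] v unfolding eig_def by auto
  have "WM f n p (\<lambda>_. 0) (shift (int k) v) (c + 0)"
    by (rule WM_shift[where b = "\<lambda>_. 0", OF qv n_pos X _ W]) simp_all
  moreover have "a \<noteq> (-1) ^ n * (\<Prod>j=1..n. q i (int j))" if "i \<in> set [1..int m]" for i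
  proof -
    have "nat i \<in> {1..m}" "int (nat i) = i" using that by auto
    then show ?thesis using no unfolding eps_def by metis
  qed
  ultimately have W': "WM f n p (\<lambda>_. 0) (Lop m k q v) c"
    unfolding Lop_def by (intro WM_Tl_unit[OF over q qper_shift[OF qv]]) simp_all
  have Y: "vge f p Y 1" using over by (simp add: lies_over_def vanishes_at_vge)
  have "vge f p (Lop m k q v j) (0 + (c + 1))" if "j \<le> int n" for j
  proof -
    have "vge f p (Y * v j) (1 + c)" using WM_vge[OF W that] by (intro vge_mult[OF Y]) simp
    moreover have "f dvd Lop m k q v j - Y * v j" using v that by (simp add: eig_def)
    ultimately show ?thesis using vge_cong by (simp add: add.commute)
  qed
  then show False using WM_not[OF W', of "c + 1"] by simp
qed

text \<open>The m distinct values that \<open>V_cal\<close> provides all occur among the m row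
  values \<open>eps\<close>, so by counting the two families agree up to a permutation.\<close>

lemma A_points_eps_bij:
  assumes q: "q \<in> phase_space n m k" and v: "eig f n m k q v"
  shows "inj_on (\<lambda>r. eps q (int r)) {1..m}"
    and "r \<in> {1..m} \<Longrightarrow> eps q (int r) \<noteq> 0 \<and> (\<exists>p\<in>places f. lies_over f p (eps q (int r)) 0)"
proof -
  obtain E where E: "inj_on E {1..m}" "\<And>r. r \<in> {1..m} \<Longrightarrow> E r \<noteq> 0"
    "\<And>r. r \<in> {1..m} \<Longrightarrow> \<exists>p\<in>places f. lies_over f p ((-1) ^ n * E r) 0"
    using A_points_eps by metis
  have "\<exists>s\<in>{1..m}. (-1) ^ n * E r = eps q (int s)" if r: "r \<in> {1..m}" for r
  proof -
    obtain p where "p \<in> places f" "lies_over f p ((-1) ^ n * E r) 0" using E(3)[OF r] by metis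
    then show ?thesis using A_point_eps[OF q v] E(2)[OF r] by simp
  qed
  then obtain h where h: "\<And>r. r \<in> {1..m} \<Longrightarrow> h r \<in> {1..m} \<and> (-1) ^ n * E r = eps q (int (h r))"
    by metis
  have "inj_on h {1..m}"
  proof (rule inj_onI)
    fix r s assume rs: "r \<in> {1..m}" "s \<in> {1..m}" "h r = h s"
    then have "(-1) ^ n * E r = (-1) ^ n * E s" using h[OF rs(1)] h[OF rs(2)] by simp
    then have "E r = E s" by simp
    then show "r = s" using E(1) rs by (auto dest: inj_onD)
  qed
  then have im: "h ` {1..m} = {1..m}" using h by (intro endo_inj_surj) auto
  show "inj_on (\<lambda>r. eps q (int r)) {1..m}"
  proof (rule inj_onI)
    fix r s assume rs: "r \<in> {1..m}" "s \<in> {1..m}" "eps q (int r) = eps q (int s)"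
    obtain r' s' where r': "r' \<in> {1..m}" "r = h r'" "s' \<in> {1..m}" "s = h s'"
      using rs(1,2) im by (metis imageE)
    then have "(-1) ^ n * E r' = (-1) ^ n * E s'" using h rs(3) by metis
    then have "E r' = E s'" by simp
    then have "r' = s'" using E(1) r' by (auto dest: inj_onD)
    then show "r = s" using r' by simp
  qed
  assume "r \<in> {1..m}"
  then obtain r' where r': "r' \<in> {1..m}" "r = h r'" using im by (metis imageE)
  then have "eps q (int r) = (-1) ^ n * E r'" using h by metis
  then show "eps q (int r) \<noteq> 0 \<and> (\<exists>p\<in>places f. lies_over f p (eps q (int r)) 0)"
    using E(2,3)[OF r'(1)] by simp
qed

text \<open>Every coordinate is a factor of some row product, and row products are, up to sign, the
  nonzero x-coordinates of the A-points.\<close>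

lemma coordinates_nonzero:
  assumes q: "q \<in> phase_space n m k" and v: "eig f n m k q v" shows "q i j \<noteq> 0"
proof -
  obtain r s where rs: "r \<in> {1..m}" "s \<in> {1..n}" "q i j = q (int r) (int s)"
    by (rule phase_space_reduce[OF q _ m1]) (use n2 in auto)
  have "(\<Prod>j=1..n. q (int r) (int j)) \<noteq> 0"
    using A_points_eps_bij(2)[OF q v rs(1)] by (simp add: eps_def)
  then show ?thesis using rs by auto
qed

lemma A_list_nth:
  assumes q: "q \<in> phase_space n m k" and v: "eig f n m k q v" and r: "r \<in> {1..m}"
  shows "A_list n m f q ! (r - 1) \<in> places f" "lies_over f (A_list n m f q ! (r - 1)) (eps q (int r)) 0"
    "p \<in> places f \<Longrightarrow> lies_over f p (eps q (int r)) 0 \<Longrightarrow> p = A_list n m f q ! (r - 1)"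
proof -
  obtain p where p: "p \<in> places f" "lies_over f p (eps q (int r)) 0" and e: "eps q (int r) \<noteq> 0"
    using A_points_eps_bij(2)[OF q v r] by metis
  have u: "p' = p" if "p' \<in> places f" "lies_over f p' (eps q (int r)) 0" for p'
    using smooth_place_unique[OF smooth irr that(1) p(1) that(2) p(2)] e by simp
  have "r - 1 < m" "1 + (r - 1) = r" using r unfolding atLeastAtMost_iff by linarith+
  then have "r - 1 < length [1..<Suc m]" "[1..<Suc m] ! (r - 1) = r" by (simp_all del: upt_Suc)
  then have "A_list n m f q ! (r - 1) = (THE p. p \<in> places f \<and> lies_over f p (eps q (int r)) 0)"
    unfolding A_list_def eps_epsilon by (simp only: nth_map)
  also have "\<dots> = p" by (rule the_equality) (use p u in blast)+
  finally have eq: "A_list n m f q ! (r - 1) = p" .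
  show "A_list n m f q ! (r - 1) \<in> places f" "lies_over f (A_list n m f q ! (r - 1)) (eps q (int r)) 0"
    unfolding eq by (rule p)+
  show "p = A_list n m f q ! (r - 1)" if "p \<in> places f" "lies_over f p (eps q (int r)) 0" for p
    unfolding eq by (rule u[OF that])
qed

lemma upto_split: "1 \<le> r \<Longrightarrow> r \<le> int m \<Longrightarrow> [1..int m] = [1..r - 1] @ r # [r + 1..int m]"
  by (metis upto_split3)

text \<open>By smoothness x - a or y has order 1. In the first case exactly one factor Q_r
  degenerates at p and the others preserve minimal orders, so by the cyclic recursion the order of y
  cannot exceed that of x - a.\<close>

lemma A_point_Y:
  assumes q: "q \<in> phase_space n m k" and v: "eig f n m k q v"
    and p: "p \<in> places f" and over: "lies_over f p a 0" and a: "a \<noteq> 0"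
  shows "veq f p Y 1"
proof -
  interpret place f p using p by (rule placeI)
  have qv: "qper n v" using v by (simp add: eig_def)
  note X = A_point_X[OF place_axioms over a]
  have Y1: "vge f p Y 1" using over by (simp add: lies_over_def vanishes_at_vge)
  then have Y: "veq f p Y (p Y)" "p Y \<ge> 1" using not_dvd_Y by (auto simp: veq_def vge_def)
  have "veq f p (X - const2 a) 1 \<or> veq f p (Y - const2 0) 1"
    using smooth_place_parameter[OF smooth irr p over] a by simp
  then show ?thesis
  proof
    assume Xa: "veq f p (X - const2 a) 1"
    obtain c where W: "WM f n p (\<lambda>_. 0) v c"
      using WM_exists[where b = "\<lambda>_. 0", OF qv n_pos X] v unfolding eig_def by auto
    obtain r where r: "r \<in> {1..m}" "a = eps q (int r)" using A_point_eps[OF q v p over a] by metis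
    have ns: "a \<noteq> (-1) ^ n * (\<Prod>j=1..n. q i (int j))" if "i \<in> {1..int m}" "i \<noteq> int r" for i
    proof -
      have "nat i \<in> {1..m}" "int (nat i) = i" using that(1) by auto
      moreover have "nat i \<noteq> r" using that(2) \<open>int (nat i) = i\<close> by auto
      ultimately have "eps q (int (nat i)) \<noteq> eps q (int r)"
        using inj_onD[OF A_points_eps_bij(1)[OF q v], of "nat i" r] r(1) by auto
      then show ?thesis using \<open>int (nat i) = i\<close> r(2) by (simp add: eps_def)
    qed
    define w where "w = Tl q [int r + 1..int m] (shift (int k) v)"
    have "WM f n p (\<lambda>_. 0) (shift (int k) v) (c + 0)"
      by (rule WM_shift[where b = "\<lambda>_. 0", OF qv n_pos X _ W]) simp_all
    then have Ww: "WM f n p (\<lambda>_. 0) w c"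
      unfolding w_def using WM_Tl_unit[OF over q qper_shift[OF qv], of "int k" "[int r + 1..int m]" c] ns by simp
    have qw: "qper n w" unfolding w_def by (intro qper_Tl[OF q] qper_shift[OF qv]) simp
    have split: "Lop m k q v = Tl q [1..int r - 1] (Tq q (int r) w)"
      unfolding Lop_def w_def using upto_split[of "int r"] r(1) by simp
    have TT: "vge f p (Tl q [1..int r - 1] (Tq q (int r) w) j) (p Y + c)" if "j \<le> int n" for j
    proof -
      have "vge f p (Y * v j) (p Y + c)"
        using WM_vge[OF W that] Y(1) by (intro vge_mult) (auto intro: veq_imp_vge)
      moreover have "f dvd Lop m k q v j - Y * v j" using v that by (simp add: eig_def)
      ultimately show ?thesis using vge_cong unfolding split by simp
    qed
    have Tr: "vge f p (Tq q (int r) w j) (p Y + c)" if "j \<le> int n" for j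
      by (rule vge_Tl_inv[OF over q qper_Tq[OF q qw] _ TT that]) (use ns r in auto)
    have "vge f p ((X - const2 a) * w j) (p Y + c)" if "j \<le> int n" for j
      unfolding r(2) eps_def
      by (rule Tq_cyclic[where q = q and i = "int r", OF qw Tr that phase_space_col'[OF q]])
    then have "vge f p (w j) (0 + (p Y + c - 1))" if "j \<le> int n" for j
      using vge_mult_cancel[OF Xa, of "w j" "p Y + c - 1"] that by simp
    then have "p Y + c - 1 \<le> c" using WM_not[OF Ww, of "p Y + c - 1"] by force
    then show "veq f p Y 1" using Y by simp
  qed simp
qed

section \<open>The divisors of eigenvectors related by a partial product of the Lax matrix\<close>

text \<open>The coefficient at p of O_(j+1) + ... + O_n - (n - j) P, continued to all integers j.
  The difference of floors counts the indices in (j, n] congruent to s modulo N.\<close>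

definition wt :: "place list \<Rightarrow> place \<Rightarrow> int \<Rightarrow> int" where
  "wt os p j = (if p = P_point f then j - int n
     else \<Sum>s | s \<in> {1..N} \<and> os ! (s - 1) = p. (int n - int s) div int N - (j - int s) div int N)"

lemma P_not_O: "P_point f \<notin> O_points f"
  using P_inf by (auto simp: O_points_def at_infinity_def)

lemma wt_P: "wt os (P_point f) j = j - int n"
  by (simp add: wt_def)

lemma nth_pos:
  assumes "length os = N" "distinct os" "r \<in> {1..N}" "s \<in> {1..N}" "os ! (s - 1) = os ! (r - 1)"
  shows "s = r"
proof -
  have "s - 1 < length os" "r - 1 < length os" using assms(1,3,4) by auto
  then have "s - 1 = r - 1" using assms(2,5) nth_eq_iff_index_eq by blast
  then show ?thesis using assms(3,4) by auto
qed

lemma wt_O: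
  assumes "length os = N" "os \<in> orderings (O_points f)" "s \<in> {1..N}"
  shows "wt os (os ! (s - 1)) j = (int n - int s) div int N - (j - int s) div int N"
proof -
  have "s - 1 < length os" using assms(1,3) by auto
  then have "os ! (s - 1) \<in> O_points f" using assms(2) nth_mem unfolding orderings_def by blast
  then have "os ! (s - 1) \<noteq> P_point f" using P_not_O by auto
  moreover have "distinct os" using assms(2) by (simp add: orderings_def)
  then have "{r. r \<in> {1..N} \<and> os ! (r - 1) = os ! (s - 1)} = {s}"
    using nth_pos[OF assms(1) _ assms(3)] assms(3) by blast
  ultimately show ?thesis unfolding wt_def by simp
qed

lemma wt_other:
  assumes "length os = N" "os \<in> orderings (O_points f)" "p \<noteq> P_point f" "p \<notin> O_points f"
  shows "wt os p j = 0"
proof -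
  have "os ! (s - 1) \<noteq> p" if "s \<in> {1..N}" for s
  proof -
    have "s - 1 < length os" using assms(1) that by auto
    then show ?thesis using assms(2,4) nth_mem unfolding orderings_def by blast
  qed
  then have "{s. s \<in> {1..N} \<and> os ! (s - 1) = p} = {}" by blast
  then show ?thesis unfolding wt_def using assms(3) by (simp only: if_False sum.empty)
qed

lemma count_class:
  assumes "s \<in> {1..N}" "i \<le> n"
  shows "int (card {j \<in> {i + 1..n}. (j - 1) mod N = s - 1})
    = (int n - int s) div int N - (int i - int s) div int N"
  using assms(2)
proof (induction "n - i" arbitrary: i)
  case (Suc d)
  have iN: "(i mod N = s - 1) \<longleftrightarrow> int N dvd int (Suc i) - int s"
  proof -
    have s1: "s - 1 < N" "int (Suc i) - int s = int i - int (s - 1)" using assms(1) by auto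
    have "int N dvd int (Suc i) - int s \<longleftrightarrow> int i mod int N = int (s - 1) mod int N"
      unfolding s1(2) by (rule mod_eq_dvd_iff[symmetric])
    also have "\<dots> \<longleftrightarrow> i mod N = (s - 1) mod N" by (metis of_nat_mod of_nat_eq_iff)
    finally show ?thesis using s1(1) by (simp only: mod_less)
  qed
  have "{j \<in> {i + 1..n}. (j - 1) mod N = s - 1}
      = (if i mod N = s - 1 then {Suc i} else {}) \<union> {j \<in> {Suc i + 1..n}. (j - 1) mod N = s - 1}"
  proof -
    have "{i + 1..n} = insert (Suc i) {Suc i + 1..n}" using Suc(2) by auto
    then show ?thesis by auto
  qed
  then have "card {j \<in> {i + 1..n}. (j - 1) mod N = s - 1}
      = (if i mod N = s - 1 then 1 else 0) + card {j \<in> {Suc i + 1..n}. (j - 1) mod N = s - 1}"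
    by (simp add: card_Un_disjoint)
  moreover have "int (card {j \<in> {Suc i + 1..n}. (j - 1) mod N = s - 1})
      = (int n - int s) div int N - (int (Suc i) - int s) div int N"
    using Suc(1)[of "Suc i"] Suc(2) by simp
  moreover have "(int (Suc i) - int s) div int N
      = (int i - int s) div int N + (if i mod N = s - 1 then 1 else 0)"
  proof (cases "int N dvd int (Suc i) - int s")
    case True
    then obtain z where z: "int (Suc i) - int s = int N * z" by (auto elim: dvdE)
    then have "int i - int s = int N * (z - 1) + (int N - 1)" by (simp add: algebra_simps)
    then have "(int i - int s) div int N = z - 1"
      by (rule int_div_pos_eq) (use N_pos in auto)
    then show ?thesis using True iN z N_pos by simp
  next
    case False
    define x where "x = int i - int s"
    define r where "r = x mod int N"
    have x: "x = int N * (x div int N) + r" by (simp add: r_def)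
    have "0 \<le> r" "r < int N" using N_pos by (simp_all add: r_def)
    moreover have "r \<noteq> int N - 1"
    proof
      assume "r = int N - 1"
      then have "int (Suc i) - int s = int N * (x div int N + 1)" using x by (simp add: x_def algebra_simps)
      then show False using False by simp
    qed
    ultimately have "(x + 1) div int N = x div int N"
      using x by (intro int_div_pos_eq[where r = "r + 1"]) auto
    moreover have "int (Suc i) - int s = x + 1" by (simp add: x_def)
    ultimately show ?thesis using False iN by (simp only: x_def if_False)
  qed
  ultimately show ?case by simp
qed simp

lemma hb_wt:
  assumes ol: "length (O_list n m k f q) = N" "O_list n m k f q \<in> orderings (O_points f)"
    and i: "i \<in> {1..n}"
  shows "hb q p i = wt (O_list n m k f q) p (int i)"
proof -
  define os where "os = O_list n m k f q"
  have len: "length os = N" using ol(1) by (simp add: os_def)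
  have fr: "Poly_Mapping.lookup (frag_of x) p = (if x = p then 1 else 0)" for x by simp
  have "hb q p i = (\<Sum>j\<in>{i + 1..n}. if os ! ((j - 1) mod N) = p then 1 else 0)
      - int (n - i) * (if P_point f = p then 1 else 0)"
    unfolding hb_def h_bound_def os_def[symmetric]
    by (simp only: lookup_minus lookup_sum lookup_frag_cmul fr len)
  also have "int (n - i) * (if P_point f = p then 1 else 0) = (if p = P_point f then int n - int i else 0)"
    using i by auto
  also have "(\<Sum>j\<in>{i + 1..n}. if os ! ((j - 1) mod N) = p then 1 else (0 :: int))
      = int (card {j \<in> {i + 1..n}. os ! ((j - 1) mod N) = p})"
    by (simp add: sum.If_cases Int_def)
  finally have hb: "hb q p i = int (card {j \<in> {i + 1..n}. os ! ((j - 1) mod N) = p})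
      - (if p = P_point f then int n - int i else 0)" .
  have mem: "os ! ((j - 1) mod N) \<in> O_points f" for j
    using ol N_pos nth_mem[of "(j - 1) mod N" os] unfolding os_def orderings_def by auto
  consider "p = P_point f" | "p \<noteq> P_point f" "p \<notin> O_points f" | "p \<in> O_points f" by metis
  then show ?thesis
  proof cases
    case 1
    have "os ! ((j - 1) mod N) \<noteq> p" for j using mem[of j] P_not_O 1 by metis
    then have "{j \<in> {i + 1..n}. os ! ((j - 1) mod N) = p} = {}" by blast
    then show ?thesis using hb 1 by (simp only: wt_P) simp
  next
    case 2
    then have "{j \<in> {i + 1..n}. os ! ((j - 1) mod N) = p} = {}" using mem by auto
    then show ?thesis using hb 2 wt_other[OF ol 2] by simp
  next
    case 3
    then obtain t where t: "t < N" "p = os ! t"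
      using ol unfolding os_def orderings_def by (metis (mono_tags, lifting) in_set_conv_nth mem_Collect_eq)
    define s where "s = t + 1"
    have s: "s \<in> {1..N}" "p = os ! (s - 1)" using t by (auto simp: s_def)
    have d: "distinct os" using ol by (simp add: os_def orderings_def)
    have "os ! ((j - 1) mod N) = p \<longleftrightarrow> (j - 1) mod N = s - 1" for j
      using nth_eq_iff_index_eq[OF d, of "(j - 1) mod N" t] ol(1) N_pos t by (simp add: os_def s_def)
    then have "hb q p i = int (card {j \<in> {i + 1..n}. (j - 1) mod N = s - 1})"
      using hb 3 P_not_O by auto
    also have "\<dots> = wt os p (int i)"
      using count_class[OF s(1), of i] wt_O[OF _ _ s(1), of os] ol i s(2) by (simp add: os_def)
    finally show ?thesis by (simp add: os_def)
  qed
qed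

lemma wt_O_period:
  "(int n - int s) div int N - (j - int n - int s) div int N
    = ((int n - int s) div int N - (j - int s) div int N) + int n'"
proof -
  have "j - int n - int s = (j - int s) + int N * (- int n')" by (simp add: int_nN)
  then have "(j - int n - int s) div int N = (j - int s) div int N - int n'"
    using N_pos by (simp only: div_mult_self2)
  then show ?thesis by simp
qed

lemma wt_period:
  assumes os: "length os = N" "os \<in> orderings (O_points f)" and p: "p \<in> places f"
    and X: "veq f (P_point f) X (- int n)"
  obtains e where "veq f p X e" "\<And>j. wt os p (j - int n) = wt os p j + e"
proof (rule place_cases[OF p])
  assume P: "p = P_point f"
  have "veq f p X (- int n)" unfolding P by (rule X)
  then show thesis by (rule that) (simp add: P wt_P)
next
  assume pO: "p \<in> O_points f"
  then have "p \<in> set os" using os(2) by (simp add: orderings_def)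
  then obtain t where t: "t < N" "os ! t = p" using in_set_conv_nth[of p os] os(1) by auto
  then have s: "t + 1 \<in> {1..N}" "os ! (t + 1 - 1) = p" by simp_all
  have w: "wt os p j = (int n - int (t + 1)) div int N - (j - int (t + 1)) div int N" for j
    using wt_O[OF os s(1)] unfolding s(2) .
  have "wt os p (j - int n) = wt os p j + int n'" for j unfolding w by (rule wt_O_period)
  then show thesis by (rule that[OF O_point_orders(1)[OF pO]])
next
  fix a b assume ab: "a \<noteq> 0" "lies_over f p a b"
  have P: "p \<noteq> P_point f" using ab P_inf by (auto simp: at_infinity_def)
  have "p \<notin> O_points f"
    using place.lies_over_unique(1)[OF placeI[OF p] ab(2), of 0 0] ab(1) by (auto simp: O_points_def)
  then have w0: "wt os p j = 0" for j by (rule wt_other[OF os P])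
  have "veq f p X 0" by (rule A_point_X[OF placeI[OF p] ab(2,1)])
  then show thesis by (rule that[of 0]) (simp only: w0 add_0_left)
qed

lemma D_min_WM:
  assumes q: "q \<in> phase_space n m k" and v: "eig f n m k q v"
    and os: "length (O_list n m k f q) = N" "O_list n m k f q \<in> orderings (O_points f)"
    and p: "p \<in> places f" and X: "veq f (P_point f) X (- int n)"
  shows "\<exists>c. WM f n p (wt (O_list n m k f q) p) v c \<and>
    Poly_Mapping.lookup (D_min n m k f q) p = p (v (int n)) - c"
proof -
  interpret place f p using p by (rule placeI)
  obtain c where c: "\<forall>i\<in>{1..n}. vge f p (v (int i)) (hb q p i + c)"
      "\<exists>i\<in>{1..n}. veq f p (v (int i)) (hb q p i + c)"
      "Poly_Mapping.lookup (D_min n m k f q) p = p (v (int n)) - c"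
    using D_min_lookup(2)[OF q v p] by metis
  obtain e where e: "veq f p X e" "\<And>j. wt (O_list n m k f q) p (j - int n) = wt (O_list n m k f q) p j + e"
    using wt_period[OF os p X] by metis
  have qv: "qper n v" using v by (simp add: eig_def)
  have "WM f n p (wt (O_list n m k f q) p) v c"
    unfolding WM_iff_period[where b = "wt (O_list n m k f q) p" and v = v and c = c, OF qv n_pos e]
  proof (intro conjI ballI)
    fix i assume i: "i \<in> {1..n}"
    show "vge f p (v (int i)) (wt (O_list n m k f q) p (int i) + c)"
      unfolding hb_wt[OF os i, symmetric] by (rule bspec[OF c(1) i])
  next
    obtain i where i: "i \<in> {1..n}" "veq f p (v (int i)) (hb q p i + c)" using c(2) by metis
    then show "\<exists>i\<in>{1..n}. veq f p (v (int i)) (wt (O_list n m k f q) p (int i) + c)"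
      unfolding hb_wt[OF os i(1)] by metis
  qed
  then show ?thesis using c(3) by metis
qed

end

section \<open>Explicit form of the exchange maps\<close>

lemma Ez_shift: "Ez d (\<lambda>j. a (j - c)) (\<lambda>j. b (j - c)) l = Ez d a b (l - c)"
proof -
  have "l + 1 + int s - c = l - c + 1 + int s" for s by simp
  then show ?thesis by (simp only: Ez_def)
qed

lemma prod_telescope:
  fixes e :: "int \<Rightarrow> complex"
  assumes "\<And>j. e j \<noteq> 0"
  shows "(\<Prod>j=1..n. e (int j) / e (int j - 1)) = e (int n) / e 0"
  by (induction n) (use assms in \<open>simp_all add: field_simps\<close>)

lemma row_coordinates_inj:
  assumes p: "p \<in> phase_space n m k" "p' \<in> phase_space n m k" and nm: "n \<ge> 1" "m \<ge> 1"
    and eq: "\<And>t. t \<in> {1..m} \<Longrightarrow> row_of n p t = row_of n p' t"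
  shows "p = p'"
proof (intro ext)
  fix i j
  define z where "z = (i - 1) div int m"
  define r where "r = nat ((i - 1) mod int m) + 1"
  have ir: "int r + int m * z = i" using nm by (simp add: r_def z_def)
  define j' where "j' = j - int k * z"
  define y where "y = (j' - 1) div int n"
  define s where "s = nat ((j' - 1) mod int n) + 1"
  have js: "int s + int n * y = j'" using nm by (simp add: s_def y_def)
  have r: "r \<in> {1..m}" and s: "s \<in> {1..n}" using nm by (auto simp: r_def s_def nat_less_iff Suc_le_eq)
  have red: "x i j = x (int r) (int s)" if x: "x \<in> phase_space n m k" for x
  proof -
    have "x i j = x (int r) j'"
      using phase_space_row_multiple[OF x, of "int r" z j'] by (simp add: ir j'_def)
    also have "\<dots> = x (int r) (int s)"
      using periodic_multiple[where g = "x (int r)", OF phase_space_col[OF x], of "int s" y] by (simp only: js)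
    finally show ?thesis .
  qed
  have "s \<in> set [1..<Suc n]" using s by auto
  then have "p (int r) (int s) = p' (int r) (int s)"
    using eq[OF r] unfolding row_of_def map_eq_conv by blast
  then show "p i j = p' i j" using red[OF p(1)] red[OF p(2)] by simp
qed

text \<open>Here e_j is E_j for the rows r and r + 1, and \<kappa> is the difference of their
  products. These relations suffice afterwards, without the sum that defines E.\<close>

lemma s_map_explicit:
  assumes q: "q \<in> phase_space n m k" and n: "n \<ge> 1" and r: "1 \<le> r" "r < m"
    and s: "s_map n m k r q = Some p"
  shows "p \<in> phase_space n m k"
    and "\<exists>e \<kappa>. (\<forall>j. e j \<noteq> 0) \<and> (\<forall>j. e (j + int n) = e j) \<and>
      (\<forall>j. p (int r) j = q (int r + 1) j * e j / e (j - 1)) \<and>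
      (\<forall>j. p (int r + 1) j = q (int r) j * e (j - 1) / e j) \<and>
      (\<forall>i\<in>{1..int m} - {int r, int r + 1}. \<forall>j. p i j = q i j) \<and>
      (\<forall>j. q (int r) j * e (j - 1) - q (int r + 1) j * e j = \<kappa>)"
proof -
  define E where "E i = Ez n (q i) (q (i + 1))" for i
  have per: "q i (j + int n) = q i j" for i j by (rule phase_space_col[OF q])
  have Ecol: "E i (j + int n) = E i j" for i j unfolding E_def by (rule Ez_period; rule per)
  have Erow: "E (i + int m) j = E i (j - int k)" for i j
  proof -
    have "q (i + int m) = (\<lambda>j. q i (j - int k))" "q (i + int m + 1) = (\<lambda>j. q (i + 1) (j - int k))"
      using phase_space_row[OF q, of i] phase_space_row[OF q, of "i + 1"] by (auto simp: algebra_simps)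
    then show ?thesis unfolding E_def by (simp only: Ez_shift)
  qed
  have R: "R_defined (row_of n q r) (row_of n q (r + 1))"
    using s unfolding s_map_def exchange_def by (simp split: if_splits)
  have ip: "int (r + 1) = int r + 1" by simp
  have nz: "E (int r) j \<noteq> 0" for j
    unfolding E_def
  proof (rule Ez_nonzero[where a = "q (int r)" and b = "q (int r + 1)", OF per per])
    show "n > 0" using n by simp
    show "R_defined (map (\<lambda>j. q (int r) (int j)) [1..<Suc n]) (map (\<lambda>j. q (int r + 1) (int j)) [1..<Suc n])"
      using R unfolding row_of_def ip .
  qed
  \<comment> \<open>The new rows are prescribed on whole classes modulo m, so that the image extends
    to Z^2. The second class is written with mod because r + 1 may equal m.\<close>
  define P where "P i j = (if i mod int m = int r then q (i + 1) j * E i j / E i (j - 1)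
    else if i mod int m = (int r + 1) mod int m then q (i - 1) j * E (i - 1) (j - 1) / E (i - 1) j
    else q i j)" for i j
  have Pr: "P (int r) j = q (int r + 1) j * E (int r) j / E (int r) (j - 1)" for j
    using r by (simp add: P_def)
  have ne: "(int r + 1) mod int m \<noteq> int r"
  proof
    assume a: "(int r + 1) mod int m = int r"
    show False
    proof (cases "int r + 1 = int m")
      case True
      then show False using a r by simp
    next
      case False
      then have "(int r + 1) mod int m = int r + 1" using r by (intro mod_pos_pos_trivial) auto
      then show False using a by simp
    qed
  qed
  have Pr1: "P (int r + 1) j = q (int r) j * E (int r) (j - 1) / E (int r) j" for j
    using ne by (simp add: P_def)
  have Pother: "P i j = q i j" if i: "i \<in> {1..int m} - {int r, int r + 1}" for i j
  proof -
    have "i mod int m \<noteq> int r"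
    proof (cases "i = int m")
      case True
      then show ?thesis using r by simp
    next
      case False
      then show ?thesis using i by simp
    qed
    moreover have "i mod int m \<noteq> (int r + 1) mod int m"
    proof (cases "i = int m")
      case True
      then have "int r + 1 < int m" using i r by auto
      then show ?thesis using True by simp
    next
      case False
      then have im: "i mod int m = i" using i by simp
      show ?thesis
      proof (cases "int r + 1 = int m")
        case True
        then show ?thesis using im i by simp
      next
        case False
        then have "(int r + 1) mod int m = int r + 1" using r by (intro mod_pos_pos_trivial) auto
        then show ?thesis using im i by simp
      qed
    qed
    ultimately show ?thesis by (simp add: P_def)
  qed
  have Pps: "P \<in> phase_space n m k"
    unfolding phase_space_def
  proof (intro CollectI conjI allI)
    fix i j
    have e1: "E i' (j + int n - 1) = E i' (j - 1)" for i' using Ecol[of i' "j - 1"] by (simp add: algebra_simps)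
    show "P i (j + int n) = P i j" unfolding P_def e1 by (simp only: per Ecol)
    have idx: "i + int m + 1 = i + 1 + int m" "i + int m - 1 = i - 1 + int m" "j - 1 - int k = j - int k - 1"
      by simp_all
    show "P (i + int m) j = P i (j - int k)"
      unfolding P_def idx mod_add_self2 phase_space_row[OF q] Erow by (simp only: idx)
  qed
  have PR: "(row_of n P r, row_of n P (r + 1)) = R_map (row_of n q r) (row_of n q (r + 1))"
    unfolding row_of_def ip R_map_Ez[of "q (int r)" n "q (int r + 1)", OF per per]
    using Pr Pr1 by (simp add: E_def del: upt_Suc)
  have "s_map n m k r q = Some P"
    unfolding s_map_def
  proof (rule exchange_eqI[OF R Pps PR])
    fix t assume t: "t \<in> {1..m} - {r, r + 1}"
    then have "int t \<in> {1..int m} - {int r, int r + 1}" by auto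
    then show "row_of n P t = row_of n q t" unfolding row_of_def by (simp only: Pother)
  next
    fix a b assume "a \<in> phase_space n m k" "b \<in> phase_space n m k"
      "\<And>t. t \<in> {1..m} \<Longrightarrow> row_of n a t = row_of n b t"
    then show "a = b" using row_coordinates_inj[of a n m k b] n r by simp
  qed (use r in auto)
  then have pP: "p = P" using s by simp
  show "p \<in> phase_space n m k" using Pps pP by simp
  have "q (int r) j * E (int r) (j - 1) - q (int r + 1) j * E (int r) j
      = (\<Prod>s<n. q (int r) (int s)) - (\<Prod>s<n. q (int r + 1) (int s))" for j
    unfolding E_def using n by (intro Ez_recursion per) simp
  then show "\<exists>e \<kappa>. (\<forall>j. e j \<noteq> 0) \<and> (\<forall>j. e (j + int n) = e j) \<and>
      (\<forall>j. p (int r) j = q (int r + 1) j * e j / e (j - 1)) \<and>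
      (\<forall>j. p (int r + 1) j = q (int r) j * e (j - 1) / e j) \<and>
      (\<forall>i\<in>{1..int m} - {int r, int r + 1}. \<forall>j. p i j = q i j) \<and>
      (\<forall>j. q (int r) j * e (j - 1) - q (int r + 1) j * e j = \<kappa>)"
    using nz Ecol Pr Pr1 Pother unfolding pP
    by (intro exI[of _ "E (int r)"] exI[of _ "(\<Prod>s<n. q (int r) (int s)) - (\<Prod>s<n. q (int r + 1) (int s))"]) simp
qed

text \<open>A step of k columns is undone by a step of m rows, and N is an integer combination of n
  and k. So a column in the class of c is column c read from another row, with an offset common to
  all points.\<close>

lemma phase_space_class:
  assumes q: "q \<in> phase_space n m k" and j: "int (gcd n k) dvd j - c"
  obtains z where "\<And>g. g \<in> phase_space n m k \<Longrightarrow> (\<And>i. g i j = g (i + int m * z) c)"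
proof -
  obtain w where w: "j - c = int (gcd n k) * w" using j by (auto elim: dvdE)
  obtain u y where uy: "u * int n + y * int k = int (gcd n k)"
    using bezout_int[of "int n" "int k"] by auto
  have jj: "j = c + int k * (w * y) + int n * (w * u)"
    using w by (simp add: algebra_simps flip: uy)
  have "g i j = g (i + int m * (- (w * y))) c" if g: "g \<in> phase_space n m k" for g i
  proof -
    have "g i j = g i (c + int k * (w * y))"
      unfolding jj by (rule periodic_multiple[where g = "g i", OF phase_space_col[OF g]])
    also have "\<dots> = g (i + int m * (- (w * y)) + int m * (w * y)) (c + int k * (w * y))" by simp
    also have "\<dots> = g (i + int m * (- (w * y))) c" by (rule phase_space_row_multiple[OF g])
    finally show ?thesis .
  qed
  then show thesis using that by metis
qed

lemma phase_space_long_row: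
  assumes q: "q \<in> phase_space n m k" shows "q (i + int (m * (n div gcd n k))) j = q i j"
proof -
  have "k * (n div gcd n k) = n * (k div gcd n k)" by (metis div_mult_swap gcd_dvd1 gcd_dvd2 mult.commute)
  then have kn: "int k * int (n div gcd n k) = int n * int (k div gcd n k)" by (metis of_nat_mult)
  have "q (i + int m * int (n div gcd n k)) (j + int k * int (n div gcd n k)) = q i j"
    by (rule phase_space_row_multiple[OF q])
  moreover have "q (i + int m * int (n div gcd n k)) (j + int n * int (k div gcd n k))
      = q (i + int m * int (n div gcd n k)) j"
    by (rule periodic_multiple[where g = "q (i + int m * int (n div gcd n k))", OF phase_space_col[OF q]])
  ultimately show ?thesis using kn by simp
qed

lemma trow_coordinates_inj:
  assumes p: "p \<in> phase_space n m k" "p' \<in> phase_space n m k" and nm: "n \<ge> 1" "m \<ge> 1"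
    and eq: "\<And>t. t \<in> {1..gcd n k} \<Longrightarrow> trow_of n m k p t = trow_of n m k p' t"
  shows "p = p'"
proof (intro ext)
  fix i j
  define N where "N = gcd n k"
  define d where "d = m * (n div gcd n k)"
  have N: "N > 0" using nm by (simp add: N_def)
  have d: "d > 0" using nm by (simp add: d_def div_greater_zero_iff gcd_le1_nat)
  define c where "c = nat ((j - 1) mod int N) + 1"
  have c: "c \<in> {1..N}" using N by (auto simp: c_def nat_less_iff Suc_le_eq)
  have "j - int c = int N * ((j - 1) div int N)"
    using minus_mod_eq_mult_div[of "j - 1" "int N"] N by (simp add: c_def)
  then have "int (gcd n k) dvd j - int c" unfolding N_def by simp
  then obtain z where z: "\<And>g i. g \<in> phase_space n m k \<Longrightarrow> g i j = g (i + int m * z) (int c)"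
    using phase_space_class[OF p(1)] by metis
  define i' where "i' = i + int m * z"
  define l where "l = nat ((int m - i') mod int d) + 1"
  define y where "y = (int m - i') div int d"
  have l: "l \<in> {1..d}" using d by (auto simp: l_def nat_less_iff Suc_le_eq)
  have "int l - 1 + int d * y = int m - i'" using d by (simp add: l_def y_def)
  then have il: "i' + int d * y = int m + 1 - int l" by linarith
  have red: "x i j = x (int m + 1 - int l) (int c)" if x: "x \<in> phase_space n m k" for x
  proof -
    have "x i j = x i' (int c)" unfolding i'_def by (rule z[OF x])
    also have "\<dots> = x (i' + int d * y) (int c)"
      by (rule periodic_multiple[where g = "\<lambda>i. x i (int c)", symmetric])
         (unfold d_def, rule phase_space_long_row[OF x])
    finally show ?thesis unfolding il .
  qed
  define t where "t = N + 1 - c"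
  have t: "t \<in> {1..gcd n k}" "int (gcd n k) + 1 - int t = int c" using c by (auto simp: t_def N_def)
  have "l \<in> set [1..<Suc d]" using l by auto
  then have "p (int m + 1 - int l) (int c) = p' (int m + 1 - int l) (int c)"
    using eq[OF t(1)] unfolding trow_of_def map_eq_conv t(2) d_def by blast
  then show "p i j = p' i j" using red[OF p(1)] red[OF p(2)] by simp
qed

text \<open>Tuples r and r + 1 are columns c + 1 and c read with row index m + 1 - l over the m n'
  rows of a period. Thus F in row i is E at l = m + 1 - i, and E_(l-1) is F in row i + 1. F and
  \<kappa> are defined for all columns to have the periods of the phase space, but describe the map
  on the class of c.\<close>

lemma ts_map_explicit:
  assumes q: "q \<in> phase_space n m k" and n: "n \<ge> 1" and m: "m \<ge> 1" and k: "k \<ge> 1"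
    and r: "1 \<le> r" "r < gcd n k" and s: "ts_map n m k r q = Some p"
  defines "c \<equiv> int (gcd n k - r)"
  shows "p \<in> phase_space n m k"
    and "\<exists>F \<kappa>. F \<in> phase_space n m k \<and> (\<forall>i j. int (gcd n k) dvd j - c \<longrightarrow> F i j \<noteq> 0) \<and>
      (\<forall>i j. int (gcd n k) dvd j - c \<longrightarrow> p i j = q i (j + 1) * F (i + 1) j / F i j \<and>
         p i (j + 1) = q i j * F i j / F (i + 1) j) \<and>
      (\<forall>i j. \<not> int (gcd n k) dvd j - c \<longrightarrow> \<not> int (gcd n k) dvd j - 1 - c \<longrightarrow> p i j = q i j) \<and>
      (\<forall>j. \<kappa> (j - int k) = \<kappa> j) \<and> (\<forall>j. \<kappa> (j + int n) = (\<kappa> j :: complex)) \<and>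
      (\<forall>i j. q i (j + 1) * F (i + 1) j - q i j * F i j = \<kappa> j)"
proof -
  define N where "N = gcd n k"
  define d where "d = m * (n div gcd n k)"
  have N: "N > 1" using r by (simp add: N_def)
  have d: "d > 0" using n m by (simp add: d_def div_greater_zero_iff gcd_le1_nat)
  have Nn: "int N dvd int n" "int N dvd int k" by (simp_all add: N_def)
  have cN: "c = int N - int r" using r by (simp add: c_def N_def of_nat_diff)
  define a where "a j l = q (int m + 1 - l) (j + 1)" for j l :: int
  define b where "b j l = q (int m + 1 - l) j" for j l :: int
  have ab: "a j l = b (j + 1) l" for j l by (simp add: a_def b_def)
  have bper: "b j (l + int d) = b j l" for j l
  proof -
    have "int m + 1 - l = int m + 1 - (l + int d) + int d" by simp
    then show ?thesis unfolding b_def d_def using phase_space_long_row[OF q] by metis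
  qed
  have aper: "a j (l + int d) = a j l" for j l unfolding ab by (rule bper)
  have bcol: "b (j + int n) l = b j l" for j l unfolding b_def by (rule phase_space_col[OF q])
  have bk: "b (j - int k) = (\<lambda>l. b j (l - int m))" for j
    unfolding b_def using phase_space_row[OF q, of "int m + 1 - l" j for l] by (auto simp: algebra_simps)
  have ak: "a (j - int k) = (\<lambda>l. a j (l - int m))" for j
    using bk[of "j + 1"] unfolding ab by (simp add: algebra_simps fun_eq_iff)
  define F where "F i j = Ez d (a j) (b j) (int m + 1 - i)" for i j
  define \<kappa> where "\<kappa> j = (\<Prod>s<d. a j (int s)) - (\<Prod>s<d. b j (int s))" for j
  have acol: "a (j + int n) = a j" for j
  proof
    fix l
    have "j + int n + 1 = j + 1 + int n" by simp
    then show "a (j + int n) l = a j l" unfolding a_def using phase_space_col[OF q] by metis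
  qed
  have bcol': "b (j + int n) = b j" for j using bcol by auto
  have Fps: "F \<in> phase_space n m k"
    unfolding phase_space_def
  proof (intro CollectI conjI allI)
    fix i j
    show "F i (j + int n) = F i j" unfolding F_def acol bcol' ..
    have "int m + 1 - (i + int m) = int m + 1 - i - int m" by simp
    then show "F (i + int m) j = F i (j - int k)" unfolding F_def ak bk Ez_shift by (simp only:)
  qed
  have \<kappa>k: "\<kappa> (j - int k) = \<kappa> j" for j
  proof -
    have "(\<Prod>s<d. a j (int s - int m)) = (\<Prod>s<d. a j (int s))" "(\<Prod>s<d. b j (int s - int m)) = (\<Prod>s<d. b j (int s))"
      using period_prod[of "a j" d "- int m", OF aper] period_prod[of "b j" d "- int m", OF bper]
      by (simp_all add: algebra_simps)
    then show ?thesis unfolding \<kappa>_def ak bk by simp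
  qed
  have \<kappa>n: "\<kappa> (j + int n) = \<kappa> j" for j unfolding \<kappa>_def acol bcol' ..
  have rec: "q i (j + 1) * F (i + 1) j - q i j * F i j = \<kappa> j" for i j
  proof -
    have "a j (int m + 1 - i) * Ez d (a j) (b j) (int m + 1 - i - 1) - b j (int m + 1 - i) * Ez d (a j) (b j) (int m + 1 - i) = \<kappa> j"
      unfolding \<kappa>_def by (rule Ez_recursion[where a = "a j" and b = "b j", OF aper bper d])
    moreover have "int m + 1 - i - 1 = int m + 1 - (i + 1)" by simp
    ultimately show ?thesis unfolding F_def by (simp add: a_def b_def)
  qed
  have trow: "trow_of n m k x t = map (\<lambda>l. x (int m + 1 - int l) (int N + 1 - int t)) [1..<Suc d]" for x t
    unfolding trow_of_def N_def d_def ..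
  have cols: "int N + 1 - int r = c + 1" "int N + 1 - int (r + 1) = c" using cN by simp_all
  have tq: "trow_of n m k q r = map (\<lambda>l. a c (int l)) [1..<Suc d]"
    "trow_of n m k q (r + 1) = map (\<lambda>l. b c (int l)) [1..<Suc d]"
    unfolding trow cols a_def b_def by (rule refl)+
  have R: "R_defined (trow_of n m k q r) (trow_of n m k q (r + 1))"
    using s unfolding ts_map_def exchange_def by (simp split: if_splits)
  have Fc: "F i c \<noteq> 0" for i
    unfolding F_def by (rule Ez_nonzero[where a = "a c" and b = "b c" and d = d, OF aper bper d]) (use R tq in simp)
  have nz: "F i j \<noteq> 0" if "int N dvd j - c" for i j
  proof -
    obtain z where "\<And>g i. g \<in> phase_space n m k \<Longrightarrow> g i j = g (i + int m * z) c"
      using phase_space_class[OF q, of j c] \<open>int N dvd j - c\<close> unfolding N_def by metis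
    then show ?thesis using Fc Fps by metis
  qed
  define P where "P i j = (if int N dvd j - c then q i (j + 1) * F (i + 1) j / F i j
    else if int N dvd j - 1 - c then q i (j - 1) * F i (j - 1) / F (i + 1) (j - 1) else q i j)" for i j
  have not1: "\<not> int N dvd j + 1 - c" if "int N dvd j - c" for j
  proof
    assume "int N dvd j + 1 - c"
    then have "int N dvd (j + 1 - c) - (j - c)" using that by (rule dvd_diff)
    then have "int N dvd 1" by simp
    then show False using N by simp
  qed
  have P0: "P i j = q i (j + 1) * F (i + 1) j / F i j" if "int N dvd j - c" for i j
    using that by (simp add: P_def)
  have P1: "P i (j + 1) = q i j * F i j / F (i + 1) j" if "int N dvd j - c" for i j
    using that not1[OF that] by (simp add: P_def)
  have P2: "P i j = q i j" if "\<not> int N dvd j - c" "\<not> int N dvd j - 1 - c" for i j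
    using that by (simp add: P_def)
  have Pps: "P \<in> phase_space n m k"
    unfolding phase_space_def
  proof (intro CollectI conjI allI)
    fix i j
    have dn: "int N dvd x + int n \<longleftrightarrow> int N dvd x" for x using Nn(1) by (rule dvd_add_left_iff)
    have dk: "int N dvd x - int k \<longleftrightarrow> int N dvd x" for x
      using dvd_add_left_iff[OF Nn(2), of "x - int k"] by simp
    have i1: "j + int n - c = j - c + int n" "j - 1 + int n - c = j - 1 - c + int n"
      "j + int n + 1 = j + 1 + int n" "j + int n - 1 = j - 1 + int n" by simp_all
    show "P i (j + int n) = P i j"
      unfolding P_def i1 dn phase_space_col[OF q] phase_space_col[OF Fps] ..
    have i2: "j - int k - c = j - c - int k" "j - 1 - int k - c = j - 1 - c - int k"
      "j - int k + 1 = j + 1 - int k" "j - int k - 1 = j - 1 - int k" "i + int m + 1 = i + 1 + int m" by simp_all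
    show "P (i + int m) j = P i (j - int k)"
      unfolding P_def i2 dk phase_space_row[OF q] phase_space_row[OF Fps] ..
  qed
  have PR: "(trow_of n m k P r, trow_of n m k P (r + 1)) = R_map (trow_of n m k q r) (trow_of n m k q (r + 1))"
  proof -
    have "P (int m + 1 - int l) (c + 1) = b c (int l) * Ez d (a c) (b c) (int l) / Ez d (a c) (b c) (int l - 1)"
      "P (int m + 1 - int l) c = a c (int l) * Ez d (a c) (b c) (int l - 1) / Ez d (a c) (b c) (int l)" for l
      using P1[of c "int m + 1 - int l"] P0[of c "int m + 1 - int l"]
      by (simp_all add: F_def a_def b_def algebra_simps)
    then show ?thesis unfolding tq R_map_Ez[of "a c" d "b c", OF aper bper] unfolding trow cols by simp
  qed
  have "ts_map n m k r q = Some P"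
    unfolding ts_map_def
  proof (rule exchange_eqI[OF R Pps PR])
    fix t assume t: "t \<in> {1..gcd n k} - {r, r + 1}"
    define x where "x = int N + 1 - int t"
    have nd: "\<not> int N dvd y" if "y \<noteq> 0" "\<bar>y\<bar> < int N" for y :: int
      using that zdvd_imp_le[of "int N" "\<bar>y\<bar>"] by auto
    have xc: "x - c = 1 + int r - int t" "x - 1 - c = int r - int t" by (simp_all add: x_def cN)
    have t': "t \<noteq> r" "t \<noteq> r + 1" "1 \<le> t" "t \<le> N" "r < N" using t r by (simp_all add: N_def)
    have "\<not> int N dvd x - c" "\<not> int N dvd x - 1 - c"
      unfolding xc by (rule nd; use t' r(1) in linarith)+
    then have "P i x = q i x" for i by (rule P2)
    then show "trow_of n m k P t = trow_of n m k q t"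
      unfolding trow x_def[symmetric] by (simp only:)
  next
    fix x y assume "x \<in> phase_space n m k" "y \<in> phase_space n m k"
      "\<And>t. t \<in> {1..gcd n k} \<Longrightarrow> trow_of n m k x t = trow_of n m k y t"
    then show "x = y" using trow_coordinates_inj[of x n m k y] n m by simp
  qed (use r in auto)
  then have pP: "p = P" using s by simp
  show "p \<in> phase_space n m k" using Pps pP by simp
  show "\<exists>F \<kappa>. F \<in> phase_space n m k \<and> (\<forall>i j. int (gcd n k) dvd j - c \<longrightarrow> F i j \<noteq> 0) \<and>
      (\<forall>i j. int (gcd n k) dvd j - c \<longrightarrow> p i j = q i (j + 1) * F (i + 1) j / F i j \<and>
         p i (j + 1) = q i j * F i j / F (i + 1) j) \<and>
      (\<forall>i j. \<not> int (gcd n k) dvd j - c \<longrightarrow> \<not> int (gcd n k) dvd j - 1 - c \<longrightarrow> p i j = q i j) \<and>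
      (\<forall>j. \<kappa> (j - int k) = \<kappa> j) \<and> (\<forall>j. \<kappa> (j + int n) = (\<kappa> j :: complex)) \<and>
      (\<forall>i j. q i (j + 1) * F (i + 1) j - q i j * F i j = \<kappa> j)"
    unfolding N_def[symmetric] pP
    by (intro exI[of _ F] exI[of _ \<kappa>] conjI allI impI Fps nz P0 P1 P2 \<kappa>k \<kappa>n rec)
qed

section \<open>Composites of the birational maps\<close>

text \<open>The invariant carries a label g that changes with each letter;
  \<open>foldr h w g\<close> is its final value.\<close>

lemma comp_list_invariant:
  assumes "comp_list (map F w) x = Some y" and "Q g x"
    and "\<And>r g x y. r \<in> set w \<Longrightarrow> Q g x \<Longrightarrow> F r x = Some y \<Longrightarrow> Q (h r g) y"
  shows "Q (foldr h w g) y"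
  using assms(1,3)
proof (induction w arbitrary: y)
  case Nil
  then show ?case using assms(2) by (simp add: comp_list_def)
next
  case (Cons r w)
  obtain z where z: "comp_list (map F w) x = Some z" "F r z = Some y"
    using Cons.prems(1) by (auto simp: comp_list_def map_comp_Some_iff)
  have "Q (foldr h w g) z" by (rule Cons.IH[OF z(1)]) (use Cons.prems(2) in simp)
  then show ?case using Cons.prems(2)[of r] z(2) by simp
qed

definition swap_at :: "nat \<Rightarrow> (nat \<Rightarrow> 'a) \<Rightarrow> nat \<Rightarrow> 'a" where
  "swap_at r g = g(r := g (Suc r), Suc r := g r)"

lemma swap_at_block:
  assumes "t \<le> b"
  shows "foldr swap_at [t..<b] g = (\<lambda>i. if i = t then g b else if t < i \<and> i \<le> b then g (i - 1) else g i)"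
  using assms
proof (induction "b - t" arbitrary: t)
  case 0
  then show ?case by (auto simp: fun_eq_iff)
next
  case (Suc d)
  then have "t < b" by simp
  then have "foldr swap_at [t..<b] g = swap_at t (foldr swap_at [Suc t..<b] g)"
    by (simp add: upt_conv_Cons)
  also have "\<dots> = (\<lambda>i. if i = t then g b else if t < i \<and> i \<le> b then g (i - 1) else g i)"
    using Suc(2) \<open>t < b\<close> by (subst Suc(1)) (auto simp: swap_at_def fun_eq_iff)
  finally show ?case .
qed

text \<open>The word of transpositions undoes the rotation by u that the power of \<pi> causes. This
  is why the orderings A and O return unchanged.\<close>

lemma e_word_rotation:
  assumes u: "1 \<le> u" "u \<le> d" and r: "r \<in> {1..d}"
  shows "foldr swap_at (e_word d u) (\<lambda>i. if i \<le> d - u then F (i + u) else F (i - (d - u))) r = F r"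
proof -
  let ?g = "\<lambda>i. if i \<le> d - u then F (i + u) else F (i - (d - u))"
  \<comment> \<open>After t blocks the positions hold F_1, ..., F_t, then F_(u+1), ..., F_d, while
    F_(t+1), ..., F_u still wait at the end.\<close>
  have "foldr swap_at (concat (map (\<lambda>t. [t..<d - u + t]) (rev [1..<Suc t]))) ?g r
      = (if r \<le> t then F r else if r \<le> d - u + t then F (r - t + u) else F (r - (d - u)))"
    if "t \<le> u" "r \<in> {1..d}" for t r
    using that
  proof (induction t arbitrary: r)
    case (Suc t)
    define G where "G = foldr swap_at (concat (map (\<lambda>t. [t..<d - u + t]) (rev [1..<Suc t]))) ?g"
    have G: "G r = (if r \<le> t then F r else if r \<le> d - u + t then F (r - t + u) else F (r - (d - u)))"
      if "r \<in> {1..d}" for r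
      unfolding G_def using Suc.IH[of r] Suc.prems(1) that by simp
    have "foldr swap_at (concat (map (\<lambda>t. [t..<d - u + t]) (rev [1..<Suc (Suc t)]))) ?g
        = foldr swap_at [Suc t..<d - u + Suc t] G"
      by (simp add: G_def)
    then show ?case
    proof (simp only:, subst swap_at_block)
      show "Suc t \<le> d - u + Suc t" by simp
      have ud: "d - u + Suc t \<le> d" using Suc.prems(1) u(2) by simp
      consider "r \<le> t" | "r = Suc t" | "Suc t < r" "r \<le> d - u + Suc t" | "r > d - u + Suc t" by linarith
      then show "(if r = Suc t then G (d - u + Suc t)
          else if Suc t < r \<and> r \<le> d - u + Suc t then G (r - 1) else G r) =
        (if r \<le> Suc t then F r else if r \<le> d - u + Suc t then F (r - Suc t + u) else F (r - (d - u)))"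
      proof cases
        case 2
        have "G (d - u + Suc t) = F (d - u + Suc t - (d - u))"
          by (subst G) (use ud in auto)
        then show ?thesis using 2 by simp
      next
        case 3
        have "G (r - 1) = F (r - 1 - t + u)" by (subst G) (use 3 ud in auto)
        moreover have "r \<noteq> Suc t" "\<not> r \<le> Suc t" "r - Suc t + u = r - 1 - t + u" using 3 by simp_all
        ultimately show ?thesis using 3 by (simp only: if_True if_False simp_thms)
      qed (use Suc.prems(2) G[of r] in simp_all)
    qed
  qed simp
  from this[of u r] show ?thesis using r u by (simp add: e_word_def del: upt_Suc)
qed

lemma e_word_letters: "u \<le> d \<Longrightarrow> r \<in> set (e_word d u) \<Longrightarrow> 1 \<le> r \<and> r < d"
  unfolding e_word_def by auto

lemma pi_map_power: "(pi_map ^^ u) q = (\<lambda>i j. q (i + int u) j)"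
  by (induction u) (simp_all add: pi_map_def fun_eq_iff add_ac)

lemma tpi_map_power: "(tpi_map ^^ u) q = (\<lambda>i j. q i (j - int u))"
  by (induction u) (simp_all add: tpi_map_def fun_eq_iff diff_diff_eq add_ac)

section \<open>The coordinates \<open>c\<close>\<close>

lemma delta_period: "q \<in> phase_space n m k \<Longrightarrow> delta m q (j + int n) = delta m q j"
proof -
  assume q: "q \<in> phase_space n m k"
  have "j + int n - int i + 1 = j - int i + 1 + int n" for i by simp
  then show ?thesis unfolding delta_def using phase_space_col[OF q] by (simp only:)
qed

text \<open>\<open>csum\<close> adds n/M values of \<open>delta\<close> with step m + k. Corrections
  T_j - T_(j-m-k) telescope to T_j - T_(j-nb), which vanishes since T has period n.\<close>

lemma csum_telescope:
  fixes T :: "int \<Rightarrow> complex"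
  assumes nk: "n \<ge> 2" "k \<ge> 1" and per: "\<And>j. T (j + int n) = T j"
    and d: "\<And>j. delta m p j = delta m q (j + d) + T j - T (j - int (m + k))"
  shows "csum n m k p j = csum n m k q (j + d)"
proof -
  define a where "a = n div gcd n (m + k)"
  define b where "b = (m + k) div gcd n (m + k)"
  have ab: "a * (m + k) = n * b" unfolding a_def b_def by (rule gcd_data(2)[OF nk refl])
  have "(\<Sum>l<a. delta m p (j - int (l * (m + k)))) =
      (\<Sum>l<a. delta m q (j + d - int (l * (m + k)))) + T j - T (j - int (a * (m + k)))"
  proof (induction a)
    case (Suc a)
    have "j - int (a * (m + k)) - int (m + k) = j - int (Suc a * (m + k))"
      "j - int (a * (m + k)) + d = j + d - int (a * (m + k))" by simp_all
    then have "delta m p (j - int (a * (m + k))) = delta m q (j + d - int (a * (m + k)))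
        + T (j - int (a * (m + k))) - T (j - int (Suc a * (m + k)))"
      using d[of "j - int (a * (m + k))"] by (simp only:)
    then show ?case unfolding sum.lessThan_Suc Suc by (simp only: add_ac diff_conv_add_uminus) simp
  qed simp
  moreover have "T (j - int (a * (m + k))) = T j"
    using periodic_multiple[where g = T and d = "int n" and j = j and z = "- int b"] per
    unfolding ab by simp
  ultimately show ?thesis unfolding csum_def a_def[symmetric] by (simp only: add_diff_cancel_right')
qed

text \<open>Period n is inherited from \<open>delta\<close>, period m + k follows by telescoping
  with T = \<open>delta\<close>, and Bezout combines them.\<close>

lemma csum_period:
  assumes nk: "n \<ge> 2" "k \<ge> 1" and q: "q \<in> phase_space n m k"
  shows "csum n m k q (j + int (gcd n (m + k))) = csum n m k q j"
proof -
  have n: "csum n m k q (j + int n) = csum n m k q j" for j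
  proof -
    have "j + int n - int (l * (m + k)) = j - int (l * (m + k)) + int n" for l by simp
    then show ?thesis unfolding csum_def using delta_period[OF q] by (simp only:)
  qed
  have mk: "csum n m k q (j + int (m + k)) = csum n m k q j" for j
  proof -
    have "csum n m k q (j + int (m + k)) = csum n m k q (j + int (m + k) + - int (m + k))"
      by (rule csum_telescope[where T = "delta m q", OF nk delta_period[OF q]])
        (simp only: diff_conv_add_uminus add.commute[of "delta m q _" "delta m q _"] add.assoc right_minus add_0_right)
    then show ?thesis by simp
  qed
  obtain x y where xy: "x * int n + y * int (m + k) = int (gcd n (m + k))"
    using bezout_int[of "int n" "int (m + k)"] by (metis gcd_int_int_eq)
  have "csum n m k q (j + int (gcd n (m + k))) = csum n m k q (j + int n * x + int (m + k) * y)"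
    unfolding xy[symmetric] by (simp only: mult.commute add.assoc)
  also have "\<dots> = csum n m k q (j + int n * x)"
    by (rule periodic_multiple[where g = "csum n m k q", OF mk])
  also have "\<dots> = csum n m k q j"
    by (rule periodic_multiple[where g = "csum n m k q", OF n])
  finally show ?thesis .
qed

lemma tau_inv_periodic:
  assumes "M > 0" and "h (1 + int M) = h 1"
  shows "tau_inv (map (\<lambda>l. h (int l)) [1..<Suc M]) = map (\<lambda>l. h (int l + 1)) [1..<Suc M]"
proof -
  obtain M' where M: "M = Suc M'" using assms(1) by (cases M) auto
  have "map (\<lambda>l. h (int l)) [1..<Suc M] = h 1 # map (\<lambda>l. h (int l)) [2..<Suc M]"
    unfolding M by (subst upt_conv_Cons) (simp_all add: numeral_2_eq_2 del: upt_Suc)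
  moreover have "map (\<lambda>l. h (int l)) [2..<Suc M] = map (\<lambda>l. h (int l + 1)) [1..<M]"
    by (rule nth_equalityI) (simp_all add: M algebra_simps del: upt_Suc)
  moreover have "map (\<lambda>l. h (int l + 1)) [1..<Suc M] = map (\<lambda>l. h (int l + 1)) [1..<M] @ [h 1]"
    using assms by (simp add: add.commute)
  ultimately show ?thesis by (simp only: tau_inv_def list.sel)
qed

lemma tau_inv_power_periodic:
  assumes M: "M > 0" and per: "\<And>j. h (j + int M) = h j"
  shows "(tau_inv ^^ u) (map (\<lambda>l. h (int l)) [1..<Suc M]) = map (\<lambda>l. h (int l + int u)) [1..<Suc M]"
proof (induction u)
  case (Suc u)
  have "1 + int M + int u = 1 + int u + int M" by simp
  then have "tau_inv (map (\<lambda>l. h (int l + int u)) [1..<Suc M]) = map (\<lambda>l. h (int l + 1 + int u)) [1..<Suc M]"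
    by (intro tau_inv_periodic[where h = "\<lambda>j. h (j + int u)", OF M]) (simp only: per)
  then show ?case using Suc by (simp add: algebra_simps del: upt_Suc)
qed simp

lemma tau_power_periodic:
  assumes M: "M > 0" and per: "\<And>j. h (j + int M) = h j"
  shows "(tau ^^ u) (map (\<lambda>l. h (int l)) [1..<Suc M]) = map (\<lambda>l. h (int l - int u)) [1..<Suc M]"
proof (induction u)
  case (Suc u)
  have "1 + int M - int (Suc u) = 1 - int (Suc u) + int M" by simp
  then have "tau_inv (map (\<lambda>l. h (int l - int (Suc u))) [1..<Suc M]) = map (\<lambda>l. h (int l + 1 - int (Suc u))) [1..<Suc M]"
    by (intro tau_inv_periodic[where h = "\<lambda>j. h (j - int (Suc u))", OF M]) (simp only: per)
  also have "\<dots> = map (\<lambda>l. h (int l - int u)) [1..<Suc M]" by (simp del: upt_Suc)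
  finally have "tau (map (\<lambda>l. h (int l - int u)) [1..<Suc M])
      = tau (tau_inv (map (\<lambda>l. h (int l - int (Suc u))) [1..<Suc M]))" by simp
  also have "\<dots> = map (\<lambda>l. h (int l - int (Suc u))) [1..<Suc M]"
    using M by (intro tau_tau_inv(1)) simp
  finally show ?case using Suc by simp
qed simp

lemma c_list_shift:
  assumes "n \<ge> 2" "k \<ge> 1" "m \<ge> 1" and q: "q \<in> phase_space n m k" and p: "p \<in> phase_space n m k"
  shows "(\<And>j. csum n m k p j = csum n m k q (j + int u)) \<Longrightarrow> c_list n m k p = (tau_inv ^^ u) (c_list n m k q)"
    and "(\<And>j. csum n m k p j = csum n m k q (j - int u)) \<Longrightarrow> c_list n m k p = (tau ^^ u) (c_list n m k q)"
proof -
  have M: "gcd n (m + k) > 0" using assms(1) by simp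
  note per = csum_period[OF assms(1,2) q]
  show "c_list n m k p = (tau_inv ^^ u) (c_list n m k q)" if "\<And>j. csum n m k p j = csum n m k q (j + int u)"
    unfolding c_list_csum[OF assms(1-3) q] c_list_csum[OF assms(1-3) p]
      tau_inv_power_periodic[where h = "csum n m k q", OF M per] that ..
  show "c_list n m k p = (tau ^^ u) (c_list n m k q)" if "\<And>j. csum n m k p j = csum n m k q (j - int u)"
    unfolding c_list_csum[OF assms(1-3) q] c_list_csum[OF assms(1-3) p]
      tau_power_periodic[where h = "csum n m k q", OF M per] that ..
qed

section \<open>The effect of one exchange or shift\<close>

lemma sum_exchange:
  fixes f g :: "nat \<Rightarrow> 'a :: comm_monoid_add"
  assumes r: "1 \<le> r" "r < m" and fg: "f r + f (r + 1) = g r + g (r + 1)"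
    and eq: "\<And>i. i \<in> {1..m} \<Longrightarrow> i \<noteq> r \<Longrightarrow> i \<noteq> r + 1 \<Longrightarrow> f i = g i"
  shows "sum f {1..m} = sum g {1..m}"
proof -
  have "sum h {1..m} = sum h ({1..m} - {r, r + 1}) + (h r + h (r + 1))" for h :: "nat \<Rightarrow> 'a"
    using r sum.subset_diff[of "{r, r + 1}" "{1..m}" h] by simp
  moreover have "sum f ({1..m} - {r, r + 1}) = sum g ({1..m} - {r, r + 1})"
    by (rule sum.cong[OF refl]) (use eq in blast)
  ultimately show ?thesis using fg by simp
qed

lemma prod_exchange:
  fixes f g :: "nat \<Rightarrow> 'a :: comm_monoid_mult"
  assumes r: "1 \<le> r" "r < m" and fg: "f r * f (r + 1) = g r * g (r + 1)"
    and eq: "\<And>i. i \<in> {1..m} \<Longrightarrow> i \<noteq> r \<Longrightarrow> i \<noteq> r + 1 \<Longrightarrow> f i = g i"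
  shows "prod f {1..m} = prod g {1..m}"
proof -
  have "prod h {1..m} = prod h ({1..m} - {r, r + 1}) * (h r * h (r + 1))" for h :: "nat \<Rightarrow> 'a"
    using r prod.subset_diff[of "{r, r + 1}" "{1..m}" h] by simp
  moreover have "prod f ({1..m} - {r, r + 1}) = prod g ({1..m} - {r, r + 1})"
    by (rule prod.cong[OF refl]) (use eq in blast)
  ultimately show ?thesis using fg by simp
qed

lemma Tl_rows_cong: "(\<And>i. i \<in> set is \<Longrightarrow> p i = q i) \<Longrightarrow> Tl p is v = Tl q is v"
  by (induction "is") (simp_all add: Tq_def)

lemma pi_map_phase_space:
  assumes "q \<in> phase_space n m k" shows "pi_map q \<in> phase_space n m k"
proof -
  have "i + int m + 1 = i + 1 + int m" for i :: int by simp
  then show ?thesis using phase_space_col[OF assms] phase_space_row[OF assms]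
    unfolding phase_space_def pi_map_def mem_Collect_eq by (simp only: simp_thms)
qed

text \<open>Rotating the rows removes the summand of row 1 from \<open>delta\<close> and adds that
  of row m + 1, which is row 1 moved by k columns; the correction telescopes.\<close>

lemma csum_pi_map:
  assumes "n \<ge> 2" "k \<ge> 1" and q: "q \<in> phase_space n m k"
  shows "csum n m k (pi_map q) j = csum n m k q (j + 1)"
proof (rule csum_telescope[where T = "\<lambda>j. - q 1 (j + 1)", OF assms(1,2)])
  fix j
  have "j + int n + 1 = j + 1 + int n" by simp
  then show "- q 1 (j + int n + 1) = - q 1 (j + 1)" using phase_space_col[OF q] by (simp only:)
  have tel: "(\<Sum>i=1..m. h (Suc i)) = (\<Sum>i=1..m. h i) + h (Suc m) - h 1" for h :: "nat \<Rightarrow> complex"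
    by (induction m) simp_all
  have "delta m (pi_map q) j = (\<Sum>i=1..m. q (int (Suc i)) (j + 1 - int (Suc i) + 1))"
    by (simp add: delta_def pi_map_def algebra_simps)
  also have "\<dots> = delta m q (j + 1) + q (int (Suc m)) (j + 1 - int (Suc m) + 1) - q 1 (j + 1)"
    using tel[of "\<lambda>i. q (int i) (j + 1 - int i + 1)"] by (simp add: delta_def)
  also have "q (int (Suc m)) (j + 1 - int (Suc m) + 1) = q 1 (j - int (m + k) + 1)"
    using phase_space_row[OF q, of 1 "j + 1 - int m"] by (simp add: algebra_simps)
  finally show "delta m (pi_map q) j = delta m q (j + 1) + - q 1 (j + 1) - - q 1 (j - int (m + k) + 1)"
    by simp
qed

text \<open>The gauge transformation 1 + \<tau> P^(-1) of a column exchange, acting against the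
  direction of the shift P.\<close>

definition Aop :: "(int \<Rightarrow> complex) \<Rightarrow> (int \<Rightarrow> poly2) \<Rightarrow> int \<Rightarrow> poly2" where
  "Aop \<tau> v = (\<lambda>j. v j + const2 (\<tau> j) * v (j + 1))"

text \<open>The hypotheses compare the coefficients of w_j and w_(j+1) in Q_i(p) (1 + t_(i+1)
  P^(-1)) = (1 + t_i P^(-1)) Q_i(q). Chained over the rows, the gauge factor travels from one end of
  the product to the other.\<close>

lemma Tl_Aop:
  assumes "\<And>i j. p i j + t (i + 1) (j - 1) = q i j + t i j"
    and "\<And>i j. p i j * t (i + 1) j = t i j * q i (j + 1)"
  shows "Tl p [1..int u] (Aop (t (int u + 1)) w) = Aop (t 1) (Tl q [1..int u] w)"
proof -
  have T: "Tq p i (Aop (t (i + 1)) w) = Aop (t i) (Tq q i w)" for i w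
  proof
    fix j
    have "Tq p i (Aop (t (i + 1)) w) j =
        const2 (p i j + t (i + 1) (j - 1)) * w j + const2 (p i j * t (i + 1) j) * w (j + 1) + w (j - 1)"
      by (simp add: Tq_def Aop_def algebra_simps)
    also have "\<dots> = const2 (q i j + t i j) * w j + const2 (t i j * q i (j + 1)) * w (j + 1) + w (j - 1)"
      by (simp only: assms)
    also have "\<dots> = Aop (t i) (Tq q i w) j" by (simp add: Tq_def Aop_def algebra_simps)
    finally show "Tq p i (Aop (t (i + 1)) w) j = Aop (t i) (Tq q i w) j" .
  qed
  show ?thesis
  proof (induction u arbitrary: w)
    case (Suc u)
    have u: "[1..int (Suc u)] = [1..int u] @ [int u + 1]" using upto_rec2[of 1 "int u + 1"] by (simp add: add.commute)
    have "int (Suc u) + 1 = int u + 1 + 1" by simp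
    then show ?case unfolding u Tl_simps using T[of "int u + 1"] Suc by (simp only:)
  qed simp
qed

context spectral_curve
begin

text \<open>\<open>sigma\<close> is a product of n' values of \<open>dprod\<close> with step k.
  Factors G_(j-k)/G_j telescope over n' k = n k', a multiple of the period of G; the offset d lets
  the residue class change.\<close>

lemma sigma_telescope:
  fixes G :: "int \<Rightarrow> complex"
  assumes p: "p \<in> phase_space n m k" and q: "q \<in> phase_space n m k"
    and per: "\<And>j. G (j + int n) = G j" and nz: "\<And>j. int N dvd j - int r \<Longrightarrow> G j \<noteq> 0"
    and d: "\<And>j. int N dvd j - int r \<Longrightarrow> dprod m p j = dprod m q (j + d) * (G (j - int k) / G j)"
    and r: "int N dvd int r + d - int r'"
  shows "sigma n m k p r = sigma n m k q r'"
proof -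
  have Nk: "int N dvd int r - int (s * k) - int r" for s by (simp add: int_kN)
  have tel: "(\<Prod>s<t. G (int r - int (s * k) - int k) / G (int r - int (s * k))) = G (int r - int (t * k)) / G (int r)" for t
  proof (induction t)
    case 0
    then show ?case using nz[of "int r"] by simp
  next
    case (Suc t)
    have "int r - int (t * k) - int k = int r - int (Suc t * k)" by simp
    then show ?case unfolding prod.lessThan_Suc Suc using nz[OF Nk[of t]] by (simp only:) simp
  qed
  have "sigma n m k p r = (\<Prod>s<n'. dprod m p (int r - int (s * k)))"
    by (rule dprod_sigma[OF p, symmetric]) simp
  also have "\<dots> = (\<Prod>s<n'. dprod m q (int r + d - int (s * k)) *
      (G (int r - int (s * k) - int k) / G (int r - int (s * k))))"
  proof (rule prod.cong[OF refl])
    fix s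
    have "int r - int (s * k) + d = int r + d - int (s * k)" by simp
    then show "dprod m p (int r - int (s * k)) = dprod m q (int r + d - int (s * k)) *
      (G (int r - int (s * k) - int k) / G (int r - int (s * k)))" using d[OF Nk[of s]] by (simp only:)
  qed
  also have "\<dots> = sigma n m k q r' * (G (int r - int (n' * k)) / G (int r))"
    unfolding prod.distrib tel by (simp only: dprod_sigma[OF q r])
  also have "G (int r - int (n' * k)) = G (int r)"
    using periodic_multiple[where g = G and d = "int n" and j = "int r" and z = "- int k'"] per
    unfolding n'k by simp
  finally show ?thesis using nz[of "int r"] by simp
qed

lemma eps_prod: "eps q i = (-1) ^ n * (\<Prod>s<n. q i (1 + int s))"
  using prod.atLeast1_atMost_eq[of "\<lambda>j. q i (int j)" n] by (simp add: eps_def)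

lemma eps_row_shift:
  assumes q: "q \<in> phase_space n m k" shows "eps q (i + int m) = eps q i"
proof -
  have "q (i + int m) (1 + int s) = q i (1 - int k + int s)" for s
    using phase_space_row[OF q, of i "1 + int s"] by (simp add: algebra_simps)
  then have "eps q (i + int m) = (-1) ^ n * (\<Prod>s<n. q i (1 - int k + int s))"
    unfolding eps_prod by (simp only:)
  also have "\<dots> = eps q i"
    unfolding eps_prod using period_prod[of "q i" n, OF phase_space_col[OF q]] by (simp only:)
  finally show ?thesis .
qed

lemma sigma_pi_map:
  assumes q: "q \<in> phase_space n m k" and nz: "\<And>i j. q i j \<noteq> 0"
  shows "sigma n m k (pi_map q) r = sigma n m k q r"
proof (rule sigma_telescope[where G = "q 1" and d = 0, OF pi_map_phase_space[OF q] q phase_space_col[OF q]])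
  fix j
  have tel: "(\<Prod>i=1..m. h (Suc i)) * h 1 = (\<Prod>i=1..m. h i) * h (Suc m)" for h :: "nat \<Rightarrow> complex"
    by (induction m) (simp_all add: mult_ac)
  have "dprod m (pi_map q) j * q 1 j = dprod m q j * q (1 + int m) j"
    using tel[of "\<lambda>i. q (int i) j"] by (simp add: dprod_def pi_map_def add.commute)
  then show "dprod m (pi_map q) j = dprod m q (j + 0) * (q 1 (j - int k) / q 1 j)"
    using nz[of 1 j] phase_space_row[OF q, of 1 j] by (simp add: field_simps)
qed (use nz in simp_all)

lemma pi_map_power_effect:
  assumes q: "q \<in> phase_space n m k" and nz: "\<And>i j. q i j \<noteq> 0"
  shows "(pi_map ^^ u) q \<in> phase_space n m k"
    and "csum n m k ((pi_map ^^ u) q) j = csum n m k q (j + int u)"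
    and "sigma n m k ((pi_map ^^ u) q) r = sigma n m k q r"
proof -
  have "(pi_map ^^ u) q \<in> phase_space n m k \<and> (\<forall>j. csum n m k ((pi_map ^^ u) q) j = csum n m k q (j + int u)) \<and>
      sigma n m k ((pi_map ^^ u) q) r = sigma n m k q r"
  proof (induction u)
    case (Suc u)
    define x where "x = (pi_map ^^ u) q"
    have x: "x \<in> phase_space n m k" "\<And>j. csum n m k x j = csum n m k q (j + int u)" "sigma n m k x r = sigma n m k q r"
      using Suc by (simp_all add: x_def)
    have nzx: "x i j \<noteq> 0" for i j using nz by (simp add: x_def pi_map_power)
    have x1: "(pi_map ^^ Suc u) q = pi_map x" by (simp add: x_def)
    show ?case unfolding x1 using pi_map_phase_space[OF x(1)] sigma_pi_map[OF x(1) nzx] csum_pi_map[OF n2 k1 x(1)] x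
      by (simp add: algebra_simps)
  qed (use q in simp)
  then show "(pi_map ^^ u) q \<in> phase_space n m k"
    "csum n m k ((pi_map ^^ u) q) j = csum n m k q (j + int u)"
    "sigma n m k ((pi_map ^^ u) q) r = sigma n m k q r" by simp_all
qed

lemma tpi_map_power_effect:
  assumes q: "q \<in> phase_space n m k"
  shows "(tpi_map ^^ u) q \<in> phase_space n m k"
    and "csum n m k ((tpi_map ^^ u) q) j = csum n m k q (j - int u)"
    and "int N dvd int r - int u - int r' \<Longrightarrow> sigma n m k ((tpi_map ^^ u) q) r = sigma n m k q r'"
    and "eps ((tpi_map ^^ u) q) i = eps q i"
proof -
  have c: "j + int n - int u = j - int u + int n" "j - int k - int u = j - int u - int k" for j by simp_all
  show ps: "(tpi_map ^^ u) q \<in> phase_space n m k"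
    unfolding phase_space_def tpi_map_power mem_Collect_eq c
    using phase_space_col[OF q] phase_space_row[OF q] by simp
  show "csum n m k ((tpi_map ^^ u) q) j = csum n m k q (j - int u)"
    using csum_telescope[where T = "\<lambda>_. 0" and d = "- int u" and p = "(tpi_map ^^ u) q" and q = q, OF n2 k1]
    by (simp add: tpi_map_power delta_def algebra_simps)
  show "sigma n m k ((tpi_map ^^ u) q) r = sigma n m k q r'" if "int N dvd int r - int u - int r'"
    by (rule sigma_telescope[where G = "\<lambda>_. 1" and d = "- int u", OF ps q])
      (use that in \<open>simp_all add: tpi_map_power dprod_def\<close>)
  have s: "1 + int s - int u = 1 - int u + int s" for s by simp
  show "eps ((tpi_map ^^ u) q) i = eps q i"
    unfolding eps_prod tpi_map_power s using period_prod[of "q i" n, OF phase_space_col[OF q]] by (simp only:)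
qed

lemma s_map_effect:
  assumes q: "q \<in> phase_space n m k" and r: "1 \<le> r" "r < m" and s: "s_map n m k r q = Some p"
  shows "p \<in> phase_space n m k" and "Lop m k p = Lop m k q"
    and "csum n m k p j = csum n m k q j" and "sigma n m k p t = sigma n m k q t"
    and "i \<in> {1..m} \<Longrightarrow> eps p (int i) = swap_at r (\<lambda>i. eps q (int i)) i"
proof -
  have n1: "n \<ge> 1" using n2 by simp
  show p: "p \<in> phase_space n m k" by (rule s_map_explicit(1)[OF q n1 r s])
  obtain e \<kappa> where e: "\<forall>j. e j \<noteq> 0" "\<forall>j. e (j + int n) = e j"
      "\<forall>j. p (int r) j = q (int r + 1) j * e j / e (j - 1)"
      "\<forall>j. p (int r + 1) j = q (int r) j * e (j - 1) / e j"
      "\<forall>i\<in>{1..int m} - {int r, int r + 1}. \<forall>j. p i j = q i j"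
      "\<forall>j. q (int r) j * e (j - 1) - q (int r + 1) j * e j = \<kappa>"
    using s_map_explicit(2)[OF q n1 r s] by (elim exE conjE)
  have e0: "e j \<noteq> 0" for j using e(1) by (rule spec)
  note p0 = e(3)[rule_format] and p1 = e(4)[rule_format]
  have K: "q (int r) j * e (j - 1) = \<kappa> + q (int r + 1) j * e j" for j
    using e(6)[rule_format, of j] by (simp only: diff_eq_eq)
  have other: "p i = q i" if "1 \<le> i" "i \<le> int m" "i \<noteq> int r" "i \<noteq> int r + 1" for i
    using e(5) that by (intro ext) simp
  have A: "p (int r) j * p (int r + 1) j = q (int r) j * q (int r + 1) j" for j
    unfolding p0 p1 using e0[of j] e0[of "j - 1"] by simp
  \<comment> \<open>By the relation with \<kappa> the two entries change by \<kappa>/e_(j-1) with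
    opposite signs.\<close>
  have B: "p (int r) j + p (int r + 1) (j - 1) = q (int r) j + q (int r + 1) (j - 1)" for j
  proof -
    have "p (int r) j = q (int r) j - \<kappa> / e (j - 1)"
      unfolding p0 using K[of j] e0[of "j - 1"] by (simp add: field_simps)
    moreover have "p (int r + 1) (j - 1) = q (int r + 1) (j - 1) + \<kappa> / e (j - 1)"
      unfolding p1 K add_divide_distrib using e0[of "j - 1"] by simp
    ultimately show ?thesis by simp
  qed
  \<comment> \<open>Q_r Q_(r+1) is determined by the products of A and the shifted sums of
    B.\<close>
  have T: "Tq p (int r) (Tq p (int r + 1) w) = Tq q (int r) (Tq q (int r + 1) w)" for w
  proof
    fix j
    have ex: "Tq x (int r) (Tq x (int r + 1) w) j = const2 (x (int r) j * x (int r + 1) j) * w j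
        + const2 (x (int r) j + x (int r + 1) (j - 1)) * w (j - 1) + w (j - 1 - 1)" for x
      by (simp add: Tq_def algebra_simps)
    show "Tq p (int r) (Tq p (int r + 1) w) j = Tq q (int r) (Tq q (int r + 1) w) j"
      unfolding ex A B ..
  qed
  have sp: "[1..int m] = [1..int r - 1] @ int r # (int r + 1) # [int r + 2..int m]"
    using upto_split[of "int r"] r upto_rec1[of "int r + 1" "int m"] by (simp add: add.commute)
  show "Lop m k p = Lop m k q"
  proof (rule ext)
    fix v
    have "Tl p [int r + 2..int m] w = Tl q [int r + 2..int m] w" "Tl p [1..int r - 1] w = Tl q [1..int r - 1] w" for w
      by (rule Tl_rows_cong, rule other; use r in simp)+
    then show "Lop m k p v = Lop m k q v" unfolding Lop_def sp Tl_simps T by (simp only:)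
  qed
  have other': "p (int i) = q (int i)" if "i \<in> {1..m}" "i \<noteq> r" "i \<noteq> r + 1" for i
    using that by (intro other) auto
  have r1: "int (r + 1) = int r + 1" by simp
  have "delta m p j = delta m q j" for j
    unfolding delta_def
  proof (rule sum_exchange[OF r])
    have "j - (int r + 1) + 1 = j - int r + 1 - 1" by simp
    then show "p (int r) (j - int r + 1) + p (int (r + 1)) (j - int (r + 1) + 1)
      = q (int r) (j - int r + 1) + q (int (r + 1)) (j - int (r + 1) + 1)"
      unfolding r1 using B[of "j - int r + 1"] by (simp only:)
  next
    show "p (int i) (j - int i + 1) = q (int i) (j - int i + 1)" if "i \<in> {1..m}" "i \<noteq> r" "i \<noteq> r + 1" for i
      unfolding other'[OF that] ..
  qed
  then show "csum n m k p j = csum n m k q j" unfolding csum_def by (simp only:)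
  have dp: "dprod m p j = dprod m q j" for j
    unfolding dprod_def
  proof (rule prod_exchange[OF r])
    show "p (int r) j * p (int (r + 1)) j = q (int r) j * q (int (r + 1)) j" unfolding r1 by (rule A)
    show "p (int i) j = q (int i) j" if "i \<in> {1..m}" "i \<noteq> r" "i \<noteq> r + 1" for i unfolding other'[OF that] ..
  qed
  show "sigma n m k p t = sigma n m k q t"
    by (rule sigma_telescope[where G = "\<lambda>_. 1" and d = 0, OF p q]) (simp_all add: dp)
  \<comment> \<open>Around a period the factors e_j/e_(j-1) multiply to 1, so the two row products
    are merely interchanged.\<close>
  have tel: "(\<Prod>j=1..n. e (int j) / e (int j - 1)) = 1"
    using prod_telescope[of e n, OF e0] e(2)[rule_format, of 0] e0[of 0] by simp
  have "(\<Prod>j=1..n. p (int r) (int j)) = (\<Prod>j=1..n. q (int r + 1) (int j)) * (\<Prod>j=1..n. e (int j) / e (int j - 1))"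
    unfolding p0 prod.distrib[symmetric] by simp
  then have E0: "eps p (int r) = eps q (int r + 1)" by (simp only: eps_def tel mult_1_right)
  have "(\<Prod>j=1..n. p (int r + 1) (int j)) * (\<Prod>j=1..n. e (int j) / e (int j - 1)) = (\<Prod>j=1..n. q (int r) (int j))"
    unfolding p1 prod.distrib[symmetric] using e0 by simp
  then have E1: "eps p (int r + 1) = eps q (int r)" by (simp only: eps_def tel mult_1_right)
  show "eps p (int i) = swap_at r (\<lambda>i. eps q (int i)) i" if "i \<in> {1..m}"
  proof -
    consider "i = r" | "i = Suc r" | "i \<noteq> r" "i \<noteq> r + 1" by force
    then show ?thesis
    proof cases
      case 3
      then show ?thesis using other'[OF that] by (simp add: swap_at_def eps_def)
    qed (use E0 E1 in \<open>simp_all add: swap_at_def add.commute\<close>)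
  qed
qed

lemma ts_map_effect:
  assumes q: "q \<in> phase_space n m k" and nz: "\<And>i j. q i j \<noteq> 0"
    and r: "1 \<le> r" "r < N" and s: "ts_map n m k r q = Some p"
  defines "c \<equiv> N - r"
  shows "p \<in> phase_space n m k"
    and "\<exists>\<tau>. (\<forall>j. \<not> int N dvd j - int c \<longrightarrow> \<tau> j = 0) \<and> (\<forall>j. \<tau> (j + int n) = \<tau> j) \<and>
      (\<forall>w. Lop m k p (Aop \<tau> w) = Aop \<tau> (Lop m k q w))"
    and "csum n m k p j = csum n m k q j" and "eps p i = eps q i"
    and "sigma n m k p c = sigma n m k q (c + 1)" and "sigma n m k p (c + 1) = sigma n m k q c"
    and "t \<in> {1..N} \<Longrightarrow> t \<noteq> c \<Longrightarrow> t \<noteq> c + 1 \<Longrightarrow> sigma n m k p t = sigma n m k q t"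
proof -
  have n1: "n \<ge> 1" using n2 by simp
  have r': "r < gcd n k" using r(2) by (simp add: N_def)
  have c: "1 \<le> c" "c < N" using r by (simp_all add: c_def)
  note ex = ts_map_explicit[OF q n1 m1 k1 r(1) r' s, folded N_def, folded c_def]
  show p: "p \<in> phase_space n m k" by (rule ex(1))
  obtain F \<kappa> where F: "F \<in> phase_space n m k"
      and F0: "\<forall>i j. int N dvd j - int c \<longrightarrow> F i j \<noteq> 0"
      and pF: "\<forall>i j. int N dvd j - int c \<longrightarrow> p i j = q i (j + 1) * F (i + 1) j / F i j \<and>
         p i (j + 1) = q i j * F i j / F (i + 1) j"
      and po: "\<forall>i j. \<not> int N dvd j - int c \<longrightarrow> \<not> int N dvd j - 1 - int c \<longrightarrow> p i j = q i j"
      and \<kappa>k: "\<forall>j. \<kappa> (j - int k) = \<kappa> j" and \<kappa>n: "\<forall>j. \<kappa> (j + int n) = (\<kappa> j :: complex)"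
      and rec: "\<forall>i j. q i (j + 1) * F (i + 1) j - q i j * F i j = \<kappa> j"
    using ex(2) by (elim exE conjE)
  define cl where "cl j \<longleftrightarrow> int N dvd j - int c" for j
  have F0: "F i j \<noteq> 0" if "cl j" for i j
    by (rule F0[rule_format]) (rule that[unfolded cl_def])
  have p0: "p i j = q i (j + 1) * F (i + 1) j / F i j" and p1: "p i (j + 1) = q i j * F i j / F (i + 1) j"
    if "cl j" for i j using pF that by (simp_all only: cl_def)
  have po: "p i j = q i j" if "\<not> cl j" "\<not> cl (j - 1)" for i j using po that by (simp only: cl_def) simp
  have rec: "q i (j + 1) * F (i + 1) j = q i j * F i j + \<kappa> j" for i j
    using rec[rule_format, of i j] by (simp add: algebra_simps)
  have cl1: "\<not> cl (j + 1)" if "cl j" for j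
  proof
    assume "cl (j + 1)"
    then have "int N dvd (j + 1 - int c) - (j - int c)" using that unfolding cl_def by (rule dvd_diff)
    then have "int N dvd 1" by simp
    then show False using c by simp
  qed
  have Nn: "int N dvd int n" "int N dvd int k" by (simp_all add: N_def)
  have cln: "cl (j + int n) \<longleftrightarrow> cl j" for j
  proof -
    have "j + int n - int c = j - int c + int n" by simp
    then show ?thesis unfolding cl_def using dvd_add_left_iff[OF Nn(1), of "j - int c"] by (simp only:)
  qed
  have clk: "cl (j - int k) \<longleftrightarrow> cl j" for j
  proof -
    have "j - int c = j - int k - int c + int k" by simp
    then show ?thesis unfolding cl_def using dvd_add_left_iff[OF Nn(2), of "j - int k - int c"] by (simp only:)
  qed
  \<comment> \<open>The solution of the gauge relations: on the class of c, \<kappa>_j/F_ij is the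
    change p_ij - q_ij.\<close>
  define t where "t i j = (if cl j then \<kappa> j / F i j else 0)" for i j
  have t1: "p i j + t (i + 1) (j - 1) = q i j + t i j" for i j
  proof -
    consider "cl j" "\<not> cl (j - 1)" | "cl (j - 1)" "\<not> cl j" | "\<not> cl j" "\<not> cl (j - 1)"
      using cl1[of "j - 1"] by force
    then show ?thesis
    proof cases
      case 1
      then show ?thesis unfolding t_def p0[OF 1(1)] rec add_divide_distrib using F0[OF 1(1), of i] by simp
    next
      case 2
      have "p i j = q i (j - 1) * F i (j - 1) / F (i + 1) (j - 1)" using p1[OF 2(1), of i] by simp
      also have "q i (j - 1) * F i (j - 1) = q i j * F (i + 1) (j - 1) - \<kappa> (j - 1)"
        using rec[of i "j - 1"] by simp
      finally show ?thesis unfolding t_def using 2 F0[OF 2(1), of "i + 1"] by (simp add: field_simps)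
    next
      case 3
      then show ?thesis using po[OF 3] by (simp add: t_def)
    qed
  qed
  have t2: "p i j * t (i + 1) j = t i j * q i (j + 1)" for i j
    using F0[of j i] F0[of j "i + 1"] p0[of j i] by (simp add: t_def)
  have tn: "t i (j + int n) = t i j" for i j
    unfolding t_def cln phase_space_col[OF F] \<kappa>n[rule_format] ..
  have tm: "t (1 + int m) j = t 1 (j - int k)" for j
    unfolding t_def clk phase_space_row[OF F] \<kappa>k[rule_format] ..
  show "\<exists>\<tau>. (\<forall>j. \<not> int N dvd j - int c \<longrightarrow> \<tau> j = 0) \<and> (\<forall>j. \<tau> (j + int n) = \<tau> j) \<and>
      (\<forall>w. Lop m k p (Aop \<tau> w) = Aop \<tau> (Lop m k q w))"
  proof (intro exI[of _ "t 1"] conjI allI impI)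
    show "t 1 j = 0" if "\<not> int N dvd j - int c" for j using that by (simp add: t_def cl_def)
    show "t 1 (j + int n) = t 1 j" for j by (rule tn)
    \<comment> \<open>In row m + 1 the gauge factor is that of row 1 moved by k columns, so P^k
      carries it back to the first one and L is conjugated.\<close>
    have sh: "shift (int k) (Aop (t 1) w) = Aop (t (int m + 1)) (shift (int k) w)" for w
      using tm by (simp add: shift_def Aop_def fun_eq_iff add.commute algebra_simps)
    show "Lop m k p (Aop (t 1) w) = Aop (t 1) (Lop m k q w)" for w
      unfolding Lop_def sh by (rule Tl_Aop[where t = t, OF t1 t2])
  qed
  have "csum n m k p j = csum n m k q (j + 0)"
  proof (rule csum_telescope[where T = "t 1", OF n2 k1 tn])
    fix j
    \<comment> \<open>Along the diagonal that defines \<open>delta\<close> the changes p - q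
      telescope in the gauge parameters.\<close>
    have "(\<Sum>i=1..u. p (int i) (j - int i + 1)) = (\<Sum>i=1..u. q (int i) (j - int i + 1))
        + t 1 j - t (int u + 1) (j - int u)" for u
    proof (induction u)
      case (Suc u)
      have e1: "(\<Sum>i=1..Suc u. x (int i) (j - int i + 1)) = (\<Sum>i=1..u. x (int i) (j - int i + 1))
          + x (int u + 1) (j - int u)" for x :: point
        by (simp add: add.commute)
      have e2: "int (Suc u) + 1 = int u + 1 + 1" "j - int (Suc u) = j - int u - 1" by simp_all
      have pq: "p (int u + 1) (j - int u) = q (int u + 1) (j - int u) + t (int u + 1) (j - int u)
          - t (int u + 1 + 1) (j - int u - 1)"
        unfolding t1[of "int u + 1" "j - int u", symmetric] by simp
      show ?case unfolding e1 e2 Suc pq by simp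
    qed simp
    from this[of m] have "delta m p j = delta m q j + t 1 j - t (int m + 1) (j - int m)"
      unfolding delta_def .
    moreover have "t (int m + 1) (j - int m) = t 1 (j - int (m + k))"
      using tm[of "j - int m"] by (simp add: algebra_simps)
    ultimately show "delta m p j = delta m q (j + 0) + t 1 j - t 1 (j - int (m + k))" by simp
  qed
  then show "csum n m k p j = csum n m k q j" by simp
  \<comment> \<open>For the fixed row i this gives p_ij = q_ij \<rho>_j/\<rho>_(j-1). Over a period
    of columns the quotients cancel, so row products are preserved.\<close>
  define \<rho> where "\<rho> j = (if cl j then q i (j + 1) * F (i + 1) j / (q i j * F i j) else 1)" for j
  have \<rho>0: "\<rho> j \<noteq> 0" for j using nz F0[of j] by (simp add: \<rho>_def)
  have \<rho>n: "\<rho> (j + int n) = \<rho> j" for j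
  proof -
    have "j + int n + 1 = j + 1 + int n" by simp
    then show ?thesis unfolding \<rho>_def cln phase_space_col[OF F] phase_space_col[OF q]
      using phase_space_col[OF q] by (simp only:)
  qed
  have p\<rho>: "p i j = q i j * (\<rho> j / \<rho> (j - 1))" for j
  proof -
    consider "cl j" "\<not> cl (j - 1)" | "cl (j - 1)" "\<not> cl j" | "\<not> cl j" "\<not> cl (j - 1)"
      using cl1[of "j - 1"] by force
    then show ?thesis
    proof cases
      case 1
      then show ?thesis unfolding p0[OF 1(1)] \<rho>_def using nz[of i j] by simp
    next
      case 2
      have "p i j = q i (j - 1) * F i (j - 1) / F (i + 1) (j - 1)" using p1[OF 2(1), of i] by simp
      then show ?thesis unfolding \<rho>_def using 2 nz[of i j] by simp
    next
      case 3
      then show ?thesis using po[OF 3] by (simp add: \<rho>_def)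
    qed
  qed
  have "(\<Prod>j=1..n. \<rho> (int j) / \<rho> (int j - 1)) = 1"
    using prod_telescope[of \<rho> n, OF \<rho>0] \<rho>n[of 0] \<rho>0[of 0] by simp
  then show "eps p i = eps q i" unfolding eps_def p\<rho> prod.distrib by (simp only: mult_1_right)
  \<comment> \<open>Over the rows 1 to m the quotients F_(i+1)/F_i telescope, and F in row m + 1 is
    F in row 1 moved by k columns.\<close>
  have dF: "dprod m p j = dprod m q (j + 1) * (F 1 (j - int k) / F 1 j)" if j: "cl j" for j
  proof -
    have "(\<Prod>i=1..m. F (int i + 1) j / F (int i - 1 + 1) j) = F (int m + 1) j / F (0 + 1) j"
      by (rule prod_telescope[where e = "\<lambda>i. F (i + 1) j"]) (rule F0[OF j])
    then have tel: "(\<Prod>i=1..m. F (int i + 1) j / F (int i) j) = F 1 (j - int k) / F 1 j"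
      using phase_space_row[OF F, of 1 j] by (simp only: add.commute[of 1] diff_add_cancel add_0_left)
    have "dprod m p j = (\<Prod>i=1..m. q (int i) (j + 1) * (F (int i + 1) j / F (int i) j))"
      unfolding dprod_def p0[OF j] by (simp only: times_divide_eq_right)
    then show ?thesis unfolding prod.distrib tel dprod_def .
  qed
  \<comment> \<open>Follows from the other column of the pair, since p_ij p_i(j+1) = q_ij
    q_i(j+1).\<close>
  have dF1: "dprod m p (j + 1) = dprod m q j * (F 1 j / F 1 (j - int k))" if j: "cl j" for j
  proof -
    have "dprod m p j * dprod m p (j + 1) = dprod m q j * dprod m q (j + 1)"
      unfolding dprod_def prod.distrib[symmetric] p0[OF j] p1[OF j]
      by (rule prod.cong[OF refl]) (use F0[OF j] in simp)
    then have "dprod m q (j + 1) * (dprod m p (j + 1) * (F 1 (j - int k) / F 1 j)) = dprod m q (j + 1) * dprod m q j"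
      unfolding dF[OF j] by (simp add: mult_ac)
    moreover have "dprod m q (j + 1) \<noteq> 0" using nz by (simp add: dprod_def)
    ultimately have "dprod m p (j + 1) * (F 1 (j - int k) / F 1 j) = dprod m q j" by (simp only: mult_cancel_left) simp
    then show ?thesis using F0[OF j, of 1] F0[of "j - int k" 1] clk[of j] j by (simp add: field_simps)
  qed
  show "sigma n m k p c = sigma n m k q (c + 1)"
    by (rule sigma_telescope[where G = "F 1" and d = 1, OF p q phase_space_col[OF F] F0 dF]) (simp_all add: cl_def)
  show "sigma n m k p (c + 1) = sigma n m k q c"
  proof (rule sigma_telescope[where G = "\<lambda>j. 1 / F 1 (j - 1)" and d = "- 1", OF p q])
    fix j
    have "j + int n - 1 = j - 1 + int n" by simp
    then show "1 / F 1 (j + int n - 1) = 1 / F 1 (j - 1)" using phase_space_col[OF F] by (simp only:)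
    assume "int N dvd j - int (c + 1)"
    then have j: "cl (j - 1)" by (simp add: cl_def algebra_simps)
    show "1 / F 1 (j - 1) \<noteq> 0" using F0[OF j] by simp
    have "j - int k - 1 = j - 1 - int k" by simp
    then show "dprod m p j = dprod m q (j + - 1) * (1 / F 1 (j - int k - 1) / (1 / F 1 (j - 1)))"
      using dF1[OF j] by (simp only:) simp
  qed simp
  show "sigma n m k p t = sigma n m k q t" if t: "t \<in> {1..N}" "t \<noteq> c" "t \<noteq> c + 1" for t
  proof (rule sigma_telescope[where G = "\<lambda>_. 1" and d = 0, OF p q])
    fix j assume j: "int N dvd j - int t"
    have "\<not> cl j" using residue_class_unique[OF t(1) _ j, of c] c t(2) by (auto simp: cl_def)
    moreover have "\<not> cl (j - 1)"
    proof
      assume "cl (j - 1)"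
      then have "int N dvd j - int (c + 1)" by (simp add: cl_def algebra_simps)
      then show False using residue_class_unique[OF t(1) _ j, of "c + 1"] c t(3) by simp
    qed
    ultimately have "p i j = q i j" for i by (rule po)
    then show "dprod m p j = dprod m q (j + 0) * (1 / 1)" by (simp add: dprod_def)
  qed simp_all
qed

end

section \<open>The row maps\<close>

lemma Tl_index_shift: "Tl (\<lambda>i j. q (i + a) j) is v = Tl q (map (\<lambda>i. i + a) is) v"
  by (induction "is") (simp_all add: Tq_def)

lemma Tl_row_shift:
  assumes q: "q \<in> phase_space n m k"
  shows "Tl q (map (\<lambda>i. i + int m) is) (shift (int k) w) = shift (int k) (Tl q is w)"
proof (induction "is")
  case (Cons i "is")
  then show ?case
    using phase_space_row[OF q] by (simp add: Tq_def shift_def fun_eq_iff algebra_simps)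
qed simp

lemma map_add_upto: "map (\<lambda>i. i + a) [b..c] = [b + a..c + a]" for a b c :: int
  by (rule nth_equalityI) auto

context val
begin

text \<open>At P the weights fall with the index, so the term v_(j-1) leads in Q_i and lowers the
  minimum by exactly 1. The attaining index is taken below n because its image sits at j +
  1.\<close>

lemma WM_Tq_decreasing:
  assumes v: "qper n v" and n: "n > 0" and X: "veq f p X (- int n)"
    and W: "WM f n p (\<lambda>j. j - int n) v c"
  shows "WM f n p (\<lambda>j. j - int n) (Tq q i v) (c - 1)"
proof (rule WM_I)
  fix j assume j: "j \<le> int n"
  have "vge f p (v j) (j - int n + (c - 1))" by (rule vge_mono[OF WM_vge[OF W j]]) simp
  then have "vge f p (const2 (q i j) * v j) (j - int n + (c - 1))" by (rule vge_cmult)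
  moreover have "vge f p (v (j - 1)) (j - int n + (c - 1))"
    using WM_vge[OF W, of "j - 1"] j by (simp add: algebra_simps)
  ultimately show "vge f p (Tq q i v j) (j - int n + (c - 1))" unfolding Tq_def by (rule vge_add)
next
  show "\<not> (\<forall>j\<le>int n. vge f p (Tq q i v j) (j - int n + (c - 1 + 1)))"
  proof
    assume T: "\<forall>j\<le>int n. vge f p (Tq q i v j) (j - int n + (c - 1 + 1))"
    obtain j where j: "j \<le> int n - 1" "veq f p (v j) (j - int n + c)"
      using WM_low[where b = "\<lambda>j. j - int n" and J = "int n - 1", OF v n X _ W] by auto
    have "vge f p (Tq q i v (j + 1)) (j + 1 - int n + c)"
      using T[rule_format, of "j + 1"] j(1) by simp
    moreover have "vge f p (const2 (q i (j + 1)) * v (j + 1)) (j + 1 - int n + c)"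
      using WM_vge[OF W, of "j + 1"] j(1) by (intro vge_cmult) simp
    ultimately have "vge f p (Tq q i v (j + 1) - const2 (q i (j + 1)) * v (j + 1)) (j + 1 - int n + c)"
      by (rule vge_diff)
    then have "vge f p (v j) (j - int n + c + 1)" by (simp add: Tq_def algebra_simps)
    then show False using veq_not_vge[OF j(2), of "j - int n + c + 1"] by simp
  qed
qed

lemma WM_Tl_decreasing:
  assumes q: "q \<in> phase_space n m k" and v: "qper n v" and n: "n > 0" and X: "veq f p X (- int n)"
    and W: "WM f n p (\<lambda>j. j - int n) v c"
  shows "WM f n p (\<lambda>j. j - int n) (Tl q is v) (c - int (length is))"
proof (induction "is")
  case (Cons i "is")
  have "WM f n p (\<lambda>j. j - int n) (Tq q i (Tl q is v)) (c - int (length is) - 1)"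
    by (rule WM_Tq_decreasing[OF qper_Tl[OF q v] n X Cons])
  then show ?case by (simp add: algebra_simps)
qed (use W in simp)

end

lemma pred_div_le_div:
  assumes "N > 0" shows "(j - 1) div int N \<le> j div int N"
  using assms by (intro zdiv_mono1) simp_all

locale spectral_point = spectral_curve +
  fixes q :: point and v :: "int \<Rightarrow> poly2"
  assumes q: "q \<in> phase_space n m k" and v: "eig f n m k q v"
    and ord: "O_list n m k f q \<in> orderings (O_points f)"
    and csum_nz: "\<And>j. csum n m k q j \<noteq> 0"
begin

definition Os :: "place list" where "Os = O_list n m k f q"
definition As :: "place list" where "As = A_list n m f q"

lemmas nz = coordinates_nonzero[OF q v]
lemmas P_X = P_orders(1)[OF q v csum_nz] and P_Y = P_orders(2)[OF q v csum_nz]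

lemma qv: "qper n v" using v by (simp add: eig_def)

lemma Os_ord: "Os \<in> orderings (O_points f)" and Os_length: "length Os = N"
  and inj_sigma: "inj_on (sigma n m k q) {1..N}"
  using ord O_list_props(1,2)[OF q v nz ord] by (simp_all add: Os_def)

lemma Os_nth:
  assumes "r \<in> {1..N}"
  shows "Os ! (r - 1) \<in> O_points f" "has_value_at f (Os ! (r - 1)) (Y ^ n') (X ^ k') (sigma n m k q r)"
  using O_list_props(3)[OF q v nz ord assms] by (simp_all add: Os_def)

lemma Os_cases:
  assumes "p \<in> O_points f" obtains s where "s \<in> {1..N}" "p = Os ! (s - 1)"
proof -
  have "p \<in> set Os" using assms Os_ord by (simp add: orderings_def)
  then obtain t where "t < N" "Os ! t = p" using in_set_conv_nth[of p Os] Os_length by auto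
  then show thesis using that[of "t + 1"] by simp
qed

text \<open>The divisor is ord v_n minus the minimal weighted order. If the latter moves by a, the
  divisors differ by that of w_n/v_n minus a. Equal O-lists guarantee equal weights on both
  sides.\<close>

lemma D_min_difference:
  assumes y: "y \<in> phase_space n m k" and w: "eig f n m k y w" and Oy: "O_list n m k f y = Os"
    and W: "\<And>p c. p \<in> places f \<Longrightarrow> WM f n p (wt Os p) v c \<Longrightarrow> WM f n p (wt Os p) w (c + a p)"
    and p: "p \<in> places f"
  shows "Poly_Mapping.lookup (D_min n m k f y) p - Poly_Mapping.lookup (D_min n m k f q) p
    = p (w (int n)) - p (v (int n)) - a p"
proof -
  interpret pl: place f p using p by (rule placeI)
  obtain c where c: "WM f n p (wt Os p) v c" "Poly_Mapping.lookup (D_min n m k f q) p = p (v (int n)) - c"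
    using D_min_WM[OF q v Os_length[unfolded Os_def] Os_ord[unfolded Os_def] p P_X] unfolding Os_def by metis
  obtain d where d: "WM f n p (wt Os p) w d" "Poly_Mapping.lookup (D_min n m k f y) p = p (w (int n)) - d"
    using D_min_WM[OF y w _ _ p P_X] Os_length Os_ord unfolding Oy by metis
  have "d = c + a p" by (rule pl.WM_unique[OF d(1) W[OF p c(1)]])
  then show ?thesis using c(2) d(2) by simp
qed

lemma O_list_cong: "(\<And>r. r \<in> {1..N} \<Longrightarrow> sigma n m k y r = sigma n m k q r) \<Longrightarrow> O_list n m k f y = Os"
  unfolding Os_def O_list_def Let_def N_def[symmetric] by (intro map_cong refl) (simp del: upt_Suc)

lemma A_list_cong:
  assumes "\<And>r. r \<in> {1..m} \<Longrightarrow> eps y (int r) = eps q (int r)" shows "A_list n m f y = As"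
  unfolding As_def A_list_def eps_epsilon[symmetric] using assms by (intro map_cong refl) (simp del: upt_Suc)

end

locale row_shift = spectral_point +
  fixes u :: nat
  assumes u: "1 \<le> u" "u \<le> m"
begin

definition v' :: "int \<Rightarrow> poly2" where
  "v' = Tl q [int u + 1..int m] (shift (int k) v)"

lemma split: "[1..int m] = [1..int u] @ [int u + 1..int m]"
  using u upto_split2[of 1 "int u" "int m"] by simp

lemma qv': "qper n v'"
  unfolding v'_def by (intro qper_Tl[OF q] qper_shift[OF qv]) simp

lemma factor: "Tl q [1..int u] v' = Lop m k q v"
  unfolding v'_def Lop_def split Tl_simps ..

lemma factor_Y: "j \<le> int n \<Longrightarrow> f dvd Tl q [1..int u] v' j - Y * v j"
  unfolding factor using v by (simp add: eig_def)

text \<open>Cyclic rotation of the factors of L: rows m + 1 to m + u are rows 1 to u moved by k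
  columns, that is, conjugated by P^k.\<close>

lemma Lop_pi: "Lop m k ((pi_map ^^ u) q) w = Tl q [int u + 1..int m] (shift (int k) (Tl q [1..int u] w))"
proof -
  have "Lop m k ((pi_map ^^ u) q) w = Tl q [1 + int u..int m + int u] (shift (int k) w)"
    unfolding Lop_def pi_map_power Tl_index_shift map_add_upto ..
  also have "[1 + int u..int m + int u] = [int u + 1..int m] @ map (\<lambda>i. i + int m) [1..int u]"
  proof (cases "u = m")
    case False
    then show ?thesis
      using u upto_split2[of "int u + 1" "int m" "int m + int u"] unfolding map_add_upto by (simp add: add.commute)
  qed (simp add: map_add_upto add.commute)
  finally show ?thesis unfolding Tl_simps Tl_row_shift[OF q] .
qed

lemma eig_v': "eig f n m k ((pi_map ^^ u) q) v'"
  unfolding eig_def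
proof (intro conjI allI impI)
  interpret Pv: place f "P_point f" by (rule placeI[OF P_place])
  show "qper n v'" by (rule qv')
  show "\<exists>j\<le>int n. \<not> f dvd v' j"
  proof (rule ccontr)
    assume "\<not> ?thesis"
    then have z: "f dvd v' j - (\<lambda>j. 0 * v' j) j" if "j \<le> int n" for j using that by simp
    have "f dvd v j" if j: "j \<le> int n" for j
    proof -
      have "f dvd Tl q [1..int u] v' j - Tl q [1..int u] (\<lambda>j. 0 * v' j) j"
        by (rule Tl_cong[OF z j])
      then have "f dvd Tl q [1..int u] v' j" unfolding Tl_scale by simp
      then have "f dvd Y * v j" using factor_Y[OF j] by (simp only: dvd_diff_cong)
      then show "f dvd v j"
        using not_dvd_Y Pv.dvd_mult_iff by simp
    qed
    then show False using v by (auto simp: eig_def)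
  qed
  fix j assume j: "j \<le> int n"
  have "f dvd shift (int k) (Tl q [1..int u] v') j - shift (int k) (\<lambda>j. Y * v j) j" if "j \<le> int n" for j
    using factor_Y[of "j - int k"] that by (simp add: shift_def)
  then have "f dvd Lop m k ((pi_map ^^ u) q) v' j - Tl q [int u + 1..int m] (shift (int k) (\<lambda>j. Y * v j)) j"
    unfolding Lop_pi using Tl_cong j by metis
  moreover have "shift (int k) (\<lambda>j. Y * v j) = (\<lambda>j. Y * shift (int k) v j)" by (simp add: shift_def)
  ultimately show "f dvd Lop m k ((pi_map ^^ u) q) v' j - Y * v' j"
    unfolding v'_def by (simp only: Tl_scale)
qed

lemma A_div_lookup:
  "Poly_Mapping.lookup (A_div f As u) p =
    (if P_point f = p then int u else 0) - (\<Sum>i=1..u. if As ! (i - 1) = p then 1 else 0)"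
proof -
  have fr: "Poly_Mapping.lookup (frag_of x) p = (if x = p then 1 else 0)" for x by simp
  show ?thesis unfolding A_div_def lookup_minus lookup_sum lookup_frag_cmul fr by simp
qed

lemma As_over:
  assumes "r \<in> {1..m}" shows "As ! (r - 1) \<in> places f" "lies_over f (As ! (r - 1)) (eps q (int r)) 0"
  unfolding As_def by (rule A_list_nth[OF q v assms])+

lemma A_div_lookup_not_A:
  assumes "\<And>a. a \<noteq> 0 \<Longrightarrow> \<not> lies_over f p a 0"
  shows "Poly_Mapping.lookup (A_div f As u) p = (if P_point f = p then int u else 0)"
proof -
  have ne: "As ! (i - 1) \<noteq> p" if "i \<in> {1..u}" for i
  proof -
    have i: "i \<in> {1..m}" using that u by simp
    show ?thesis using As_over(2)[OF i] assms A_points_eps_bij(2)[OF q v i] by metis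
  qed
  then have "(\<Sum>i=1..u. if As ! (i - 1) = p then 1 else (0 :: int)) = 0" by (intro sum.neutral) simp
  then show ?thesis unfolding A_div_lookup by simp
qed

lemma A_div_lookup_A:
  assumes r: "r \<in> {1..m}" and p: "p = As ! (r - 1)"
  shows "Poly_Mapping.lookup (A_div f As u) p = (if r \<le> u then - 1 else 0)"
proof -
  have eq: "As ! (i - 1) = p \<longleftrightarrow> i = r" if i: "i \<in> {1..u}" for i
  proof
    assume ip: "As ! (i - 1) = p"
    have i': "i \<in> {1..m}" using i u by simp
    have "eps q (int i) = eps q (int r)"
      using place.lies_over_unique(1)[OF placeI[OF As_over(1)[OF r]]] As_over(2)[OF i'] As_over(2)[OF r] ip p by metis
    then show "i = r" using inj_onD[OF A_points_eps_bij(1)[OF q v] _ i' r] by simp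
  qed (use p in simp)
  have "(\<Sum>i=1..u. if As ! (i - 1) = p then 1 else 0) = (\<Sum>i=1..u. if i = r then 1 else (0 :: int))"
    by (intro sum.cong refl if_cong) (use eq in auto)
  also have "\<dots> = (if r \<le> u then 1 else 0)" using r by simp
  finally have s: "(\<Sum>i=1..u. if As ! (i - 1) = p then 1 else (0 :: int)) = (if r \<le> u then 1 else 0)" .
  have "P_point f \<noteq> p" using P_inf As_over(2)[OF r] p by (auto simp: at_infinity_def)
  then show ?thesis unfolding A_div_lookup s by simp
qed

text \<open>Place by place: at P each of the k + m - u shifts lowers the minimum by 1. At O-points
  and general points it moves by ord y. At A_r with r \<le> u all factors occurring in v' are
  invertible and nothing changes. At A_r with r > u the factors Q_1, ..., Q_u are invertible, so v'
  behaves like y v.\<close>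

lemma order_v':
  assumes p: "p \<in> places f" and W: "WM f n p (wt Os p) v c"
  shows "WM f n p (wt Os p) v' (c + (p Y + Poly_Mapping.lookup (A_div f As u) p))"
proof -
  interpret pl: place f p using p by (rule placeI)
  have fac: "f dvd Tl q [1..int u] (Tl q [int u + 1..int m] (shift (int k) v)) j - Y * v j" if "j \<le> int n" for j
    using factor_Y[OF that] unfolding v'_def .
  show ?thesis
  proof (rule place_cases[OF p])
    assume P: "p = P_point f"
    have b: "wt Os p = (\<lambda>j. j - int n)" unfolding P wt_P ..
    have X: "veq f p X (- int n)" unfolding P by (rule P_X)
    have pY: "p Y = - int (m + k)" using P_Y unfolding P veq_def by simp
    have A: "Poly_Mapping.lookup (A_div f As u) p = int u"
      using A_div_lookup_not_A[of p] P_inf P by (auto simp: at_infinity_def)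
    have "WM f n p (\<lambda>j. j - int n) (shift (int k) v) (c + - int k)"
      by (rule pl.WM_shift[where b = "\<lambda>j. j - int n", OF qv n_pos X _ W[unfolded b]]) simp_all
    then have "WM f n p (\<lambda>j. j - int n) v' (c + - int k - int (length [int u + 1..int m]))"
      unfolding v'_def by (intro pl.WM_Tl_decreasing[OF q qper_shift[OF qv] n_pos X]) simp_all
    moreover have "c + - int k - int (length [int u + 1..int m]) = c + (p Y + Poly_Mapping.lookup (A_div f As u) p)"
      unfolding pY A using u by simp
    ultimately show ?thesis unfolding b by (simp only:)
  next
    assume pO: "p \<in> O_points f"
    then obtain s where s: "s \<in> {1..N}" "p = Os ! (s - 1)" by (rule Os_cases)
    have b: "wt Os p j = (int n - int s) div int N - (j - int s) div int N" for j
      unfolding s(2) by (rule wt_O[OF Os_length Os_ord s(1)])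
    have "p \<noteq> P_point f" using pO P_not_O by metis
    moreover have "\<not> lies_over f p a 0" if "a \<noteq> 0" for a
      using pl.lies_over_unique(1)[of a 0 0 0] pO that by (auto simp: O_points_def)
    ultimately have A: "Poly_Mapping.lookup (A_div f As u) p = 0" using A_div_lookup_not_A[of p] by simp
    have Y: "veq f p Y (int k')" by (rule O_point_orders(2)[OF pO])
    have pY: "p Y = int k'" using Y by (simp add: veq_def)
    have "WM f n p (wt Os p) v' (c + int k')"
      unfolding v'_def
    proof (rule pl.WM_factor[where b = "wt Os p", OF _ _ Y W fac])
      show "wt Os p j \<le> wt Os p (j - 1)" for j
        unfolding b using pred_div_le_div[OF N_pos, of "j - int s"] by (simp add: algebra_simps)
      show "wt Os p (j - int k) = wt Os p j + int k'" for j
      proof -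
        have "j - int k - int s = (j - int s) + int N * (- int k')" by (simp add: int_kN)
        then have "(j - int k - int s) div int N = - int k' + (j - int s) div int N"
          using N_pos by (simp only: div_mult_self2)
        then show ?thesis unfolding b by simp
      qed
    qed
    then show ?thesis unfolding A pY by simp
  next
    fix a b assume a: "a \<noteq> 0" and over: "lies_over f p a b"
    have nP: "p \<noteq> P_point f" using over P_inf by (auto simp: at_infinity_def)
    have nO: "p \<notin> O_points f"
      using pl.lies_over_unique(1)[OF over, of 0 0] a by (auto simp: O_points_def)
    have b0: "wt Os p = (\<lambda>_. 0)" using wt_other[OF Os_length Os_ord nP nO] by auto
    note X = A_point_X[OF pl.place_axioms over a]
    note W0 = W[unfolded b0]
    show ?thesis
    proof (cases "b = 0")
      case False
      have "\<not> lies_over f p a' 0" for a'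
        using pl.lies_over_unique(2)[OF over, of a' 0] False by auto
      then have A: "Poly_Mapping.lookup (A_div f As u) p = 0" using A_div_lookup_not_A[of p] nP by simp
      have Y: "veq f p Y 0" using pl.lies_over_eval_veq[OF over, of Y] False by simp
      have pY: "p Y = 0" using Y by (simp add: veq_def)
      have "WM f n p (\<lambda>_. 0) v' (c + 0)"
        unfolding v'_def by (rule pl.WM_factor[where b = "\<lambda>_. 0", OF _ _ Y W0 fac]) simp_all
      then show ?thesis unfolding A pY b0 by simp
    next
      case True
      note over = over[unfolded True]
      obtain r where r: "r \<in> {1..m}" "a = eps q (int r)" using A_point_eps[OF q v p over a] by metis
      have pr: "p = As ! (r - 1)" unfolding As_def by (rule A_list_nth(3)[OF q v r(1) p over[unfolded r(2)]])
      have Y: "veq f p Y 1" by (rule A_point_Y[OF q v p over a])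
      have pY: "p Y = 1" using Y by (simp add: veq_def)
      have ns: "a \<noteq> (-1) ^ n * (\<Prod>j=1..n. q i (int j))" if "i \<in> {1..int m}" "i \<noteq> int r" for i
      proof -
        have "nat i \<in> {1..m}" "int (nat i) = i" using that(1) by auto
        moreover have "nat i \<noteq> r" using that(2) \<open>int (nat i) = i\<close> by auto
        ultimately have "eps q (int (nat i)) \<noteq> eps q (int r)"
          using inj_onD[OF A_points_eps_bij(1)[OF q v], of "nat i" r] r(1) by auto
        then show ?thesis using \<open>int (nat i) = i\<close> r(2) by (simp add: eps_def)
      qed
      show ?thesis
      proof (cases "r \<le> u")
        case True
        have A: "Poly_Mapping.lookup (A_div f As u) p = - 1" using A_div_lookup_A[OF r(1) pr] True by simp
        have "WM f n p (\<lambda>_. 0) (shift (int k) v) (c + 0)"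
          by (rule pl.WM_shift[where b = "\<lambda>_. 0", OF qv n_pos X _ W0]) simp_all
        then have Ws: "WM f n p (\<lambda>_. 0) (shift (int k) v) c" by simp
        have ns': "a \<noteq> (-1) ^ n * (\<Prod>j=1..n. q i (int j))" if "i \<in> set [int u + 1..int m]" for i
          by (rule ns) (use that True in auto)
        have qs: "qper n (shift (int k) v)" by (rule qper_shift[OF qv]) simp
        have "WM f n p (\<lambda>_. 0) v' c"
          unfolding v'_def by (rule pl.WM_Tl_unit[OF over q qs ns' Ws])
        then show ?thesis unfolding A pY b0 by simp
      next
        case False
        have A: "Poly_Mapping.lookup (A_div f As u) p = 0" using A_div_lookup_A[OF r(1) pr] False by simp
        have ns': "a \<noteq> (-1) ^ n * (\<Prod>j=1..n. q i (int j))" if "i \<in> set [1..int u]" for i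
          by (rule ns) (use that False u in auto)
        have pull: "vge f p (v' j) d" if T: "\<And>j. j \<le> int n \<Longrightarrow> vge f p (Y * v j) d" and j: "j \<le> int n" for j d
        proof (rule pl.vge_Tl_inv[OF over q qv' ns' _ j])
          show "vge f p (Tl q [1..int u] v' j) d" if "j \<le> int n" for j
            using pl.vge_cong[OF factor_Y[OF that]] T[OF that] by simp
        qed
        have "WM f n p (\<lambda>_. 0) v' (c + 1)"
        proof (rule pl.WM_I)
          show "vge f p (v' j) (0 + (c + 1))" if "j \<le> int n" for j
          proof (rule pull[OF _ that])
            fix j assume "j \<le> int n"
            then show "vge f p (Y * v j) (0 + (c + 1))"
              using pl.vge_mult[OF pl.veq_imp_vge[OF Y, of 1] pl.WM_vge[OF W0, of j]] by (simp add: add.commute)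
          qed
          show "\<not> (\<forall>j\<le>int n. vge f p (v' j) (0 + (c + 1 + 1)))"
          proof
            assume T: "\<forall>j\<le>int n. vge f p (v' j) (0 + (c + 1 + 1))"
            have "vge f p (v j) (0 + (c + 1))" if j: "j \<le> int n" for j
            proof -
              have "vge f p (Tl q [1..int u] v' j) (0 + (c + 1 + 1))"
                by (rule pl.vge_Tl[where b = "\<lambda>_. 0", OF _ _ j]) (use T in auto)
              then have "vge f p (Y * v j) (1 + (c + 1))"
                using pl.vge_cong[OF factor_Y[OF j]] by (simp add: add.commute)
              then show ?thesis using pl.vge_mult_cancel[OF Y, of "v j" "c + 1"] by simp
            qed
            then show False using pl.WM_not[OF W0, of "c + 1"] by simp
          qed
        qed
        then show ?thesis unfolding A pY b0 by simp
      qed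
    qed
  qed
qed

lemma e_map_effect:
  assumes e: "e_map n m k u q = Some y"
  shows "y \<in> phase_space n m k" "eig f n m k y v'" "c_list n m k y = (tau_inv ^^ u) (c_list n m k q)"
    "O_list n m k f y = Os" "A_list n m f y = As"
proof -
  define x0 where "x0 = (pi_map ^^ u) q"
  have e': "comp_list (map (s_map n m k) (e_word m u)) x0 = Some y"
    using e by (simp add: e_map_def x0_def)
  \<comment> \<open>Row exchanges fix L, \<open>csum\<close> and \<open>sigma\<close> and permute
    the values \<open>eps\<close>, whose current arrangement is g. As L stays fixed, v' remains an
    eigenvector.\<close>
  define Q where "Q g x \<longleftrightarrow> x \<in> phase_space n m k \<and> Lop m k x = Lop m k x0 \<and>
      (\<forall>j. csum n m k x j = csum n m k q (j + int u)) \<and> (\<forall>r. sigma n m k x r = sigma n m k q r) \<and>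
      (\<forall>i\<in>{1..m}. eps x (int i) = g i)" for g :: "nat \<Rightarrow> complex" and x
  define g0 where "g0 i = (if i \<le> m - u then eps q (int (i + u)) else eps q (int (i - (m - u))))" for i
  have x0: "x0 \<in> phase_space n m k" "\<And>j. csum n m k x0 j = csum n m k q (j + int u)"
    "\<And>r. sigma n m k x0 r = sigma n m k q r"
    unfolding x0_def by (rule pi_map_power_effect[OF q nz])+
  have g0: "eps x0 (int i) = g0 i" if i: "i \<in> {1..m}" for i
  proof -
    have e: "eps x0 (int i) = eps q (int i + int u)" by (simp add: x0_def pi_map_power eps_def)
    show ?thesis
    proof (cases "i \<le> m - u")
      case False
      then have "int i + int u = int (i - (m - u)) + int m" using u by simp
      then show ?thesis unfolding e g0_def using False eps_row_shift[OF q] by (simp only: if_False)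
    qed (simp add: e g0_def)
  qed
  have "Q (foldr swap_at (e_word m u) g0) y"
  proof (rule comp_list_invariant[OF e', where Q = Q and h = swap_at])
    show "Q g0 x0" unfolding Q_def using x0 g0 by simp
    fix r g x z assume r: "r \<in> set (e_word m u)" and Qx: "Q g x" and s: "s_map n m k r x = Some z"
    have r': "1 \<le> r" "r < m" using e_word_letters[OF u(2) r] by simp_all
    have x: "x \<in> phase_space n m k" "Lop m k x = Lop m k x0" "\<And>j. csum n m k x j = csum n m k q (j + int u)"
      "\<And>r. sigma n m k x r = sigma n m k q r" "\<And>i. i \<in> {1..m} \<Longrightarrow> eps x (int i) = g i"
      using Qx unfolding Q_def by simp_all
    note ef = s_map_effect[OF x(1) r' s]
    have "eps z (int i) = swap_at r g i" if i: "i \<in> {1..m}" for i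
    proof -
      have rr: "r \<in> {1..m}" "Suc r \<in> {1..m}" using r' by simp_all
      show ?thesis unfolding ef(5)[OF i] swap_at_def using x(5)[OF i] x(5)[OF rr(1)] x(5)[OF rr(2)]
        by (simp only: fun_upd_apply)
    qed
    then show "Q (swap_at r g) z" unfolding Q_def using ef(1-4) x(2-4) by (simp only:) simp
  qed
  moreover have "foldr swap_at (e_word m u) g0 i = eps q (int i)" if "i \<in> {1..m}" for i
    unfolding g0_def using e_word_rotation[OF u that, of "\<lambda>i. eps q (int i)"] .
  ultimately have y: "y \<in> phase_space n m k" "Lop m k y = Lop m k x0" "\<And>j. csum n m k y j = csum n m k q (j + int u)"
      "\<And>r. sigma n m k y r = sigma n m k q r" "\<And>i. i \<in> {1..m} \<Longrightarrow> eps y (int i) = eps q (int i)"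
    unfolding Q_def by simp_all
  show "y \<in> phase_space n m k" by (rule y)
  show "eig f n m k y v'" using eig_v' unfolding eig_def y(2) x0_def .
  show "c_list n m k y = (tau_inv ^^ u) (c_list n m k q)" by (rule c_list_shift(1)[OF n2 k1 m1 q y(1,3)])
  show "O_list n m k f y = Os" by (rule O_list_cong) (rule y)
  show "A_list n m f y = As" by (rule A_list_cong) (rule y)
qed

end

section \<open>The column maps\<close>

context spectral_curve
begin

lemma N_le_n: "N \<le> n"
  unfolding N_def by (rule gcd_le1_nat) (use n2 in simp)

text \<open>At j = n the added entry v_(n+1) is not tied to v_1 by quasi-periodicity, so \<tau>_n =
  0 is asked for. Exchanges satisfy it: they act on classes c with 1 \<le> c < N.\<close>

lemma Aop_qper:
  assumes \<tau>: "\<And>j. \<tau> (j + int n) = \<tau> j" and \<tau>n: "\<tau> (int n) = 0" and w: "qper n w"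
  shows "qper n (Aop \<tau> w)"
  unfolding qper_def
proof (intro allI impI)
  fix j assume j: "j \<le> int n"
  have t: "\<tau> (j - int n) = \<tau> j" using \<tau>[of "j - int n"] by simp
  show "Aop \<tau> w (j - int n) = X * Aop \<tau> w j"
  proof (cases "j = int n")
    case True
    then show ?thesis using qper_D[OF w j] t \<tau>n by (simp add: Aop_def)
  next
    case False
    then have "w (j + 1 - int n) = X * w (j + 1)" using qper_D[OF w, of "j + 1"] j by simp
    moreover have "j + 1 - int n = j - int n + 1" by simp
    ultimately show ?thesis using qper_D[OF w j] t by (simp add: Aop_def algebra_simps)
  qed
qed

text \<open>No two neighbouring values of \<tau> are nonzero below n, and \<tau>_n = 0, so 1 -
  \<tau> P^(-1) inverts 1 + \<tau> P^(-1).\<close>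

lemma Aop_vge_inverse:
  assumes p: "place f p" and \<tau>: "\<And>j. \<tau> j \<noteq> 0 \<Longrightarrow> \<tau> (j + 1) = 0" and \<tau>n: "\<tau> (int n) = 0"
    and b: "\<And>j. b j \<le> b (j + 1)"
    and A: "\<And>j. j \<le> int n \<Longrightarrow> vge f p (Aop \<tau> w j) (b j + c)" and j: "j \<le> int n"
  shows "vge f p (w j) (b j + c)"
proof -
  interpret place f p by (rule p)
  show ?thesis
  proof (cases "\<tau> j = 0")
    case True
    then show ?thesis using A[OF j] by (simp add: Aop_def)
  next
    case False
    then have "j \<noteq> int n" using \<tau>n by auto
    then have "vge f p (Aop \<tau> w (j + 1)) (b (j + 1) + c)" using A j by simp
    then have "vge f p (w (j + 1)) (b j + c)"
      using \<tau>[OF False] vge_mono[of "w (j + 1)" "b (j + 1) + c" "b j + c"] b[of j] by (simp add: Aop_def)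
    then have "vge f p (Aop \<tau> w j - const2 (\<tau> j) * w (j + 1)) (b j + c)"
      by (intro vge_diff A[OF j] vge_cmult)
    then show ?thesis by (simp add: Aop_def)
  qed
qed

text \<open>For weights nondecreasing in j the added entry never lowers the minimum, and the inverse
  has the same form. This serves P and all places of weight 0.\<close>

lemma Aop_WM:
  assumes p: "place f p" and \<tau>: "\<And>j. \<tau> j \<noteq> 0 \<Longrightarrow> \<tau> (j + 1) = 0" and \<tau>n: "\<tau> (int n) = 0"
    and b: "\<And>j. b j \<le> b (j + 1)" and W: "WM f n p b w c"
  shows "WM f n p b (Aop \<tau> w) c"
proof -
  interpret place f p by (rule p)
  show ?thesis
  proof (rule WM_I)
    fix j assume j: "j \<le> int n"
    show "vge f p (Aop \<tau> w j) (b j + c)"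
    proof (cases "\<tau> j = 0")
      case True
      then show ?thesis using WM_vge[OF W j] by (simp add: Aop_def)
    next
      case False
      then have "j \<noteq> int n" using \<tau>n by auto
      then have "vge f p (w (j + 1)) (b (j + 1) + c)" using WM_vge[OF W, of "j + 1"] j by simp
      then have "vge f p (w (j + 1)) (b j + c)"
        using vge_mono[of "w (j + 1)" "b (j + 1) + c" "b j + c"] b[of j] by simp
      then show ?thesis unfolding Aop_def by (intro vge_add WM_vge[OF W j] vge_cmult)
    qed
  next
    show "\<not> (\<forall>j\<le>int n. vge f p (Aop \<tau> w j) (b j + (c + 1)))"
    proof
      assume T: "\<forall>j\<le>int n. vge f p (Aop \<tau> w j) (b j + (c + 1))"
      have "vge f p (w j) (b j + (c + 1))" if j: "j \<le> int n" for j
        by (rule Aop_vge_inverse[where \<tau> = \<tau> and b = b, OF p \<tau> \<tau>n b _ j]) (use T in simp_all)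
      then show False using WM_not[OF W, of "c + 1"] by simp
    qed
  qed
qed

lemma Aop_eig:
  assumes x: "eig f n m k x w" and \<tau>: "\<And>j. \<tau> j \<noteq> 0 \<Longrightarrow> \<tau> (j + 1) = 0" and \<tau>n: "\<tau> (int n) = 0"
    and per: "\<And>j. \<tau> (j + int n) = \<tau> j" and L: "\<And>w. Lop m k y (Aop \<tau> w) = Aop \<tau> (Lop m k x w)"
  shows "eig f n m k y (Aop \<tau> w)"
  unfolding eig_def
proof (intro conjI allI impI)
  have qw: "qper n w" using x by (simp add: eig_def)
  show "qper n (Aop \<tau> w)" by (rule Aop_qper[where \<tau> = \<tau>, OF per \<tau>n qw])
  have lx: "f dvd Lop m k x w j - Y * w j" if "j \<le> int n" for j using x that by (simp add: eig_def)
  show "\<exists>j\<le>int n. \<not> f dvd Aop \<tau> w j"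
  proof (rule ccontr)
    assume "\<not> ?thesis"
    then have z: "f dvd Aop \<tau> w j" if "j \<le> int n" for j using that by simp
    have "f dvd w j" if j: "j \<le> int n" for j
    proof (cases "\<tau> j = 0")
      case True
      then show ?thesis using z[OF j] by (simp add: Aop_def)
    next
      case False
      then have "j \<noteq> int n" using \<tau>n by auto
      then have "f dvd w (j + 1)" using z[of "j + 1"] j \<tau>[OF False] by (simp add: Aop_def)
      then have "f dvd Aop \<tau> w j - const2 (\<tau> j) * w (j + 1)" by (intro dvd_diff z[OF j] dvd_mult)
      then show ?thesis by (simp add: Aop_def)
    qed
    then show False using x by (auto simp: eig_def)
  qed
  fix j assume j: "j \<le> int n"
  have e: "Lop m k y (Aop \<tau> w) j - Y * Aop \<tau> w j =
      (Lop m k x w j - Y * w j) + const2 (\<tau> j) * (Lop m k x w (j + 1) - Y * w (j + 1))"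
    unfolding L by (simp add: Aop_def algebra_simps)
  show "f dvd Lop m k y (Aop \<tau> w) j - Y * Aop \<tau> w j"
  proof (cases "\<tau> j = 0")
    case True
    then show ?thesis unfolding e using lx[OF j] by simp
  next
    case False
    then have "j + 1 \<le> int n" using \<tau>n j by (cases "j = int n") auto
    then show ?thesis unfolding e by (intro dvd_add dvd_mult lx j)
  qed
qed

lemma scl_vge: "vge f (scl N p) g (int N * c) \<longleftrightarrow> vge f p g c"
  using N_pos by (simp add: vge_def scl_def)

text \<open>The free constant in the position of the O-point is expressed by the order of v_s, which
  is available as s \<le> N \<le> n.\<close>

lemma O_position_at:
  assumes pO: "p \<in> O_points f" and q: "q \<in> phase_space n m k" and v: "eig f n m k q v"
    and inj: "inj_on (sigma n m k q) {1..N}" and s: "s \<in> {1..N}"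
    and val: "has_value_at f p (Y ^ n') (X ^ k') (sigma n m k q s)"
  shows "veq f p (v (int s)) (p (v (int s)))"
    and "j \<le> int n \<Longrightarrow> vge f (scl N p) (v j) (int N * p (v (int s)) + int s - j)"
    and "j \<le> int n \<Longrightarrow> veq f (scl N p) (v j) (int N * p (v (int s)) + int s - j) \<longleftrightarrow> int N dvd j - int s"
proof -
  obtain s' \<mu> where s': "s' \<in> {1..N}" "has_value_at f p (Y ^ n') (X ^ k') (sigma n m k q s')"
      "\<forall>j\<le>int n. vge f (scl N p) (v j) (\<mu> - j)"
      "\<forall>j\<le>int n. veq f (scl N p) (v j) (\<mu> - j) \<longleftrightarrow> int N dvd j - int s'"
    using O_position[OF pO q v coordinates_nonzero[OF q v] inj] by metis
  have "sigma n m k q s' = sigma n m k q s" by (rule value_unique[OF pO s'(2) val])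
  then have ss: "s' = s" using inj_onD[OF inj _ s'(1) s] by simp
  have "int s \<le> int n" using s N_le_n by auto
  then have "veq f (scl N p) (v (int s)) (\<mu> - int s)" using s'(4) ss by simp
  then have e: "\<not> f dvd v (int s)" "int N * p (v (int s)) = \<mu> - int s" by (simp_all add: veq_def scl_def)
  show "veq f p (v (int s)) (p (v (int s)))" using e(1) by (simp add: veq_def)
  have mu: "int N * p (v (int s)) + int s = \<mu>" using e(2) by simp
  show "vge f (scl N p) (v j) (int N * p (v (int s)) + int s - j)" if "j \<le> int n"
    unfolding mu using s'(3) that by simp
  show "veq f (scl N p) (v j) (int N * p (v (int s)) + int s - j) \<longleftrightarrow> int N dvd j - int s" if "j \<le> int n"
    unfolding mu using s'(4) that ss by simp
qed

text \<open>Scaled orders are multiples of N bounded below by a linear function of j; rounding up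
  yields the floors in the weights. Index s attains the minimum.\<close>

lemma O_WM:
  assumes os: "length os = N" "os \<in> orderings (O_points f)"
    and q: "q \<in> phase_space n m k" and v: "eig f n m k q v"
    and inj: "inj_on (sigma n m k q) {1..N}" and s: "s \<in> {1..N}"
    and val: "has_value_at f (os ! (s - 1)) (Y ^ n') (X ^ k') (sigma n m k q s)"
  shows "WM f n (os ! (s - 1)) (wt os (os ! (s - 1))) v
    ((os ! (s - 1)) (v (int s)) - (int n - int s) div int N)"
proof -
  define p where "p = os ! (s - 1)"
  have "s - 1 < length os" using s os(1) by auto
  then have pO: "p \<in> O_points f" using os(2) nth_mem unfolding p_def orderings_def by blast
  have b: "wt os p j = (int n - int s) div int N - (j - int s) div int N" for j
    unfolding p_def by (rule wt_O[OF os s])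
  note P = O_position_at[OF pO q v inj s val[folded p_def]]
  have sn: "int s \<le> int n" using s N_le_n by auto
  have bs: "wt os p (int s) + (p (v (int s)) - (int n - int s) div int N) = p (v (int s))" unfolding b by simp
  have "WM f n p (wt os p) v (p (v (int s)) - (int n - int s) div int N)"
    unfolding WM_def
  proof (intro conjI allI impI)
    show "\<exists>j\<le>int n. veq f p (v j) (wt os p j + (p (v (int s)) - (int n - int s) div int N))"
      by (rule exI[of _ "int s"]) (use sn P(1) bs in simp)
    fix j assume j: "j \<le> int n"
    define z where "z = (j - int s) div int N"
    have "j - int s < int N * (z + 1)"
    proof -
      have "j - int s = int N * z + (j - int s) mod int N" by (simp add: z_def)
      moreover have "(j - int s) mod int N < int N" using N_pos by simp
      moreover have "int N * (z + 1) = int N * z + int N" by (simp add: distrib_left)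
      ultimately show ?thesis by linarith
    qed
    then have z: "int s - j > int N * (- z - 1)" by (simp add: algebra_simps)
    have "vge f (scl N p) (v j) (int N * p (v (int s)) + int s - j)" by (rule P(2)[OF j])
    then have "f dvd v j \<or> int N * p (v (int s)) + (int s - j) \<le> int N * p (v j)" by (simp add: vge_def scl_def algebra_simps)
    moreover have "p (v (int s)) - z \<le> p (v j)" if "int N * p (v (int s)) + (int s - j) \<le> int N * p (v j)"
    proof -
      have "int N * (p (v (int s)) - z - 1) < int N * p (v j)" using that z by (simp add: algebra_simps)
      then have "p (v (int s)) - z - 1 < p (v j)" using N_pos by simp
      then show ?thesis by simp
    qed
    ultimately show "vge f p (v j) (wt os p j + (p (v (int s)) - (int n - int s) div int N))"
      unfolding b z_def[symmetric] vge_def by auto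
  qed
  then show ?thesis unfolding p_def .
qed

text \<open>The exchange moves p between the classes c and c + 1. Before and after, its position
  bounds the other entry of the pair by the one in its class, up to 1/N. As orders are integers and
  only entry c is altered, the order in the class of p is preserved.\<close>

lemma Aop_O_order:
  assumes pO: "p \<in> O_points f" and x: "x \<in> phase_space n m k" "eig f n m k x w" "inj_on (sigma n m k x) {1..N}"
    and y: "y \<in> phase_space n m k" "eig f n m k y (Aop \<tau> w)" "inj_on (sigma n m k y) {1..N}"
    and \<tau>: "\<forall>j. \<not> int N dvd j - int c \<longrightarrow> \<tau> j = 0" and c: "1 \<le> c" "c < N"
  shows "has_value_at f p (Y ^ n') (X ^ k') (sigma n m k x c) \<Longrightarrow>
      has_value_at f p (Y ^ n') (X ^ k') (sigma n m k y (c + 1)) \<Longrightarrow>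
      p (Aop \<tau> w (int (c + 1))) = p (w (int c))"
    and "has_value_at f p (Y ^ n') (X ^ k') (sigma n m k x (c + 1)) \<Longrightarrow>
      has_value_at f p (Y ^ n') (X ^ k') (sigma n m k y c) \<Longrightarrow>
      p (Aop \<tau> w (int c)) = p (w (int (c + 1)))"
proof -
  have pp: "p \<in> places f" using pO by (simp add: O_points_def)
  interpret place f p using pp by (rule placeI)
  interpret sc: val f "scl N p" by (rule val_scl)
  have cN: "c \<in> {1..N}" "c + 1 \<in> {1..N}" using c by auto
  have le: "int c \<le> int n" "int (c + 1) \<le> int n" using c N_le_n by auto
  have nd: "\<not> int N dvd int (c + 1) - int c" "\<not> int N dvd int c - int (c + 1)" using c by auto
  have A1: "Aop \<tau> w (int (c + 1)) = w (int (c + 1))" using \<tau>[rule_format, OF nd(1)] by (simp add: Aop_def)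
  have A0: "Aop \<tau> w (int c) = w (int c) + const2 (\<tau> (int c)) * w (int (c + 1))" by (simp add: Aop_def add.commute)
  show "p (Aop \<tau> w (int (c + 1))) = p (w (int c))"
    if hx: "has_value_at f p (Y ^ n') (X ^ k') (sigma n m k x c)"
      and hy: "has_value_at f p (Y ^ n') (X ^ k') (sigma n m k y (c + 1))"
  proof -
    note Px = O_position_at[OF pO x cN(1) hx] and Py = O_position_at[OF pO y cN(2) hy]
    define d where "d = p (w (int c))"
    define d' where "d' = p (Aop \<tau> w (int (c + 1)))"
    have w0: "veq f p (w (int c)) d" unfolding d_def by (rule Px(1))
    have w1: "veq f p (w (int (c + 1))) d'" using Py(1) unfolding A1 d'_def .
    have "vge f (scl N p) (w (int (c + 1))) (int N * d - 1)" using Px(2)[OF le(2)] by (simp add: d_def)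
    then have "int N * d - 1 \<le> int N * d'" using w1 by (auto simp: vge_def veq_def scl_def)
    then have "int N * d < int N * (d' + 1)" using c by (simp add: algebra_simps)
    then have ge: "d \<le> d'" using N_pos by simp
    have "vge f (scl N p) (Aop \<tau> w (int c)) (int N * d' + 1)" using Py(2)[OF le(1)] by (simp add: d'_def)
    moreover have "d < d' \<Longrightarrow> veq f p (Aop \<tau> w (int c)) d"
    proof -
      assume "d < d'"
      then have "vge f p (const2 (\<tau> (int c)) * w (int (c + 1))) (d + 1)"
        by (intro vge_cmult veq_imp_vge[OF w1]) simp
      then show "veq f p (Aop \<tau> w (int c)) d" unfolding A0 by (rule veq_add[OF w0])
    qed
    moreover have "d < d' \<Longrightarrow> int N * d' + 1 \<le> int N * d \<Longrightarrow> False"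
    proof -
      assume "d < d'" "int N * d' + 1 \<le> int N * d"
      then have "int N * d' < int N * d" by simp
      then show False using \<open>d < d'\<close> N_pos by simp
    qed
    ultimately have "\<not> d < d'" by (auto simp: vge_def veq_def scl_def)
    then show ?thesis using ge by (simp add: d_def d'_def)
  qed
  show "p (Aop \<tau> w (int c)) = p (w (int (c + 1)))"
    if hx: "has_value_at f p (Y ^ n') (X ^ k') (sigma n m k x (c + 1))"
      and hy: "has_value_at f p (Y ^ n') (X ^ k') (sigma n m k y c)"
  proof -
    note Px = O_position_at[OF pO x cN(2) hx] and Py = O_position_at[OF pO y cN(1) hy]
    define d where "d = p (w (int (c + 1)))"
    define d' where "d' = p (Aop \<tau> w (int c))"
    have w1: "veq f p (w (int (c + 1))) d" unfolding d_def by (rule Px(1))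
    have w0: "veq f p (Aop \<tau> w (int c)) d'" unfolding d'_def by (rule Py(1))
    have "vge f (scl N p) (w (int c)) (int N * d + 1)" using Px(2)[OF le(1)] by (simp add: d_def)
    then have "vge f (scl N p) (w (int c)) (int N * d)" by (rule sc.vge_mono) simp
    then have "vge f p (Aop \<tau> w (int c)) d"
      unfolding A0 scl_vge by (intro vge_add vge_cmult veq_imp_vge[OF w1]) simp_all
    then have ge: "d \<le> d'" using w0 by (auto simp: vge_def veq_def)
    have "vge f (scl N p) (Aop \<tau> w (int (c + 1))) (int N * d' - 1)" using Py(2)[OF le(2)] by (simp add: d'_def)
    then have "int N * d' - 1 \<le> int N * d" using w1 unfolding A1 by (auto simp: vge_def veq_def scl_def)
    then have "int N * d' < int N * (d + 1)" using c by (simp add: algebra_simps)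
    then have "d' \<le> d" using N_pos by simp
    then show ?thesis using ge by (simp add: d_def d'_def)
  qed
qed

end

section \<open>Composites of column maps\<close>

locale column_shift = spectral_point +
  fixes u :: nat
  assumes u: "1 \<le> u" "u \<le> N"
begin

lemma Lop_tpi: "Lop m k ((tpi_map ^^ u) q) (shift (int u) w) = shift (int u) (Lop m k q w)"
proof -
  have "Tl (\<lambda>i j. q i (j - int u)) is (shift (int u) w) = shift (int u) (Tl q is w)" for "is" w
    by (induction "is") (simp_all add: Tq_def shift_def fun_eq_iff algebra_simps)
  moreover have "shift (int k) (shift (int u) w) = shift (int u) (shift (int k) w)"
    by (simp add: shift_def algebra_simps)
  ultimately show ?thesis unfolding Lop_def tpi_map_power by simp
qed

lemma u_le_n: "int u \<le> int n" using u N_le_n by simp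

lemma eig_shift: "eig f n m k ((tpi_map ^^ u) q) (shift (int u) v)"
  unfolding eig_def
proof (intro conjI allI impI)
  interpret Pv: place f "P_point f" by (rule placeI[OF P_place])
  show "qper n (shift (int u) v)" by (rule qper_shift[OF qv]) simp
  obtain j where j: "j \<le> int n" "\<not> f dvd v j" using v unfolding eig_def by metis
  have "\<not> f dvd v (j - int n)"
    unfolding qper_D[OF qv j(1)]
    using j(2) not_dvd_X Pv.dvd_mult_iff by simp
  then show "\<exists>j\<le>int n. \<not> f dvd shift (int u) v j"
    using j(1) u_le_n by (intro exI[of _ "j - int n + int u"]) (simp add: shift_def)
  fix j assume "j \<le> int n"
  then show "f dvd Lop m k ((tpi_map ^^ u) q) (shift (int u) v) j - Y * shift (int u) v j"
    using v unfolding Lop_tpi by (simp add: shift_def eig_def)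
qed

text \<open>State within a composite: g r is the original number of the tuple now at position r, and
  position r is column N + 1 - r, as tuples are numbered from the right. At the O-point of a tuple,
  the entry in its column keeps its order, with a gain of 1 if the shift carried the tuple across
  the boundary of a block of N columns, that is if g r \<le> u.\<close>

definition good :: "(nat \<Rightarrow> nat) \<Rightarrow> point \<Rightarrow> (int \<Rightarrow> poly2) \<Rightarrow> bool" where
  "good g x w \<longleftrightarrow> x \<in> phase_space n m k \<and> eig f n m k x w \<and>
    (\<forall>j. csum n m k x j = csum n m k q (j - int u)) \<and> (\<forall>i. eps x i = eps q i) \<and>
    (\<forall>c. WM f n (P_point f) (\<lambda>j. j - int n) v c \<longrightarrow> WM f n (P_point f) (\<lambda>j. j - int n) w (c - int u)) \<and>
    (\<forall>p c. p \<in> places f \<longrightarrow> p \<noteq> P_point f \<longrightarrow> p \<notin> O_points f \<longrightarrow>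
      WM f n p (\<lambda>_. 0) v c \<longrightarrow> WM f n p (\<lambda>_. 0) w c) \<and>
    inj_on g {1..N} \<and>
    (\<forall>r\<in>{1..N}. g r \<in> {1..N} \<and> sigma n m k x (N + 1 - r) = sigma n m k q (N + 1 - g r) \<and>
      (Os ! (N - g r)) (w (int (N + 1 - r))) =
        (Os ! (N - g r)) (v (int (N + 1 - g r))) + (if g r \<le> u then 1 else 0))"

lemma Os_reflect:
  assumes "r \<in> {1..N}"
  shows "N + 1 - r \<in> {1..N}" "Os ! (N - r) \<in> O_points f"
    "has_value_at f (Os ! (N - r)) (Y ^ n') (X ^ k') (sigma n m k q (N + 1 - r))"
proof -
  show r: "N + 1 - r \<in> {1..N}" using assms by auto
  have "N + 1 - r - 1 = N - r" by simp
  then show "Os ! (N - r) \<in> O_points f"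
    "has_value_at f (Os ! (N - r)) (Y ^ n') (X ^ k') (sigma n m k q (N + 1 - r))"
    using Os_nth[OF r] by (simp_all only:)
qed

lemma goodD:
  assumes "good g x w"
  shows "x \<in> phase_space n m k" "eig f n m k x w" "csum n m k x j = csum n m k q (j - int u)" "eps x i = eps q i"
    "WM f n (P_point f) (\<lambda>j. j - int n) v c \<Longrightarrow> WM f n (P_point f) (\<lambda>j. j - int n) w (c - int u)"
    "p \<in> places f \<Longrightarrow> p \<noteq> P_point f \<Longrightarrow> p \<notin> O_points f \<Longrightarrow>
      WM f n p (\<lambda>_. 0) v c \<Longrightarrow> WM f n p (\<lambda>_. 0) w c"
    "inj_on g {1..N}" "r \<in> {1..N} \<Longrightarrow> g r \<in> {1..N}"
    "r \<in> {1..N} \<Longrightarrow> sigma n m k x (N + 1 - r) = sigma n m k q (N + 1 - g r)"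
    "r \<in> {1..N} \<Longrightarrow> (Os ! (N - g r)) (w (int (N + 1 - r))) =
        (Os ! (N - g r)) (v (int (N + 1 - g r))) + (if g r \<le> u then 1 else 0)"
  using assms unfolding good_def by simp_all

lemma good_inj:
  assumes "good g x w" shows "inj_on (sigma n m k x) {1..N}"
proof (rule inj_onI)
  fix s t assume st: "s \<in> {1..N}" "t \<in> {1..N}" "sigma n m k x s = sigma n m k x t"
  define r r' where "r = N + 1 - s" and "r' = N + 1 - t"
  have r: "r \<in> {1..N}" "r' \<in> {1..N}" "s = N + 1 - r" "t = N + 1 - r'" using st by (auto simp: r_def r'_def)
  have g: "g r \<in> {1..N}" "g r' \<in> {1..N}" "sigma n m k q (N + 1 - g r) = sigma n m k q (N + 1 - g r')"
    using goodD(8,9)[OF assms r(1)] goodD(8,9)[OF assms r(2)] st(3) unfolding r(3,4) by simp_all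
  have "N + 1 - g r = N + 1 - g r'"
    by (rule inj_onD[OF inj_sigma g(3) Os_reflect(1)[OF g(1)] Os_reflect(1)[OF g(2)]])
  then have "g r = g r'" using g(1,2) by auto
  then have "r = r'" using inj_onD[OF goodD(7)[OF assms] _ r(1,2)] by simp
  then show "s = t" using r by simp
qed

lemma good_start:
  "good (\<lambda>i. if i \<le> N - u then i + u else i - (N - u)) ((tpi_map ^^ u) q) (shift (int u) v)"
  unfolding good_def
proof (intro conjI allI impI ballI)
  note t = tpi_map_power_effect[OF q]
  show "(tpi_map ^^ u) q \<in> phase_space n m k" by (rule t)
  show "eig f n m k ((tpi_map ^^ u) q) (shift (int u) v)" by (rule eig_shift)
  show "csum n m k ((tpi_map ^^ u) q) j = csum n m k q (j - int u)" for j by (rule t)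
  show "eps ((tpi_map ^^ u) q) i = eps q i" for i by (rule t)
  show "WM f n (P_point f) (\<lambda>j. j - int n) (shift (int u) v) (c - int u)"
    if W: "WM f n (P_point f) (\<lambda>j. j - int n) v c" for c
  proof -
    interpret place f "P_point f" by (rule placeI[OF P_place])
    have "WM f n (P_point f) (\<lambda>j. j - int n) (shift (int u) v) (c + - int u)"
      by (rule WM_shift[where b = "\<lambda>j. j - int n", OF qv n_pos P_X _ W]) simp_all
    then show ?thesis by simp
  qed
  show "WM f n p (\<lambda>_. 0) (shift (int u) v) c"
    if p: "p \<in> places f" "p \<noteq> P_point f" "p \<notin> O_points f" and W: "WM f n p (\<lambda>_. 0) v c" for p c
  proof -
    interpret place f p by (rule placeI[OF p(1)])
    obtain a b where "a \<noteq> 0" "lies_over f p a b" using place_cases[OF p(1)] p(2,3) by metis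
    then have X: "veq f p X 0" using A_point_X[OF place_axioms] by metis
    have "WM f n p (\<lambda>_. 0) (shift (int u) v) (c + 0)"
      by (rule WM_shift[where b = "\<lambda>_. 0", OF qv n_pos X _ W]) simp_all
    then show ?thesis by simp
  qed
  show "inj_on (\<lambda>i. if i \<le> N - u then i + u else i - (N - u)) {1..N}"
    using u by (auto simp: inj_on_def)
  fix r assume r: "r \<in> {1..N}"
  define g where "g = (if r \<le> N - u then r + u else r - (N - u))"
  have g: "g \<in> {1..N}" using r u by (auto simp: g_def)
  show "(if r \<le> N - u then r + u else r - (N - u)) \<in> {1..N}" using g unfolding g_def .
  \<comment> \<open>Tuples with r > N - u have wrapped around: their original column lies N higher
    than the index that the shift reads.\<close>
  have pos: "int (N + 1 - r) - int u - int (N + 1 - g) = (if r \<le> N - u then 0 else - int N)"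
    using r u by (auto simp: g_def of_nat_diff)
  then have "int N dvd int (N + 1 - r) - int u - int (N + 1 - g)" by (simp split: if_splits)
  then have "sigma n m k ((tpi_map ^^ u) q) (N + 1 - r) = sigma n m k q (N + 1 - g)" by (rule t(3))
  then show "sigma n m k ((tpi_map ^^ u) q) (N + 1 - r)
      = sigma n m k q (N + 1 - (if r \<le> N - u then r + u else r - (N - u)))" unfolding g_def .
  define p where "p = Os ! (N - g)"
  have "p (shift (int u) v (int (N + 1 - r))) = p (v (int (N + 1 - g))) + (if g \<le> u then 1 else 0)"
  proof (cases "r \<le> N - u")
    case True
    then have "int (N + 1 - r) - int u = int (N + 1 - g)" "\<not> g \<le> u" using pos r by (auto simp: g_def)
    then show ?thesis unfolding shift_def by (simp only: if_False)
  next
    case False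
    have gu: "g \<le> u" using False r u by (auto simp: g_def)
    have e: "int (N + 1 - r) - int u = int (N + 1 - g) - int N" using pos False by simp
    note rg = Os_reflect[OF g, folded p_def]
    note P = O_position_at[OF rg(2) q v inj_sigma rg(1,3)]
    have le: "int (N + 1 - g) - int N \<le> int n" using g N_le_n by auto
    \<comment> \<open>Lowering an index by N inside the class of p raises the scaled order by N,
      hence the order by 1.\<close>
    have "veq f (scl N p) (v (int (N + 1 - g) - int N)) (int N * p (v (int (N + 1 - g))) + int N)"
      using P(3)[OF le] by simp
    then have "int N * p (v (int (N + 1 - g) - int N)) = int N * (p (v (int (N + 1 - g))) + 1)"
      by (simp add: veq_def scl_def algebra_simps)
    then have "p (v (int (N + 1 - g) - int N)) = p (v (int (N + 1 - g))) + 1" using N_pos by (simp only: mult_cancel_left) simp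
    then show ?thesis unfolding shift_def e using gu by simp
  qed
  then show "(Os ! (N - (if r \<le> N - u then r + u else r - (N - u)))) (shift (int u) v (int (N + 1 - r))) =
      (Os ! (N - (if r \<le> N - u then r + u else r - (N - u))))
        (v (int (N + 1 - (if r \<le> N - u then r + u else r - (N - u))))) +
      (if (if r \<le> N - u then r + u else r - (N - u)) \<le> u then 1 else 0)"
    unfolding p_def g_def .
qed

lemma good_step:
  assumes g: "good g x w" and r: "1 \<le> r" "r < N" and s: "ts_map n m k r x = Some y"
  shows "\<exists>w'. good (swap_at r g) y w'"
proof -
  define c where "c = N - r"
  have c: "1 \<le> c" "c < N" using r by (auto simp: c_def)
  have x: "x \<in> phase_space n m k" "eig f n m k x w" using g by (simp_all add: good_def)
  note ef = ts_map_effect[OF x(1) coordinates_nonzero[OF x] r s, folded c_def]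
  obtain \<tau> where \<tau>': "\<forall>j. \<not> int N dvd j - int c \<longrightarrow> \<tau> j = 0" "\<forall>j. \<tau> (j + int n) = \<tau> j"
      "\<forall>w. Lop m k y (Aop \<tau> w) = Aop \<tau> (Lop m k x w)"
    using ef(2) by (elim exE conjE)
  note \<tau> = \<tau>'[rule_format]
  have \<tau>1: "\<tau> (j + 1) = 0" if "\<tau> j \<noteq> 0" for j
  proof (rule \<tau>(1), rule notI)
    assume "int N dvd j + 1 - int c"
    moreover have "int N dvd j - int c" using \<tau>(1)[of j] that by blast
    ultimately have "int N dvd (j + 1 - int c) - (j - int c)" by (rule dvd_diff)
    then have "int N dvd 1" by simp
    then show False using c by simp
  qed
  have \<tau>n: "\<tau> (int n) = 0"
  proof (rule \<tau>(1), rule notI)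
    assume d: "int N dvd int n - int c"
    have "int N dvd int n" by (simp add: N_def)
    then have "int N dvd int n - (int n - int c)" using d by (rule dvd_diff)
    then have "int N dvd int c" by simp
    then have "N dvd c" by (simp only: int_dvd_int_iff)
    then show False using c by (auto dest: dvd_imp_le)
  qed
  define w' where "w' = Aop \<tau> w"
  have y: "y \<in> phase_space n m k" by (rule ef(1))
  have ew: "eig f n m k y w'" unfolding w'_def by (rule Aop_eig[where \<tau> = \<tau>, OF x(2) \<tau>1 \<tau>n \<tau>(2,3)])
  have gr: "g i \<in> {1..N}" "sigma n m k x (N + 1 - i) = sigma n m k q (N + 1 - g i)"
      "(Os ! (N - g i)) (w (int (N + 1 - i))) = (Os ! (N - g i)) (v (int (N + 1 - g i))) + (if g i \<le> u then 1 else 0)"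
    if "i \<in> {1..N}" for i by (rule goodD(8-10)[OF g that])+
  have rr: "r \<in> {1..N}" "Suc r \<in> {1..N}" using r by auto
  have pos: "N + 1 - r = c + 1" "N + 1 - Suc r = c" using r by (auto simp: c_def)
  have other: "N + 1 - i \<in> {1..N}" "N + 1 - i \<noteq> c" "N + 1 - i \<noteq> c + 1"
    if "i \<in> {1..N}" "i \<noteq> r" "i \<noteq> Suc r" for i using that r by (auto simp: c_def)
  have inj': "inj_on (swap_at r g) {1..N}"
  proof -
    have ig: "inj_on g {1..N}" using g by (simp add: good_def)
    have "swap_at r g i = g (if i = r then Suc r else if i = Suc r then r else i)" for i by (simp add: swap_at_def)
    moreover have "inj_on (\<lambda>i. g (if i = r then Suc r else if i = Suc r then r else i)) {1..N}"
    proof (rule inj_onI)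
      fix a b
      define T where "T i = (if i = r then Suc r else if i = Suc r then r else i)" for i
      assume ab: "a \<in> {1..N}" "b \<in> {1..N}"
        "g (if a = r then Suc r else if a = Suc r then r else a) = g (if b = r then Suc r else if b = Suc r then r else b)"
      have "T a \<in> {1..N}" "T b \<in> {1..N}" using ab(1,2) rr by (simp_all add: T_def)
      then have "T a = T b" using inj_onD[OF ig, of "T a" "T b"] ab(3) by (simp only: T_def)
      then show "a = b" by (simp add: T_def split: if_splits)
    qed
    ultimately show ?thesis by (simp cong: inj_on_cong)
  qed
  have sw: "swap_at r g i \<in> {1..N}" "sigma n m k y (N + 1 - i) = sigma n m k q (N + 1 - swap_at r g i)"
    if i: "i \<in> {1..N}" for i
  proof -
    consider "i = r" | "i = Suc r" | "i \<noteq> r" "i \<noteq> Suc r" by metis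
    then have "swap_at r g i \<in> {1..N} \<and> sigma n m k y (N + 1 - i) = sigma n m k q (N + 1 - swap_at r g i)"
    proof cases
      case 1
      then have "swap_at r g i = g (Suc r)" by (simp add: swap_at_def)
      then show ?thesis using gr(1,2)[OF rr(2)] ef(6) 1 unfolding pos by (simp only: pos)
    next
      case 2
      then have "swap_at r g i = g r" by (simp add: swap_at_def)
      then show ?thesis using gr(1,2)[OF rr(1)] ef(5) 2 unfolding pos by (simp only: pos)
    next
      case 3
      then have "swap_at r g i = g i" by (simp add: swap_at_def)
      then show ?thesis using gr(1,2)[OF i] ef(7)[OF other[OF i 3]] by simp
    qed
    then show "swap_at r g i \<in> {1..N}" "sigma n m k y (N + 1 - i) = sigma n m k q (N + 1 - swap_at r g i)" by simp_all
  qed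
  have injy: "inj_on (sigma n m k y) {1..N}"
  proof (rule inj_onI)
    fix s t assume st: "s \<in> {1..N}" "t \<in> {1..N}" "sigma n m k y s = sigma n m k y t"
    define a b where "a = N + 1 - s" and "b = N + 1 - t"
    have r: "a \<in> {1..N}" "b \<in> {1..N}" "s = N + 1 - a" "t = N + 1 - b" using st by (auto simp: a_def b_def)
    have e: "sigma n m k q (N + 1 - swap_at r g a) = sigma n m k q (N + 1 - swap_at r g b)"
      using sw(2)[OF r(1)] sw(2)[OF r(2)] st(3) r(3,4) by simp
    have "N + 1 - swap_at r g a = N + 1 - swap_at r g b"
      by (rule inj_onD[OF inj_sigma e Os_reflect(1)[OF sw(1)[OF r(1)]] Os_reflect(1)[OF sw(1)[OF r(2)]]])
    then have "swap_at r g a = swap_at r g b" using sw(1)[OF r(1)] sw(1)[OF r(2)] by auto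
    then have "a = b" using inj_onD[OF inj' _ r(1,2)] by metis
    then show "s = t" using r by simp
  qed
  \<comment> \<open>For the two exchanged tuples the O-point changes class together with the entry;
    in all other classes the gauge factor changes nothing.\<close>
  have ord: "(Os ! (N - swap_at r g i)) (w' (int (N + 1 - i))) =
        (Os ! (N - swap_at r g i)) (v (int (N + 1 - swap_at r g i))) + (if swap_at r g i \<le> u then 1 else 0)"
    if i: "i \<in> {1..N}" for i
  proof -
    note re = Os_reflect[OF sw(1)[OF i]]
    have hy: "has_value_at f (Os ! (N - swap_at r g i)) (Y ^ n') (X ^ k') (sigma n m k y (N + 1 - i))"
      unfolding sw(2)[OF i] by (rule re(3))
    note AO = Aop_O_order[where \<tau> = \<tau> and c = c, OF re(2) x good_inj[OF g] y ew[unfolded w'_def] injy \<tau>'(1) c,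
        folded w'_def]
    consider "i = r" | "i = Suc r" | "i \<noteq> r" "i \<noteq> Suc r" by metis
    then show ?thesis
    proof cases
      case 1
      then have si: "swap_at r g i = g (Suc r)" by (simp add: swap_at_def)
      have hx: "has_value_at f (Os ! (N - swap_at r g i)) (Y ^ n') (X ^ k') (sigma n m k x c)"
        using re(3) gr(2)[OF rr(2)] unfolding si pos by (simp only:)
      have "(Os ! (N - swap_at r g i)) (w' (int (c + 1))) = (Os ! (N - swap_at r g i)) (w (int c))"
        by (rule AO(1)[OF hx]) (use hy 1 pos in simp)
      then show ?thesis using gr(3)[OF rr(2)] 1 unfolding si pos by (simp only: pos)
    next
      case 2
      then have si: "swap_at r g i = g r" by (simp add: swap_at_def)
      have hx: "has_value_at f (Os ! (N - swap_at r g i)) (Y ^ n') (X ^ k') (sigma n m k x (c + 1))"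
        using re(3) gr(2)[OF rr(1)] unfolding si pos by (simp only:)
      have "(Os ! (N - swap_at r g i)) (w' (int c)) = (Os ! (N - swap_at r g i)) (w (int (c + 1)))"
        by (rule AO(2)[OF hx]) (use hy 2 pos in simp)
      then show ?thesis using gr(3)[OF rr(1)] 2 unfolding si pos by (simp only: pos)
    next
      case 3
      then have si: "swap_at r g i = g i" by (simp add: swap_at_def)
      have "\<not> int N dvd int (N + 1 - i) - int c"
      proof
        assume d: "int N dvd int (N + 1 - i) - int c"
        have "c \<in> {1..N}" using c by simp
        then have "N + 1 - i = c"
          using residue_class_unique[OF other(1)[OF i 3] _ _ d] by simp
        then show False using other(2)[OF i 3] by simp
      qed
      then have "w' (int (N + 1 - i)) = w (int (N + 1 - i))" using \<tau>(1) by (simp add: w'_def Aop_def)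
      then show ?thesis using gr(3)[OF i] unfolding si by simp
    qed
  qed
  have "good (swap_at r g) y w'"
    unfolding good_def
  proof (intro conjI allI impI ballI)
    show "csum n m k y j = csum n m k q (j - int u)" for j using ef(3) goodD(3)[OF g] by simp
    show "eps y i = eps q i" for i using ef(4) goodD(4)[OF g] by simp
    show "WM f n (P_point f) (\<lambda>j. j - int n) w' (d - int u)"
      if "WM f n (P_point f) (\<lambda>j. j - int n) v d" for d
      unfolding w'_def
    proof (rule Aop_WM[where \<tau> = \<tau> and b = "\<lambda>j. j - int n", OF placeI[OF P_place] \<tau>1 \<tau>n])
      show "WM f n (P_point f) (\<lambda>j. j - int n) w (d - int u)" by (rule goodD(5)[OF g that])
    qed simp_all
    show "WM f n p (\<lambda>_. 0) w' d"
      if p: "p \<in> places f" "p \<noteq> P_point f" "p \<notin> O_points f" "WM f n p (\<lambda>_. 0) v d" for p d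
      unfolding w'_def
    proof (rule Aop_WM[where \<tau> = \<tau> and b = "\<lambda>_. 0", OF placeI[OF p(1)] \<tau>1 \<tau>n])
      show "WM f n p (\<lambda>_. 0) w d" by (rule goodD(6)[OF g p])
    qed simp_all
  qed (fact y ew inj' sw ord)+
  then show ?thesis by (rule exI[of _ w'])
qed

lemma O_div_lookup:
  "Poly_Mapping.lookup (O_div f Os u) p =
    (if P_point f = p then int u else 0) - (\<Sum>i=N - u + 1..N. if Os ! (i - 1) = p then 1 else 0)"
proof -
  have fr: "Poly_Mapping.lookup (frag_of x) p = (if x = p then 1 else 0)" for x by simp
  show ?thesis unfolding O_div_def lookup_minus lookup_sum lookup_frag_cmul fr Os_length by simp
qed

lemma O_div_lookup_not_O:
  assumes "p \<notin> O_points f" shows "Poly_Mapping.lookup (O_div f Os u) p = (if P_point f = p then int u else 0)"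
proof -
  have "Os ! (i - 1) \<noteq> p" if "i \<in> {N - u + 1..N}" for i
  proof -
    have "i \<in> {1..N}" using that by auto
    then show ?thesis using Os_nth(1) assms by metis
  qed
  then have "(\<Sum>i=N - u + 1..N. if Os ! (i - 1) = p then 1 else (0 :: int)) = 0" by (intro sum.neutral) simp
  then show ?thesis unfolding O_div_lookup by simp
qed

lemma O_div_lookup_O:
  assumes s: "s \<in> {1..N}" and p: "p = Os ! (s - 1)"
  shows "Poly_Mapping.lookup (O_div f Os u) p = (if N + 1 - s \<le> u then - 1 else 0)"
proof -
  have d: "distinct Os" using Os_ord by (simp add: orderings_def)
  have eq: "Os ! (i - 1) = p \<longleftrightarrow> i = s" if "i \<in> {N - u + 1..N}" for i
    using nth_pos[OF Os_length d s, of i] that p by auto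
  have "(\<Sum>i=N - u + 1..N. if Os ! (i - 1) = p then 1 else 0) = (\<Sum>i=N - u + 1..N. if i = s then 1 else (0 :: int))"
    by (intro sum.cong refl if_cong) (use eq in auto)
  also have "\<dots> = (if N + 1 - s \<le> u then 1 else 0)" using s u by auto
  finally have e: "(\<Sum>i=N - u + 1..N. if Os ! (i - 1) = p then 1 else (0 :: int)) = (if N + 1 - s \<le> u then 1 else 0)" .
  have "P_point f \<noteq> p" using P_not_O Os_nth(1)[OF s] p by metis
  then show ?thesis unfolding O_div_lookup e by simp
qed

text \<open>The whole word restores the original numbering, so at each O-point the entries of the
  same class are compared. The gain of 1 occurs for s > N - u, which is the part -O_s of the
  divisor; the drop by u at P is its part u P.\<close>

lemma te_map_effect:
  assumes e: "te_map n m k u q = Some y"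
  shows "\<exists>w. y \<in> phase_space n m k \<and> eig f n m k y w \<and> c_list n m k y = (tau ^^ u) (c_list n m k q) \<and>
    O_list n m k f y = Os \<and> A_list n m f y = As \<and>
    (\<forall>p\<in>places f. \<forall>c. WM f n p (wt Os p) v c \<longrightarrow>
      WM f n p (wt Os p) w (c + - Poly_Mapping.lookup (O_div f Os u) p))"
proof -
  define x0 where "x0 = (tpi_map ^^ u) q"
  have e': "comp_list (map (ts_map n m k) (e_word N u)) x0 = Some y"
    using e by (simp add: te_map_def x0_def N_def)
  define g0 where "g0 i = (if i \<le> N - u then i + u else i - (N - u))" for i
  have "\<exists>w. good (foldr swap_at (e_word N u) g0) y w"
  proof (rule comp_list_invariant[OF e', where Q = "\<lambda>g x. \<exists>w. good g x w" and h = swap_at])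
    have "good g0 x0 (shift (int u) v)" using good_start unfolding g0_def x0_def .
    then show "\<exists>w. good g0 x0 w" by (rule exI[of _ "shift (int u) v"])
    fix r g x z assume r: "r \<in> set (e_word N u)" and "\<exists>w. good g x w" and s: "ts_map n m k r x = Some z"
    then obtain w where "good g x w" by metis
    then show "\<exists>w. good (swap_at r g) z w" using good_step s e_word_letters[OF u(2) r] by metis
  qed
  then obtain w where gw: "good (foldr swap_at (e_word N u) g0) y w" by metis
  have id: "foldr swap_at (e_word N u) g0 r = r" if "r \<in> {1..N}" for r
    unfolding g0_def using e_word_rotation[OF u that, of "\<lambda>i. i"] .
  have y: "y \<in> phase_space n m k" "eig f n m k y w" "\<And>j. csum n m k y j = csum n m k q (j - int u)"
      "\<And>i. eps y i = eps q i" by (rule goodD[OF gw])+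
  have G: "sigma n m k y s = sigma n m k q s"
      "(Os ! (s - 1)) (w (int s)) = (Os ! (s - 1)) (v (int s)) + (if N + 1 - s \<le> u then 1 else 0)"
    if s: "s \<in> {1..N}" for s
  proof -
    define r where "r = N + 1 - s"
    have r: "r \<in> {1..N}" "N + 1 - r = s" "N - r = s - 1" using s by (auto simp: r_def)
    have "sigma n m k y (N + 1 - r) = sigma n m k q (N + 1 - r) \<and>
      (Os ! (N - r)) (w (int (N + 1 - r))) = (Os ! (N - r)) (v (int (N + 1 - r))) + (if r \<le> u then 1 else 0)"
      using goodD(9,10)[OF gw r(1)] unfolding id[OF r(1)] by (rule conjI)
    then show "sigma n m k y s = sigma n m k q s"
      "(Os ! (s - 1)) (w (int s)) = (Os ! (s - 1)) (v (int s)) + (if N + 1 - s \<le> u then 1 else 0)"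
      unfolding r(2,3) by (simp_all add: r_def)
  qed
  have W: "WM f n p (wt Os p) w (c + - Poly_Mapping.lookup (O_div f Os u) p)"
    if p: "p \<in> places f" and W: "WM f n p (wt Os p) v c" for p c
  proof -
    interpret pl: place f p by (rule placeI[OF p])
    consider "p = P_point f" | "p \<in> O_points f" | "p \<noteq> P_point f" "p \<notin> O_points f" by metis
    then show ?thesis
    proof cases
      case 1
      have b: "wt Os (P_point f) = (\<lambda>j. j - int n)" by (rule ext) (rule wt_P)
      have "WM f n (P_point f) (\<lambda>j. j - int n) w (c - int u)"
        by (rule goodD(5)[OF gw]) (use W in \<open>simp only: 1 b\<close>)
      moreover have "Poly_Mapping.lookup (O_div f Os u) p = int u"
        using O_div_lookup_not_O[of p] P_not_O 1 by simp
      ultimately show ?thesis unfolding 1 b by simp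
    next
      case 2
      then obtain s where s: "s \<in> {1..N}" "p = Os ! (s - 1)" by (rule Os_cases)
      have hq: "has_value_at f (Os ! (s - 1)) (Y ^ n') (X ^ k') (sigma n m k q s)" by (rule Os_nth[OF s(1)])
      have hy: "has_value_at f (Os ! (s - 1)) (Y ^ n') (X ^ k') (sigma n m k y s)" unfolding G(1)[OF s(1)] by (rule hq)
      note Wq = O_WM[OF Os_length Os_ord q v inj_sigma s(1) hq, folded s(2)]
      note Wy = O_WM[OF Os_length Os_ord y(1,2) good_inj[OF gw] s(1) hy, folded s(2)]
      have "c = p (v (int s)) - (int n - int s) div int N" by (rule pl.WM_unique[OF W Wq])
      then have "c + - Poly_Mapping.lookup (O_div f Os u) p = p (w (int s)) - (int n - int s) div int N"
        using G(2)[OF s(1), folded s(2)] O_div_lookup_O[OF s] by simp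
      then show ?thesis using Wy by simp
    next
      case 3
      have b: "wt Os p = (\<lambda>_. 0)" using wt_other[OF Os_length Os_ord 3] by auto
      have "WM f n p (\<lambda>_. 0) w c" by (rule goodD(6)[OF gw p 3 W[unfolded b]])
      moreover have "Poly_Mapping.lookup (O_div f Os u) p = 0" using O_div_lookup_not_O[OF 3(2)] 3(1) by simp
      ultimately show ?thesis unfolding b by simp
    qed
  qed
  have c: "c_list n m k y = (tau ^^ u) (c_list n m k q)" by (rule c_list_shift(2)[OF n2 k1 m1 q y(1,3)])
  have O: "O_list n m k f y = Os" by (rule O_list_cong) (rule G(1))
  have A: "A_list n m f y = As" by (rule A_list_cong) (rule y(4))
  show ?thesis using y(1,2) c O A W by (intro exI[of _ w] conjI ballI allI impI)
qed

end

section \<open>Linear equivalence\<close>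

lemma divisors_iff: "D \<in> divisors f \<longleftrightarrow> (\<forall>p. p \<notin> places f \<longrightarrow> Poly_Mapping.lookup D p = 0)"
  by (auto simp: divisors_def in_keys_iff)

lemma divisors_diff: "D \<in> divisors f \<Longrightarrow> E \<in> divisors f \<Longrightarrow> D - E \<in> divisors f"
  by (simp add: divisors_iff lookup_minus)

lemma divisors_add: "D \<in> divisors f \<Longrightarrow> E \<in> divisors f \<Longrightarrow> D + E \<in> divisors f"
  by (simp add: divisors_iff lookup_add)

lemma lin_equiv_function:
  assumes D: "D \<in> divisors f" "E \<in> divisors f" and gh: "\<not> f dvd g" "\<not> f dvd h"
    and eq: "\<And>p. p \<in> places f \<Longrightarrow> Poly_Mapping.lookup E p - Poly_Mapping.lookup D p = p g - p h"
  shows "lin_equiv f D E"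
proof -
  have "\<forall>p\<in>places f. Poly_Mapping.lookup E p - Poly_Mapping.lookup D p = p g - p h"
    by (rule ballI) (rule eq)
  with gh have "\<not> f dvd g \<and> \<not> f dvd h \<and>
      (\<forall>p\<in>places f. Poly_Mapping.lookup E p - Poly_Mapping.lookup D p = p g - p h)"
    by (intro conjI)
  then have "\<exists>h. \<not> f dvd g \<and> \<not> f dvd h \<and>
      (\<forall>p\<in>places f. Poly_Mapping.lookup E p - Poly_Mapping.lookup D p = p g - p h)"
    by (rule exI[of _ h])
  then have "\<exists>g h. \<not> f dvd g \<and> \<not> f dvd h \<and>
      (\<forall>p\<in>places f. Poly_Mapping.lookup E p - Poly_Mapping.lookup D p = p g - p h)"
    by (rule exI[of _ g])
  with D show ?thesis unfolding lin_equiv_def by (intro conjI)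
qed

lemma lin_equiv_refl:
  assumes "irreducible f" "D \<in> divisors f" shows "lin_equiv f D D"
  unfolding lin_equiv_def using assms by (intro conjI exI[of _ 1]) (auto simp: irreducible_def)

lemma lin_equiv_sym:
  assumes "lin_equiv f D E" shows "lin_equiv f E D"
proof -
  obtain g h where gh: "\<not> f dvd g" "\<not> f dvd h"
      "\<forall>p\<in>places f. Poly_Mapping.lookup E p - Poly_Mapping.lookup D p = p g - p h"
    using assms unfolding lin_equiv_def by metis
  have "\<forall>p\<in>places f. Poly_Mapping.lookup D p - Poly_Mapping.lookup E p = p h - p g"
    using gh(3) by (metis minus_diff_eq)
  then show ?thesis using assms gh(1,2) unfolding lin_equiv_def by metis
qed

lemma lin_equiv_trans:
  assumes irr: "irreducible f" and DE: "lin_equiv f D E" and EF: "lin_equiv f E F"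
  shows "lin_equiv f D F"
proof (cases "places f = {}")
  case True
  then show ?thesis using DE EF unfolding lin_equiv_def by auto
next
  case False
  then obtain p0 where "p0 \<in> places f" by blast
  then interpret place f p0 using irr by (simp add: place_def)
  obtain g h where gh: "\<not> f dvd g" "\<not> f dvd h"
      "\<forall>p\<in>places f. Poly_Mapping.lookup E p - Poly_Mapping.lookup D p = p g - p h"
    using DE unfolding lin_equiv_def by metis
  obtain g' h' where gh': "\<not> f dvd g'" "\<not> f dvd h'"
      "\<forall>p\<in>places f. Poly_Mapping.lookup F p - Poly_Mapping.lookup E p = p g' - p h'"
    using EF unfolding lin_equiv_def by metis
  have "Poly_Mapping.lookup F p - Poly_Mapping.lookup D p = p (g * g') - p (h * h')" if p: "p \<in> places f" for p
  proof -
    have "p (g * g') = p g + p g'" "p (h * h') = p h + p h'"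
      using p gh(1,2) gh'(1,2) by (simp_all add: places_def)
    then show ?thesis using bspec[OF gh(3) p] bspec[OF gh'(3) p] by simp
  qed
  moreover have "\<not> f dvd g * g'" "\<not> f dvd h * h'" using gh(1,2) gh'(1,2) dvd_mult_iff by simp_all
  moreover have "D \<in> divisors f" "F \<in> divisors f" using DE EF by (simp_all add: lin_equiv_def)
  ultimately show ?thesis using lin_equiv_function[of D f F "g * g'" "h * h'"] by metis
qed

lemma lin_equiv_add:
  assumes DE: "lin_equiv f D E" and F: "F \<in> divisors f" shows "lin_equiv f (D + F) (E + F)"
proof -
  obtain g h where gh: "\<not> f dvd g" "\<not> f dvd h"
      "\<forall>p\<in>places f. Poly_Mapping.lookup E p - Poly_Mapping.lookup D p = p g - p h"
    using DE unfolding lin_equiv_def by metis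
  have D: "D \<in> divisors f" "E \<in> divisors f" using DE by (simp_all add: lin_equiv_def)
  show ?thesis
  proof (rule lin_equiv_function[OF divisors_add[OF D(1) F] divisors_add[OF D(2) F] gh(1,2)])
    show "Poly_Mapping.lookup (E + F) p - Poly_Mapping.lookup (D + F) p = p g - p h" if "p \<in> places f" for p
      using bspec[OF gh(3) that] by (simp add: lookup_add)
  qed
qed

lemma pic_class_eq:
  assumes "irreducible f" "lin_equiv f D E" shows "pic_class f D = pic_class f E"
  unfolding pic_class_def
  using lin_equiv_trans[OF assms(1)] lin_equiv_sym assms(2) by (intro Collect_cong iffI) metis+

section \<open>Comparison of the divisor classes\<close>

context row_shift
begin

lemma A_div_divisors: "A_div f As u \<in> divisors f"
  unfolding divisors_iff
proof (intro allI impI)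
  fix p assume p: "p \<notin> places f"
  have "As ! (i - 1) \<noteq> p" if "i \<in> {1..u}" for i
  proof -
    have "i \<in> {1..m}" using that u by simp
    then show ?thesis using As_over(1) p by metis
  qed
  then have "(\<Sum>i=1..u. if As ! (i - 1) = p then 1 else (0 :: int)) = 0" by (intro sum.neutral) simp
  moreover have "P_point f \<noteq> p" using P_place p by metis
  ultimately show "Poly_Mapping.lookup (A_div f As u) p = 0" unfolding A_div_lookup by simp
qed

lemma D_min_e_map:
  assumes e: "e_map n m k u q = Some y"
  shows "lin_equiv f (D_min n m k f q - A_div f As u) (D_min n m k f y)"
proof (rule lin_equiv_function)
  interpret Pv: place f "P_point f" by (rule placeI[OF P_place])
  note y = e_map_effect[OF e]
  show "D_min n m k f q - A_div f As u \<in> divisors f"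
    by (rule divisors_diff[OF D_min_lookup(1)[OF q v] A_div_divisors])
  show "D_min n m k f y \<in> divisors f" by (rule D_min_lookup(1)[OF y(1,2)])
  show v'n: "\<not> f dvd v' (int n)" by (rule eig_last[OF y(1,2)])
  show "\<not> f dvd v (int n) * Y" using eig_last[OF q v] not_dvd_Y Pv.dvd_mult_iff by simp
  fix p assume p: "p \<in> places f"
  have "Poly_Mapping.lookup (D_min n m k f y) p - Poly_Mapping.lookup (D_min n m k f q) p
      = p (v' (int n)) - p (v (int n)) - (p Y + Poly_Mapping.lookup (A_div f As u) p)"
    by (rule D_min_difference[where a = "\<lambda>p. p Y + Poly_Mapping.lookup (A_div f As u) p", OF y(1,2,4) order_v' p])
  moreover have "p (v (int n) * Y) = p (v (int n)) + p Y"
    using place.pl[OF placeI[OF p]] eig_last[OF q v] not_dvd_Y by (simp add: places_def)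
  ultimately show "Poly_Mapping.lookup (D_min n m k f y) p
      - Poly_Mapping.lookup (D_min n m k f q - A_div f As u) p = p (v' (int n)) - p (v (int n) * Y)"
    by (simp add: lookup_minus)
qed

end

context column_shift
begin

lemma O_div_divisors: "O_div f Os u \<in> divisors f"
  unfolding divisors_iff
proof (intro allI impI)
  fix p assume p: "p \<notin> places f"
  then have "p \<notin> O_points f" "P_point f \<noteq> p" using P_place by (auto simp: O_points_def)
  then show "Poly_Mapping.lookup (O_div f Os u) p = 0" using O_div_lookup_not_O by simp
qed

text \<open>Column maps move the minimal orders by the divisor itself, up to sign, with no
  contribution of y; the function is therefore w_n/v_n.\<close>

lemma D_min_te_map:
  assumes y: "y \<in> phase_space n m k" "eig f n m k y w" "O_list n m k f y = Os"
    and W: "\<And>p c. p \<in> places f \<Longrightarrow> WM f n p (wt Os p) v c \<Longrightarrow>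
      WM f n p (wt Os p) w (c + - Poly_Mapping.lookup (O_div f Os u) p)"
  shows "lin_equiv f (D_min n m k f q + O_div f Os u) (D_min n m k f y)"
proof (rule lin_equiv_function)
  show "D_min n m k f q + O_div f Os u \<in> divisors f"
    by (rule divisors_add[OF D_min_lookup(1)[OF q v] O_div_divisors])
  show "D_min n m k f y \<in> divisors f" by (rule D_min_lookup(1)[OF y(1,2)])
  show "\<not> f dvd w (int n)" by (rule eig_last[OF y(1,2)])
  show "\<not> f dvd v (int n)" by (rule eig_last[OF q v])
  fix p assume p: "p \<in> places f"
  have "Poly_Mapping.lookup (D_min n m k f y) p - Poly_Mapping.lookup (D_min n m k f q) p
      = p (w (int n)) - p (v (int n)) - - Poly_Mapping.lookup (O_div f Os u) p"
    by (rule D_min_difference[where a = "\<lambda>p. - Poly_Mapping.lookup (O_div f Os u) p", OF y W p])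
  then show "Poly_Mapping.lookup (D_min n m k f y) p
      - Poly_Mapping.lookup (D_min n m k f q + O_div f Os u) p = p (w (int n)) - p (v (int n))"
    by (simp add: lookup_add)
qed

end

lemma csum_nonzero:
  assumes "n \<ge> 2" "k \<ge> 1" "m \<ge> 1" and q: "q \<in> phase_space n m k" and c: "0 \<notin> set (c_list n m k q)"
  shows "csum n m k q j \<noteq> 0"
proof -
  define M where "M = gcd n (m + k)"
  have M: "M > 0" using assms(1) by (simp add: M_def)
  define l where "l = nat ((j - 1) mod int M) + 1"
  have jl: "j = int l + int M * ((j - 1) div int M)" using M by (simp add: l_def)
  have "nat ((j - 1) mod int M) < M" using M by (simp add: nat_less_iff)
  then have l: "l \<in> set [1..<Suc M]" by (simp add: l_def del: upt_Suc)
  have "csum n m k q j = csum n m k q (int l)"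
    by (subst jl) (rule periodic_multiple[where g = "csum n m k q", OF csum_period[OF assms(1,2) q, folded M_def]])
  moreover have "csum n m k q (int l) \<in> set (c_list n m k q)"
    unfolding c_list_csum[OF assms(1-3) q] M_def[symmetric] set_map using l by (rule imageI)
  ultimately show ?thesis using c by metis
qed

theorem theorem7p3:
  fixes n m k :: nat and f :: poly2 and q :: point and D :: divisor
    and c :: "complex list" and os as :: "place list"
  assumes "n \<ge> 2" and "m \<ge> 1" and "1 \<le> k" and "k \<le> n"
    and "f \<in> V_ring n m k"
    and "q \<in> psi_fibre n m k f"
    and "phi n m k f q = (pic_class f D, c, os, as)"
    and "(pic_class f D, c, os, as) \<in> phi_target n m k f"
  shows "(\<forall>u\<in>{1..m}. \<forall>q'. e_map n m k u q = Some q' \<longrightarrow>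
            phi n m k f q' = (pic_class f (D - A_div f as u), (tau_inv ^^ u) c, os, as))
       \<and> (\<forall>u\<in>{1..gcd n k}. \<forall>q'. te_map n m k u q = Some q' \<longrightarrow>
            phi n m k f q' = (pic_class f (D + O_div f os u), (tau ^^ u) c, os, as))"
proof -
  have q: "q \<in> phase_space n m k" and psi: "psi n m k q = f"
    using assms(6) by (simp_all add: psi_fibre_def generic_locus_def)
  have V: "f \<in> V_cal n m k" using assms(5) by (simp add: V_ring_def)
  interpret spectral_curve n m k f by unfold_locales (use assms V q psi in auto)
  obtain v where v: "eig f n m k q v" using eig_exists[OF n2 q psi] by metis
  have phi: "pic_class f (D_min n m k f q) = pic_class f D" "c_list n m k q = c"
      "O_list n m k f q = os" "A_list n m f q = as"
    using assms(7) by (simp_all add: phi_def)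
  \<comment> \<open>The two facts drawn from the target: the O-list enumerates the O-points without
    repetition, and no c_l is 0.\<close>
  have ord: "O_list n m k f q \<in> orderings (O_points f)" and c0: "0 \<notin> set (c_list n m k q)"
    using assms(8) unfolding phi(2,3) by (simp_all add: phi_target_def S_f_def)
  interpret spectral_point n m k f q v
    by unfold_locales (rule q v ord csum_nonzero[OF n2 k1 m1 q c0])+
  have Os: "Os = os" and As: "As = as" using phi by (simp_all add: Os_def As_def)
  \<comment> \<open>\<open>D\<close> is an arbitrary representative of the class; reflexivity turns
    the equality of classes into a linear equivalence between \<open>D\<close> and the minimal
    divisor.\<close>
  have "D_min n m k f q \<in> pic_class f (D_min n m k f q)"
    using lin_equiv_refl[OF irr D_min_lookup(1)[OF q v]] by (simp add: pic_class_def)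
  then have DD: "lin_equiv f D (D_min n m k f q)" unfolding phi(1) by (simp add: pic_class_def)
  have result: "pic_class f E = pic_class f (D + F)"
    if "lin_equiv f (D_min n m k f q + F) E" "F \<in> divisors f" for E F
    using pic_class_eq[OF irr lin_equiv_trans[OF irr lin_equiv_add[OF DD that(2)] that(1)]] ..
  show ?thesis
  proof (intro conjI ballI allI impI)
    fix u q' assume u: "u \<in> {1..m}" and e: "e_map n m k u q = Some q'"
    interpret row_shift n m k f q v u by unfold_locales (use u in auto)
    note y = e_map_effect[OF e]
    have F: "- A_div f As u \<in> divisors f" using A_div_divisors by (simp add: divisors_iff)
    have "pic_class f (D_min n m k f q') = pic_class f (D + - A_div f As u)"
      by (rule result[OF _ F]) (use D_min_e_map[OF e] in simp)
    then show "phi n m k f q' = (pic_class f (D - A_div f as u), (tau_inv ^^ u) c, os, as)"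
      unfolding phi_def y(3-5) phi(2) Os As by simp
  next
    fix u q' assume u: "u \<in> {1..gcd n k}" and e: "te_map n m k u q = Some q'"
    interpret column_shift n m k f q v u by unfold_locales (use u in \<open>auto simp: N_def\<close>)
    obtain w where y: "q' \<in> phase_space n m k" "eig f n m k q' w" "c_list n m k q' = (tau ^^ u) (c_list n m k q)"
        "O_list n m k f q' = Os" "A_list n m f q' = As"
      and W: "\<forall>p\<in>places f. \<forall>c. WM f n p (wt Os p) v c \<longrightarrow>
        WM f n p (wt Os p) w (c + - Poly_Mapping.lookup (O_div f Os u) p)"
      using te_map_effect[OF e] by (elim exE conjE)
    have "pic_class f (D_min n m k f q') = pic_class f (D + O_div f Os u)"
      by (rule result[OF D_min_te_map[OF y(1,2,4)] O_div_divisors]) (use W in blast)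
    then show "phi n m k f q' = (pic_class f (D + O_div f os u), (tau ^^ u) c, os, as)"
      unfolding phi_def y(3-5) phi(2) Os As by simp
  qed
qed

end
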